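(* (Divergence form of Noether's theorem.) Let $\pi_{XY}:Y\to X$ be a finite-dimensional fiber bundle over an oriented $(n+1)$-dimensional manifold $X$, let $\mathcal L:J^1Y\to\Lambda^{n+1}X$ be a Lagrangian density, and let $\mathcal G$ be a Lie group (perhaps infinite-dimensional) with Lie algebra $\mathfrak g$. Assume that $\mathcal G$ acts on $Y$ by $\pi_{XY}$-bundle automorphisms and that $\mathcal L$ is equivariant with respect to $\mathcal G$. Then for each $\xi\in\mathfrak g$, $$\mathbf{d}\left[(j^1\phi)^*J^{\mathcal L}(\xi)\right]=0$$ for any section $\phi$ of $\pi_{XY}$ satisfying the Euler–Lagrange equations of $\mathcal L$.
   Context: All manifolds and maps are $C^\infty$; $\lrcorner$ and $\mathbf{i}$ denote the interior product. $V_yY=\ker T_y\pi_{XY}$. The first jet bundle $J^1Y\to Y$ is the affine bundle whose fiber $J^1_yY$ over $y\in Y_x=\pi_{XY}^{-1}(x)$ is the set of linear maps $\gamma:T_xX\to T_yY$ with $T\pi_{XY}\circ\gamma=\mathrm{Id}$. Coordinates $x^\mu$ ($\mu=0,\dots,n$) on $X$ and fiber coordinates $y^A$ on $Y$ induce coordinates $(x^\mu,y^A,v^A{}_\mu)$ on $J^1Y$. For a section $\phi$ of $Y$, $j^1\phi:X\to J^1Y$ is $x\mapsto T_x\phi$. $Z\subset\Lambda^{n+1}Y$ is the subbundle over $Y$ with fibers $Z_y=\{z\mid\mathbf{i}_v\mathbf{i}_wz=0\ \forall v,w\in V_yY\}$ and projection $\pi_{YZ}$; its canonical $(n+1)$-form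 is $\Theta(z)(u_1,\dots,u_{n+1})=z(T\pi_{YZ}u_1,\dots,T\pi_{YZ}u_{n+1})$. $Z$ is identified with the bundle $J^1Y^\star$ whose fiber over $y\in Y_x$ is the space of affine maps $J^1_yY\to\Lambda^{n+1}_xX$, by $\langle z,\gamma\rangle=\gamma^*z$. A Lagrangian density is a smooth bundle map $\mathcal L:J^1Y\to\Lambda^{n+1}X$ over $X$; in coordinates $\mathcal L=L(x^\mu,y^A,v^A{}_\mu)\,d^{n+1}x$. The covariant Legendre transformation $\mathbb F\mathcal L:J^1Y\to J^1Y^\star\cong Z$ is $\langle\mathbb F\mathcal L(\gamma),\gamma'\rangle=\mathcal L(\gamma)+\frac{d}{d\varepsilon}\mathcal L(\gamma+\varepsilon(\gamma'-\gamma))|_{\varepsilon=0}$ for $\gamma,\gamma'\in J^1_yY$. The Euler–Lagrange equations for a section $\phi$ are, in coordinates, $\frac{\partial L}{\partial y^A}(j^1\phi)-\frac{\partial}{\partial x^\mu}\left(\frac{\partial L}{\partial v^A{}_\mu}(j^1\phi)\right)=0$ for all $A$. $\eta\in\mathcal G$ acts on $Y$ by a bundle automorphism $\eta_Y$ covering a diffeomorphism $\eta_X$ of $X$. The lifted actions are $\eta_{J^1Y}(\gamma)=T\eta_Y\circ\gamma\circ T\eta_X^{-1}$ on $J^1Y$ and $\eta_Z(z)=(\eta_Y^{-1})^*z$ on $Z$; $\xi_Z$ is the infinitesimal generator on $Z$ of $\xi\in\mathfrak g$ (the vector field whose flow is the action of $\exp(\lambda\xi)$). $J(\xi)=\mathbf{i}_{\xi_Z}\Theta$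 is the special covariant momentum map, and $J^{\mathcal L}(\xi)=\mathbb F\mathcal L^*J(\xi)$, an $n$-form on $J^1Y$, is the covariant momentum map in the Lagrangian representation. $\mathcal L$ is equivariant with respect to $\mathcal G$ if $\mathcal L(\eta_{J^1Y}(\gamma))=(\eta_X^{-1})^*\mathcal L(\gamma)$ for all $\eta\in\mathcal G$, $\gamma\in J^1Y$. *)

theory Defs
  imports "HOL-Analysis.Analysis" "HOL-Algebra.Group_Action"
begin

section \<open>Smooth maps between topological vector spaces\<close>

definition dir_deriv ::
    "('a::{real_vector,t2_space} \<Rightarrow> 'b::{real_vector,t2_space}) \<Rightarrow> 'a \<Rightarrow> 'a \<Rightarrow> 'b" where
  "dir_deriv f x v = Lim (at (0::real)) (\<lambda>t. (f (x + t *\<^sub>R v) - f x) /\<^sub>R t)"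

fun iter_deriv ::
    "('a::{real_vector,t2_space} \<Rightarrow> 'b::{real_vector,t2_space}) \<Rightarrow> 'a list \<Rightarrow> 'a \<Rightarrow> 'b" where
  "iter_deriv f [] x = f x"
| "iter_deriv f (v # vs) x = dir_deriv (iter_deriv f vs) x v"

text \<open>Smoothness in the sense of Michal--Bastiani (as used by Hamilton, Milnor, Neeb): all iterated
  directional derivatives exist and are jointly continuous in the base point and the directions.
  Between finite-dimensional spaces this is the usual notion; it is stated in this generality so
  that it also serves for Lie groups modelled on infinite-dimensional spaces.  The directions
  \<open>v 0, \<dots>, v (k-1)\<close> are the first \<open>k\<close> entries of a sequence \<open>v\<close>, the space of sequences carrying
  the product topology.\<close>

definition smooth_on ::
    "'a::{real_vector,t2_space} set \<Rightarrow> ('a \<Rightarrow> 'b::{real_vector,t2_space}) \<Rightarrow> bool" where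
  "smooth_on U f \<longleftrightarrow> open U \<and>
    (\<forall>x\<in>U. \<forall>vs v. \<exists>l.
      ((\<lambda>t::real. (iter_deriv f vs (x + t *\<^sub>R v) - iter_deriv f vs x) /\<^sub>R t) \<longlongrightarrow> l) (at 0)) \<and>
    (\<forall>k. continuous_on (U \<times> UNIV) (\<lambda>(x, v :: nat \<Rightarrow> 'a). iter_deriv f (map v [0..<k]) x))"

class locally_convex_space = real_vector + t2_space + topological_ab_group_add +
  assumes tendsto_scaleR_Pair: "LIM p (nhds (a::real) \<times>\<^sub>F nhds x). fst p *\<^sub>R snd p :> nhds (a *\<^sub>R x)"
    and locally_convex: "open U \<Longrightarrow> 0 \<in> U \<Longrightarrow> \<exists>V. open V \<and> 0 \<in> V \<and> V \<subseteq> U \<and>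
      (\<forall>x\<in>V. \<forall>y\<in>V. \<forall>s\<ge>0. \<forall>t\<ge>0. s + t = 1 \<longrightarrow> s *\<^sub>R x + t *\<^sub>R y \<in> V)"

instance real_normed_vector \<subseteq> locally_convex_space
proof
  show "LIM p (nhds (a::real) \<times>\<^sub>F nhds x). fst p *\<^sub>R snd p :> nhds (a *\<^sub>R x)" for a and x :: 'a
    by (intro tendsto_scaleR filterlim_fst filterlim_snd)
  show "\<exists>V. open V \<and> 0 \<in> V \<and> V \<subseteq> U \<and>
      (\<forall>x\<in>V. \<forall>y\<in>V. \<forall>s\<ge>0. \<forall>t\<ge>0. s + t = 1 \<longrightarrow> s *\<^sub>R x + t *\<^sub>R y \<in> V)" if U: "open U" "0 \<in> U" for U :: "'a set"
  proof -
    obtain e where "e > 0" "ball 0 e \<subseteq> U"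
      using U by (meson open_contains_ball)
    moreover have "convex (ball (0::'a) e)" by simp
    ultimately show ?thesis
      unfolding convex_def by (intro exI[of _ "ball 0 e"]) auto
  qed
qed


section \<open>Manifolds\<close>

text \<open>A chart is a pair of a domain and a map (irrelevant off the domain); a manifold is given by
  an atlas, its points being the union of the chart domains.\<close>

type_synonym ('a, 'e) chart = "'a set \<times> ('a \<Rightarrow> 'e)"
type_synonym ('a, 'e) atlas = "('a, 'e) chart set"

abbreviation cdom :: "('a, 'e) chart \<Rightarrow> 'a set" where "cdom \<equiv> fst"
abbreviation cmap :: "('a, 'e) chart \<Rightarrow> 'a \<Rightarrow> 'e" where "cmap \<equiv> snd"
abbreviation cinv :: "('a, 'e) chart \<Rightarrow> 'e \<Rightarrow> 'a" where "cinv C \<equiv> inv_into (cdom C) (cmap C)"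

definition points :: "('a, 'e) atlas \<Rightarrow> 'a set" where
  "points M = (\<Union>C\<in>M. cdom C)"

definition atlas_topology :: "('a, 'e::topological_space) atlas \<Rightarrow> 'a topology" where
  "atlas_topology M =
    topology (\<lambda>S. S \<subseteq> points M \<and> (\<forall>C\<in>M. open (cmap C ` (S \<inter> cdom C))))"

definition chart_of ::
    "'a set \<Rightarrow> ('a, 'e::{real_vector,t2_space}) chart \<Rightarrow> bool" where
  "chart_of P C \<longleftrightarrow> cdom C \<subseteq> P \<and> inj_on (cmap C) (cdom C) \<and> open (cmap C ` cdom C)"

definition smooth_change ::
    "('a, 'e::{real_vector,t2_space}) chart \<Rightarrow> ('a, 'e) chart \<Rightarrow> bool" where
  "smooth_change C D \<longleftrightarrow> smooth_on (cmap C ` (cdom C \<inter> cdom D)) (cmap D \<circ> cinv C)"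

definition smooth_manifold :: "('a, 'e::{real_vector,t2_space}) atlas \<Rightarrow> bool" where
  "smooth_manifold M \<longleftrightarrow>
    (\<forall>C\<in>M. chart_of (points M) C) \<and> (\<forall>C\<in>M. \<forall>D\<in>M. smooth_change C D) \<and>
    Hausdorff_space (atlas_topology M)"

lemma openin_atlas_topology:
  assumes "smooth_manifold M"
  shows "openin (atlas_topology M) S \<longleftrightarrow>
    S \<subseteq> points M \<and> (\<forall>C\<in>M. open (cmap C ` (S \<inter> cdom C)))"
proof -
  have "istopology (\<lambda>S. S \<subseteq> points M \<and> (\<forall>C\<in>M. open (cmap C ` (S \<inter> cdom C))))"
    unfolding istopology_def
  proof (intro conjI allI impI ballI)
    fix S T C
    assume S: "S \<subseteq> points M \<and> (\<forall>C\<in>M. open (cmap C ` (S \<inter> cdom C)))"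
      and T: "T \<subseteq> points M \<and> (\<forall>C\<in>M. open (cmap C ` (T \<inter> cdom C)))"
    show "S \<inter> T \<subseteq> points M" using S by blast
    assume C: "C \<in> M"
    have "inj_on (cmap C) (cdom C)"
      using assms C by (auto simp: smooth_manifold_def chart_of_def)
    then have "cmap C ` (S \<inter> T \<inter> cdom C) = cmap C ` (S \<inter> cdom C) \<inter> cmap C ` (T \<inter> cdom C)"
      by (auto simp: inj_on_def)
    then show "open (cmap C ` (S \<inter> T \<inter> cdom C))"
      using S T C by auto
  next
    fix K C
    assume K: "\<forall>S\<in>K. S \<subseteq> points M \<and> (\<forall>C\<in>M. open (cmap C ` (S \<inter> cdom C)))"
    show "\<Union>K \<subseteq> points M" using K by blast
    assume C: "C \<in> M"
    have "cmap C ` (\<Union>K \<inter> cdom C) = (\<Union>S\<in>K. cmap C ` (S \<inter> cdom C))"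
      by auto
    then show "open (cmap C ` (\<Union>K \<inter> cdom C))"
      using K C by auto
  qed
  then show ?thesis
    by (simp add: atlas_topology_def topology_inverse')
qed

definition max_atlas :: "('a, 'e::{real_vector,t2_space}) atlas \<Rightarrow> ('a, 'e) atlas" where
  "max_atlas M = {C. chart_of (points M) C \<and> (\<forall>D\<in>M. smooth_change C D \<and> smooth_change D C)}"

definition smooth_map ::
    "('a, 'e::{real_vector,t2_space}) atlas \<Rightarrow> ('b, 'f::{real_vector,t2_space}) atlas
      \<Rightarrow> ('a \<Rightarrow> 'b) \<Rightarrow> bool" where
  "smooth_map M N f \<longleftrightarrow> f ` points M \<subseteq> points N \<and>
    (\<forall>C\<in>M. \<forall>D\<in>N. smooth_on (cmap C ` (cdom C \<inter> f -` cdom D)) (cmap D \<circ> f \<circ> cinv C))"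

definition diffeomorphism ::
    "('a, 'e::{real_vector,t2_space}) atlas \<Rightarrow> ('b, 'f::{real_vector,t2_space}) atlas
      \<Rightarrow> ('a \<Rightarrow> 'b) \<Rightarrow> bool" where
  "diffeomorphism M N f \<longleftrightarrow> bij_betw f (points M) (points N) \<and>
    smooth_map M N f \<and> smooth_map N M (inv_into (points M) f)"

definition vs_atlas :: "('e, 'e) atlas" where
  "vs_atlas = {(UNIV, \<lambda>v. v)}"

definition open_submanifold :: "'a set \<Rightarrow> ('a, 'e) atlas \<Rightarrow> ('a, 'e) atlas" where
  "open_submanifold S M = (\<lambda>C. (cdom C \<inter> S, cmap C)) ` M"

definition prod_atlas :: "('a, 'e) atlas \<Rightarrow> ('b, 'f) atlas \<Rightarrow> ('a \<times> 'b, 'e \<times> 'f) atlas" where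
  "prod_atlas M N =
    (\<lambda>(C, D). (cdom C \<times> cdom D, \<lambda>(a, b). (cmap C a, cmap D b))) ` (M \<times> N)"

text \<open>A manifold is oriented by an atlas with orientation-preserving coordinate changes.\<close>

definition oriented_atlas :: "('a, real^'n) atlas \<Rightarrow> bool" where
  "oriented_atlas M \<longleftrightarrow> (\<forall>C\<in>M. \<forall>D\<in>M. \<forall>p\<in>cdom C \<inter> cdom D.
    0 < det (matrix (dir_deriv (cmap D \<circ> cinv C) (cmap C p))))"


section \<open>Tangent vectors and differential forms\<close>

text \<open>At every point one chart of the atlas is singled out.  The tangent space at \<open>p\<close> is the model
  space \<open>'e\<close>, a vector \<open>v\<close> standing for the tangent vector with components \<open>v\<close> in the chart
  \<^term>\<open>chart_at M p\<close>.  A \<open>k\<close>-form at \<open>p\<close> is an alternating \<open>k\<close>-linear function of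
  lists of \<open>k\<close> such vectors, set to \<open>0\<close> on lists of other lengths.\<close>

definition chart_at :: "('a, 'e) atlas \<Rightarrow> 'a \<Rightarrow> ('a, 'e) chart" where
  "chart_at M p = (SOME C. C \<in> M \<and> p \<in> cdom C)"

definition tangent_map ::
    "('a, 'e::{real_vector,t2_space}) atlas \<Rightarrow> ('b, 'f::{real_vector,t2_space}) atlas
      \<Rightarrow> ('a \<Rightarrow> 'b) \<Rightarrow> 'a \<Rightarrow> 'e \<Rightarrow> 'f" where
  "tangent_map M N f p =
    dir_deriv (cmap (chart_at N (f p)) \<circ> f \<circ> cinv (chart_at M p)) (cmap (chart_at M p) p)"

definition velocity :: "('a, 'e::{real_vector,t2_space}) atlas \<Rightarrow> (real \<Rightarrow> 'a) \<Rightarrow> 'e" where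
  "velocity M c = tangent_map vs_atlas M c 0 1"

text \<open>Components in the chart \<open>C\<close> of the tangent vector \<open>v\<close> at \<open>p\<close>, and the tangent vector at
  \<open>p\<close> with components \<open>v\<close> in the chart \<open>C\<close>.\<close>

definition coord_comp ::
    "('a, 'e::{real_vector,t2_space}) atlas \<Rightarrow> ('a, 'e) chart \<Rightarrow> 'a \<Rightarrow> 'e \<Rightarrow> 'e" where
  "coord_comp M C p = dir_deriv (cmap C \<circ> cinv (chart_at M p)) (cmap (chart_at M p) p)"

definition coord_vec ::
    "('a, 'e::{real_vector,t2_space}) atlas \<Rightarrow> ('a, 'e) chart \<Rightarrow> 'a \<Rightarrow> 'e \<Rightarrow> 'e" where
  "coord_vec M C p = dir_deriv (cmap (chart_at M p) \<circ> cinv C) (cmap C p)"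

type_synonym 'e form = "'e list \<Rightarrow> real"

definition alternating_forms :: "nat \<Rightarrow> 'e::real_vector form set" where
  "alternating_forms k = {\<omega>.
    (\<forall>vs. length vs \<noteq> k \<longrightarrow> \<omega> vs = 0) \<and>
    (\<forall>vs i. length vs = k \<and> i < k \<longrightarrow> linear (\<lambda>v. \<omega> (vs[i := v]))) \<and>
    (\<forall>vs i j. length vs = k \<and> i < j \<and> j < k \<and> vs ! i = vs ! j \<longrightarrow> \<omega> vs = 0)}"

definition interior_prod :: "'e \<Rightarrow> 'e form \<Rightarrow> 'e form" (infixr "\<lrcorner>" 70) where
  "v \<lrcorner> \<omega> = (\<lambda>vs. \<omega> (v # vs))"

definition pullback ::
    "('a, 'e::{real_vector,t2_space}) atlas \<Rightarrow> ('b, 'f::{real_vector,t2_space}) atlas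
      \<Rightarrow> ('a \<Rightarrow> 'b) \<Rightarrow> ('b \<Rightarrow> 'f form) \<Rightarrow> ('a \<Rightarrow> 'e form)" where
  "pullback M N f \<omega> = (\<lambda>p vs. \<omega> (f p) (map (tangent_map M N f p) vs))"

text \<open>\<open>d\<omega>(v\<^sub>0,\<dots>,v\<^sub>k) = \<Sum>\<^sub>i (-1)\<^sup>i \<partial>\<^bsub>v\<^sub>i\<^esub> (\<omega>(v\<^sub>0,\<dots>,\<close> omit \<open>v\<^sub>i,\<dots>,v\<^sub>k))\<close> for vectors with constant
  components in the chart at \<open>p\<close>.\<close>

definition ext_deriv ::
    "('a, 'e::{real_vector,t2_space}) atlas \<Rightarrow> nat \<Rightarrow> ('a \<Rightarrow> 'e form) \<Rightarrow> 'a \<Rightarrow> 'e form" where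
  "ext_deriv M k \<omega> p vs = (let C = chart_at M p in
    if length vs = Suc k then
      \<Sum>i\<le>k. (-1) ^ i * dir_deriv
        (\<lambda>u. \<omega> (cinv C u) (map (coord_vec M C (cinv C u)) (take i vs @ drop (Suc i) vs)))
        (cmap C p) (vs ! i)
    else 0)"

text \<open>For a diffeomorphism \<open>\<eta>\<close> of \<open>M\<close>, the map \<open>(\<eta>\<^sup>-\<^sup>1)\<^sup>*\<close> from the forms at \<open>p\<close> to those at \<open>\<eta> p\<close>.\<close>

definition form_action ::
    "('a, 'e::{real_vector,t2_space}) atlas \<Rightarrow> ('a \<Rightarrow> 'a) \<Rightarrow> 'a \<times> 'e form \<Rightarrow> 'a \<times> 'e form" where
  "form_action M \<eta> = (\<lambda>(p, \<omega>).
    (\<eta> p, \<lambda>vs. \<omega> (map (tangent_map M M (inv_into (points M) \<eta>) (\<eta> p)) vs)))"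


section \<open>Fiber bundles and adapted charts\<close>

definition fiber_bundle ::
    "('y, 'e::{real_vector,t2_space} \<times> 'v::{real_vector,t2_space}) atlas \<Rightarrow> ('x, 'e) atlas
      \<Rightarrow> ('f, 'v) atlas \<Rightarrow> ('y \<Rightarrow> 'x) \<Rightarrow> bool" where
  "fiber_bundle Y X F \<pi> \<longleftrightarrow> smooth_map Y X \<pi> \<and> \<pi> ` points Y = points X \<and>
    (\<forall>x\<in>points X. \<exists>U \<psi>. openin (atlas_topology X) U \<and> x \<in> U \<and>
      diffeomorphism (open_submanifold (\<pi> -` U) Y) (prod_atlas (open_submanifold U X) F) \<psi> \<and>
      (\<forall>y\<in>points Y \<inter> \<pi> -` U. fst (\<psi> y) = \<pi> y))"

text \<open>Coordinates \<open>x\<^sup>\<mu>\<close> on \<open>X\<close> (the chart \<open>B\<close>) and \<open>(x\<^sup>\<mu>, y\<^sup>A)\<close> on \<open>Y\<close> (the chart \<open>C\<close>).\<close>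

definition adapted ::
    "('x, 'e::{real_vector,t2_space}) atlas \<Rightarrow> ('y, 'e \<times> 'v::{real_vector,t2_space}) atlas
      \<Rightarrow> ('y \<Rightarrow> 'x) \<Rightarrow> ('x, 'e) chart \<Rightarrow> ('y, 'e \<times> 'v) chart \<Rightarrow> bool" where
  "adapted X Y \<pi> B C \<longleftrightarrow> B \<in> max_atlas X \<and> C \<in> max_atlas Y \<and> \<pi> ` cdom C \<subseteq> cdom B \<and>
    (\<forall>y\<in>cdom C. fst (cmap C y) = cmap B (\<pi> y))"

definition smooth_section ::
    "('x, 'e::{real_vector,t2_space}) atlas \<Rightarrow> ('y, 'f::{real_vector,t2_space}) atlas
      \<Rightarrow> ('y \<Rightarrow> 'x) \<Rightarrow> ('x \<Rightarrow> 'y) \<Rightarrow> bool" where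
  "smooth_section X Y \<pi> \<phi> \<longleftrightarrow> smooth_map X Y \<phi> \<and> (\<forall>x\<in>points X. \<pi> (\<phi> x) = x)"


section \<open>The first jet bundle\<close>

text \<open>The base manifold is modelled on \<^typ>\<open>real^'n\<close>, so that \<open>n + 1\<close> is \<^term>\<open>CARD('n)\<close> and the
  indices \<open>\<mu>\<close> are the elements of \<open>'n\<close>, in an order fixed once and for all; the total space is
  modelled on \<open>real^'n \<times> 'v\<close>.\<close>

definition indices :: "'n::finite list" where
  "indices = (SOME ns. distinct ns \<and> set ns = UNIV)"

definition jet_fiber ::
    "('x, 'e::{real_vector,t2_space}) atlas \<Rightarrow> ('y, 'f::{real_vector,t2_space}) atlas
      \<Rightarrow> ('y \<Rightarrow> 'x) \<Rightarrow> 'y \<Rightarrow> ('e \<Rightarrow> 'f) set" where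
  "jet_fiber X Y \<pi> y = {\<gamma>. linear \<gamma> \<and> (\<forall>u. tangent_map Y X \<pi> y (\<gamma> u) = u)}"

definition jet_space ::
    "('x, 'e::{real_vector,t2_space}) atlas \<Rightarrow> ('y, 'f::{real_vector,t2_space}) atlas
      \<Rightarrow> ('y \<Rightarrow> 'x) \<Rightarrow> ('y \<times> ('e \<Rightarrow> 'f)) set" where
  "jet_space X Y \<pi> = {(y, \<gamma>). y \<in> points Y \<and> \<gamma> \<in> jet_fiber X Y \<pi> y}"

text \<open>The coordinates \<open>((x\<^sup>\<mu>, y\<^sup>A), v\<^sup>A\<^sub>\<mu>)\<close>.\<close>

definition jet_chart ::
    "('x, real^'n) atlas \<Rightarrow> ('y, (real^'n) \<times> 'v::real_normed_vector) atlas \<Rightarrow> ('y \<Rightarrow> 'x)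
      \<Rightarrow> ('x, real^'n) chart \<Rightarrow> ('y, (real^'n) \<times> 'v) chart
      \<Rightarrow> ('y \<times> (real^'n \<Rightarrow> (real^'n) \<times> 'v), ((real^'n) \<times> 'v) \<times> ('v^'n)) chart" where
  "jet_chart X Y \<pi> B C = ({(y, \<gamma>) \<in> jet_space X Y \<pi>. y \<in> cdom C},
    \<lambda>(y, \<gamma>). (cmap C y,
      \<chi> \<mu>. snd (coord_comp Y C y (\<gamma> (coord_vec X B (\<pi> y) (axis \<mu> 1))))))"

definition jet_atlas ::
    "('x, real^'n) atlas \<Rightarrow> ('y, (real^'n) \<times> 'v::real_normed_vector) atlas \<Rightarrow> ('y \<Rightarrow> 'x)
      \<Rightarrow> ('y \<times> (real^'n \<Rightarrow> (real^'n) \<times> 'v), ((real^'n) \<times> 'v) \<times> ('v^'n)) atlas" where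
  "jet_atlas X Y \<pi> = {jet_chart X Y \<pi> B C | B C. adapted X Y \<pi> B C}"

definition jet_prolongation ::
    "('x, 'e::{real_vector,t2_space}) atlas \<Rightarrow> ('y, 'f::{real_vector,t2_space}) atlas
      \<Rightarrow> ('x \<Rightarrow> 'y) \<Rightarrow> 'x \<Rightarrow> 'y \<times> ('e \<Rightarrow> 'f)" where
  "jet_prolongation X Y \<phi> x = (\<phi> x, tangent_map X Y \<phi> x)"

definition jet_action ::
    "('x, 'e::{real_vector,t2_space}) atlas \<Rightarrow> ('y, 'f::{real_vector,t2_space}) atlas
      \<Rightarrow> ('y \<Rightarrow> 'x) \<Rightarrow> ('y \<Rightarrow> 'y) \<Rightarrow> ('x \<Rightarrow> 'x) \<Rightarrow> 'y \<times> ('e \<Rightarrow> 'f) \<Rightarrow> 'y \<times> ('e \<Rightarrow> 'f)" where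
  "jet_action X Y \<pi> \<eta>Y \<eta>X = (\<lambda>(y, \<gamma>).
    (\<eta>Y y, tangent_map Y Y \<eta>Y y \<circ> \<gamma> \<circ> tangent_map X X (inv_into (points X) \<eta>X) (\<eta>X (\<pi> y))))"


section \<open>The dual jet bundle\<close>

text \<open>The bundle \<open>Z\<close>.\<close>

definition dual_fiber ::
    "('x, real^'n) atlas \<Rightarrow> ('y, (real^'n) \<times> 'v::real_normed_vector) atlas \<Rightarrow> ('y \<Rightarrow> 'x)
      \<Rightarrow> 'y \<Rightarrow> ((real^'n) \<times> 'v) form set" where
  "dual_fiber X Y \<pi> y = {z \<in> alternating_forms CARD('n).
    \<forall>v w. tangent_map Y X \<pi> y v = 0 \<longrightarrow> tangent_map Y X \<pi> y w = 0 \<longrightarrow> v \<lrcorner> w \<lrcorner> z = (\<lambda>_. 0)}"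

definition dual_space ::
    "('x, real^'n) atlas \<Rightarrow> ('y, (real^'n) \<times> 'v::real_normed_vector) atlas \<Rightarrow> ('y \<Rightarrow> 'x)
      \<Rightarrow> ('y \<times> ((real^'n) \<times> 'v) form) set" where
  "dual_space X Y \<pi> = {(y, z). y \<in> points Y \<and> z \<in> dual_fiber X Y \<pi> y}"

text \<open>The coordinates \<open>((x\<^sup>\<mu>, y\<^sup>A), p, p\<^sub>A\<^sup>\<mu>)\<close> for which
  \<open>z = p d\<^sup>n\<^sup>+\<^sup>1x + p\<^sub>A\<^sup>\<mu> dy\<^sup>A \<and> (\<partial>\<^sub>\<mu> \<lrcorner> d\<^sup>n\<^sup>+\<^sup>1x)\<close>: the first is \<open>p = z(\<partial>\<^sub>0,\<dots>,\<partial>\<^sub>n)\<close>, and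
  \<open>p\<^sub>A\<^sup>\<mu> w\<^sup>A\<close> is obtained from it by replacing the argument \<open>\<partial>\<^sub>\<mu>\<close> by the vertical vector
  \<open>w\<^sup>A \<partial>\<^sub>A\<close>.  For each \<open>\<mu>\<close> the \<open>p\<^sub>A\<^sup>\<mu>\<close> are combined into a linear form on \<open>'v\<close>.\<close>

definition dual_chart ::
    "('x, real^'n) atlas \<Rightarrow> ('y, (real^'n) \<times> 'v::real_normed_vector) atlas
      \<Rightarrow> ('y \<Rightarrow> 'x) \<Rightarrow> ('y, (real^'n) \<times> 'v) chart
      \<Rightarrow> ('y \<times> ((real^'n) \<times> 'v) form,
          ((real^'n) \<times> 'v) \<times> real \<times> (('v \<Rightarrow>\<^sub>L real)^'n)) chart" where
  "dual_chart X Y \<pi> C = ({(y, z) \<in> dual_space X Y \<pi>. y \<in> cdom C},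
    \<lambda>(y, z). (cmap C y,
      z (map (\<lambda>\<nu>. coord_vec Y C y (axis \<nu> 1, 0)) indices),
      \<chi> \<mu>. Blinfun (\<lambda>w.
        z (map (\<lambda>\<nu>. coord_vec Y C y (if \<nu> = \<mu> then (0, w) else (axis \<nu> 1, 0))) indices))))"

definition dual_atlas ::
    "('x, real^'n) atlas \<Rightarrow> ('y, (real^'n) \<times> 'v::real_normed_vector) atlas
      \<Rightarrow> ('y \<Rightarrow> 'x)
      \<Rightarrow> ('y \<times> ((real^'n) \<times> 'v) form,
          ((real^'n) \<times> 'v) \<times> real \<times> (('v \<Rightarrow>\<^sub>L real)^'n)) atlas" where
  "dual_atlas X Y \<pi> = {dual_chart X Y \<pi> C | B C. adapted X Y \<pi> B C}"

definition canonical_form ::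
    "('x, real^'n) atlas \<Rightarrow> ('y, (real^'n) \<times> 'v::real_normed_vector) atlas
      \<Rightarrow> ('y \<Rightarrow> 'x) \<Rightarrow> 'y \<times> ((real^'n) \<times> 'v) form
      \<Rightarrow> (((real^'n) \<times> 'v) \<times> real \<times> (('v \<Rightarrow>\<^sub>L real)^'n)) form" where
  "canonical_form X Y \<pi> z us = snd z (map (tangent_map (dual_atlas X Y \<pi>) Y fst z) us)"


section \<open>Lagrangian densities\<close>

text \<open>The line bundle of top-degree forms, in whose charts \<open>L d\<^sup>n\<^sup>+\<^sup>1x\<close> at \<open>x\<close> has the coordinates
  \<open>(x\<^sup>\<mu>, L)\<close>.\<close>

definition top_form_chart ::
    "('x, real^'n) atlas \<Rightarrow> ('x, real^'n) chart
      \<Rightarrow> ('x \<times> (real^'n) form, (real^'n) \<times> real) chart" where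
  "top_form_chart X B = ({(x, \<omega>). x \<in> cdom B \<and> \<omega> \<in> alternating_forms CARD('n)},
    \<lambda>(x, \<omega>). (cmap B x, \<omega> (map (\<lambda>\<mu>. coord_vec X B x (axis \<mu> 1)) indices)))"

definition top_form_atlas ::
    "('x, real^'n) atlas
      \<Rightarrow> ('x \<times> (real^'n) form, (real^'n) \<times> real) atlas" where
  "top_form_atlas X = top_form_chart X ` X"

type_synonym ('x, 'y, 'e, 'f) density = "'y \<times> ('e \<Rightarrow> 'f) \<Rightarrow> 'x \<times> 'e form"

definition lagrangian_density ::
    "('x, real^'n) atlas \<Rightarrow> ('y, (real^'n) \<times> 'v::real_normed_vector) atlas
      \<Rightarrow> ('y \<Rightarrow> 'x) \<Rightarrow> ('x, 'y, real^'n, (real^'n) \<times> 'v) density \<Rightarrow> bool" where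
  "lagrangian_density X Y \<pi> \<L> \<longleftrightarrow> smooth_map (jet_atlas X Y \<pi>) (top_form_atlas X) \<L> \<and>
    (\<forall>(y, \<gamma>)\<in>jet_space X Y \<pi>. fst (\<L> (y, \<gamma>)) = \<pi> y)"

text \<open>The coordinate function \<open>L(x\<^sup>\<mu>, y\<^sup>A, v\<^sup>A\<^sub>\<mu>)\<close>.\<close>

definition lagrangian_coord ::
    "('x, real^'n) atlas \<Rightarrow> ('y, (real^'n) \<times> 'v::real_normed_vector) atlas
      \<Rightarrow> ('y \<Rightarrow> 'x) \<Rightarrow> ('x, 'y, real^'n, (real^'n) \<times> 'v) density
      \<Rightarrow> ('x, real^'n) chart \<Rightarrow> ('y, (real^'n) \<times> 'v) chart
      \<Rightarrow> ((real^'n) \<times> 'v) \<times> ('v^'n) \<Rightarrow> real" where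
  "lagrangian_coord X Y \<pi> \<L> B C q =
    snd (cmap (top_form_chart X B) (\<L> (cinv (jet_chart X Y \<pi> B C) q)))"

text \<open>The equation for \<open>w\<close> is the one in the fiber coordinate direction \<open>w\<close>; for \<open>w\<close> the \<open>A\<close>-th
  vector of a basis of \<open>'v\<close> it is
  \<open>\<partial>L/\<partial>y\<^sup>A(j\<^sup>1\<phi>) - \<partial>/\<partial>x\<^sup>\<mu> (\<partial>L/\<partial>v\<^sup>A\<^sub>\<mu>(j\<^sup>1\<phi>)) = 0\<close>.  Speaking of directions rather than indices \<open>A\<close>
  keeps the case of zero-dimensional fibers.\<close>

definition euler_lagrange ::
    "('x, real^'n) atlas \<Rightarrow> ('y, (real^'n) \<times> 'v::real_normed_vector) atlas
      \<Rightarrow> ('y \<Rightarrow> 'x) \<Rightarrow> ('x, 'y, real^'n, (real^'n) \<times> 'v) density \<Rightarrow> ('x \<Rightarrow> 'y) \<Rightarrow> bool" where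
  "euler_lagrange X Y \<pi> \<L> \<phi> \<longleftrightarrow>
    (\<forall>B C x w. adapted X Y \<pi> B C \<and> x \<in> points X \<and> \<phi> x \<in> cdom C \<longrightarrow>
      (let L = lagrangian_coord X Y \<pi> \<L> B C;
           j = (\<lambda>u. cmap (jet_chart X Y \<pi> B C) (jet_prolongation X Y \<phi> (cinv B u)))
       in dir_deriv L (j (cmap B x)) ((0, w), 0) -
          (\<Sum>\<mu>\<in>UNIV. dir_deriv (\<lambda>u. dir_deriv L (j u) ((0, 0), axis \<mu> w)) (cmap B x) (axis \<mu> 1))
          = 0))"

text \<open>The element of \<open>Z\<close> is described through its identification \<open>\<langle>z, \<gamma>\<rangle> = \<gamma>\<^sup>*z\<close> with an affine map
  on the jets at \<open>y\<close>; the derivative of a curve of forms is taken for each list of arguments.\<close>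

definition legendre ::
    "('x, real^'n) atlas \<Rightarrow> ('y, (real^'n) \<times> 'v::real_normed_vector) atlas
      \<Rightarrow> ('y \<Rightarrow> 'x) \<Rightarrow> ('x, 'y, real^'n, (real^'n) \<times> 'v) density
      \<Rightarrow> 'y \<times> (real^'n \<Rightarrow> (real^'n) \<times> 'v) \<Rightarrow> 'y \<times> ((real^'n) \<times> 'v) form" where
  "legendre X Y \<pi> \<L> = (\<lambda>(y, \<gamma>). (y, THE z. z \<in> dual_fiber X Y \<pi> y \<and>
    (\<forall>\<gamma>'\<in>jet_fiber X Y \<pi> y. \<forall>us. z (map \<gamma>' us) =
      snd (\<L> (y, \<gamma>)) us +
      deriv (\<lambda>\<epsilon>. snd (\<L> (y, \<lambda>u. \<gamma> u + \<epsilon> *\<^sub>R (\<gamma>' u - \<gamma> u))) us) 0)))"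


section \<open>Symmetry groups and momentum maps\<close>

text \<open>Lie groups in the sense of Milnor, modelled on an arbitrary locally convex space.\<close>

definition lie_group ::
    "('g, 'm) monoid_scheme \<Rightarrow> ('g, 'a::locally_convex_space) atlas \<Rightarrow> bool" where
  "lie_group G A \<longleftrightarrow> group G \<and> points A = carrier G \<and> smooth_manifold A \<and>
    smooth_map (prod_atlas A A) A (\<lambda>(g, h). g \<otimes>\<^bsub>G\<^esub> h) \<and>
    smooth_map A A (\<lambda>g. inv\<^bsub>G\<^esub> g)"

text \<open>The Lie algebra is the tangent space at the identity, that is, the model space \<open>'a\<close>.  An
  infinite-dimensional Lie group need not have an exponential map, but there is at most one.\<close>

definition exponential_map ::
    "('g, 'm) monoid_scheme \<Rightarrow> ('g, 'a::locally_convex_space) atlas \<Rightarrow> ('a \<Rightarrow> 'g) \<Rightarrow> bool" where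
  "exponential_map G A ex \<longleftrightarrow> (\<forall>\<xi>.
    smooth_map vs_atlas A (\<lambda>t::real. ex (t *\<^sub>R \<xi>)) \<and>
    (\<forall>s t. ex ((s + t) *\<^sub>R \<xi>) = ex (s *\<^sub>R \<xi>) \<otimes>\<^bsub>G\<^esub> ex (t *\<^sub>R \<xi>)) \<and>
    velocity A (\<lambda>t. ex (t *\<^sub>R \<xi>)) = \<xi>)"

text \<open>A smooth action of \<open>G\<close> on \<open>Y\<close> by bundle automorphisms, \<open>act g\<close> covering \<open>actX g\<close>.\<close>

definition acts_by_bundle_automorphisms ::
    "('g, 'm) monoid_scheme \<Rightarrow> ('g, 'a::locally_convex_space) atlas
      \<Rightarrow> ('x, 'e::{real_vector,t2_space}) atlas \<Rightarrow> ('y, 'f::{real_vector,t2_space}) atlas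
      \<Rightarrow> ('y \<Rightarrow> 'x) \<Rightarrow> ('g \<Rightarrow> 'y \<Rightarrow> 'y) \<Rightarrow> ('g \<Rightarrow> 'x \<Rightarrow> 'x) \<Rightarrow> bool" where
  "acts_by_bundle_automorphisms G A X Y \<pi> act actX \<longleftrightarrow>
    group_action G (points Y) act \<and> smooth_map (prod_atlas A Y) Y (\<lambda>(g, y). act g y) \<and>
    (\<forall>g\<in>carrier G. diffeomorphism X X (actX g) \<and> (\<forall>y\<in>points Y. \<pi> (act g y) = actX g (\<pi> y)))"

definition equivariant ::
    "('g, 'm) monoid_scheme \<Rightarrow> ('x, 'e::{real_vector,t2_space}) atlas
      \<Rightarrow> ('y, 'f::{real_vector,t2_space}) atlas \<Rightarrow> ('y \<Rightarrow> 'x)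
      \<Rightarrow> ('g \<Rightarrow> 'y \<Rightarrow> 'y) \<Rightarrow> ('g \<Rightarrow> 'x \<Rightarrow> 'x) \<Rightarrow> ('x, 'y, 'e, 'f) density \<Rightarrow> bool" where
  "equivariant G X Y \<pi> act actX \<L> \<longleftrightarrow> (\<forall>g\<in>carrier G. \<forall>\<gamma>\<in>jet_space X Y \<pi>.
    \<L> (jet_action X Y \<pi> (act g) (actX g) \<gamma>) = form_action X (actX g) (\<L> \<gamma>))"

definition generator ::
    "('p, 'b::{real_vector,t2_space}) atlas \<Rightarrow> ('a::real_vector \<Rightarrow> 'g) \<Rightarrow> ('g \<Rightarrow> 'p \<Rightarrow> 'p)
      \<Rightarrow> 'a \<Rightarrow> 'p \<Rightarrow> 'b" where
  "generator M ex act \<xi> p = velocity M (\<lambda>t. act (ex (t *\<^sub>R \<xi>)) p)"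

definition momentum_map ::
    "('x, real^'n) atlas \<Rightarrow> ('y, (real^'n) \<times> 'v::real_normed_vector) atlas
      \<Rightarrow> ('y \<Rightarrow> 'x) \<Rightarrow> ('a::real_vector \<Rightarrow> 'g) \<Rightarrow> ('g \<Rightarrow> 'y \<Rightarrow> 'y) \<Rightarrow> 'a
      \<Rightarrow> 'y \<times> ((real^'n) \<times> 'v) form
      \<Rightarrow> (((real^'n) \<times> 'v) \<times> real \<times> (('v \<Rightarrow>\<^sub>L real)^'n)) form" where
  "momentum_map X Y \<pi> ex act \<xi> z =
    generator (dual_atlas X Y \<pi>) ex (\<lambda>g. form_action Y (act g)) \<xi> z \<lrcorner> canonical_form X Y \<pi> z"

definition lagrangian_momentum_map ::
    "('x, real^'n) atlas \<Rightarrow> ('y, (real^'n) \<times> 'v::real_normed_vector) atlas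
      \<Rightarrow> ('y \<Rightarrow> 'x) \<Rightarrow> ('x, 'y, real^'n, (real^'n) \<times> 'v) density
      \<Rightarrow> ('a::real_vector \<Rightarrow> 'g) \<Rightarrow> ('g \<Rightarrow> 'y \<Rightarrow> 'y) \<Rightarrow> 'a
      \<Rightarrow> 'y \<times> (real^'n \<Rightarrow> (real^'n) \<times> 'v) \<Rightarrow> (((real^'n) \<times> 'v) \<times> ('v^'n)) form" where
  "lagrangian_momentum_map X Y \<pi> \<L> ex act \<xi> =
    pullback (jet_atlas X Y \<pi>) (dual_atlas X Y \<pi>) (legendre X Y \<pi> \<L>)
      (momentum_map X Y \<pi> ex act \<xi>)"

end

theory Submission imports Defs begin

text \<open>In adapted charts the form \<open>(j\<^sup>1\<phi>)\<^sup>*J\<close> is \<open>det (J, \<cdot>)\<close> for the Noether current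
  \<open>J\<^sup>\<mu> = L \<xi>\<^sup>\<mu> + \<partial>L/\<partial>v\<^sup>A\<^sub>\<mu> (\<xi>\<^sup>A - v\<^sup>A\<^sub>\<nu> \<xi>\<^sup>\<nu>)\<close>, and its exterior derivative is the divergence of \<open>J\<close>. Equivariance
  under \<open>exp (t\<xi>)\<close>, differentiated at \<open>t = 0\<close>, expresses this divergence by the Euler-Lagrange
  expression paired with \<open>\<xi>\<^sup>A - v\<^sup>A\<^sub>\<nu> \<xi>\<^sup>\<nu>\<close>, where the second derivatives of \<open>\<phi>\<close> and of the flow commute.
  All maps enter only through their derivatives up to order two, so Bastiani \<open>C\<^sup>2\<close> calculus on locally
  convex spaces suffices even for infinite-dimensional groups.\<close>

section \<open>Calculus in locally convex spaces\<close>

text \<open>The form lives on the jet bundle and on \<open>Z\<close>, whose tangent maps are read in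
  charts picked by \<open>chart_at\<close>, hence not in charts of one's choice. This is bearable
  because \<open>canonical_form\<close> sees a tangent vector of \<open>Z\<close> only through its
  projection to \<open>Y\<close>: of the derivatives of the prolongation, the Legendre
  transformation and the lifted flow, only the component along \<open>Y\<close> has to be computed.
  The other components must still be shown to be differentiable along the curves in question, since
  a \<open>Lim\<close> in the product space that fails to exist says nothing about its first
  component. There the finite dimension of the fibres enters: the momentum coordinates are bounded
  linear forms, compared in norm. The chain rule rests on a mean value estimate with normed target.
  The model space of the group is a target only for the one-parameter subgroup, where homogeneity in
  one real variable replaces that estimate. The jet action contains the inverse of the base map, so
  the Jacobian in the equivariance identity is that of the flow at \<open>- t\<close>; its
  derivative at 0 is minus the divergence of the base part of the generator.\<close>

lemma tendsto_scaleR_lcs: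
  fixes g :: "'c \<Rightarrow> 'a::locally_convex_space"
  assumes "(f \<longlongrightarrow> a) F" and "(g \<longlongrightarrow> x) F"
  shows "((\<lambda>z. f z *\<^sub>R g z) \<longlongrightarrow> a *\<^sub>R x) F"
proof -
  have "filterlim (\<lambda>z. (f z, g z)) (nhds a \<times>\<^sub>F nhds x) F"
    using assms by (rule filterlim_Pair)
  from filterlim_compose[OF tendsto_scaleR_Pair this] show ?thesis by simp
qed

section \<open>Products of locally convex spaces\<close>

instance prod :: (topological_monoid_add, topological_monoid_add) topological_monoid_add
proof
  fix a b :: "'a \<times> 'b"
  have 1: "((\<lambda>p. fst (fst p) + fst (snd p)) \<longlongrightarrow> fst a + fst b) (nhds a \<times>\<^sub>F nhds b)"
    by (intro tendsto_add tendsto_fst filterlim_fst filterlim_snd)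
  have 2: "((\<lambda>p. snd (fst p) + snd (snd p)) \<longlongrightarrow> snd a + snd b) (nhds a \<times>\<^sub>F nhds b)"
    by (intro tendsto_add tendsto_snd filterlim_fst filterlim_snd)
  show "LIM x (nhds a \<times>\<^sub>F nhds b). fst x + snd x :> nhds (a + b)"
    using tendsto_Pair[OF 1 2] by (simp add: plus_prod_def)
qed

instance prod :: (topological_comm_monoid_add, topological_comm_monoid_add)
  topological_comm_monoid_add ..

instance prod :: (topological_group_add, topological_group_add) topological_group_add
proof
  fix a :: "'a \<times> 'b"
  have "((\<lambda>p. (- fst p, - snd p)) \<longlongrightarrow> (- fst a, - snd a)) (nhds a)"
    by (intro tendsto_Pair tendsto_minus tendsto_fst tendsto_snd filterlim_ident)
  moreover have "uminus = (\<lambda>p::'a \<times> 'b. (- fst p, - snd p))"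
    by (auto simp: fun_eq_iff prod_eq_iff)
  moreover have "(- fst a, - snd a) = - a"
    by (simp add: prod_eq_iff)
  ultimately show "(uminus \<longlongrightarrow> - a) (nhds a)"
    by (simp only:)
qed

instance prod :: (topological_ab_group_add, topological_ab_group_add) topological_ab_group_add ..

text \<open>Serves the charts of \<open>prod_atlas A Y\<close>, one factor of which is not normed,
  and the pairs of point and direction on which a derivative is differentiated once more.\<close>

instance prod :: (locally_convex_space, locally_convex_space) locally_convex_space
proof
  fix a :: real and x :: "'a \<times> 'b"
  have 1: "((\<lambda>p. fst p *\<^sub>R fst (snd p)) \<longlongrightarrow> a *\<^sub>R fst x) (nhds a \<times>\<^sub>F nhds x)"
    by (intro tendsto_scaleR_lcs filterlim_fst tendsto_fst filterlim_snd)
  have 2: "((\<lambda>p. fst p *\<^sub>R snd (snd p)) \<longlongrightarrow> a *\<^sub>R snd x) (nhds a \<times>\<^sub>F nhds x)"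
    by (intro tendsto_scaleR_lcs filterlim_fst tendsto_snd filterlim_snd)
  show "LIM p (nhds a \<times>\<^sub>F nhds x). fst p *\<^sub>R snd p :> nhds (a *\<^sub>R x)"
    using tendsto_Pair[OF 1 2] by (simp add: scaleR_prod_def)
next
  fix U :: "('a \<times> 'b) set"
  assume "open U" "0 \<in> U"
  then obtain A B where AB: "open A" "open B" "0 \<in> A" "0 \<in> B" "A \<times> B \<subseteq> U"
    by (metis open_prod_elim mem_Sigma_iff zero_prod_def)
  obtain A' where A': "open A'" "0 \<in> A'" "A' \<subseteq> A"
    "\<forall>x\<in>A'. \<forall>y\<in>A'. \<forall>s\<ge>0. \<forall>t\<ge>0. s + t = 1 \<longrightarrow> s *\<^sub>R x + t *\<^sub>R y \<in> A'"
    using locally_convex[OF AB(1) AB(3)] by blast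
  obtain B' where B': "open B'" "0 \<in> B'" "B' \<subseteq> B"
    "\<forall>x\<in>B'. \<forall>y\<in>B'. \<forall>s\<ge>0. \<forall>t\<ge>0. s + t = 1 \<longrightarrow> s *\<^sub>R x + t *\<^sub>R y \<in> B'"
    using locally_convex[OF AB(2) AB(4)] by blast
  show "\<exists>V. open V \<and> 0 \<in> V \<and> V \<subseteq> U \<and>
      (\<forall>x\<in>V. \<forall>y\<in>V. \<forall>s\<ge>0. \<forall>t\<ge>0. s + t = 1 \<longrightarrow> s *\<^sub>R x + t *\<^sub>R y \<in> V)"
    using A' B' AB
    by (intro exI[of _ "A' \<times> B'"]) (auto simp: open_Times zero_prod_def)
qed

section \<open>Directional derivatives\<close>

lemma tendsto_line:
  fixes x v :: "'a::locally_convex_space"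
  shows "((\<lambda>t. x + t *\<^sub>R v) \<longlongrightarrow> x) (at 0)"
proof -
  have "((\<lambda>t. x + t *\<^sub>R v) \<longlongrightarrow> x + 0 *\<^sub>R v) (at 0)"
    by (intro tendsto_intros tendsto_scaleR_lcs tendsto_ident_at)
  then show ?thesis by simp
qed

text \<open>\<open>dir_deriv\<close> is a \<open>Lim\<close> and denotes something even where no
  limit exists; existence is therefore recorded by a separate predicate.\<close>

definition has_dir_deriv ::
    "('a::{real_vector,t2_space} \<Rightarrow> 'b::{real_vector,t2_space}) \<Rightarrow> 'b \<Rightarrow> 'a \<Rightarrow> 'a \<Rightarrow> bool" where
  "has_dir_deriv f l x v \<longleftrightarrow> ((\<lambda>t::real. (f (x + t *\<^sub>R v) - f x) /\<^sub>R t) \<longlongrightarrow> l) (at 0)"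

lemma dir_deriv_eqI: "has_dir_deriv f l x v \<Longrightarrow> dir_deriv f x v = l"
  unfolding has_dir_deriv_def dir_deriv_def by (rule tendsto_Lim) auto

lemma has_dir_deriv_exI: "\<exists>l. has_dir_deriv f l x v \<Longrightarrow> has_dir_deriv f (dir_deriv f x v) x v"
  using dir_deriv_eqI by blast

lemma has_dir_deriv_cong:
  fixes x :: "'a::locally_convex_space"
  assumes "\<forall>\<^sub>F y in nhds x. f y = g y"
  shows "has_dir_deriv f l x v \<longleftrightarrow> has_dir_deriv g l x v"
proof -
  have "\<forall>\<^sub>F t in at 0. f (x + t *\<^sub>R v) = g (x + t *\<^sub>R v)"
    using assms tendsto_line[of x v] by (rule eventually_compose_filterlim)
  moreover have "f x = g x" using assms by (rule eventually_nhds_x_imp_x)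
  ultimately have "\<forall>\<^sub>F t in at 0. (f (x + t *\<^sub>R v) - f x) /\<^sub>R t = (g (x + t *\<^sub>R v) - g x) /\<^sub>R t"
    by (auto elim: eventually_mono)
  then show ?thesis unfolding has_dir_deriv_def by (rule tendsto_cong)
qed

text \<open>Holds without differentiability: the two difference quotients converge to the same
  values, so \<open>Lim\<close> agrees even if there is no limit.\<close>

lemma dir_deriv_cong:
  fixes x :: "'a::locally_convex_space"
  assumes "\<forall>\<^sub>F y in nhds x. f y = g y"
  shows "dir_deriv f x v = dir_deriv g x v"
  using has_dir_deriv_cong[OF assms, of _ v]
  by (simp add: has_dir_deriv_def dir_deriv_def t2_space_class.Lim_def)

lemma has_dir_deriv_scaleR:
  fixes f :: "'a::locally_convex_space \<Rightarrow> 'b::locally_convex_space"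
  assumes "has_dir_deriv f l x v"
  shows "has_dir_deriv f (c *\<^sub>R l) x (c *\<^sub>R v)"
proof (cases "c = 0")
  case True
  then show ?thesis by (simp add: has_dir_deriv_def)
next
  case False
  have "filterlim (\<lambda>t. t * c) (at 0) (at (0::real))"
    unfolding filterlim_at using False
    by (auto simp: eventually_at_filter intro!: tendsto_mult_left_zero tendsto_ident_at)
  then have "((\<lambda>t. (f (x + (t * c) *\<^sub>R v) - f x) /\<^sub>R (t * c)) \<longlongrightarrow> l) (at 0)"
    using assms unfolding has_dir_deriv_def by (rule filterlim_compose[rotated])
  then have "((\<lambda>t. c *\<^sub>R ((f (x + (t * c) *\<^sub>R v) - f x) /\<^sub>R (t * c))) \<longlongrightarrow> c *\<^sub>R l) (at 0)"
    by (intro tendsto_scaleR_lcs tendsto_const)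
  moreover have "c *\<^sub>R ((f (x + (t * c) *\<^sub>R v) - f x) /\<^sub>R (t * c)) =
      (f (x + t *\<^sub>R c *\<^sub>R v) - f x) /\<^sub>R t" for t
    using False by (cases "t = 0") simp_all
  ultimately show ?thesis unfolding has_dir_deriv_def by (simp only:)
qed

lemma has_dir_deriv_iff_has_vector_derivative:
  fixes f :: "'a::{real_vector,t2_space} \<Rightarrow> 'b::real_normed_vector"
  shows "has_dir_deriv f l x v \<longleftrightarrow> ((\<lambda>t. f (x + t *\<^sub>R v)) has_vector_derivative l) (at 0)"
proof -
  have "((\<lambda>t. f (x + t *\<^sub>R v)) has_vector_derivative l) (at 0) \<longleftrightarrow>
      (\<lambda>t. norm ((f (x + t *\<^sub>R v) - f x - t *\<^sub>R l) /\<^sub>R norm t)) \<midarrow>0\<rightarrow> 0"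
    by (simp add: has_vector_derivative_def has_derivative_at bounded_linear_scaleR_left
        divide_inverse mult.commute)
  also have "\<dots> \<longleftrightarrow> (\<lambda>t. norm ((f (x + t *\<^sub>R v) - f x) /\<^sub>R t - l)) \<midarrow>0\<rightarrow> 0"
  proof (rule tendsto_cong)
    have "norm ((f (x + t *\<^sub>R v) - f x - t *\<^sub>R l) /\<^sub>R norm t) =
        norm ((f (x + t *\<^sub>R v) - f x) /\<^sub>R t - l)" if "t \<noteq> 0" for t
    proof -
      have "(f (x + t *\<^sub>R v) - f x) /\<^sub>R t - l = (f (x + t *\<^sub>R v) - f x - t *\<^sub>R l) /\<^sub>R t"
        using that by (simp add: scaleR_diff_right)
      then show ?thesis by simp
    qed
    then show "\<forall>\<^sub>F t in at 0. norm ((f (x + t *\<^sub>R v) - f x - t *\<^sub>R l) /\<^sub>R norm t) =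
        norm ((f (x + t *\<^sub>R v) - f x) /\<^sub>R t - l)"
      by (simp add: eventually_at_filter)
  qed
  also have "\<dots> \<longleftrightarrow> has_dir_deriv f l x v"
    unfolding has_dir_deriv_def by (subst LIM_zero_iff[symmetric], subst tendsto_norm_zero_iff) simp
  finally show ?thesis by simp
qed

lemma has_dir_deriv_real:
  fixes f :: "real \<Rightarrow> 'b::real_normed_vector"
  shows "has_dir_deriv f l x 1 \<longleftrightarrow> (f has_vector_derivative l) (at x)"
proof -
  have "((\<lambda>t. f (x + t)) has_vector_derivative l) (at 0)" if "(f has_vector_derivative l) (at x)"
  proof -
    have "((\<lambda>t. x + t) has_vector_derivative 1) (at 0)"
      by (auto intro!: derivative_eq_intros)
    with vector_diff_chain_at[OF this, of f l] that show ?thesis by (simp add: o_def)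
  qed
  moreover have "(f has_vector_derivative l) (at x)" if "((\<lambda>t. f (x + t)) has_vector_derivative l) (at 0)"
  proof -
    have "((\<lambda>t. t - x) has_vector_derivative 1) (at x)"
      by (auto intro!: derivative_eq_intros)
    with vector_diff_chain_at[OF this, of "\<lambda>t. f (x + t)" l] that show ?thesis by (simp add: o_def)
  qed
  ultimately show ?thesis by (auto simp: has_dir_deriv_iff_has_vector_derivative)
qed

section \<open>Maps of class C^1: mean values, chain rule, linearity of the derivative\<close>

definition C1_on ::
    "'a::{real_vector,t2_space} set \<Rightarrow> ('a \<Rightarrow> 'b::{real_vector,t2_space}) \<Rightarrow> bool" where
  "C1_on U f \<longleftrightarrow> open U \<and> continuous_on U f \<and>
    (\<forall>x\<in>U. \<forall>v. has_dir_deriv f (dir_deriv f x v) x v) \<and>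
    continuous_on (U \<times> UNIV) (\<lambda>(x, v). dir_deriv f x v)"

lemma C1_onD:
  assumes "C1_on U f"
  shows "open U" "continuous_on U f" "x \<in> U \<Longrightarrow> has_dir_deriv f (dir_deriv f x v) x v"
    "continuous_on (U \<times> UNIV) (\<lambda>(x, v). dir_deriv f x v)"
  using assms unfolding C1_on_def by auto

lemma C1_onI:
  assumes "open U" "continuous_on U f" "\<And>x v. x \<in> U \<Longrightarrow> has_dir_deriv f (D x v) x v"
    "continuous_on (U \<times> UNIV) (\<lambda>(x, v). D x v)"
  shows "C1_on U f" "\<And>x v. x \<in> U \<Longrightarrow> dir_deriv f x v = D x v"
proof -
  show D: "dir_deriv f x v = D x v" if "x \<in> U" for x v
    using assms(3)[OF that] by (rule dir_deriv_eqI)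
  have "continuous_on (U \<times> UNIV) (\<lambda>(x, v). dir_deriv f x v) =
      continuous_on (U \<times> UNIV) (\<lambda>(x, v). D x v)"
    by (rule continuous_on_cong) (auto simp: D)
  then show "C1_on U f"
    using assms D unfolding C1_on_def by simp
qed

text \<open>Subtracting the linear part \<open>s *\<^sub>R l\<close> reduces this to the mean value
  bound for a curve with derivative \<open>D s - l\<close>. The interval is symmetric so that both
  signs of \<open>t\<close> are covered.\<close>

lemma mvt_dir_deriv:
  fixes f :: "'a::locally_convex_space \<Rightarrow> 'b::real_normed_vector"
  assumes "\<And>s. \<bar>s\<bar> \<le> \<bar>t\<bar> \<Longrightarrow> has_dir_deriv f (D s) (x + s *\<^sub>R v) v"
    and "\<And>s. \<bar>s\<bar> \<le> \<bar>t\<bar> \<Longrightarrow> norm (D s - l) \<le> e"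
  shows "norm (f (x + t *\<^sub>R v) - f x - t *\<^sub>R l) \<le> e * \<bar>t\<bar>"
proof -
  define g where "g s = f (x + s *\<^sub>R v) - s *\<^sub>R l" for s
  have "norm (g t - g 0) \<le> e * norm (t - 0)"
  proof (rule differentiable_bound)
    show "convex {-\<bar>t\<bar>..\<bar>t\<bar>}" by simp
    show "0 \<in> {-\<bar>t\<bar>..\<bar>t\<bar>}" "t \<in> {-\<bar>t\<bar>..\<bar>t\<bar>}" by auto
    fix s assume s: "s \<in> {-\<bar>t\<bar>..\<bar>t\<bar>}"
    then have "\<bar>s\<bar> \<le> \<bar>t\<bar>" by auto
    then have "((\<lambda>r. f ((x + s *\<^sub>R v) + r *\<^sub>R v)) has_vector_derivative D s) (at 0)"
      using assms(1) by (simp add: has_dir_deriv_iff_has_vector_derivative)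
    then have "((\<lambda>r. f (x + (s + r *\<^sub>R 1) *\<^sub>R v)) has_vector_derivative D s) (at 0)"
      by (simp add: algebra_simps)
    then have "has_dir_deriv (\<lambda>s. f (x + s *\<^sub>R v)) (D s) s 1"
      unfolding has_dir_deriv_iff_has_vector_derivative .
    then have "((\<lambda>s. f (x + s *\<^sub>R v)) has_vector_derivative D s) (at s)"
      by (rule has_dir_deriv_real[THEN iffD1])
    then have "(g has_vector_derivative D s - l) (at s)"
      unfolding g_def by (auto intro!: derivative_eq_intros)
    then show "(g has_derivative (\<lambda>r. r *\<^sub>R (D s - l))) (at s within {-\<bar>t\<bar>..\<bar>t\<bar>})"
      unfolding has_vector_derivative_def by (rule has_derivative_at_withinI)
    show "onorm (\<lambda>r. r *\<^sub>R (D s - l)) \<le> e"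
      using assms(2)[OF \<open>\<bar>s\<bar> \<le> \<bar>t\<bar>\<close>]
      by (intro onorm_le) (simp add: mult.commute[of e] mult_left_mono)
  qed
  then show ?thesis by (simp add: g_def algebra_simps)
qed

text \<open>The base point is allowed to move: this gives both the chain rule and, with a fixed
  direction, the additivity of the derivative.\<close>

lemma tendsto_difference_quotient:
  fixes g :: "'a::locally_convex_space \<Rightarrow> 'b::real_normed_vector"
  assumes g: "C1_on U g" and x: "x \<in> U"
    and y: "(y \<longlongrightarrow> x) (at 0)" and h: "(h \<longlongrightarrow> w) (at (0::real))"
  shows "((\<lambda>t. (g (y t + t *\<^sub>R h t) - g (y t)) /\<^sub>R t) \<longlongrightarrow> dir_deriv g x w) (at 0)"
proof (rule tendstoI)
  fix e :: real assume "e > 0"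
  \<comment> \<open>The mean value bound is not strict; half of \<open>e\<close> makes the final
    inequality strict.\<close>
  define e' where "e' = e / 2"
  have "e' > 0" using \<open>e > 0\<close> by (simp add: e'_def)
  have "isCont (\<lambda>(x, v). dir_deriv g x v) (x, w)"
    using C1_onD(4)[OF g] C1_onD(1)[OF g] x
    by (subst (asm) continuous_on_eq_continuous_at) (auto intro: open_Times)
  then have "((\<lambda>(x, v). dir_deriv g x v) \<longlongrightarrow> dir_deriv g x w) (nhds (x, w))"
    using tendsto_at_iff_tendsto_nhds[of "\<lambda>(x, v). dir_deriv g x v" "(x, w)"]
    by (simp add: isCont_def)
  then have "\<forall>\<^sub>F p in nhds (x, w). dist (dir_deriv g (fst p) (snd p)) (dir_deriv g x w) < e'"
    using \<open>e' > 0\<close> by (auto simp: tendsto_iff case_prod_beta)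
  moreover have "\<forall>\<^sub>F p in nhds (x, w). p \<in> U \<times> UNIV"
    using C1_onD(1)[OF g] x by (intro eventually_nhds_in_open open_Times) auto
  ultimately have ev: "\<forall>\<^sub>F p in nhds (x, w).
      fst p \<in> U \<and> dist (dir_deriv g (fst p) (snd p)) (dir_deriv g x w) < e'"
    by eventually_elim auto
  \<comment> \<open>The parameter of \<open>y\<close>, the position on the segment and the direction
    are treated as independent variables, so that one product neighbourhood controls the derivative
    on the whole segment.\<close>
  have "((\<lambda>p. (y (fst p) + fst (snd p) *\<^sub>R snd (snd p), snd (snd p))) \<longlongrightarrow> (x + 0 *\<^sub>R w, w))
      (at 0 \<times>\<^sub>F (nhds 0 \<times>\<^sub>F nhds w))"
    by (intro tendsto_Pair tendsto_add tendsto_scaleR_lcs filterlim_compose[OF y] filterlim_fst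
        filterlim_compose[OF filterlim_fst filterlim_snd] filterlim_compose[OF filterlim_snd filterlim_snd])
  then have "\<forall>\<^sub>F p in at 0 \<times>\<^sub>F (nhds 0 \<times>\<^sub>F nhds w). y (fst p) + fst (snd p) *\<^sub>R snd (snd p) \<in> U \<and>
      dist (dir_deriv g (y (fst p) + fst (snd p) *\<^sub>R snd (snd p)) (snd (snd p))) (dir_deriv g x w) < e'"
    using eventually_compose_filterlim[OF ev] by fastforce
  from iffD1[OF eventually_prod_filter this] obtain P1 Q1 where P1: "eventually P1 (at (0::real))"
    and "eventually Q1 (nhds 0 \<times>\<^sub>F nhds w)"
    and PQ: "\<And>t q. P1 t \<Longrightarrow> Q1 q \<Longrightarrow> y t + fst q *\<^sub>R snd q \<in> U \<and>
      dist (dir_deriv g (y t + fst q *\<^sub>R snd q) (snd q)) (dir_deriv g x w) < e'"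
    by fastforce
  from iffD1[OF eventually_prod_filter \<open>eventually Q1 (nhds 0 \<times>\<^sub>F nhds w)\<close>] obtain P2 P3 where P2: "eventually P2 (nhds (0::real))" and P3: "eventually P3 (nhds w)"
    and Q1: "\<And>s k. P2 s \<Longrightarrow> P3 k \<Longrightarrow> Q1 (s, k)"
    by auto
  obtain d where d: "d > 0" "\<And>s. \<bar>s\<bar> < d \<Longrightarrow> P2 s"
    using P2 unfolding eventually_nhds_metric by (auto simp: dist_real_def)
  have "\<forall>\<^sub>F t in at 0. P3 (h t)"
    using P3 h by (rule eventually_compose_filterlim)
  moreover have "\<forall>\<^sub>F t in at (0::real). \<bar>t\<bar> < d"
    using d(1) by (auto simp: eventually_at dist_real_def)
  moreover have "\<forall>\<^sub>F t in at (0::real). t \<noteq> 0"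
    by (simp add: eventually_at_filter)
  ultimately show "\<forall>\<^sub>F t in at 0.
      dist ((g (y t + t *\<^sub>R h t) - g (y t)) /\<^sub>R t) (dir_deriv g x w) < e"
    using P1
  proof eventually_elim
    case (elim t)
    have s: "y t + s *\<^sub>R h t \<in> U \<and> dist (dir_deriv g (y t + s *\<^sub>R h t) (h t)) (dir_deriv g x w) < e'"
      if "\<bar>s\<bar> \<le> \<bar>t\<bar>" for s
      using PQ[OF elim(4) Q1[OF d(2)[of s] elim(1)]] that elim(2) by simp
    have "norm (g (y t + t *\<^sub>R h t) - g (y t) - t *\<^sub>R dir_deriv g x w) \<le> e' * \<bar>t\<bar>"
      using s by (intro mvt_dir_deriv[where D = "\<lambda>s. dir_deriv g (y t + s *\<^sub>R h t) (h t)"] C1_onD(3)[OF g])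
        (auto simp: dist_norm less_imp_le)
    moreover have "(g (y t + t *\<^sub>R h t) - g (y t)) /\<^sub>R t - dir_deriv g x w =
        (g (y t + t *\<^sub>R h t) - g (y t) - t *\<^sub>R dir_deriv g x w) /\<^sub>R t"
      using elim(3) by (simp add: scaleR_diff_right)
    then have "norm ((g (y t + t *\<^sub>R h t) - g (y t)) /\<^sub>R t - dir_deriv g x w) =
        norm (g (y t + t *\<^sub>R h t) - g (y t) - t *\<^sub>R dir_deriv g x w) / \<bar>t\<bar>"
      by (simp only: norm_scaleR) (simp add: divide_inverse)
    ultimately have "norm ((g (y t + t *\<^sub>R h t) - g (y t)) /\<^sub>R t - dir_deriv g x w) \<le> e'"
      using elim(3) by (simp add: pos_divide_le_eq)
    also have "e' < e" using \<open>e > 0\<close> by (simp add: e'_def)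
    finally show ?case by (simp add: dist_norm)
  qed
qed

lemma has_dir_deriv_tendsto:
  fixes h :: "'c::locally_convex_space \<Rightarrow> 'a::locally_convex_space"
  assumes "has_dir_deriv h w x v"
  shows "((\<lambda>t. h (x + t *\<^sub>R v)) \<longlongrightarrow> h x) (at 0)"
proof -
  have "((\<lambda>t. h x + t *\<^sub>R ((h (x + t *\<^sub>R v) - h x) /\<^sub>R t)) \<longlongrightarrow> h x + 0 *\<^sub>R w) (at 0)"
    using assms unfolding has_dir_deriv_def
    by (intro tendsto_add tendsto_scaleR_lcs tendsto_const tendsto_ident_at)
  moreover have "\<forall>\<^sub>F t in at 0. h x + t *\<^sub>R ((h (x + t *\<^sub>R v) - h x) /\<^sub>R t) = h (x + t *\<^sub>R v)"
    by (simp add: eventually_at_filter)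
  ultimately show ?thesis by (subst (asm) tendsto_cong) auto
qed

text \<open>The inner difference quotient plays the moving direction, so the inner map needs a
  derivative at one point in one direction only.\<close>

lemma has_dir_deriv_compose:
  fixes g :: "'a::locally_convex_space \<Rightarrow> 'b::real_normed_vector"
    and h :: "'c::locally_convex_space \<Rightarrow> 'a"
  assumes h: "has_dir_deriv h w x v" and g: "C1_on U g" and "h x \<in> U"
  shows "has_dir_deriv (\<lambda>y. g (h y)) (dir_deriv g (h x) w) x v"
proof -
  have "((\<lambda>t. (g (h x + t *\<^sub>R ((h (x + t *\<^sub>R v) - h x) /\<^sub>R t)) - g (h x)) /\<^sub>R t)
      \<longlongrightarrow> dir_deriv g (h x) w) (at 0)"
    using h unfolding has_dir_deriv_def
    by (intro tendsto_difference_quotient[OF g \<open>h x \<in> U\<close>] tendsto_const)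
  moreover have "\<forall>\<^sub>F t in at 0. (g (h x + t *\<^sub>R ((h (x + t *\<^sub>R v) - h x) /\<^sub>R t)) - g (h x)) /\<^sub>R t =
      (g (h (x + t *\<^sub>R v)) - g (h x)) /\<^sub>R t"
    by (simp add: eventually_at_filter)
  ultimately show ?thesis unfolding has_dir_deriv_def by (subst (asm) tendsto_cong)
qed

text \<open>For additivity the increment along \<open>v + w\<close> is made in two stages; the
  second starts at the moving point \<open>x + t *\<^sub>R v\<close>, where the joint continuity of
  the derivative is used.\<close>

lemma linear_dir_deriv:
  fixes g :: "'a::locally_convex_space \<Rightarrow> 'b::real_normed_vector"
  assumes g: "C1_on U g" and x: "x \<in> U"
  shows "linear (dir_deriv g x)"
proof (rule linearI)
  show "dir_deriv g x (c *\<^sub>R v) = c *\<^sub>R dir_deriv g x v" for c v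
    using has_dir_deriv_scaleR[OF C1_onD(3)[OF g x]] by (rule dir_deriv_eqI)
  fix v w
  have "((\<lambda>t. (g (x + t *\<^sub>R v + t *\<^sub>R w) - g (x + t *\<^sub>R v)) /\<^sub>R t) \<longlongrightarrow> dir_deriv g x w) (at 0)"
    by (intro tendsto_difference_quotient[OF g x] tendsto_line tendsto_const)
  moreover have "((\<lambda>t. (g (x + t *\<^sub>R v) - g x) /\<^sub>R t) \<longlongrightarrow> dir_deriv g x v) (at 0)"
    using C1_onD(3)[OF g x] unfolding has_dir_deriv_def .
  ultimately have "((\<lambda>t. (g (x + t *\<^sub>R v) - g x) /\<^sub>R t + (g (x + t *\<^sub>R v + t *\<^sub>R w) - g (x + t *\<^sub>R v)) /\<^sub>R t)
      \<longlongrightarrow> dir_deriv g x v + dir_deriv g x w) (at 0)"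
    by (intro tendsto_add)
  moreover have "(g (x + t *\<^sub>R v) - g x) /\<^sub>R t + (g (x + t *\<^sub>R v + t *\<^sub>R w) - g (x + t *\<^sub>R v)) /\<^sub>R t =
      (g (x + t *\<^sub>R (v + w)) - g x) /\<^sub>R t" for t
    by (simp add: scaleR_diff_right scaleR_add_right add.assoc)
  ultimately have "has_dir_deriv g (dir_deriv g x v + dir_deriv g x w) x (v + w)"
    unfolding has_dir_deriv_def by (simp only:)
  then show "dir_deriv g x (v + w) = dir_deriv g x v + dir_deriv g x w"
    by (rule dir_deriv_eqI)
qed

lemma C1_on_subset: "C1_on U f \<Longrightarrow> open V \<Longrightarrow> V \<subseteq> U \<Longrightarrow> C1_on V f"
  unfolding C1_on_def by (auto intro: continuous_on_subset)

lemma C1_on_cong: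
  fixes f :: "'a::locally_convex_space \<Rightarrow> 'b::locally_convex_space"
  assumes f: "C1_on U f" and eq: "\<And>x. x \<in> U \<Longrightarrow> g x = f x"
  shows "C1_on U g"
proof -
  have ev: "\<forall>\<^sub>F y in nhds x. g y = f y" if "x \<in> U" for x
    using eventually_nhds_in_open[OF C1_onD(1)[OF f] that] by eventually_elim (rule eq)
  show ?thesis
  proof (rule C1_onI(1)[where D = "dir_deriv f"])
    show "continuous_on U g"
      using C1_onD(2)[OF f] by (subst continuous_on_cong[OF refl eq])
    show "has_dir_deriv g (dir_deriv f x v) x v" if "x \<in> U" for x v
      using C1_onD(3)[OF f that] has_dir_deriv_cong[OF ev[OF that]] by blast
  qed (use C1_onD[OF f] in auto)
qed

lemma C1_on_local:
  assumes "\<And>x. x \<in> U \<Longrightarrow> \<exists>V. x \<in> V \<and> V \<subseteq> U \<and> C1_on V f"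
  shows "C1_on U f"
proof -
  obtain V where V: "\<And>x. x \<in> U \<Longrightarrow> x \<in> V x \<and> V x \<subseteq> U \<and> C1_on (V x) f"
    using assms by metis
  have U: "U = (\<Union>x\<in>U. V x)" using V by blast
  have o: "open (V x)" if "x \<in> U" for x
    using V[OF that] C1_onD(1) by blast
  have "open (\<Union>x\<in>U. V x)" using o by blast
  then have "open U" using U by simp
  moreover have "continuous_on (\<Union>x\<in>U. V x) f"
    using o V C1_onD(2) by (intro continuous_on_open_UN) blast+
  then have "continuous_on U f" using U by simp
  moreover have "continuous_on (\<Union>x\<in>U. V x \<times> UNIV) (\<lambda>(x, v). dir_deriv f x v)"
    using o V C1_onD(4) by (intro continuous_on_open_UN open_Times) blast+
  moreover have "(\<Union>x\<in>U. V x \<times> UNIV) = U \<times> UNIV" using V by blast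
  ultimately show ?thesis
    using V unfolding C1_on_def by metis
qed

lemma C1_on_compose:
  fixes g :: "'a::locally_convex_space \<Rightarrow> 'b::real_normed_vector"
    and h :: "'c::locally_convex_space \<Rightarrow> 'a"
  assumes h: "C1_on W h" and g: "C1_on U g" and sub: "\<And>x. x \<in> W \<Longrightarrow> h x \<in> U"
  shows "C1_on W (\<lambda>x. g (h x))"
    and "x \<in> W \<Longrightarrow> dir_deriv (\<lambda>x. g (h x)) x v = dir_deriv g (h x) (dir_deriv h x v)"
proof -
  have 1: "has_dir_deriv (\<lambda>x. g (h x)) (dir_deriv g (h x) (dir_deriv h x v)) x v" if "x \<in> W" for x v
    by (rule has_dir_deriv_compose[OF C1_onD(3)[OF h that] g sub[OF that]])
  have "continuous_on (W \<times> UNIV) (\<lambda>p. (h (fst p), dir_deriv h (fst p) (snd p)))"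
    using C1_onD(4)[OF h]
    by (intro continuous_on_Pair continuous_on_compose2[OF C1_onD(2)[OF h]] continuous_intros)
      (auto simp: case_prod_beta)
  then have "continuous_on (W \<times> UNIV)
      (\<lambda>p. (\<lambda>(x, v). dir_deriv g x v) (h (fst p), dir_deriv h (fst p) (snd p)))"
    by (rule continuous_on_compose2[OF C1_onD(4)[OF g]]) (auto simp: sub)
  then have 2: "continuous_on (W \<times> UNIV) (\<lambda>(x, v). dir_deriv g (h x) (dir_deriv h x v))"
    by (simp add: case_prod_beta)
  have 3: "continuous_on W (\<lambda>x. g (h x))"
    using sub by (intro continuous_on_compose2[OF C1_onD(2)[OF g] C1_onD(2)[OF h]]) auto
  show "C1_on W (\<lambda>x. g (h x))"
    by (rule C1_onI(1)[OF C1_onD(1)[OF h] 3 1 2])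
  show "x \<in> W \<Longrightarrow> dir_deriv (\<lambda>x. g (h x)) x v = dir_deriv g (h x) (dir_deriv h x v)"
    using 1 by (rule dir_deriv_eqI)
qed

lemma has_dir_deriv_Pair:
  assumes "has_dir_deriv f l x v" "has_dir_deriv g m x v"
  shows "has_dir_deriv (\<lambda>x. (f x, g x)) (l, m) x v"
  using tendsto_Pair[OF assms[unfolded has_dir_deriv_def]] by (simp add: has_dir_deriv_def)

lemma C1_on_Pair:
  assumes f: "C1_on U f" and g: "C1_on U g"
  shows "C1_on U (\<lambda>x. (f x, g x))"
    and "x \<in> U \<Longrightarrow> dir_deriv (\<lambda>x. (f x, g x)) x v = (dir_deriv f x v, dir_deriv g x v)"
proof -
  have 1: "has_dir_deriv (\<lambda>x. (f x, g x)) (dir_deriv f x v, dir_deriv g x v) x v" if "x \<in> U" for x v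
    by (intro has_dir_deriv_Pair C1_onD(3)[OF f that] C1_onD(3)[OF g that])
  show "x \<in> U \<Longrightarrow> dir_deriv (\<lambda>x. (f x, g x)) x v = (dir_deriv f x v, dir_deriv g x v)"
    using 1 by (rule dir_deriv_eqI)
  show "C1_on U (\<lambda>x. (f x, g x))"
    using C1_onD(4)[OF f] C1_onD(4)[OF g]
    by (intro C1_onI(1)[OF C1_onD(1)[OF f] _ 1] continuous_on_Pair C1_onD(2)[OF f] C1_onD(2)[OF g])
      (auto simp: case_prod_beta intro!: continuous_on_Pair)
qed

lemma has_dir_deriv_linear:
  assumes "linear f"
  shows "has_dir_deriv f (f v) x v"
proof -
  have "\<forall>\<^sub>F t in at 0. (f (x + t *\<^sub>R v) - f x) /\<^sub>R t = f v"
    by (simp add: eventually_at_filter linear_add[OF assms] linear_scale[OF assms])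
  then show ?thesis
    unfolding has_dir_deriv_def by (subst tendsto_cong) auto
qed

lemma C1_on_linear:
  assumes "linear f" "continuous_on UNIV f" "open U"
  shows "C1_on U f" "dir_deriv f x v = f v"
  using assms
  by (auto intro!: C1_onI(1)[where D = "\<lambda>x v. f v"] has_dir_deriv_linear dir_deriv_eqI
      continuous_on_subset[OF assms(2)] continuous_on_compose2[OF assms(2)] continuous_intros
      simp: case_prod_beta)

lemma C1_on_const: "open U \<Longrightarrow> C1_on U (\<lambda>x. c)" "dir_deriv (\<lambda>x. c) x v = 0"
  by (auto intro!: C1_onI(1)[where D = "\<lambda>x v. 0"] dir_deriv_eqI simp: has_dir_deriv_def)

text \<open>A continuous affine inner map commutes with difference quotients, which gives a chain
  rule for locally convex targets, to which \<open>C1_on_compose\<close> does not apply.\<close>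

lemma C1_on_affine:
  fixes f :: "'a::locally_convex_space \<Rightarrow> 'b::locally_convex_space"
    and L :: "'c::locally_convex_space \<Rightarrow> 'a"
  assumes f: "C1_on U f" and L: "linear L" "continuous_on UNIV L"
    and W: "open W" "\<And>x. x \<in> W \<Longrightarrow> a + L x \<in> U"
  shows "C1_on W (\<lambda>x. f (a + L x))"
    and "x \<in> W \<Longrightarrow> dir_deriv (\<lambda>x. f (a + L x)) x v = dir_deriv f (a + L x) (L v)"
proof -
  have 1: "has_dir_deriv (\<lambda>x. f (a + L x)) (dir_deriv f (a + L x) (L v)) x v" if "x \<in> W" for x v
    using C1_onD(3)[OF f W(2)[OF that], of "L v"]
    by (simp add: has_dir_deriv_def linear_add[OF L(1)] linear_scale[OF L(1)] add.assoc)
  have cL: "continuous_on S (\<lambda>x. L (g x))" if "continuous_on S g" for S and g :: "'d::topological_space \<Rightarrow> 'c"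
    by (rule continuous_on_compose2[OF L(2) that]) simp
  have 2: "continuous_on W (\<lambda>x. f (a + L x))"
    using W by (intro continuous_on_compose2[OF C1_onD(2)[OF f]] continuous_intros cL) auto
  have "continuous_on (W \<times> UNIV) (\<lambda>p. (\<lambda>(x, v). dir_deriv f x v) (a + L (fst p), L (snd p)))"
    using W by (intro continuous_on_compose2[OF C1_onD(4)[OF f]] continuous_intros cL) auto
  then have 3: "continuous_on (W \<times> UNIV) (\<lambda>(x, v). dir_deriv f (a + L x) (L v))"
    by (simp add: case_prod_beta)
  show "C1_on W (\<lambda>x. f (a + L x))"
    by (rule C1_onI(1)[OF W(1) 2 1 3])
  show "x \<in> W \<Longrightarrow> dir_deriv (\<lambda>x. f (a + L x)) x v = dir_deriv f (a + L x) (L v)"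
    using 1 by (rule dir_deriv_eqI)
qed

section \<open>Maps of class C^2\<close>

definition C2_on ::
    "'a::{real_vector,t2_space} set \<Rightarrow> ('a \<Rightarrow> 'b::{real_vector,t2_space}) \<Rightarrow> bool" where
  "C2_on U f \<longleftrightarrow> C1_on U f \<and> C1_on (U \<times> UNIV) (\<lambda>p. dir_deriv f (fst p) (snd p))"

lemma C2_onD:
  assumes "C2_on U f"
  shows "C1_on U f" "C1_on (U \<times> UNIV) (\<lambda>p. dir_deriv f (fst p) (snd p))" "open U" "continuous_on U f"
  using assms C1_onD[of U f] unfolding C2_on_def by auto

lemma C2_on_subset: "C2_on U f \<Longrightarrow> open V \<Longrightarrow> V \<subseteq> U \<Longrightarrow> C2_on V f"
  unfolding C2_on_def
  using C1_on_subset[of "U \<times> UNIV" _ "V \<times> UNIV"] by (auto intro: C1_on_subset open_Times)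

lemma C2_on_cong:
  fixes f :: "'a::locally_convex_space \<Rightarrow> 'b::locally_convex_space"
  assumes f: "C2_on U f" and eq: "\<And>x. x \<in> U \<Longrightarrow> g x = f x"
  shows "C2_on U g"
proof -
  have "dir_deriv g x v = dir_deriv f x v" if "x \<in> U" for x v
  proof (rule dir_deriv_cong)
    show "\<forall>\<^sub>F y in nhds x. g y = f y"
      using eventually_nhds_in_open[OF C2_onD(3)[OF f] that] by eventually_elim (rule eq)
  qed
  then show ?thesis
    using C1_on_cong[OF C2_onD(1)[OF f] eq] C1_on_cong[OF C2_onD(2)[OF f]]
    unfolding C2_on_def by auto
qed

lemma C2_on_local:
  assumes "\<And>x. x \<in> U \<Longrightarrow> \<exists>V. x \<in> V \<and> V \<subseteq> U \<and> C2_on V f"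
  shows "C2_on U f"
proof -
  have "C1_on U f"
    by (rule C1_on_local) (metis assms C2_onD(1))
  moreover have "C1_on (U \<times> UNIV) (\<lambda>p. dir_deriv f (fst p) (snd p))"
  proof (rule C1_on_local)
    fix p assume "p \<in> U \<times> (UNIV :: 'a set)"
    then have "fst p \<in> U" by auto
    then obtain V where V: "fst p \<in> V" "V \<subseteq> U" "C2_on V f"
      using assms by blast
    then show "\<exists>V. p \<in> V \<and> V \<subseteq> U \<times> UNIV \<and> C1_on V (\<lambda>p. dir_deriv f (fst p) (snd p))"
      using C2_onD(2)[OF V(3)] by (intro exI[of _ "V \<times> UNIV"]) (auto simp: mem_Times_iff)
  qed
  ultimately show ?thesis unfolding C2_on_def by simp
qed

text \<open>C^2 amounts to C^1 of the tangent map, and the tangent map of a composite is the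
  composite of the tangent maps; so this is \<open>C1_on_compose\<close> once more.\<close>

lemma C2_on_compose:
  fixes g :: "'a::locally_convex_space \<Rightarrow> 'b::real_normed_vector"
    and h :: "'c::locally_convex_space \<Rightarrow> 'a"
  assumes h: "C2_on W h" and g: "C2_on U g" and sub: "\<And>x. x \<in> W \<Longrightarrow> h x \<in> U"
  shows "C2_on W (\<lambda>x. g (h x))"
proof -
  note h1 = C2_onD(1)[OF h] and g1 = C2_onD(1)[OF g]
  have "C1_on (W \<times> UNIV) (\<lambda>p::'c \<times> 'c. h (0 + fst p))"
    using C2_onD(3)[OF h] by (intro C1_on_affine(1)[OF h1 linear_fst]) (auto intro!: continuous_intros open_Times)
  then have "C1_on (W \<times> UNIV) (\<lambda>p. (h (fst p), dir_deriv h (fst p) (snd p)))"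
    using C1_on_Pair(1)[OF _ C2_onD(2)[OF h]] by simp
  then have "C1_on (W \<times> UNIV) (\<lambda>p. (\<lambda>q. dir_deriv g (fst q) (snd q)) (h (fst p), dir_deriv h (fst p) (snd p)))"
    by (rule C1_on_compose(1)[OF _ C2_onD(2)[OF g]]) (auto simp: sub)
  then have "C1_on (W \<times> UNIV) (\<lambda>p. dir_deriv g (h (fst p)) (dir_deriv h (fst p) (snd p)))"
    by simp
  then have "C1_on (W \<times> UNIV) (\<lambda>p. dir_deriv (\<lambda>x. g (h x)) (fst p) (snd p))"
    by (rule C1_on_cong) (auto simp: C1_on_compose(2)[OF h1 g1 sub])
  then show ?thesis
    using C1_on_compose(1)[OF h1 g1 sub] unfolding C2_on_def by simp
qed

lemma C2_on_affine:
  fixes f :: "'a::locally_convex_space \<Rightarrow> 'b::locally_convex_space"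
    and L :: "'c::locally_convex_space \<Rightarrow> 'a"
  assumes f: "C2_on U f" and L: "linear L" "continuous_on UNIV L"
    and W: "open W" "\<And>x. x \<in> W \<Longrightarrow> a + L x \<in> U"
  shows "C2_on W (\<lambda>x. f (a + L x))"
proof -
  let ?L = "\<lambda>p. (L (fst p), L (snd p))"
  have "linear ?L"
    by (intro linearI) (auto simp: linear_add[OF L(1)] linear_scale[OF L(1)])
  moreover have "continuous_on UNIV ?L"
    by (intro continuous_on_Pair continuous_on_compose2[OF L(2)] continuous_intros) auto
  ultimately have "C1_on (W \<times> UNIV) (\<lambda>p. (\<lambda>q. dir_deriv f (fst q) (snd q)) ((a, 0) + ?L p))"
    using W by (intro C1_on_affine(1)[OF C2_onD(2)[OF f]] open_Times) auto
  then have "C1_on (W \<times> UNIV) (\<lambda>p. dir_deriv f (a + L (fst p)) (L (snd p)))"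
    by simp
  then have "C1_on (W \<times> UNIV) (\<lambda>p. dir_deriv (\<lambda>x. f (a + L x)) (fst p) (snd p))"
    by (rule C1_on_cong) (use W in \<open>auto simp: C1_on_affine(2)[OF C2_onD(1)[OF f] L]\<close>)
  then show ?thesis
    using C1_on_affine(1)[OF C2_onD(1)[OF f] L W] unfolding C2_on_def by simp
qed

lemma C2_on_Pair:
  fixes f :: "'a::locally_convex_space \<Rightarrow> 'b::locally_convex_space"
    and g :: "'a \<Rightarrow> 'c::locally_convex_space"
  assumes f: "C2_on U f" and g: "C2_on U g"
  shows "C2_on U (\<lambda>x. (f x, g x))"
proof -
  have "C1_on (U \<times> UNIV) (\<lambda>p. (dir_deriv f (fst p) (snd p), dir_deriv g (fst p) (snd p)))"
    by (intro C1_on_Pair C2_onD(2) f g)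
  then have "C1_on (U \<times> UNIV) (\<lambda>p. dir_deriv (\<lambda>x. (f x, g x)) (fst p) (snd p))"
    by (rule C1_on_cong) (auto simp: C1_on_Pair(2)[OF C2_onD(1)[OF f] C2_onD(1)[OF g]])
  then show ?thesis
    using C1_on_Pair(1)[OF C2_onD(1)[OF f] C2_onD(1)[OF g]] unfolding C2_on_def by simp
qed

lemma C2_on_linear:
  fixes f :: "'a::locally_convex_space \<Rightarrow> 'b::locally_convex_space"
  assumes f: "linear f" "continuous_on UNIV f" and "open U"
  shows "C2_on U f"
proof -
  have "linear (\<lambda>p::'a \<times> 'a. f (snd p))" "continuous_on UNIV (\<lambda>p::'a \<times> 'a. f (snd p))"
    using linear_compose[OF linear_snd f(1)]
    by (auto simp: o_def intro!: continuous_on_compose2[OF f(2)] continuous_intros)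
  from C1_on_linear(1)[OF this, of "U \<times> UNIV"] have "C1_on (U \<times> UNIV) (\<lambda>p. f (snd p))"
    using \<open>open U\<close> by (auto intro: open_Times)
  then show ?thesis
    using C1_on_linear[OF f \<open>open U\<close>] unfolding C2_on_def by simp
qed

text \<open>Extracts orders one and two from the iterated derivatives. In \<open>iter_deriv\<close>
  the head of the list is the direction of the last differentiation.\<close>

lemma smooth_on_C1_on:
  fixes f :: "'a::locally_convex_space \<Rightarrow> 'b::locally_convex_space"
  assumes f: "smooth_on U f"
  shows "C1_on U f" "\<And>v. C1_on U (\<lambda>x. dir_deriv f x v)"
    "\<And>x v w. x \<in> U \<Longrightarrow> has_dir_deriv (\<lambda>x. dir_deriv f x v) (dir_deriv (\<lambda>x. dir_deriv f x v) x w) x w"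
    "continuous_on (U \<times> UNIV \<times> UNIV) (\<lambda>(x, v, w). dir_deriv (\<lambda>x. dir_deriv f x v) x w)"
proof -
  have e0: "iter_deriv f [] = f" by (rule ext) simp
  have e1: "iter_deriv f [v] = (\<lambda>x. dir_deriv f x v)" for v by (rule ext) (simp add: e0)
  have e2: "iter_deriv f [w, v] = (\<lambda>x. dir_deriv (\<lambda>x. dir_deriv f x v) x w)" for v w
    by (rule ext) (simp add: e1)
  have o: "open U"
    and d: "\<And>x vs v. x \<in> U \<Longrightarrow> has_dir_deriv (iter_deriv f vs) (dir_deriv (iter_deriv f vs) x v) x v"
    and c: "\<And>k. continuous_on (U \<times> UNIV) (\<lambda>(x, v). iter_deriv f (map v [0..<k]) x)"
    using f has_dir_deriv_exI unfolding smooth_on_def has_dir_deriv_def by blast+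
  have c': "continuous_on S (\<lambda>z. iter_deriv f (map (v z) [0..<k]) (x z))"
    if "continuous_on S x" "\<And>i. continuous_on S (\<lambda>z. v z i)" "\<And>z. z \<in> S \<Longrightarrow> x z \<in> U"
    for S :: "'z::topological_space set" and v k x
  proof -
    have "continuous_on S (\<lambda>z. (x z, v z))"
      by (intro continuous_on_Pair that continuous_on_coordinatewise_then_product)
    from continuous_on_compose2[OF c[of k] this] show ?thesis using that(3) by auto
  qed
  have 0: "continuous_on U f"
    using c'[of U "\<lambda>z. z" "\<lambda>z i. 0" 0] by simp
  have 1: "continuous_on (U \<times> UNIV) (\<lambda>(x, v). dir_deriv f x v)"
    using c'[of "U \<times> UNIV" fst "\<lambda>z i. snd z" 1]
    by (simp add: e1 case_prod_beta continuous_on_fst continuous_on_snd continuous_on_id mem_Times_iff)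
  show "C1_on U f"
    using C1_onI(1)[OF o 0 _ 1] d[of _ "[]"] by (simp add: e0)
  show h: "x \<in> U \<Longrightarrow> has_dir_deriv (\<lambda>x. dir_deriv f x v) (dir_deriv (\<lambda>x. dir_deriv f x v) x w) x w" for x v w
    using d[of x "[v]"] by (simp add: e1)
  \<comment> \<open>Entry 0 of the direction sequence is the outer direction, the last component of
    \<open>z\<close>; entry 1 is the inner one.\<close>
  have "continuous_on (U \<times> UNIV \<times> UNIV) (\<lambda>z. iter_deriv f (map (\<lambda>i. if i = 0 then snd (snd z) else fst (snd z)) [0..<2]) (fst z))"
  proof (rule c')
    show "continuous_on (U \<times> UNIV \<times> UNIV) (\<lambda>z. if i = 0 then snd (snd z) else fst (snd z))" for i :: nat
      by (cases "i = 0") (auto intro!: continuous_intros)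
  qed (auto intro!: continuous_intros)
  then show 2: "continuous_on (U \<times> UNIV \<times> UNIV) (\<lambda>(x, v, w). dir_deriv (\<lambda>x. dir_deriv f x v) x w)"
    by (simp add: numeral_2_eq_2 e2 case_prod_beta)
  show "C1_on U (\<lambda>x. dir_deriv f x v)" for v
  proof (rule C1_onI(1)[OF o _ h])
    show "continuous_on U (\<lambda>x. dir_deriv f x v)"
      using continuous_on_compose2[OF 1, of U "\<lambda>x. (x, v)"]
      by (simp add: continuous_on_Pair continuous_on_id image_subset_iff)
    show "continuous_on (U \<times> UNIV) (\<lambda>(x, w). dir_deriv (\<lambda>x. dir_deriv f x v) x w)"
      using continuous_on_compose2[OF 2, of "U \<times> UNIV" "\<lambda>z. (fst z, v, snd z)"]
      by (simp add: continuous_on_Pair continuous_on_fst continuous_on_snd continuous_on_id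
          image_subset_iff case_prod_beta)
  qed
qed

text \<open>The derivative of \<open>dir_deriv f x v\<close> in \<open>x\<close> and
  \<open>v\<close> together is the second derivative plus the first derivative in the increment of
  \<open>v\<close>. Splitting off that increment needs linearity, which is assumed here because
  \<open>linear_dir_deriv\<close> covers normed targets only.\<close>

lemma smooth_on_C2_on_linear:
  fixes f :: "'a::locally_convex_space \<Rightarrow> 'b::locally_convex_space"
  assumes f: "smooth_on U f" and lin: "\<And>x. x \<in> U \<Longrightarrow> linear (dir_deriv f x)"
  shows "C2_on U f"
proof -
  note s = smooth_on_C1_on[OF f]
  note o = C1_onD(1)[OF s(1)]
  have "C1_on (U \<times> UNIV) (\<lambda>p. dir_deriv f (fst p) (snd p))"
  proof (rule C1_onI(1)[where D = "\<lambda>p q. dir_deriv (\<lambda>x. dir_deriv f x (snd p)) (fst p) (fst q) + dir_deriv f (fst p) (snd q)"])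
    show "open (U \<times> (UNIV :: 'a set))" using o by (auto intro: open_Times)
    show "continuous_on (U \<times> UNIV) (\<lambda>p. dir_deriv f (fst p) (snd p))"
      using C1_onD(4)[OF s(1)] by (simp add: case_prod_beta)
    have 1: "continuous_on ((U \<times> UNIV) \<times> UNIV) (\<lambda>z. (\<lambda>(x, v, w). dir_deriv (\<lambda>x. dir_deriv f x v) x w)
        (fst (fst z), snd (fst z), fst (snd z)))"
      by (rule continuous_on_compose2[OF s(4)]) (auto intro!: continuous_intros)
    have 2: "continuous_on ((U \<times> UNIV) \<times> UNIV) (\<lambda>z. (\<lambda>(x, v). dir_deriv f x v)
        (fst (fst z), snd (snd z)))"
      by (rule continuous_on_compose2[OF C1_onD(4)[OF s(1)]]) (auto intro!: continuous_intros)
    show "continuous_on ((U \<times> UNIV) \<times> UNIV)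
        (\<lambda>(p, q). dir_deriv (\<lambda>x. dir_deriv f x (snd p)) (fst p) (fst q) + dir_deriv f (fst p) (snd q))"
      using continuous_on_add[OF 1 2] by (simp add: case_prod_beta)
    fix p q :: "'a \<times> 'a"
    assume "p \<in> U \<times> UNIV"
    then obtain x v where p: "p = (x, v)" "x \<in> U" by auto
    obtain w z where q: "q = (w, z)" by (cases q)
    have "((\<lambda>t. (dir_deriv f (x + t *\<^sub>R w) v - dir_deriv f x v) /\<^sub>R t + dir_deriv f (x + t *\<^sub>R w) z) \<longlongrightarrow>
        dir_deriv (\<lambda>x. dir_deriv f x v) x w + dir_deriv f x z) (at 0)"
      using s(3)[OF p(2), of v w] has_dir_deriv_tendsto[OF s(3)[OF p(2), of z w]]
      unfolding has_dir_deriv_def by (intro tendsto_add)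
    moreover have "\<forall>\<^sub>F t in at (0::real). x + t *\<^sub>R w \<in> U"
      using tendsto_line o p(2) by (rule topological_tendstoD)
    then have "\<forall>\<^sub>F t in at (0::real). (dir_deriv f (x + t *\<^sub>R w) v - dir_deriv f x v) /\<^sub>R t + dir_deriv f (x + t *\<^sub>R w) z =
        (dir_deriv f (x + t *\<^sub>R w) (v + t *\<^sub>R z) - dir_deriv f x v) /\<^sub>R t"
      using eventually_neq_at_within[of 0 0 UNIV]
      by eventually_elim
        (simp add: linear_add[OF lin] linear_scale[OF lin] scaleR_add_right scaleR_diff_right)
    ultimately have "((\<lambda>t. (dir_deriv f (x + t *\<^sub>R w) (v + t *\<^sub>R z) - dir_deriv f x v) /\<^sub>R t) \<longlongrightarrow>
        dir_deriv (\<lambda>x. dir_deriv f x v) x w + dir_deriv f x z) (at 0)"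
      by (simp only: tendsto_cong)
    then show "has_dir_deriv (\<lambda>p. dir_deriv f (fst p) (snd p))
        (dir_deriv (\<lambda>x. dir_deriv f x (snd p)) (fst p) (fst q) + dir_deriv f (fst p) (snd q)) p q"
      by (simp add: p q has_dir_deriv_def)
  qed
  then show ?thesis using s(1) unfolding C2_on_def by simp
qed

lemma smooth_on_C2_on:
  fixes f :: "'a::locally_convex_space \<Rightarrow> 'b::real_normed_vector"
  assumes "smooth_on U f"
  shows "C2_on U f"
  using smooth_on_C2_on_linear[OF assms] linear_dir_deriv[OF smooth_on_C1_on(1)[OF assms]] by blast

text \<open>For the one-parameter subgroup in a chart of the group, whose target is not normed: on
  the real line homogeneity of the derivative already is linearity.\<close>

lemma smooth_curve_C2_on:
  fixes f :: "real \<Rightarrow> 'b::locally_convex_space"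
  assumes "smooth_on U f"
  shows "C2_on U f"
proof (rule smooth_on_C2_on_linear[OF assms])
  fix t assume t: "t \<in> U"
  have *: "dir_deriv f t s = s *\<^sub>R dir_deriv f t 1" for s
    using has_dir_deriv_scaleR[OF C1_onD(3)[OF smooth_on_C1_on(1)[OF assms] t], of s 1]
    by (simp add: dir_deriv_eqI)
  have "linear (\<lambda>s. s *\<^sub>R dir_deriv f t 1)"
    by (intro linearI) (simp_all add: scaleR_add_left)
  moreover have "dir_deriv f t = (\<lambda>s. s *\<^sub>R dir_deriv f t 1)"
    using * by (rule ext)
  ultimately show "linear (dir_deriv f t)" by (rule ssubst[rotated])
qed

lemma C2_on_partial:
  fixes f :: "'a::locally_convex_space \<Rightarrow> 'b::locally_convex_space"
  assumes f: "C2_on U f"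
  shows "C1_on U (\<lambda>x. dir_deriv f x v)"
    and "x \<in> U \<Longrightarrow> dir_deriv (\<lambda>x. dir_deriv f x v) x w = dir_deriv (\<lambda>p. dir_deriv f (fst p) (snd p)) (x, v) (w, 0)"
proof -
  have L: "linear (\<lambda>x::'a. (x, 0::'a))" by (intro linearI) auto
  have c: "continuous_on UNIV (\<lambda>x::'a. (x, 0::'a))" by (intro continuous_intros)
  show "C1_on U (\<lambda>x. dir_deriv f x v)"
    using C1_on_affine(1)[OF C2_onD(2)[OF f] L c C2_onD(3)[OF f], of "(0, v)"] by simp
  show "x \<in> U \<Longrightarrow> dir_deriv (\<lambda>x. dir_deriv f x v) x w = dir_deriv (\<lambda>p. dir_deriv f (fst p) (snd p)) (x, v) (w, 0)"
    using C1_on_affine(2)[OF C2_onD(2)[OF f] L c C2_onD(3)[OF f], of "(0, v)"] by simp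
qed

section \<open>Symmetry of the second derivative\<close>

lemma second_difference_bound:
  fixes f :: "'a::locally_convex_space \<Rightarrow> 'b::real_normed_vector"
  assumes f: "C2_on U f" and x: "x \<in> U" and e: "e > 0"
  shows "\<exists>d>0. \<forall>s t. \<bar>s\<bar> < d \<longrightarrow> \<bar>t\<bar> < d \<longrightarrow>
    norm (f (x + s *\<^sub>R v + t *\<^sub>R w) - f (x + s *\<^sub>R v) - (f (x + t *\<^sub>R w) - f x)
      - (s * t) *\<^sub>R dir_deriv (\<lambda>y. dir_deriv f y v) x w) \<le> e * (\<bar>s\<bar> * \<bar>t\<bar>)"
proof -
  let ?A = "dir_deriv (\<lambda>y. dir_deriv f y v)"
  note p = C2_on_partial(1)[OF f, of v]
  have "continuous_on U (\<lambda>y. ?A y w)"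
    using continuous_on_compose2[OF C1_onD(4)[OF p], of U "\<lambda>y. (y, w)"]
    by (simp add: continuous_on_Pair continuous_on_id image_subset_iff)
  then have "((\<lambda>y. ?A y w) \<longlongrightarrow> ?A x w) (nhds x)"
    using C2_onD(3)[OF f] x tendsto_at_iff_tendsto_nhds[of "\<lambda>y. ?A y w" x]
    by (auto simp: continuous_on_eq_continuous_at isCont_def)
  then have "\<forall>\<^sub>F y in nhds x. dist (?A y w) (?A x w) < e"
    using e by (rule tendstoD)
  moreover have "\<forall>\<^sub>F y in nhds x. y \<in> U"
    using C2_onD(3)[OF f] x by (rule eventually_nhds_in_open)
  ultimately have ev: "\<forall>\<^sub>F y in nhds x. y \<in> U \<and> dist (?A y w) (?A x w) < e"
    by eventually_elim simp
  have "((\<lambda>p. x + fst p *\<^sub>R v + snd p *\<^sub>R w) \<longlongrightarrow> x + 0 *\<^sub>R v + 0 *\<^sub>R w) (nhds 0 \<times>\<^sub>F nhds 0)"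
    by (intro tendsto_add tendsto_const tendsto_scaleR_lcs filterlim_fst filterlim_snd)
  then have "\<forall>\<^sub>F p in nhds 0 \<times>\<^sub>F nhds 0. x + fst p *\<^sub>R v + snd p *\<^sub>R w \<in> U \<and>
      dist (?A (x + fst p *\<^sub>R v + snd p *\<^sub>R w) w) (?A x w) < e"
    using eventually_compose_filterlim[OF ev] by fastforce
  from iffD1[OF eventually_prod_filter this] obtain P Q where
    P: "eventually P (nhds (0::real))" and Q: "eventually Q (nhds (0::real))"
    and PQ: "\<And>s t. P s \<Longrightarrow> Q t \<Longrightarrow> x + s *\<^sub>R v + t *\<^sub>R w \<in> U \<and>
      dist (?A (x + s *\<^sub>R v + t *\<^sub>R w) w) (?A x w) < e"
    by fastforce
  have "\<forall>\<^sub>F s in nhds 0. P s \<and> Q s" using P Q by (rule eventually_conj)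
  then obtain d where d: "d > 0" "\<And>s. \<bar>s\<bar> < d \<Longrightarrow> P s \<and> Q s"
    unfolding eventually_nhds_metric by (auto simp: dist_real_def)
  have "norm (f (x + s *\<^sub>R v + t *\<^sub>R w) - f (x + s *\<^sub>R v) - (f (x + t *\<^sub>R w) - f x)
      - (s * t) *\<^sub>R ?A x w) \<le> e * (\<bar>s\<bar> * \<bar>t\<bar>)" if st: "\<bar>s\<bar> < d" "\<bar>t\<bar> < d" for s t
  proof -
    have in_U: "x + s' *\<^sub>R v + t' *\<^sub>R w \<in> U" if "\<bar>s'\<bar> \<le> \<bar>s\<bar>" "\<bar>t'\<bar> \<le> \<bar>t\<bar>" for s' t'
      using PQ d(2)[of s'] d(2)[of t'] that st by auto
    \<comment> \<open>The mean value bound is used twice: along \<open>v\<close> for the increment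
      \<open>g\<close>, and along \<open>w\<close> for the partial derivative of \<open>f\<close> in
      direction \<open>v\<close>.\<close>
    define g where "g y = f (y + t *\<^sub>R w) - f y" for y
    have 1: "has_dir_deriv g (dir_deriv f (x + s' *\<^sub>R v + t *\<^sub>R w) v - dir_deriv f (x + s' *\<^sub>R v) v) (x + s' *\<^sub>R v) v"
      if s': "\<bar>s'\<bar> \<le> \<bar>s\<bar>" for s'
    proof -
      have "has_dir_deriv f (dir_deriv f (x + s' *\<^sub>R v + t *\<^sub>R w) v) (x + s' *\<^sub>R v + t *\<^sub>R w) v"
        using C1_onD(3)[OF C2_onD(1)[OF f] in_U[OF s']] by simp
      moreover have "has_dir_deriv f (dir_deriv f (x + s' *\<^sub>R v) v) (x + s' *\<^sub>R v) v"
        using C1_onD(3)[OF C2_onD(1)[OF f] in_U[OF s', of 0]] by simp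
      ultimately show ?thesis
        unfolding has_dir_deriv_iff_has_vector_derivative g_def
        by (intro has_vector_derivative_diff) (simp_all add: ac_simps)
    qed
    have 2: "norm (dir_deriv f (x + s' *\<^sub>R v + t *\<^sub>R w) v - dir_deriv f (x + s' *\<^sub>R v) v - t *\<^sub>R ?A x w) \<le> e * \<bar>t\<bar>"
      if s': "\<bar>s'\<bar> \<le> \<bar>s\<bar>" for s'
    proof (rule mvt_dir_deriv[where D = "\<lambda>t'. ?A (x + s' *\<^sub>R v + t' *\<^sub>R w) w"])
      fix t' assume t': "\<bar>t'\<bar> \<le> \<bar>t\<bar>"
      show "has_dir_deriv (\<lambda>y. dir_deriv f y v) (?A (x + s' *\<^sub>R v + t' *\<^sub>R w) w) (x + s' *\<^sub>R v + t' *\<^sub>R w) w"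
        using C1_onD(3)[OF p in_U[OF s' t']] .
      show "norm (?A (x + s' *\<^sub>R v + t' *\<^sub>R w) w - ?A x w) \<le> e"
        using PQ[of s' t'] d(2)[of s'] d(2)[of t'] s' t' st by (auto simp: dist_norm less_imp_le)
    qed
    have "norm (g (x + s *\<^sub>R v) - g x - s *\<^sub>R (t *\<^sub>R ?A x w)) \<le> (e * \<bar>t\<bar>) * \<bar>s\<bar>"
      by (rule mvt_dir_deriv[OF 1 2]) auto
    then show ?thesis by (simp add: g_def ac_simps)
  qed
  then show ?thesis using d(1) by blast
qed

text \<open>With equal steps \<open>s\<close>, both mixed derivatives approximate the same second
  difference up to a small multiple of \<open>s * s\<close>.\<close>

lemma mixed_dir_deriv_commute:
  fixes f :: "'a::locally_convex_space \<Rightarrow> 'b::real_normed_vector"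
  assumes f: "C2_on U f" and x: "x \<in> U"
  shows "dir_deriv (\<lambda>y. dir_deriv f y v) x w = dir_deriv (\<lambda>y. dir_deriv f y w) x v"
proof -
  let ?A = "dir_deriv (\<lambda>y. dir_deriv f y v) x w" and ?B = "dir_deriv (\<lambda>y. dir_deriv f y w) x v"
  have "norm (?A - ?B) \<le> e" if "e > 0" for e
  proof -
    have e: "e / 2 > 0" using that by simp
    obtain d1 where d1: "d1 > 0" "\<And>s t. \<bar>s\<bar> < d1 \<Longrightarrow> \<bar>t\<bar> < d1 \<Longrightarrow>
      norm (f (x + s *\<^sub>R v + t *\<^sub>R w) - f (x + s *\<^sub>R v) - (f (x + t *\<^sub>R w) - f x) - (s * t) *\<^sub>R ?A) \<le> e / 2 * (\<bar>s\<bar> * \<bar>t\<bar>)"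
      using second_difference_bound[OF f x e, of v w] by blast
    obtain d2 where d2: "d2 > 0" "\<And>s t. \<bar>s\<bar> < d2 \<Longrightarrow> \<bar>t\<bar> < d2 \<Longrightarrow>
      norm (f (x + s *\<^sub>R w + t *\<^sub>R v) - f (x + s *\<^sub>R w) - (f (x + t *\<^sub>R v) - f x) - (s * t) *\<^sub>R ?B) \<le> e / 2 * (\<bar>s\<bar> * \<bar>t\<bar>)"
      using second_difference_bound[OF f x e, of w v] by blast
    define s where "s = min d1 d2 / 2"
    have s: "s > 0" "\<bar>s\<bar> < d1" "\<bar>s\<bar> < d2" using d1(1) d2(1) by (auto simp: s_def)
    let ?D = "f (x + s *\<^sub>R v + s *\<^sub>R w) - f (x + s *\<^sub>R v) - (f (x + s *\<^sub>R w) - f x)"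
    have a: "norm (?D - (s * s) *\<^sub>R ?A) \<le> e / 2 * (s * s)"
      using d1(2)[OF s(2) s(2)] s(1) by simp
    have b: "norm (?D - (s * s) *\<^sub>R ?B) \<le> e / 2 * (s * s)"
      using d2(2)[OF s(3) s(3)] s(1) by (simp add: algebra_simps)
    have "norm ((s * s) *\<^sub>R (?A - ?B)) = norm ((?D - (s * s) *\<^sub>R ?B) - (?D - (s * s) *\<^sub>R ?A))"
      by (simp add: scaleR_diff_right)
    also have "\<dots> \<le> e / 2 * (s * s) + e / 2 * (s * s)"
      using norm_triangle_ineq4[of "?D - (s * s) *\<^sub>R ?B" "?D - (s * s) *\<^sub>R ?A"] a b by linarith
    finally have "(s * s) * norm (?A - ?B) \<le> (s * s) * e"
      using s(1) by (simp only: norm_scaleR) (simp add: mult.commute)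
    then show ?thesis using s(1) by simp
  qed
  then have "norm (?A - ?B) \<le> 0"
    by (metis dense_ge)
  then show ?thesis by simp
qed

section \<open>Finite-dimensional normed spaces\<close>

text \<open>By induction on the basis: bounded coordinates make \<open>span B\<close> closed, so a
  new vector \<open>a\<close> has positive distance \<open>d\<close> from it, and this bounds the
  coordinate along \<open>a\<close>.\<close>

lemma representation_sum_le_norm:
  fixes B :: "'v::real_normed_vector set"
  assumes "finite B" "independent B"
  shows "\<exists>K\<ge>0. \<forall>y\<in>span B. (\<Sum>b\<in>B. \<bar>representation B y b\<bar>) \<le> K * norm y"
  using assms
proof (induction B)
  case empty
  then show ?case by (auto intro: exI[of _ 0])
next
  case (insert a B)
  have ind: "independent B" and a: "a \<notin> span B"
    using insert.prems insert.hyps by (auto simp: independent_insert)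
  then obtain K where K: "K \<ge> 0" "\<And>y. y \<in> span B \<Longrightarrow> (\<Sum>b\<in>B. \<bar>representation B y b\<bar>) \<le> K * norm y"
    using insert.IH by blast
  have "closed (span B)"
    unfolding closed_sequential_limits
  proof (intro allI impI, elim conjE)
    fix s l assume s: "\<forall>n. s n \<in> span B" "s \<longlonglongrightarrow> l"
    have "convergent (\<lambda>n. representation B (s n) b)" if b: "b \<in> B" for b
    proof -
      have "dist (representation B (s m) b) (representation B (s n) b) \<le> K * dist (s m) (s n)" for m n
      proof -
        have "\<bar>representation B (s m - s n) b\<bar> \<le> (\<Sum>b\<in>B. \<bar>representation B (s m - s n) b\<bar>)"
          using b insert.hyps by (intro member_le_sum) auto
        also have "\<dots> \<le> K * norm (s m - s n)"
          using s by (intro K span_diff) auto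
        finally show ?thesis
          using s by (simp add: dist_norm representation_diff[OF ind])
      qed
      moreover have "Cauchy s" using s(2) by (rule LIMSEQ_imp_Cauchy)
      ultimately have "Cauchy (\<lambda>n. representation B (s n) b)"
        unfolding Cauchy_def
      proof (intro allI impI)
        fix e :: real assume e: "e > 0" "\<forall>e>0. \<exists>M. \<forall>m\<ge>M. \<forall>n\<ge>M. dist (s m) (s n) < e"
          and d: "\<And>m n. dist (representation B (s m) b) (representation B (s n) b) \<le> K * dist (s m) (s n)"
        \<comment> \<open>Dividing by \<open>K + 1\<close> rather than \<open>K\<close> covers the
          case \<open>K = 0\<close>.\<close>
        from e obtain M where M: "\<And>m n. m \<ge> M \<Longrightarrow> n \<ge> M \<Longrightarrow> dist (s m) (s n) < e / (K + 1)"
          using K(1) by (metis add_nonneg_pos divide_pos_pos zero_less_one)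
        have "dist (representation B (s m) b) (representation B (s n) b) < e" if "m \<ge> M" "n \<ge> M" for m n
        proof -
          have "K * dist (s m) (s n) \<le> K * (e / (K + 1))"
            using M[OF that] K(1) by (intro mult_left_mono) auto
          also have "\<dots> < e" using K(1) e(1) by (simp add: field_simps)
          finally show ?thesis using d[of m n] by linarith
        qed
        then show "\<exists>M. \<forall>m\<ge>M. \<forall>n\<ge>M. dist (representation B (s m) b) (representation B (s n) b) < e"
          by blast
      qed
      then show ?thesis by (rule Cauchy_convergent)
    qed
    then have "(\<lambda>n. \<Sum>b\<in>B. representation B (s n) b *\<^sub>R b) \<longlonglongrightarrow>
        (\<Sum>b\<in>B. lim (\<lambda>n. representation B (s n) b) *\<^sub>R b)"
      by (intro tendsto_sum tendsto_scaleR tendsto_const) (simp add: convergent_LIMSEQ_iff)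
    moreover have "(\<Sum>b\<in>B. representation B (s n) b *\<^sub>R b) = s n" for n
      using s ind insert.hyps by (intro sum_representation_eq) auto
    ultimately have "s \<longlonglongrightarrow> (\<Sum>b\<in>B. lim (\<lambda>n. representation B (s n) b) *\<^sub>R b)"
      by simp
    then have "l = (\<Sum>b\<in>B. lim (\<lambda>n. representation B (s n) b) *\<^sub>R b)"
      using s(2) LIMSEQ_unique by blast
    then show "l \<in> span B" by (simp add: span_sum span_scale span_base)
  qed
  then have "open (- span B)" by (simp add: open_Compl)
  then obtain d where d: "d > 0" "\<And>y. dist y a < d \<Longrightarrow> y \<notin> span B"
    using a unfolding open_dist by (metis ComplD ComplI)
  show ?case
  \<comment> \<open>The coordinate along \<open>a\<close> is at most \<open>norm y / d\<close>; the
    rest \<open>z\<close> then has norm at most \<open>(1 + norm a / d) * norm y\<close>, and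
    \<open>K\<close> bounds its coordinates.\<close>
  proof (intro exI[of _ "1 / d + K * (1 + norm a / d)"] conjI ballI)
    show "0 \<le> 1 / d + K * (1 + norm a / d)" using d(1) K(1) by simp
    fix y assume y: "y \<in> span (insert a B)"
    let ?c = "representation (insert a B) y a"
    define z where "z = y - ?c *\<^sub>R a"
    have "(\<Sum>b\<in>insert a B. representation (insert a B) y b *\<^sub>R b) = y"
      using y insert.prems insert.hyps by (intro sum_representation_eq) auto
    then have z: "z = (\<Sum>b\<in>B. representation (insert a B) y b *\<^sub>R b)"
      using insert.hyps by (simp add: z_def) (metis add_diff_cancel_left')
    have zB: "z \<in> span B" unfolding z by (intro span_sum span_scale span_base)
    have ext: "representation (insert a B) z = representation B z"
      by (rule representation_extend[OF insert.prems zB subset_insertI])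
    have rep: "representation (insert a B) y b = representation B z b" if "b \<in> B" for b
    proof -
      have "representation B z b = representation (insert a B) z b"
        by (simp only: ext)
      also have "\<dots> = representation (insert a B) y b - ?c * representation (insert a B) a b"
        using y insert.prems unfolding z_def
        by (simp add: representation_diff representation_scale span_base span_scale)
      also have "representation (insert a B) a b = 0"
        using insert.prems insert.hyps that by (auto simp: representation_basis)
      finally show ?thesis by simp
    qed
    have c: "\<bar>?c\<bar> * d \<le> norm y"
    proof (cases "?c = 0")
      case False
      \<comment> \<open>Dividing \<open>y\<close> by the coefficient of \<open>a\<close> exhibits a
        point of \<open>span B\<close> whose distance from \<open>a\<close> is the norm of the
        quotient.\<close>
      have "- z /\<^sub>R ?c \<in> span B" using zB by (intro span_scale span_neg)
      then have "d \<le> dist (- z /\<^sub>R ?c) a" using d(2) by (meson not_le)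
      also have "dist (- z /\<^sub>R ?c) a = norm (y /\<^sub>R ?c)"
        using False by (simp add: z_def dist_norm algebra_simps norm_minus_commute)
      finally show ?thesis using False by (simp add: field_simps)
    qed simp
    then have c': "\<bar>?c\<bar> \<le> norm y / d" using d(1) by (simp add: field_simps)
    have "norm z \<le> norm y + \<bar>?c\<bar> * norm a"
      unfolding z_def by (rule order_trans[OF norm_triangle_ineq4]) simp
    also have "\<dots> \<le> norm y + norm y / d * norm a"
      using c' by (intro add_left_mono mult_right_mono) auto
    finally have z: "norm z \<le> norm y * (1 + norm a / d)" by (simp add: algebra_simps)
    have "(\<Sum>b\<in>insert a B. \<bar>representation (insert a B) y b\<bar>) = \<bar>?c\<bar> + (\<Sum>b\<in>B. \<bar>representation B z b\<bar>)"
      using insert.hyps by (simp add: rep)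
    also have "\<dots> \<le> norm y / d + K * (norm y * (1 + norm a / d))"
      using c' K(2)[OF zB] mult_left_mono[OF z K(1)] by linarith
    finally show "(\<Sum>b\<in>insert a B. \<bar>representation (insert a B) y b\<bar>) \<le>
        (1 / d + K * (1 + norm a / d)) * norm y"
      by (simp add: algebra_simps)
  qed
qed

lemma finite_span_bounded_linear:
  fixes f :: "'v::real_normed_vector \<Rightarrow> 'w::real_normed_vector"
  assumes fin: "\<exists>D :: 'v set. finite D \<and> span D = UNIV" and f: "linear f"
  shows "bounded_linear f"
proof -
  obtain D :: "'v set" where D: "finite D" "span D = UNIV" using fin by auto
  obtain B where B: "B \<subseteq> D" "independent B" "D \<subseteq> span B"
    using maximal_independent_subset[of D] by blast
  have sB: "span B = UNIV" using B(3) D(2) by (metis span_mono span_span top.extremum_uniqueI)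
  have fB: "finite B" using B(1) D(1) finite_subset by blast
  obtain K where K: "K \<ge> 0" "\<And>y. (\<Sum>b\<in>B. \<bar>representation B y b\<bar>) \<le> K * norm y"
    using representation_sum_le_norm[OF fB B(2)] sB by auto
  show ?thesis
  proof (rule bounded_linear_intro[of _ "K * (\<Sum>b\<in>B. norm (f b))"])
    fix x
    have "x = (\<Sum>b\<in>B. representation B x b *\<^sub>R b)"
      using sB fB B(2) by (intro sum_representation_eq[symmetric]) auto
    then have "f x = (\<Sum>b\<in>B. representation B x b *\<^sub>R f b)"
      by (metis (no_types, lifting) linear_sum[OF f] linear_scale[OF f] sum.cong)
    then have "norm (f x) \<le> (\<Sum>b\<in>B. \<bar>representation B x b\<bar> * norm (f b))"
      by (simp add: sum_norm_le)
    also have "\<dots> \<le> (\<Sum>b\<in>B. \<bar>representation B x b\<bar> * (\<Sum>b\<in>B. norm (f b)))"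
      using fB by (intro sum_mono mult_left_mono member_le_sum) auto
    also have "\<dots> \<le> (K * norm x) * (\<Sum>b\<in>B. norm (f b))"
      using K(2)[of x] by (simp add: sum_distrib_right[symmetric] mult_right_mono sum_nonneg)
    finally show "norm (f x) \<le> norm x * (K * (\<Sum>b\<in>B. norm (f b)))"
      by (simp add: ac_simps)
  qed (auto simp: linear_add[OF f] linear_scale[OF f])
qed

text \<open>In finite dimension \<open>F\<close> is the sum of its values on a basis under the fixed
  bounded linear maps \<open>E b\<close>, so pointwise differentiability gives differentiability in
  operator norm, as the coordinates of \<open>dual_chart\<close> require.\<close>

lemma blinfun_curve_differentiable:
  fixes F :: "real \<Rightarrow> 'v::real_normed_vector \<Rightarrow>\<^sub>L 'w::real_normed_vector"
  assumes fin: "\<exists>D :: 'v set. finite D \<and> span D = UNIV"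
    and F: "\<And>w. ((\<lambda>t. F t w) has_vector_derivative l w) (at t0)"
  shows "\<exists>l'. (F has_vector_derivative l') (at t0)"
proof -
  obtain D :: "'v set" where D: "finite D" "span D = UNIV" using fin by auto
  obtain B where B: "B \<subseteq> D" "independent B" "D \<subseteq> span B"
    using maximal_independent_subset[of D] by blast
  have sB: "span B = UNIV" using B(3) D(2) by (metis span_mono span_span top.extremum_uniqueI)
  have fB: "finite B" using B(1) D(1) finite_subset by blast
  have rb: "bounded_linear (\<lambda>w. representation B w b)" for b
    using sB B(2)
    by (intro finite_span_bounded_linear[OF fin] linearI) (auto simp: representation_add representation_scale)
  define E where "E b y = blinfun_scaleR_left y o\<^sub>L Blinfun (\<lambda>w. representation B w b)" for b and y :: 'w
  have E: "blinfun_apply (E b y) w = representation B w b *\<^sub>R y" for b y w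
    by (simp add: E_def bounded_linear_Blinfun_apply[OF rb])
  have bE: "bounded_linear (E b)" for b
    unfolding E_def by (intro bounded_linear_intros)
  have "F t = (\<Sum>b\<in>B. E b (F t b))" for t
  proof (rule blinfun_eqI)
    fix w
    have "w = (\<Sum>b\<in>B. representation B w b *\<^sub>R b)"
      using sB fB B(2) by (intro sum_representation_eq[symmetric]) auto
    then have "F t w = (\<Sum>b\<in>B. representation B w b *\<^sub>R F t b)"
      by (metis (no_types, lifting) blinfun.sum_right blinfun.scaleR_right sum.cong)
    then show "F t w = blinfun_apply (\<Sum>b\<in>B. E b (F t b)) w"
      by (simp add: blinfun.sum_left E)
  qed
  then have "F = (\<lambda>t. \<Sum>b\<in>B. E b (F t b))" by (rule ext)
  moreover have "((\<lambda>t. \<Sum>b\<in>B. E b (F t b)) has_vector_derivative (\<Sum>b\<in>B. E b (l b))) (at t0)"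
    by (intro has_vector_derivative_sum bounded_linear.has_vector_derivative[OF bE] F)
  ultimately show ?thesis by metis
qed

section \<open>Alternating forms and determinants\<close>

lemma indices: "distinct (indices :: 'n::finite list)" "set (indices :: 'n list) = UNIV"
proof -
  have "\<exists>ns :: 'n list. distinct ns \<and> set ns = UNIV"
    using finite_distinct_list[of "UNIV :: 'n set"] by auto
  from someI_ex[OF this] show "distinct (indices :: 'n list)" "set (indices :: 'n list) = UNIV"
    unfolding indices_def by auto
qed

lemma length_indices [simp]: "length (indices :: 'n::finite list) = CARD('n)"
  using distinct_card[OF indices(1)] indices(2) by metis

text \<open>Inverse of the enumeration \<open>indices\<close>: it translates between list positions,
  where forms take their arguments, and the index type of matrix rows.\<close>

definition pos :: "'n::finite \<Rightarrow> nat" where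
  "pos i = (SOME k. k < CARD('n) \<and> indices ! k = i)"

lemma pos [simp]: "pos (i :: 'n::finite) < CARD('n)" "indices ! pos i = i"
proof -
  have "\<exists>k. k < CARD('n) \<and> indices ! k = i"
    using indices(2) by (metis UNIV_I in_set_conv_nth length_indices)
  from someI_ex[OF this] show "pos i < CARD('n)" "indices ! pos i = i"
    unfolding pos_def by auto
qed

lemma pos_indices [simp]: "k < CARD('n::finite) \<Longrightarrow> pos (indices ! k :: 'n) = k"
  by (metis indices(1) length_indices nth_eq_iff_index_eq pos)

lemma pos_eq_iff [simp]: "pos i = pos j \<longleftrightarrow> i = j"
  by (metis pos(2))

lemma map_nth_pos: "length vs = CARD('n::finite) \<Longrightarrow> map (\<lambda>i::'n. vs ! pos i) indices = vs"
  by (intro nth_equalityI) auto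

lemma map_indices_update: "(map f (indices :: 'n::finite list))[pos i := v] = map (f(i := v)) indices"
proof (rule nth_equalityI)
  fix k assume "k < length ((map f (indices :: 'n list))[pos i := v])"
  then have "k < CARD('n)" by simp
  then show "(map f indices)[pos i := v] ! k = map (f(i := v)) indices ! k"
    by (cases "k = pos i") (auto simp: nth_list_update)
qed simp

lemma alternating_formsD:
  assumes "\<omega> \<in> alternating_forms k"
  shows "length vs \<noteq> k \<Longrightarrow> \<omega> vs = 0"
    "length vs = k \<Longrightarrow> i < k \<Longrightarrow> linear (\<lambda>v. \<omega> (vs[i := v]))"
    "length vs = k \<Longrightarrow> i < j \<Longrightarrow> j < k \<Longrightarrow> vs ! i = vs ! j \<Longrightarrow> \<omega> vs = 0"
  using assms unfolding alternating_forms_def by blast+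

lemma alternating_linear:
  assumes "\<omega> \<in> alternating_forms CARD('n::finite)"
  shows "linear (\<lambda>v. \<omega> (map (f(i := v)) (indices :: 'n list)))"
  using alternating_formsD(2)[OF assms, of "map f indices" "pos i"] by (simp add: map_indices_update)

lemma alternating_eq_0:
  assumes "\<omega> \<in> alternating_forms CARD('n::finite)" and "i \<noteq> j" "f i = f j"
  shows "\<omega> (map f (indices :: 'n list)) = 0"
proof (cases "pos i < pos j")
  case True
  then show ?thesis
    using alternating_formsD(3)[OF assms(1), of "map f indices" "pos i" "pos j"] assms by simp
next
  case False
  then have "pos j < pos i" using assms(2) by (meson linorder_neqE_nat pos_eq_iff)
  then show ?thesis
    using alternating_formsD(3)[OF assms(1), of "map f indices" "pos j" "pos i"] assms by simp
qed

lemma alternating_add: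
  assumes "\<omega> \<in> alternating_forms CARD('n::finite)"
  shows "\<omega> (map (f(i := v + w)) (indices :: 'n list)) =
    \<omega> (map (f(i := v)) indices) + \<omega> (map (f(i := w)) indices)"
  using linear_add[OF alternating_linear[OF assms]] .

lemma alternating_scale:
  assumes "\<omega> \<in> alternating_forms CARD('n::finite)"
  shows "\<omega> (map (f(i := c *\<^sub>R v)) (indices :: 'n list)) = c * \<omega> (map (f(i := v)) indices)"
  using linear_scale[OF alternating_linear[OF assms]] by simp

lemma alternating_zero_arg:
  assumes "\<omega> \<in> alternating_forms CARD('n::finite)" "f i = 0"
  shows "\<omega> (map f (indices :: 'n list)) = 0"
  using linear_0[OF alternating_linear[OF assms(1), of f i]] assms(2) fun_upd_triv[of f i] by metis

lemma alternating_swap: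
  assumes \<omega>: "\<omega> \<in> alternating_forms CARD('n::finite)" and ij: "i \<noteq> j"
  shows "\<omega> (map (f(i := v, j := w)) (indices :: 'n list)) = - \<omega> (map (f(i := w, j := v)) indices)"
proof -
  have z: "\<omega> (map (f(i := u, j := u)) indices) = 0" for u
    using alternating_eq_0[OF \<omega> ij] ij by simp
  have add: "\<omega> (map (f(i := a + b, j := c)) indices) =
      \<omega> (map (f(i := a, j := c)) indices) + \<omega> (map (f(i := b, j := c)) indices)" for a b c
    using alternating_add[OF \<omega>, of "f(j := c)" i a b] fun_upd_twist[OF ij] by metis
  have "\<omega> (map (f(i := v + w, j := v + w)) indices) =
      (\<omega> (map (f(i := v, j := v)) indices) + \<omega> (map (f(i := w, j := v)) indices)) +
      (\<omega> (map (f(i := v, j := w)) indices) + \<omega> (map (f(i := w, j := w)) indices))"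
    using alternating_add[OF \<omega>, of "f(i := v + w)" j v w] add[of v w v] add[of v w w] by linarith
  then show ?thesis by (simp add: z)
qed

text \<open>By induction over elementary matrices, as determinants behave in the same way.\<close>

lemma alternating_matrix:
  fixes M :: "real^'n^'n" and f :: "'n \<Rightarrow> 'e::real_vector"
  assumes \<omega>: "\<omega> \<in> alternating_forms CARD('n)"
  shows "\<omega> (map (\<lambda>i. \<Sum>j\<in>UNIV. M $ i $ j *\<^sub>R f j) indices) = det M * \<omega> (map f indices)"
proof (induction M arbitrary: f rule: induct_matrix_elementary[case_names mult zero_row diagonal swap1 idplus])
  case (mult A B)
  have "(\<Sum>j\<in>UNIV. (A ** B) $ i $ j *\<^sub>R f j) = (\<Sum>k\<in>UNIV. A $ i $ k *\<^sub>R (\<Sum>j\<in>UNIV. B $ k $ j *\<^sub>R f j))" for i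
    unfolding matrix_matrix_mult_def
    by (simp add: scaleR_sum_left scaleR_sum_right) (subst sum.swap, simp)
  then show ?case
    using mult.IH by (simp add: det_mul)
next
  case (zero_row A i)
  then have "A $ i $ j = 0" for j
    by (simp add: row_def vec_eq_iff)
  then have "\<omega> (map (\<lambda>i. \<Sum>j\<in>UNIV. A $ i $ j *\<^sub>R f j) indices) = 0"
    by (intro alternating_zero_arg[OF \<omega>, of _ i]) simp
  then show ?case using det_zero_row(1)[OF zero_row] by simp
next
  case (diagonal A)
  have A: "(\<Sum>j\<in>UNIV. A $ i $ j *\<^sub>R f j) = A $ i $ i *\<^sub>R f i" for i
    using diagonal by (subst sum.remove[of _ i]) (auto intro!: sum.neutral)
  have "\<omega> (map (\<lambda>i. if i \<in> S then A $ i $ i *\<^sub>R f i else f i) indices) = (\<Prod>i\<in>S. A $ i $ i) * \<omega> (map f indices)"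
    if "finite S" for S
    using that
  proof (induction S)
    case (insert a S)
    let ?g = "\<lambda>S i. if i \<in> S then A $ i $ i *\<^sub>R f i else f i"
    have "\<omega> (map (?g (insert a S)) indices) = \<omega> (map ((?g S)(a := A $ a $ a *\<^sub>R f a)) indices)"
      by (intro arg_cong[of _ _ \<omega>] map_cong) auto
    also have "\<dots> = A $ a $ a * \<omega> (map ((?g S)(a := f a)) indices)"
      by (rule alternating_scale[OF \<omega>])
    also have "(?g S)(a := f a) = ?g S" using insert.hyps by auto
    finally show ?case using insert by simp
  qed simp
  from this[of UNIV] show ?case
    by (simp add: A det_diagonal[OF diagonal])
next
  case (swap1 m n)
  have "(\<Sum>j\<in>UNIV. (\<chi> i j. mat 1 $ i $ Transposition.transpose m n j) $ i $ j *\<^sub>R f j) =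
      f (Transposition.transpose m n i)" for i
  proof -
    have "(\<Sum>j\<in>UNIV. (\<chi> i j. mat 1 $ i $ Transposition.transpose m n j) $ i $ j *\<^sub>R f j) =
        (\<Sum>j\<in>UNIV. if j = Transposition.transpose m n i then f j else 0)"
      by (intro sum.cong) (auto simp: mat_def)
    then show ?thesis by simp
  qed
  moreover have "(\<lambda>i. f (Transposition.transpose m n i)) = f(m := f n, n := f m)"
    by (auto simp: fun_eq_iff Transposition.transpose_def)
  ultimately have "\<omega> (map (\<lambda>i. \<Sum>j\<in>UNIV. (\<chi> i j. mat 1 $ i $ Transposition.transpose m n j) $ i $ j *\<^sub>R f j) indices)
      = - \<omega> (map f indices)"
    using alternating_swap[OF \<omega> swap1, of f "f n" "f m"] by simp
  moreover have "det (\<chi> i j. (mat 1 :: real^'n^'n) $ i $ Transposition.transpose m n j) = -1"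
    using swap1 by (subst det_permute_columns[OF permutes_swap_id]) (auto simp: sign_swap_id)
  ultimately show ?case by simp
next
  case (idplus m n c)
  let ?M = "(\<chi> i j. if i = m \<and> j = n then c else of_bool (i = j)) :: real^'n^'n"
  have "(\<Sum>j\<in>UNIV. ?M $ i $ j *\<^sub>R f j) = (f(m := f m + c *\<^sub>R f n)) i" for i
  proof -
    have "(\<Sum>j\<in>UNIV. ?M $ i $ j *\<^sub>R f j) =
        (\<Sum>j\<in>UNIV. (if i = j then f j else 0) + (if j = n then (if i = m then c *\<^sub>R f j else 0) else 0))"
      using idplus by (intro sum.cong) auto
    then show ?thesis by (simp add: sum.distrib)
  qed
  then have "\<omega> (map (\<lambda>i. \<Sum>j\<in>UNIV. ?M $ i $ j *\<^sub>R f j) indices) = \<omega> (map (f(m := f m + c *\<^sub>R f n)) indices)"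
    by (simp only:)
  also have "\<dots> = \<omega> (map f indices) + c * \<omega> (map (f(m := f n)) indices)"
    by (simp add: alternating_add[OF \<omega>] alternating_scale[OF \<omega>])
  also have "\<omega> (map (f(m := f n)) indices) = 0"
    using idplus by (intro alternating_eq_0[OF \<omega>, of m n]) auto
  finally have 1: "\<omega> (map (\<lambda>i. \<Sum>j\<in>UNIV. ?M $ i $ j *\<^sub>R f j) indices) = \<omega> (map f indices)"
    by simp
  have "?M = (\<chi> k. if k = m then row m (mat 1 :: real^'n^'n) + c *s row n (mat 1 :: real^'n^'n)
      else row k (mat 1 :: real^'n^'n))"
    using idplus by (auto simp: vec_eq_iff row_def mat_def)
  then have "det ?M = 1" using det_row_operation[OF idplus, of "mat 1 :: real^'n^'n" c] by simp
  with 1 show ?case by simp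
qed

section \<open>The coordinate volume form as a determinant\<close>

definition det_list :: "(real^'n) form" where
  "det_list vs = (if length vs = CARD('n) then det (\<chi> i. vs ! pos i) else 0)"

lemma det_list_map_indices: "det_list (map f (indices :: 'n list)) = det (\<chi> i. f i :: real^'n^'n)"
  by (simp add: det_list_def)

lemma det_upd_linear: "linear (\<lambda>v. det (\<chi> j. if j = i then v else f j :: real^'n^'n))"
proof (rule linearI)
  show "det (\<chi> j. if j = i then v + w else f j :: real^'n^'n) =
      det (\<chi> j. if j = i then v else f j) + det (\<chi> j. if j = i then w else f j)" for v w
    using det_row_add[of i "\<lambda>_. v" "\<lambda>_. w" f] by simp
  show "det (\<chi> j. if j = i then c *\<^sub>R v else f j :: real^'n^'n) = c *\<^sub>R det (\<chi> j. if j = i then v else f j)" for c v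
    using det_row_mul[of i c "\<lambda>_. v" f] by (simp add: scalar_mult_eq_scaleR cong: if_cong)
qed

lemma alternating_det_list_map:
  fixes L :: "'e::real_vector \<Rightarrow> real^'n"
  assumes L: "linear L"
  shows "(\<lambda>vs. det_list (map L vs)) \<in> alternating_forms CARD('n)"
  unfolding alternating_forms_def mem_Collect_eq
proof (intro conjI allI impI; (elim conjE)?)
  fix vs :: "'e list" and i
  assume vs: "length vs = CARD('n)" and i: "i < CARD('n)"
  have "det_list (map L (vs[i := v])) = det (\<chi> j. if j = (indices ! i :: 'n) then L v else L (vs ! pos j))" for v
  proof -
    have "(\<chi> j. map L (vs[i := v]) ! pos j :: real^'n^'n) = (\<chi> j. if j = indices ! i then L v else L (vs ! pos j))"
      using vs i by (auto simp: vec_eq_iff nth_list_update)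
    then show ?thesis using vs by (simp add: det_list_def)
  qed
  then show "linear (\<lambda>v. det_list (map L (vs[i := v])))"
    using linear_compose[OF L det_upd_linear] by (simp add: o_def)
next
  fix vs :: "'e list" and i j
  assume vs: "length vs = CARD('n)" and ij: "i < j" "j < CARD('n)" "vs ! i = vs ! j"
  have "(indices ! i :: 'n) \<noteq> indices ! j"
    using ij indices(1)[where 'n = 'n] by (simp add: nth_eq_iff_index_eq)
  moreover have "row (indices ! i) (\<chi> k. L (vs ! pos k) :: real^'n^'n) = row (indices ! j) (\<chi> k. L (vs ! pos k) :: real^'n^'n)"
    using ij order.strict_trans[OF ij(1,2)] by (simp add: row_def)
  ultimately show "det_list (map L vs) = 0"
    using vs det_identical_rows by (simp add: det_list_def)
qed (simp add: det_list_def)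

lemma alternating_det_list: "(det_list :: (real^'n) form) \<in> alternating_forms CARD('n)"
  using alternating_det_list_map[of "\<lambda>v. v :: real^'n"] by (simp add: linear_id[unfolded id_def])

text \<open>The pullback along \<open>L\<close> has top degree, hence is a multiple of the
  determinant; the factor is read off on the coordinate axes.\<close>

lemma alternating_top_form:
  fixes \<omega> :: "'e::real_vector form" and L :: "real^'n \<Rightarrow> 'e"
  assumes \<omega>: "\<omega> \<in> alternating_forms CARD('n)" and L: "linear L"
  shows "\<omega> (map L us) = det_list us * \<omega> (map (\<lambda>\<mu>. L (axis \<mu> 1)) indices)"
proof (cases "length us = CARD('n)")
  case True
  have "L (us ! pos i) = (\<Sum>j\<in>UNIV. (us ! pos i) $ j *\<^sub>R L (axis j 1))" for i :: 'n
  proof -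
    have "us ! pos i = (\<Sum>j\<in>UNIV. (us ! pos i) $ j *\<^sub>R axis j 1)"
      by (simp add: basis_expansion flip: scalar_mult_eq_scaleR)
    then show ?thesis
      using linear_sum[OF L] linear_scale[OF L] by (metis (no_types, lifting) sum.cong)
  qed
  then have "map L us = map (\<lambda>i. \<Sum>j\<in>UNIV. (\<chi> i. us ! pos i) $ i $ j *\<^sub>R L (axis j 1)) (indices :: 'n list)"
    using True by (intro nth_equalityI) (auto, metis pos_indices)
  then show ?thesis
    using alternating_matrix[OF \<omega>, of "\<chi> i. us ! pos i"] True by (simp add: det_list_def)
next
  case False
  then show ?thesis using alternating_formsD(1)[OF \<omega>] by (simp add: det_list_def)
qed

lemma det_identity_row: "det (\<chi> i. if i = k then r else axis i 1 :: real^'n^'n) = r $ k"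
proof -
  have "(\<Sum>i\<in>UNIV. r $ i *s row i (mat 1 :: real^'n^'n)) = r"
    using basis_expansion[of r] by (simp add: row_def mat_def axis_def vec_eq_iff vector_scalar_mult_def if_distrib cong: if_cong)
  moreover have "row i (mat 1 :: real^'n^'n) = axis i 1" for i
    by (simp add: row_def mat_def axis_def vec_eq_iff)
  ultimately show ?thesis
    using cramer_lemma_transpose[of k r "mat 1 :: real^'n^'n"] by (simp cong: if_cong)
qed

lemma has_real_derivative_det:
  fixes A :: "real \<Rightarrow> real^'n^'n"
  assumes A: "\<And>i. ((\<lambda>t. A t $ i) has_vector_derivative D i) (at t0)"
  shows "((\<lambda>t. det (A t)) has_real_derivative (\<Sum>k\<in>UNIV. det (\<chi> i. if i = k then D i else A t0 $ i))) (at t0)"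
proof -
  have A': "((\<lambda>t. A t $ i $ j) has_real_derivative D i $ j) (at t0)" for i j
    using bounded_linear.has_vector_derivative[OF bounded_linear_vec_nth A[of i], of j]
    by (simp add: has_real_derivative_iff_has_vector_derivative)
  let ?P = "{p. p permutes (UNIV :: 'n set)}"
  have "((\<lambda>t. det (A t)) has_real_derivative
      (\<Sum>p\<in>?P. of_int (sign p) * (\<Sum>k\<in>UNIV. D k $ p k * (\<Prod>i\<in>UNIV - {k}. A t0 $ i $ p i)))) (at t0)"
    unfolding det_def by (intro DERIV_sum DERIV_cmult has_field_derivative_prod A')
  also have "(\<Sum>p\<in>?P. of_int (sign p) * (\<Sum>k\<in>UNIV. D k $ p k * (\<Prod>i\<in>UNIV - {k}. A t0 $ i $ p i))) =
      (\<Sum>k\<in>UNIV. \<Sum>p\<in>?P. of_int (sign p) * (D k $ p k * (\<Prod>i\<in>UNIV - {k}. A t0 $ i $ p i)))"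
    by (simp only: sum_distrib_left) (rule sum.swap)
  also have "\<dots> = (\<Sum>k\<in>UNIV. det (\<chi> i. if i = k then D i else A t0 $ i))"
  proof (rule sum.cong[OF refl])
    fix k
    have "D k $ p k * (\<Prod>i\<in>UNIV - {k}. A t0 $ i $ p i) =
        (\<Prod>i\<in>UNIV. (\<chi> i. if i = k then D i else A t0 $ i) $ i $ p i)" for p
      by (subst prod.remove[of UNIV k]) (auto intro!: prod.cong)
    then show "(\<Sum>p\<in>?P. of_int (sign p) * (D k $ p k * (\<Prod>i\<in>UNIV - {k}. A t0 $ i $ p i))) =
        det (\<chi> i. if i = k then D i else A t0 $ i)"
      unfolding det_def by simp
  qed
  finally show ?thesis .
qed

text \<open>At the identity the derivative of the determinant is the trace; this is how the Jacobian
  in the equivariance identity becomes a divergence.\<close>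

lemma has_real_derivative_det_identity:
  fixes A :: "real \<Rightarrow> real^'n^'n"
  assumes "\<And>i. ((\<lambda>t. A t $ i) has_vector_derivative D i) (at t0)" and "\<And>i. A t0 $ i = axis i 1"
  shows "((\<lambda>t. det (A t)) has_real_derivative (\<Sum>k\<in>UNIV. D k $ k)) (at t0)"
proof -
  have "det (\<chi> i. if i = k then D i else A t0 $ i) = D k $ k" for k
  proof -
    have "(\<chi> i. if i = k then D i else A t0 $ i) = (\<chi> i. if i = k then D k else axis i 1)"
      using assms(2) by (auto simp: vec_eq_iff)
    then show ?thesis
      by (simp add: det_identity_row)
  qed
  then show ?thesis
    using has_real_derivative_det[OF assms(1)] by (simp only:)
qed

text \<open>Both sides are the derivative of \<open>det (A (1 + t T))\<close> at \<open>t = 0\<close>.\<close>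

lemma sum_det_replace_row:
  fixes A :: "real^'n^'n" and T :: "real^'n \<Rightarrow> real^'n"
  assumes T: "linear T"
  shows "(\<Sum>k\<in>UNIV. det (\<chi> i. if i = k then T (A $ i) else A $ i)) = (\<Sum>k\<in>UNIV. T (axis k 1) $ k) * det A"
proof -
  define S :: "real \<Rightarrow> real^'n^'n" where "S t = (\<chi> j. axis j 1 + t *\<^sub>R T (axis j 1))" for t
  have rows: "(A ** S t) $ i = A $ i + t *\<^sub>R T (A $ i)" for i t
  proof -
    have "A $ i = (\<Sum>j\<in>UNIV. A $ i $ j *\<^sub>R axis j 1)"
      by (simp add: basis_expansion flip: scalar_mult_eq_scaleR)
    then have "T (A $ i) = (\<Sum>j\<in>UNIV. A $ i $ j *\<^sub>R T (axis j 1))"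
      using linear_sum[OF T] linear_scale[OF T] by (metis (no_types, lifting) sum.cong)
    moreover have "(A ** S t) $ i = (\<Sum>j\<in>UNIV. A $ i $ j *\<^sub>R (axis j 1 + t *\<^sub>R T (axis j 1)))"
      by (simp add: matrix_matrix_mult_def S_def vec_eq_iff)
    ultimately show ?thesis
      using \<open>A $ i = _\<close> by (simp add: scaleR_add_right sum.distrib scaleR_sum_right mult.commute)
  qed
  have "((\<lambda>t. (A ** S t) $ i) has_vector_derivative T (A $ i)) (at 0)" for i
    unfolding rows by (auto intro!: derivative_eq_intros)
  from has_real_derivative_det[OF this]
  have 1: "((\<lambda>t. det (A ** S t)) has_real_derivative (\<Sum>k\<in>UNIV. det (\<chi> i. if i = k then T (A $ i) else A $ i))) (at 0)"
    by (simp add: rows cong: if_cong)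
  have "((\<lambda>t. S t $ i) has_vector_derivative T (axis i 1)) (at 0)" for i
    by (auto simp: S_def intro!: derivative_eq_intros)
  then have "((\<lambda>t. det (S t)) has_real_derivative (\<Sum>k\<in>UNIV. T (axis k 1) $ k)) (at 0)"
    by (rule has_real_derivative_det_identity) (simp add: S_def)
  from DERIV_cmult[OF this, of "det A"]
  have "((\<lambda>t. det (A ** S t)) has_real_derivative det A * (\<Sum>k\<in>UNIV. T (axis k 1) $ k)) (at 0)"
    by (simp add: det_mul)
  from DERIV_unique[OF 1 this] show ?thesis by (simp only: mult.commute)
qed

section \<open>Forms on lists with a distinguished argument\<close>

lemma alternating_linear_list:
  assumes "\<omega> \<in> alternating_forms k" "Suc (length as + length bs) = k"
  shows "linear (\<lambda>v. \<omega> (as @ v # bs))"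
  using alternating_formsD(2)[OF assms(1), of "as @ 0 # bs" "length as"] assms(2) by simp

lemma alternating_swap_list:
  assumes \<omega>: "\<omega> \<in> alternating_forms k" and k: "Suc (Suc (length as + length bs)) = k"
  shows "\<omega> (as @ x # y # bs) = - \<omega> (as @ y # x # bs)"
proof -
  have z: "\<omega> (as @ u # u # bs) = 0" for u
    using alternating_formsD(3)[OF \<omega>, of "as @ u # u # bs" "length as" "Suc (length as)"] k
    by (simp add: nth_append)
  have l: "\<omega> (as @ (u + v) # w # bs) = \<omega> (as @ u # w # bs) + \<omega> (as @ v # w # bs)" for u v w
    using linear_add[OF alternating_linear_list[OF \<omega>, of as "w # bs"]] k by simp
  have r: "\<omega> (as @ w # (u + v) # bs) = \<omega> (as @ w # u # bs) + \<omega> (as @ w # v # bs)" for u v w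
    using linear_add[OF alternating_linear_list[OF \<omega>, of "as @ [w]" bs]] k by simp
  have "\<omega> (as @ (x + y) # (x + y) # bs) =
      (\<omega> (as @ x # x # bs) + \<omega> (as @ x # y # bs)) + (\<omega> (as @ y # x # bs) + \<omega> (as @ y # y # bs))"
    by (simp only: l r)
  then show ?thesis by (simp add: z)
qed

lemma alternating_move:
  assumes \<omega>: "\<omega> \<in> alternating_forms k" and k: "Suc (length as + length bs) = k"
  shows "\<omega> (r # as @ bs) = (-1) ^ length as * \<omega> (as @ r # bs)"
  using k
proof (induction as arbitrary: bs rule: rev_induct)
  case (snoc a as)
  have "\<omega> (r # (as @ [a]) @ bs) = \<omega> (r # as @ a # bs)" by simp
  also have "\<dots> = (-1) ^ length as * \<omega> (as @ r # a # bs)"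
    using snoc.prems by (intro snoc.IH) simp
  also have "\<omega> (as @ r # a # bs) = - \<omega> (as @ a # r # bs)"
    using snoc.prems by (intro alternating_swap_list[OF \<omega>]) simp
  finally show ?case by simp
qed simp

text \<open>For \<open>T\<close> the derivative of a vector field, the left side is the exterior
  derivative of the volume form contracted with that field. Moving \<open>T (vs ! i)\<close> back to
  slot \<open>i\<close> absorbs the sign, after which the trace identity applies.\<close>

lemma sum_det_list_replace:
  fixes T :: "real^'n \<Rightarrow> real^'n"
  assumes T: "linear T" and vs: "length vs = CARD('n)"
  shows "(\<Sum>i<CARD('n). (-1) ^ i * det_list (T (vs ! i) # take i vs @ drop (Suc i) vs)) =
    (\<Sum>k\<in>UNIV. T (axis k 1) $ k) * det_list vs"
proof -
  have "(-1) ^ i * det_list (T (vs ! i) # take i vs @ drop (Suc i) vs) =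
      det (\<chi> j. if j = (indices ! i :: 'n) then T (vs ! pos j) else vs ! pos j)" if i: "i < CARD('n)" for i
  proof -
    have "det_list (T (vs ! i) # take i vs @ drop (Suc i) vs) = (-1) ^ i * det_list (take i vs @ T (vs ! i) # drop (Suc i) vs)"
      using alternating_move[OF alternating_det_list, of "take i vs" "drop (Suc i) vs" "T (vs ! i)"] vs i by simp
    also have "take i vs @ T (vs ! i) # drop (Suc i) vs = vs[i := T (vs ! i)]"
      using vs i by (simp add: upd_conv_take_nth_drop)
    also have "det_list (vs[i := T (vs ! i)]) =
        det (\<chi> j. if j = (indices ! i :: 'n) then T (vs ! pos j) else vs ! pos j)"
    proof -
      have "(\<chi> j. vs[i := T (vs ! i)] ! pos j :: real^'n^'n) = (\<chi> j. if j = indices ! i then T (vs ! pos j) else vs ! pos j)"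
        using vs i by (auto simp: vec_eq_iff nth_list_update)
      then show ?thesis using vs by (simp add: det_list_def)
    qed
    finally show ?thesis by (simp flip: power_add mult.assoc)
  qed
  then have "(\<Sum>i<CARD('n). (-1) ^ i * det_list (T (vs ! i) # take i vs @ drop (Suc i) vs)) =
      (\<Sum>i<CARD('n). det (\<chi> j. if j = (indices ! i :: 'n) then T (vs ! pos j) else vs ! pos j))"
    by (intro sum.cong) auto
  also have "\<dots> = (\<Sum>k\<in>UNIV. det (\<chi> j. if j = (k::'n) then T (vs ! pos j) else vs ! pos j))"
    by (rule sum.reindex_bij_witness[of _ pos "\<lambda>i. indices ! i"]) auto
  also have "\<dots> = (\<Sum>k\<in>UNIV. T (axis k 1) $ k) * det_list vs"
    using sum_det_replace_row[OF T, of "\<chi> j. vs ! pos j"] vs by (simp add: det_list_def cong: if_cong)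
  finally show ?thesis .
qed

text \<open>Fewer vectors than the dimension lie in a hyperplane: \<open>l\<close> is its normal. It
  serves to tilt a jet along a single argument.\<close>

lemma exists_dual_vector:
  fixes S :: "(real^'n) set"
  assumes "finite S" "card S < CARD('n)"
  obtains l u :: "real^'n" where "l \<bullet> u = 1" "\<And>v. v \<in> S \<Longrightarrow> l \<bullet> v = 0"
proof -
  have "dim S < DIM(real^'n)"
    using dim_le_card'[OF assms(1)] assms(2) by simp
  then obtain l where l: "l \<noteq> 0" "\<And>y. y \<in> span S \<Longrightarrow> orthogonal l y"
    using orthogonal_to_subspace_exists by blast
  show ?thesis
  proof
    show "l \<bullet> (l /\<^sub>R (l \<bullet> l)) = 1" using l(1) by simp
    show "l \<bullet> v = 0" if "v \<in> S" for v
      using l(2)[OF span_base[OF that]] by (simp add: orthogonal_def)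
  qed
qed

lemma det_list_hyperplane:
  fixes vs :: "(real^'n) list"
  assumes "l \<noteq> 0" "\<And>v. v \<in> set vs \<Longrightarrow> l \<bullet> v = 0"
  shows "det_list vs = 0"
proof (cases "length vs = CARD('n)")
  case True
  have "l \<bullet> (vs ! pos i) = 0" for i :: 'n
    using assms(2) True by simp
  then have "(\<chi> i. vs ! pos i :: real^'n^'n) *v l = 0"
    by (simp add: matrix_vector_mult_def vec_eq_iff inner_vec_def mult.commute)
  then have "\<not> inj ((*v) (\<chi> i. vs ! pos i :: real^'n^'n))"
    using assms(1) by (metis injD matrix_vector_mult_0_right)
  then have "det (\<chi> i. vs ! pos i :: real^'n^'n) = 0"
    using det_nz_iff_inj_gen[of "(*v) (\<chi> i. vs ! pos i :: real^'n^'n)"] by (simp add: matrix_vector_mul_linear_gen)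
  then show ?thesis by (simp add: det_list_def)
qed (simp add: det_list_def)

text \<open>The coordinate model \<open>p d\<^sup>n\<^sup>+\<^sup>1x + P\<^sub>\<mu> \<and> (\<partial>\<^sub>\<mu> \<lrcorner> d\<^sup>n\<^sup>+\<^sup>1x)\<close> of an element of \<open>Z\<close>: wedging with
  \<open>\<partial>\<^sub>\<mu> \<lrcorner> d\<^sup>n\<^sup>+\<^sup>1x\<close> replaces the column \<open>\<mu>\<close> of the determinant.\<close>

definition affine_form ::
    "real \<Rightarrow> ('n \<Rightarrow> 'v \<Rightarrow> real) \<Rightarrow> ((real^'n) \<times> 'v::real_vector) form" where
  "affine_form p P vs = p * det_list (map fst vs) +
    (\<Sum>\<mu>\<in>UNIV. det_list (map (\<lambda>x. \<chi> \<nu>. if \<nu> = \<mu> then P \<mu> (snd x) else fst x $ \<nu>) vs))"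

text \<open>The fibre condition of \<open>Z\<close> in adapted coordinates, where a vertical vector
  is one with vanishing first component.\<close>

definition vertical_affine :: "((real^'n) \<times> 'v::real_vector) form \<Rightarrow> bool" where
  "vertical_affine z \<longleftrightarrow> z \<in> alternating_forms CARD('n) \<and>
    (\<forall>v w. fst v = 0 \<longrightarrow> fst w = 0 \<longrightarrow> v \<lrcorner> w \<lrcorner> z = (\<lambda>_. 0))"

lemma alternating_formsI:
  assumes "\<And>vs. length vs \<noteq> k \<Longrightarrow> \<omega> vs = 0"
    and "\<And>vs i. length vs = k \<Longrightarrow> i < k \<Longrightarrow> linear (\<lambda>v. \<omega> (vs[i := v]))"
    and "\<And>vs i j. length vs = k \<Longrightarrow> i < j \<Longrightarrow> j < k \<Longrightarrow> vs ! i = vs ! j \<Longrightarrow> \<omega> vs = 0"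
  shows "\<omega> \<in> alternating_forms k"
  using assms unfolding alternating_forms_def by blast

lemma alternating_forms_add:
  assumes "\<omega> \<in> alternating_forms k" "\<eta> \<in> alternating_forms k"
  shows "(\<lambda>vs. \<omega> vs + \<eta> vs) \<in> alternating_forms k"
proof (rule alternating_formsI)
  show "linear (\<lambda>v. \<omega> (vs[i := v]) + \<eta> (vs[i := v]))" if "length vs = k" "i < k" for vs i
    using alternating_formsD(2)[OF assms(1) that] alternating_formsD(2)[OF assms(2) that]
    by (rule linear_compose_add)
  show "\<omega> vs + \<eta> vs = 0" if "length vs \<noteq> k" for vs
    using alternating_formsD(1)[OF assms(1) that] alternating_formsD(1)[OF assms(2) that] by simp
  show "\<omega> vs + \<eta> vs = 0" if "length vs = k" "i < j" "j < k" "vs ! i = vs ! j" for vs i j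
    using alternating_formsD(3)[OF assms(1) that] alternating_formsD(3)[OF assms(2) that] by simp
qed

lemma alternating_forms_cmult:
  assumes "\<omega> \<in> alternating_forms k"
  shows "(\<lambda>vs. c * \<omega> vs) \<in> alternating_forms k"
proof (rule alternating_formsI)
  show "linear (\<lambda>v. c * \<omega> (vs[i := v]))" if "length vs = k" "i < k" for vs i
    using alternating_formsD(2)[OF assms that] by (auto simp: linear_iff algebra_simps)
  show "c * \<omega> vs = 0" if "length vs \<noteq> k" for vs
    using alternating_formsD(1)[OF assms that] by simp
  show "c * \<omega> vs = 0" if "length vs = k" "i < j" "j < k" "vs ! i = vs ! j" for vs i j
    using alternating_formsD(3)[OF assms that] by simp
qed

lemma alternating_forms_sum:
  assumes "finite I" "\<And>i. i \<in> I \<Longrightarrow> \<omega> i \<in> alternating_forms k"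
  shows "(\<lambda>vs. \<Sum>i\<in>I. \<omega> i vs) \<in> alternating_forms k"
  using assms
proof (induction I)
  case empty
  then show ?case by (simp add: alternating_forms_def linear_zero)
next
  case (insert a I)
  then show ?case by (simp add: alternating_forms_add)
qed

lemma linear_replace_column:
  assumes "linear (P \<mu>)"
  shows "linear (\<lambda>x. \<chi> \<nu>. if \<nu> = \<mu> then P \<mu> (snd x) else fst x $ \<nu> :: real^'n)"
  by (intro linearI) (auto simp: vec_eq_iff linear_add[OF assms] linear_scale[OF assms])

lemma alternating_affine_form:
  fixes P :: "'n::finite \<Rightarrow> 'v::real_vector \<Rightarrow> real"
  assumes "\<And>\<mu>. linear (P \<mu>)"
  shows "affine_form p P \<in> alternating_forms CARD('n)"
  unfolding affine_form_def[abs_def]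
  by (intro alternating_forms_add alternating_forms_cmult alternating_forms_sum
      alternating_det_list_map linear_fst linear_replace_column assms finite)

text \<open>Two vertical arguments become two zero rows in the first determinant, and two multiples
  of the same axis \<open>axis \<mu> 1\<close> in the determinant with index \<open>\<mu>\<close>;
  each determinant vanishes.\<close>

lemma vertical_affine_form:
  fixes P :: "'n::finite \<Rightarrow> 'v::real_vector \<Rightarrow> real"
  assumes P: "\<And>\<mu>. linear (P \<mu>)"
  shows "vertical_affine (affine_form p P)"
  unfolding vertical_affine_def
proof (intro conjI allI impI alternating_affine_form P)
  fix v w :: "(real^'n) \<times> 'v"
  assume vw: "fst v = 0" "fst w = 0"
  show "v \<lrcorner> w \<lrcorner> affine_form p P = (\<lambda>_. 0)"
  proof (rule ext)
    fix vs :: "((real^'n) \<times> 'v) list"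
    show "(v \<lrcorner> w \<lrcorner> affine_form p P) vs = 0"
    proof (cases "Suc (Suc (length vs)) = CARD('n)")
      case True
      have two: "det_list (a *\<^sub>R e # b *\<^sub>R e # us) = 0"
        if "length us = length vs" for a b e and us :: "(real^'n) list"
      proof -
        have "det_list (a *\<^sub>R e # b *\<^sub>R e # us) = a *\<^sub>R det_list (e # b *\<^sub>R e # us)"
          using linear_scale[OF alternating_linear_list[OF alternating_det_list, of "[]" "b *\<^sub>R e # us"]] True that
          by simp
        also have "det_list (e # b *\<^sub>R e # us) = b *\<^sub>R det_list (e # e # us)"
          using linear_scale[OF alternating_linear_list[OF alternating_det_list, of "[e]" us]] True that
          by simp
        also have "det_list (e # e # us) = 0"
          using alternating_formsD(3)[OF alternating_det_list, of "e # e # us" 0 1] True that by simp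
        finally show ?thesis by simp
      qed
      have 1: "det_list (map fst (w # v # vs)) = 0"
        using two[of "map fst vs" 0 0 0] vw by simp
      have 2: "det_list (map (\<lambda>x. \<chi> \<nu>. if \<nu> = \<mu> then P \<mu> (snd x) else fst x $ \<nu>) (w # v # vs)) = 0" for \<mu>
      proof -
        have "(\<chi> \<nu>. if \<nu> = \<mu> then P \<mu> (snd x) else fst x $ \<nu>) = P \<mu> (snd x) *\<^sub>R axis \<mu> 1"
          if "fst x = 0" for x :: "(real^'n) \<times> 'v"
          using that by (auto simp: vec_eq_iff axis_def)
        then show ?thesis using two vw by simp
      qed
      have "affine_form p P (w # v # vs) = 0"
        unfolding affine_form_def 1 2 by simp
      then show ?thesis by (simp add: interior_prod_def)
    next
      case False
      then show ?thesis
        using alternating_formsD(1)[OF alternating_affine_form[OF P], of "w # v # vs" p]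
        by (simp add: interior_prod_def)
    qed
  qed
qed

text \<open>On the graph of \<open>h\<close> the replaced column is the matrix of the arguments
  applied to the vector with entries \<open>P \<mu> (h (axis \<nu> 1))\<close>, so Cramer's rule
  extracts its entry \<open>\<mu>\<close>. The second factor is the affine function of the jet that
  the form represents.\<close>

lemma affine_form_jet:
  fixes P :: "'n::finite \<Rightarrow> 'v::real_vector \<Rightarrow> real"
  assumes P: "\<And>\<mu>. linear (P \<mu>)" and h: "linear h"
  shows "affine_form p P (map (\<lambda>u. (u, h u)) us) = det_list us * (p + (\<Sum>\<mu>\<in>UNIV. P \<mu> (h (axis \<mu> 1))))"
proof (cases "length us = CARD('n)")
  case True
  have "det_list (map (\<lambda>u. \<chi> \<nu>. if \<nu> = \<mu> then P \<mu> (h u) else u $ \<nu>) us) = P \<mu> (h (axis \<mu> 1)) * det_list us" for \<mu>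
  proof -
    have lin: "linear (\<lambda>u. P \<mu> (h u))"
      using linear_compose[OF h P] by (simp add: o_def)
    have expand: "P \<mu> (h u) = (\<Sum>j\<in>UNIV. u $ j * P \<mu> (h (axis j 1)))" for u
    proof -
      have "u = (\<Sum>j\<in>UNIV. u $ j *\<^sub>R axis j 1)"
        by (simp add: basis_expansion flip: scalar_mult_eq_scaleR)
      then have "P \<mu> (h u) = (\<Sum>j\<in>UNIV. u $ j *\<^sub>R P \<mu> (h (axis j 1)))"
        using linear_sum[OF lin] linear_scale[OF lin] by (metis (no_types, lifting) sum.cong)
      then show ?thesis by simp
    qed
    have "(\<chi> i. \<chi> \<nu>. if \<nu> = \<mu> then P \<mu> (h (us ! pos i)) else us ! pos i $ \<nu>) =
        (\<chi> i j. if j = \<mu> then ((\<chi> i. us ! pos i :: real^'n^'n) *v (\<chi> \<nu>. P \<mu> (h (axis \<nu> 1)))) $ i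
          else (\<chi> i. us ! pos i :: real^'n^'n) $ i $ j)"
      by (auto simp: vec_eq_iff matrix_vector_mult_def intro!: expand)
    then show ?thesis
      using cramer_lemma[of \<mu> "\<chi> i. us ! pos i" "\<chi> \<nu>. P \<mu> (h (axis \<nu> 1))"] True
      by (simp add: det_list_def)
  qed
  then show ?thesis
    by (simp add: affine_form_def o_def sum_distrib_left algebra_simps cong: if_cong)
next
  case False
  then show ?thesis by (simp add: affine_form_def det_list_def)
qed

lemma affine_form_vertical_basis:
  fixes P :: "'n::finite \<Rightarrow> 'v::real_vector \<Rightarrow> real"
  assumes P: "\<And>\<mu>. linear (P \<mu>)"
  shows "affine_form p P (map (\<lambda>\<nu>. if \<nu> = \<mu> then (0, w) else (axis \<nu> 1, 0)) indices) = P \<mu> w"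
proof -
  have row0: "det (\<chi> i. f i) = 0" if "f j = 0" for f :: "'n \<Rightarrow> real^'n" and j
    using that by (intro det_zero_row(1)[of j]) (simp add: row_def vec_eq_iff)
  let ?f = "\<lambda>\<nu>. if \<nu> = \<mu> then (0, w) else (axis \<nu> 1, 0) :: (real^'n) \<times> 'v"
  let ?r = "\<lambda>\<mu>' x. (\<chi> \<nu>. if \<nu> = \<mu>' then P \<mu>' (snd x) else fst x $ \<nu>) :: real^'n"
  have 1: "det_list (map fst (map ?f indices)) = 0"
    unfolding map_map det_list_map_indices by (rule row0[of _ \<mu>]) simp
  have 2: "det_list (map (?r \<mu>') (map ?f indices)) = (if \<mu>' = \<mu> then P \<mu> w else 0)" for \<mu>'
  proof (cases "\<mu>' = \<mu>")
    case True
    have "?r \<mu> (?f \<nu>) = (if \<nu> = \<mu> then P \<mu> w *\<^sub>R axis \<mu> 1 else axis \<nu> 1)" for \<nu>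
      using linear_0[OF P] by (auto simp: vec_eq_iff axis_def)
    then have e: "(\<chi> \<nu>. ?r \<mu> (?f \<nu>)) = (\<chi> \<nu>. if \<nu> = \<mu> then P \<mu> w *\<^sub>R axis \<mu> 1 else axis \<nu> 1)"
      by (simp only:)
    show ?thesis
      unfolding True map_map det_list_map_indices o_def e by (simp add: det_identity_row)
  next
    case False
    then have "?r \<mu>' (?f \<mu>') = 0"
      using linear_0[OF P] by (auto simp: vec_eq_iff axis_def)
    then show ?thesis
      using False unfolding map_map det_list_map_indices o_def by (simp only: row0[of _ \<mu>'] if_False)
  qed
  show ?thesis
    unfolding affine_form_def 1 2 by simp
qed

text \<open>The defining condition speaks of the first two arguments;
  \<open>alternating_move\<close> brings any two vertical arguments there.\<close>

lemma vertical_affine_two: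
  fixes z :: "((real^'n) \<times> 'v::real_vector) form" and f :: "'n \<Rightarrow> (real^'n) \<times> 'v"
  assumes z: "vertical_affine z" and ij: "i \<noteq> j" "fst (f i) = 0" "fst (f j) = 0"
  shows "z (map f indices) = 0"
proof -
  have alt: "z \<in> alternating_forms CARD('n)" using z by (simp add: vertical_affine_def)
  have two: "z (map f indices) = 0" if "pos i < pos j" "fst (f i) = 0" "fst (f j) = 0" for i j
  proof -
    let ?vs = "map f (indices :: 'n list)"
    define as bs cs where "as = take (pos i) ?vs" and "bs = drop (Suc (pos i)) (take (pos j) ?vs)"
      and "cs = drop (Suc (pos j)) ?vs"
    have l: "length as = pos i" "length bs = pos j - Suc (pos i)" "length cs = CARD('n) - Suc (pos j)"
      using that(1) pos(1)[of i] pos(1)[of j] by (auto simp: as_def bs_def cs_def)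
    have "?vs = take (pos j) ?vs @ f j # cs"
      using id_take_nth_drop[of "pos j" ?vs] by (simp add: cs_def)
    also have "take (pos j) ?vs = as @ f i # bs"
      using id_take_nth_drop[of "pos i" "take (pos j) ?vs"] that(1) pos(1)[of i] pos(1)[of j]
      by (simp add: as_def bs_def min_def)
    finally have vs: "?vs = as @ f i # bs @ f j # cs" by simp
    have k: "Suc (length as + length (bs @ f j # cs)) = CARD('n)"
      using l that(1) pos(1)[of j] by (simp del: pos(1))
    have "z (f i # as @ bs @ f j # cs) = (-1) ^ length as * z (as @ f i # bs @ f j # cs)"
      by (rule alternating_move[OF alt k])
    moreover have "z (f j # (f i # as @ bs) @ cs) = (-1) ^ length (f i # as @ bs) * z ((f i # as @ bs) @ f j # cs)"
      using k by (intro alternating_move[OF alt]) simp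
    moreover have "z (f j # (f i # as @ bs) @ cs) = 0"
      using z that(2,3) unfolding vertical_affine_def interior_prod_def
      by (metis append_Cons)
    ultimately show ?thesis unfolding vs by simp
  qed
  then show ?thesis
    using ij by (metis linorder_neqE_nat pos_eq_iff)
qed

text \<open>A multilinear expansion that stops after first order, as terms with two vertical
  arguments vanish. The indices with a vertical part are added to \<open>S\<close> one at a
  time.\<close>

lemma vertical_affine_expand:
  fixes z :: "((real^'n) \<times> 'v::real_vector) form" and A W :: "'n \<Rightarrow> (real^'n) \<times> 'v"
  assumes z: "vertical_affine z" and W: "\<And>i. fst (W i) = 0"
  shows "z (map (\<lambda>i. A i + W i) indices) = z (map A indices) + (\<Sum>i\<in>UNIV. z (map (A(i := W i)) indices))"
proof -
  have alt: "z \<in> alternating_forms CARD('n)" using z by (simp add: vertical_affine_def)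
  let ?A = "\<lambda>S i. if i \<in> S then A i + W i else A i"
  have one: "z (map ((?A S)(j := W j)) indices) = z (map (A(j := W j)) indices)" if "finite S" "j \<notin> S" for S j
    using that
  proof (induction S)
    case (insert a S)
    have "(?A (insert a S))(j := W j) = ((?A S)(j := W j))(a := A a + W a)"
      using insert by (auto simp: fun_eq_iff)
    then have "z (map ((?A (insert a S))(j := W j)) indices) =
        z (map (((?A S)(j := W j))(a := A a)) indices) + z (map (((?A S)(j := W j))(a := W a)) indices)"
      using alternating_add[OF alt, of "(?A S)(j := W j)" a "A a" "W a"] by (simp only:)
    also have "z (map (((?A S)(j := W j))(a := W a)) indices) = 0"
      using insert W by (intro vertical_affine_two[OF z, of a j]) auto
    also have "((?A S)(j := W j))(a := A a) = (?A S)(j := W j)"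
      using insert by (auto simp: fun_eq_iff)
    finally show ?case using insert by simp
  qed simp
  have "z (map (?A S) indices) = z (map A indices) + (\<Sum>i\<in>S. z (map (A(i := W i)) indices))" if "finite S" for S
    using that
  proof (induction S)
    case (insert a S)
    have "?A (insert a S) = (?A S)(a := A a + W a)" by (auto simp: fun_eq_iff)
    then have "z (map (?A (insert a S)) indices) =
        z (map ((?A S)(a := A a)) indices) + z (map ((?A S)(a := W a)) indices)"
      by (simp only: alternating_add[OF alt])
    also have "(?A S)(a := A a) = ?A S" using insert by (auto simp: fun_eq_iff)
    finally have "z (map (?A (insert a S)) indices) =
        (z (map A indices) + (\<Sum>i\<in>S. z (map (A(i := W i)) indices))) + z (map (A(a := W a)) indices)"
      by (simp only: insert.IH one[OF insert.hyps])
    then show ?case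
      using sum.insert[OF insert.hyps, of "\<lambda>i. z (map (A(i := W i)) indices)"] by linarith
  qed simp
  from this[of UNIV] show ?thesis by simp
qed

text \<open>Tilting the jet by \<open>w \<otimes> l\<close>, where the covector \<open>l\<close> kills all arguments but one, isolates a single
  vertical argument.\<close>

lemma vertical_affine_eq_0:
  fixes z :: "((real^'n) \<times> 'v::real_vector) form"
  assumes z: "vertical_affine z" and jets: "\<And>h us. linear h \<Longrightarrow> z (map (\<lambda>u. (u, h u)) us) = 0"
  shows "z vs = 0"
proof (cases "length vs = CARD('n)")
  case True
  have alt: "z \<in> alternating_forms CARD('n)" using z by (simp add: vertical_affine_def)
  have jets': "z (map (\<lambda>i. (u i, h (u i))) indices) = 0" if "linear h" for h :: "real^'n \<Rightarrow> 'v" and u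
    using jets[OF that, of "map u indices"] by (simp add: o_def)
  have zero: "linear (\<lambda>_::real^'n. 0::'v)" by (rule linear_zero)
  have single: "z (map ((\<lambda>i. (u i, 0))(j := (0, w))) indices) = 0"
    for u :: "'n \<Rightarrow> real^'n" and j w
  proof -
    have "card (u ` (UNIV - {j})) < CARD('n)"
      using le_less_trans[OF card_image_le[of "UNIV - {j}" u] card_Diff1_less[of UNIV j]] by simp
    then obtain l u' where l: "l \<bullet> u' = 1" "\<And>v. v \<in> u ` (UNIV - {j}) \<Longrightarrow> l \<bullet> v = 0"
      using exists_dual_vector[of "u ` (UNIV - {j})"] by auto
    \<comment> \<open>Slot \<open>j\<close> is occupied by the vertical vector in the goal, so
      \<open>u j\<close> is free to be replaced by a vector on which \<open>l\<close> takes the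
      value 1.\<close>
    define u'' where "u'' = u(j := u')"
    have lu: "l \<bullet> u'' i = (if i = j then 1 else 0)" for i
      using l by (auto simp: u''_def)
    let ?W = "\<lambda>i. (0, (l \<bullet> u'' i) *\<^sub>R w) :: (real^'n) \<times> 'v"
    have "linear (\<lambda>x. (l \<bullet> x) *\<^sub>R w)"
      by (intro linearI) (auto simp: inner_add_right scaleR_add_left)
    then have "0 = z (map (\<lambda>i. (u'' i, 0) + ?W i) indices)"
      using jets' by simp
    also have "\<dots> = z (map (\<lambda>i. (u'' i, 0)) indices) + (\<Sum>i\<in>UNIV. z (map ((\<lambda>i. (u'' i, 0))(i := ?W i)) indices))"
      by (rule vertical_affine_expand[OF z]) simp
    also have "z (map (\<lambda>i. (u'' i, 0)) indices) = 0" by (rule jets'[OF zero])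
    also have "(\<Sum>i\<in>UNIV. z (map ((\<lambda>i. (u'' i, 0))(i := ?W i)) indices)) =
        (\<Sum>i\<in>UNIV. if i = j then z (map ((\<lambda>i. (u'' i, 0))(j := (0, w))) indices) else 0)"
    proof (rule sum.cong[OF refl])
      fix i
      show "z (map ((\<lambda>i. (u'' i, 0))(i := ?W i)) indices) =
          (if i = j then z (map ((\<lambda>i. (u'' i, 0))(j := (0, w))) indices) else 0)"
      proof (cases "i = j")
        case False
        then have "z (map ((\<lambda>i. (u'' i, 0))(i := ?W i)) indices) = 0"
          by (intro alternating_zero_arg[OF alt, of _ i]) (simp add: lu zero_prod_def)
        then show ?thesis using False by simp
      qed (simp add: lu)
    qed
    also have "(\<lambda>i. (u'' i, 0::'v))(j := (0, w)) = (\<lambda>i. (u i, 0))(j := (0, w))"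
      by (auto simp: u''_def)
    finally show ?thesis by simp
  qed
  define f where "f i = vs ! pos i" for i :: 'n
  have "vs = map (\<lambda>i. (fst (f i), 0) + (0, snd (f i))) indices"
    using map_nth_pos[OF True] by (simp add: f_def)
  then have "z vs = z (map (\<lambda>i. (fst (f i), 0) + (0, snd (f i))) indices)" by (rule arg_cong)
  also have "\<dots> = z (map (\<lambda>i. (fst (f i), 0)) indices) +
      (\<Sum>i\<in>UNIV. z (map ((\<lambda>i. (fst (f i), 0))(i := (0, snd (f i)))) indices))"
    by (rule vertical_affine_expand[OF z]) simp
  finally show ?thesis using jets'[OF zero] single by simp
next
  case False
  then show ?thesis using z alternating_formsD(1) unfolding vertical_affine_def by blast
qed

text \<open>It suffices to test on jets; on a jet the form is fixed by its value on the axes, and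
  that expands into the values with at most one axis replaced by a vertical vector.\<close>

lemma vertical_affine_coords_0:
  fixes z :: "((real^'n) \<times> 'v::real_vector) form"
  assumes z: "vertical_affine z"
    and p: "z (map (\<lambda>\<nu>. (axis \<nu> 1, 0)) indices) = 0"
    and P: "\<And>\<mu> w. z (map (\<lambda>\<nu>. if \<nu> = \<mu> then (0, w) else (axis \<nu> 1, 0)) indices) = 0"
  shows "z vs = 0"
proof (rule vertical_affine_eq_0[OF z])
  fix h :: "real^'n \<Rightarrow> 'v" and us
  assume h: "linear h"
  have alt: "z \<in> alternating_forms CARD('n)" using z by (simp add: vertical_affine_def)
  have "linear (\<lambda>u. (u, h u))"
    by (intro linearI) (auto simp: linear_add[OF h] linear_scale[OF h])
  then have "z (map (\<lambda>u. (u, h u)) us) = det_list us * z (map (\<lambda>\<mu>. (axis \<mu> 1, h (axis \<mu> 1))) indices)"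
    by (rule alternating_top_form[OF alt])
  also have "z (map (\<lambda>\<mu>. (axis \<mu> 1, h (axis \<mu> 1))) indices) =
      z (map (\<lambda>\<mu>. (axis \<mu> 1, 0) + (0, h (axis \<mu> 1))) indices)"
    by simp
  also have "\<dots> = z (map (\<lambda>\<mu>. (axis \<mu> 1, 0)) indices) +
      (\<Sum>\<mu>\<in>UNIV. z (map ((\<lambda>\<mu>. (axis \<mu> 1, 0))(\<mu> := (0, h (axis \<mu> 1)))) indices))"
    by (rule vertical_affine_expand[OF z]) simp
  also have "\<dots> = 0"
    using p P by (simp add: fun_upd_def)
  finally show "z (map (\<lambda>u. (u, h u)) us) = 0" by simp
qed

lemma vertical_affine_diff:
  assumes "vertical_affine z" "vertical_affine z'"
  shows "vertical_affine (\<lambda>vs. z vs - z' vs)"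
  using assms alternating_forms_add[OF _ alternating_forms_cmult[of z' _ "-1"], of z]
  unfolding vertical_affine_def interior_prod_def by (auto simp: fun_eq_iff)

text \<open>Tilting the jet by a covector \<open>l\<close> that kills \<open>us\<close> and is 1 at
  an auxiliary \<open>u\<close> changes only the first argument, so the difference of two values
  from \<open>affine_form_jet\<close> isolates the vertical argument.\<close>

lemma affine_form_vertical_arg:
  fixes P :: "'n::finite \<Rightarrow> 'v::real_vector \<Rightarrow> real"
  assumes P: "\<And>\<mu>. linear (P \<mu>)" and h: "linear h"
  shows "affine_form p P ((0, w) # map (\<lambda>u. (u, h u)) us) = det_list ((\<chi> \<mu>. P \<mu> w) # us)"
proof (cases "Suc (length us) = CARD('n)")
  case True
  let ?z = "affine_form p P" and ?Q = "\<chi> \<mu>. P \<mu> w"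
  have alt: "?z \<in> alternating_forms CARD('n)" by (rule alternating_affine_form[OF P])
  have "card (set us) < CARD('n)" using card_length[of us] True by simp
  then obtain l u where l: "l \<bullet> u = 1" "\<And>v. v \<in> set us \<Longrightarrow> l \<bullet> v = 0"
    using exists_dual_vector[of "set us"] by auto
  let ?h = "\<lambda>x. h x + (l \<bullet> x) *\<^sub>R w"
  have h': "linear ?h"
    by (intro linearI) (auto simp: linear_add[OF h] linear_scale[OF h] inner_add_right algebra_simps)
  have "map (\<lambda>x. (x, ?h x)) (u # us) = ((u, h u) + (0, w)) # map (\<lambda>x. (x, h x)) us"
    using l by simp
  then have "?z (map (\<lambda>x. (x, ?h x)) (u # us)) = ?z (((u, h u) + (0, w)) # map (\<lambda>x. (x, h x)) us)"
    by (rule arg_cong)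
  also have "\<dots> = ?z (map (\<lambda>x. (x, h x)) (u # us)) + ?z ((0, w) # map (\<lambda>x. (x, h x)) us)"
    using linear_add[OF alternating_linear_list[OF alt, of "[]" "map (\<lambda>x. (x, h x)) us"], of "(u, h u)" "(0, w)"] True by simp
  finally have "?z ((0, w) # map (\<lambda>x. (x, h x)) us) =
      ?z (map (\<lambda>x. (x, ?h x)) (u # us)) - ?z (map (\<lambda>x. (x, h x)) (u # us))"
    by simp
  also have "\<dots> = det_list (u # us) * (\<Sum>\<mu>\<in>UNIV. P \<mu> (?h (axis \<mu> 1)) - P \<mu> (h (axis \<mu> 1)))"
    unfolding affine_form_jet[OF P h'] affine_form_jet[OF P h] by (simp add: sum_subtractf algebra_simps)
  also have "(\<Sum>\<mu>\<in>UNIV. P \<mu> (?h (axis \<mu> 1)) - P \<mu> (h (axis \<mu> 1))) = l \<bullet> ?Q"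
    by (simp add: linear_add[OF P] linear_scale[OF P] inner_axis) (simp add: inner_vec_def)
  finally have 1: "?z ((0, w) # map (\<lambda>x. (x, h x)) us) = (l \<bullet> ?Q) * det_list (u # us)"
    by simp
  have lin: "linear (\<lambda>v. det_list (v # us))"
    using alternating_linear_list[OF alternating_det_list, of "[]" us] True by simp
  \<comment> \<open>Without its part along \<open>u\<close>, the vector \<open>?Q\<close> lies with
    \<open>us\<close> in the hyperplane orthogonal to \<open>l\<close>; only
    \<open>l \<bullet> ?Q\<close> survives in the determinant.\<close>
  have "det_list (?Q # us) = det_list (((?Q - (l \<bullet> ?Q) *\<^sub>R u) + (l \<bullet> ?Q) *\<^sub>R u) # us)"
    by simp
  also have "\<dots> = det_list ((?Q - (l \<bullet> ?Q) *\<^sub>R u) # us) + (l \<bullet> ?Q) * det_list (u # us)"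
    by (simp only: linear_add[OF lin] linear_scale[OF lin] real_scaleR_def)
  also have "det_list ((?Q - (l \<bullet> ?Q) *\<^sub>R u) # us) = 0"
    using l by (intro det_list_hyperplane[of l]) (auto simp: inner_diff_right)
  finally show ?thesis using 1 by simp
next
  case False
  then show ?thesis by (simp add: affine_form_def det_list_def)
qed

section \<open>Maps in charts\<close>

lemma max_atlasD:
  assumes "C \<in> max_atlas M"
  shows "cdom C \<subseteq> points M" "inj_on (cmap C) (cdom C)" "open (cmap C ` cdom C)"
    "D \<in> M \<Longrightarrow> smooth_change C D" "D \<in> M \<Longrightarrow> smooth_change D C"
    "p \<in> cdom C \<Longrightarrow> cinv C (cmap C p) = p"
    "u \<in> cmap C ` cdom C \<Longrightarrow> cinv C u \<in> cdom C"
    "u \<in> cmap C ` cdom C \<Longrightarrow> cmap C (cinv C u) = u"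
  using assms unfolding max_atlas_def chart_of_def
  by (auto simp: inv_into_into f_inv_into_f)

lemma smooth_manifold_max_atlas: "smooth_manifold M \<Longrightarrow> C \<in> M \<Longrightarrow> C \<in> max_atlas M"
  unfolding smooth_manifold_def max_atlas_def by auto

lemma chart_at:
  assumes "p \<in> points M"
  shows "chart_at M p \<in> M" "p \<in> cdom (chart_at M p)"
proof -
  have "\<exists>C. C \<in> M \<and> p \<in> cdom C" using assms unfolding points_def by blast
  from someI_ex[OF this] show "chart_at M p \<in> M" "p \<in> cdom (chart_at M p)"
    unfolding chart_at_def by blast+
qed

text \<open>Ranges over the maximal atlases, unlike \<open>smooth_map\<close>, because adapted
  charts of \<open>Y\<close> need not belong to the atlas \<open>Y\<close>.\<close>

definition C2_map ::
    "('a, 'e::{real_vector,t2_space}) atlas \<Rightarrow> ('b, 'f::{real_vector,t2_space}) atlas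
      \<Rightarrow> ('a \<Rightarrow> 'b) \<Rightarrow> bool" where
  "C2_map M N f \<longleftrightarrow> f ` points M \<subseteq> points N \<and>
    (\<forall>C\<in>max_atlas M. \<forall>D\<in>max_atlas N.
      C2_on (cmap C ` (cdom C \<inter> f -` cdom D)) (\<lambda>u. cmap D (f (cinv C u))))"

lemma C2_mapD:
  assumes "C2_map M N f"
  shows "p \<in> points M \<Longrightarrow> f p \<in> points N"
    "C \<in> max_atlas M \<Longrightarrow> D \<in> max_atlas N \<Longrightarrow>
      C2_on (cmap C ` (cdom C \<inter> f -` cdom D)) (\<lambda>u. cmap D (f (cinv C u)))"
  using assms unfolding C2_map_def by auto

text \<open>Near a point the expression in arbitrary charts factors as a chart change, the map in
  charts of the given atlases, and another chart change; the C^2 chain rule and locality do the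
  rest.\<close>

lemma smooth_map_imp_C2_map:
  fixes M :: "('a, 'e::real_normed_vector) atlas" and N :: "('b, 'f::real_normed_vector) atlas"
  assumes M: "smooth_manifold M" and N: "smooth_manifold N" and f: "smooth_map M N f"
  shows "C2_map M N f"
  unfolding C2_map_def
proof (intro conjI ballI)
  show fp: "f ` points M \<subseteq> points N" using f unfolding smooth_map_def by simp
  fix C D assume C: "C \<in> max_atlas M" and D: "D \<in> max_atlas N"
  show "C2_on (cmap C ` (cdom C \<inter> f -` cdom D)) (\<lambda>u. cmap D (f (cinv C u)))"
  proof (rule C2_on_local)
    fix u assume "u \<in> cmap C ` (cdom C \<inter> f -` cdom D)"
    then obtain p where p: "p \<in> cdom C" "f p \<in> cdom D" "u = cmap C p" by auto
    have "p \<in> points M" using p max_atlasD(1)[OF C] by auto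
    then have C': "chart_at M p \<in> M" "p \<in> cdom (chart_at M p)" by (rule chart_at)+
    have "f p \<in> points N" using p max_atlasD(1)[OF D] by auto
    then have D': "chart_at N (f p) \<in> N" "f p \<in> cdom (chart_at N (f p))" by (rule chart_at)+
    let ?C = "chart_at M p" and ?D = "chart_at N (f p)"
    have Cm: "?C \<in> max_atlas M" and Dm: "?D \<in> max_atlas N"
      using smooth_manifold_max_atlas[OF M C'(1)] smooth_manifold_max_atlas[OF N D'(1)] by blast+
    define U1 where "U1 = cmap C ` (cdom C \<inter> cdom ?C)"
    define U2 where "U2 = cmap ?C ` (cdom ?C \<inter> f -` cdom ?D)"
    define U3 where "U3 = cmap ?D ` (cdom ?D \<inter> cdom D)"
    define h1 where "h1 = (\<lambda>u. cmap ?C (cinv C u))"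
    define h2 where "h2 = (\<lambda>u. cmap ?D (f (cinv ?C u)))"
    define h3 where "h3 = (\<lambda>u. cmap D (cinv ?D u))"
    have s1: "C2_on U1 h1"
      using max_atlasD(4)[OF C C'(1)] unfolding smooth_change_def U1_def h1_def o_def by (rule smooth_on_C2_on)
    have "smooth_on U2 h2"
      using f C'(1) D'(1) unfolding smooth_map_def U2_def h2_def o_def by auto
    then have s2: "C2_on U2 h2" by (rule smooth_on_C2_on)
    have s3: "C2_on U3 h3"
      using max_atlasD(5)[OF D D'(1)] unfolding smooth_change_def U3_def h3_def o_def by (rule smooth_on_C2_on)
    define V1 where "V1 = {u \<in> U1. h1 u \<in> U2}"
    define V where "V = {u \<in> V1. h2 (h1 u) \<in> U3}"
    have oV1: "open V1"
      using continuous_open_preimage[OF C2_onD(4,3)[OF s1] C2_onD(3)[OF s2]]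
      by (simp add: V1_def Int_def vimage_def)
    have c1: "C2_on V1 h1" by (rule C2_on_subset[OF s1 oV1]) (auto simp: V1_def)
    have c2: "C2_on V1 (\<lambda>u. h2 (h1 u))" by (rule C2_on_compose[OF c1 s2]) (auto simp: V1_def)
    have oV: "open V"
      using continuous_open_preimage[OF C2_onD(4,3)[OF c2] C2_onD(3)[OF s3]]
      by (simp add: V_def Int_def vimage_def)
    have c3: "C2_on V (\<lambda>u. h2 (h1 u))" by (rule C2_on_subset[OF c2 oV]) (auto simp: V_def)
    have c4: "C2_on V (\<lambda>u. h3 (h2 (h1 u)))" by (rule C2_on_compose[OF c3 s3]) (auto simp: V_def)
    \<comment> \<open>Membership in the chart images provides points that are a priori unrelated;
      injectivity of the charts identifies them with \<open>q\<close> and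
      \<open>f q\<close>.\<close>
    have pt: "u \<in> cmap C ` (cdom C \<inter> f -` cdom D)" "cmap D (f (cinv C u)) = h3 (h2 (h1 u))" if "u \<in> V" for u
    proof -
      from that have "u \<in> U1" "h1 u \<in> U2" "h2 (h1 u) \<in> U3" by (auto simp: V_def V1_def)
      then obtain q where q: "q \<in> cdom C" "q \<in> cdom ?C" "u = cmap C q" unfolding U1_def by auto
      have h1: "h1 u = cmap ?C q" unfolding h1_def q(3) max_atlasD(6)[OF C q(1)] ..
      then obtain q' where q': "q' \<in> cdom ?C" "f q' \<in> cdom ?D" "h1 u = cmap ?C q'"
        using \<open>h1 u \<in> U2\<close> unfolding U2_def by auto
      have "q' = q" using q' h1 q max_atlasD(2)[OF Cm] by (auto dest: inj_onD)
      have h2: "h2 (h1 u) = cmap ?D (f q)" unfolding h1 h2_def max_atlasD(6)[OF Cm q(2)] ..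
      then obtain r where r: "r \<in> cdom ?D" "r \<in> cdom D" "h2 (h1 u) = cmap ?D r"
        using \<open>h2 (h1 u) \<in> U3\<close> unfolding U3_def by auto
      have "r = f q" using r h2 q' \<open>q' = q\<close> max_atlasD(2)[OF Dm] by (auto dest: inj_onD)
      have "f q \<in> cdom ?D" using q' \<open>q' = q\<close> by simp
      have "h3 (h2 (h1 u)) = cmap D (f q)" unfolding h2 h3_def max_atlasD(6)[OF Dm \<open>f q \<in> cdom ?D\<close>] ..
      moreover have "cinv C u = q" unfolding q(3) by (rule max_atlasD(6)[OF C q(1)])
      ultimately show "cmap D (f (cinv C u)) = h3 (h2 (h1 u))" by simp
      show "u \<in> cmap C ` (cdom C \<inter> f -` cdom D)"
        unfolding q(3) using q(1) r(2) \<open>r = f q\<close> by (intro imageI) simp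
    qed
    show "\<exists>V. u \<in> V \<and> V \<subseteq> cmap C ` (cdom C \<inter> f -` cdom D) \<and> C2_on V (\<lambda>u. cmap D (f (cinv C u)))"
    proof (intro exI[of _ V] conjI)
      have "h1 u = cmap ?C p" "h2 (h1 u) = cmap ?D (f p)"
        unfolding p h1_def h2_def max_atlasD(6)[OF C p(1)] max_atlasD(6)[OF Cm C'(2)] by auto
      then show "u \<in> V"
        unfolding V_def V1_def U1_def U2_def U3_def using p C'(2) D'(2) by auto
      show "V \<subseteq> cmap C ` (cdom C \<inter> f -` cdom D)" using pt(1) by blast
      show "C2_on V (\<lambda>u. cmap D (f (cinv C u)))"
        by (rule C2_on_cong[OF c4]) (rule pt(2))
    qed
  qed
qed

lemma C2_map_id:
  fixes M :: "('a, 'e::real_normed_vector) atlas"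
  assumes M: "smooth_manifold M"
  shows "C2_map M M (\<lambda>p. p)"
proof (rule smooth_map_imp_C2_map[OF M M])
  show "smooth_map M M (\<lambda>p. p)"
    using M unfolding smooth_map_def smooth_manifold_def smooth_change_def
    by (auto simp: o_def vimage_def Int_def)
qed

text \<open>With an identity for \<open>f\<close> or \<open>g\<close> this is also the rule for
  changing charts, on which the independence of the chosen \<open>chart_at\<close> rests.\<close>

lemma dir_deriv_chart_compose:
  fixes M :: "('a, 'e::real_normed_vector) atlas" and N :: "('b, 'f::real_normed_vector) atlas"
    and P :: "('c, 'g::real_normed_vector) atlas"
  assumes f: "C2_map M N f" and g: "C2_map N P g"
    and C: "C \<in> max_atlas M" "p \<in> cdom C" and D: "D \<in> max_atlas N" "f p \<in> cdom D"
    and E: "E \<in> max_atlas P" "g (f p) \<in> cdom E"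
  shows "dir_deriv (\<lambda>u. cmap E (g (f (cinv C u)))) (cmap C p) v =
    dir_deriv (\<lambda>u. cmap E (g (cinv D u))) (cmap D (f p)) (dir_deriv (\<lambda>u. cmap D (f (cinv C u))) (cmap C p) v)"
proof -
  note cf = C2_mapD(2)[OF f C(1) D(1)] and cg = C2_mapD(2)[OF g D(1) E(1)]
  let ?h = "\<lambda>u. cmap D (f (cinv C u))" and ?k = "\<lambda>u. cmap E (g (cinv D u))"
  let ?U = "cmap C ` (cdom C \<inter> f -` cdom D)"
  have in_U: "cmap C p \<in> ?U" using C D by auto
  have h: "?h (cmap C p) = cmap D (f p)" using max_atlasD(6)[OF C] by simp
  have h1: "has_dir_deriv (\<lambda>u. ?k (?h u)) (dir_deriv ?k (?h (cmap C p)) (dir_deriv ?h (cmap C p) v)) (cmap C p) v"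
    using D E
    by (intro has_dir_deriv_compose[OF C1_onD(3)[OF C2_onD(1)[OF cf] in_U] C2_onD(1)[OF cg]]) (auto simp: h)
  have ev: "\<forall>\<^sub>F u in nhds (cmap C p). ?k (?h u) = cmap E (g (f (cinv C u)))"
    using eventually_nhds_in_open[OF C2_onD(3)[OF cf] in_U]
  proof eventually_elim
    case (elim u)
    then show ?case using max_atlasD(6)[OF C(1)] max_atlasD(6)[OF D(1)] by auto
  qed
  from iffD1[OF has_dir_deriv_cong[OF ev] h1] show ?thesis by (simp add: dir_deriv_eqI h)
qed

lemma linear_dir_deriv_chart:
  fixes M :: "('a, 'e::real_normed_vector) atlas" and N :: "('b, 'f::real_normed_vector) atlas"
  assumes f: "C2_map M N f" and C: "C \<in> max_atlas M" "p \<in> cdom C" and D: "D \<in> max_atlas N" "f p \<in> cdom D"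
  shows "linear (dir_deriv (\<lambda>u. cmap D (f (cinv C u))) (cmap C p))"
  using C D by (intro linear_dir_deriv[OF C2_onD(1)[OF C2_mapD(2)[OF f C(1) D(1)]]]) auto

lemma dir_deriv_chart_id:
  fixes M :: "('a, 'e::real_normed_vector) atlas"
  assumes C: "C \<in> max_atlas M" "p \<in> cdom C"
  shows "dir_deriv (\<lambda>u. cmap C (cinv C u)) (cmap C p) v = v"
proof -
  have "\<forall>\<^sub>F u in nhds (cmap C p). cmap C (cinv C u) = u"
    using eventually_nhds_in_open[OF max_atlasD(3)[OF C(1)] imageI[OF C(2)]]
    by eventually_elim (rule max_atlasD(8)[OF C(1)])
  then have "dir_deriv (\<lambda>u. cmap C (cinv C u)) (cmap C p) v = dir_deriv (\<lambda>u. u) (cmap C p) v"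
    by (rule dir_deriv_cong)
  also have "\<dots> = v"
    by (rule dir_deriv_eqI[OF has_dir_deriv_linear[OF linear_ident]])
  finally show ?thesis .
qed

section \<open>Components of tangent vectors\<close>

locale manifold =
  fixes M :: "('a, 'e::real_normed_vector) atlas"
  assumes M: "smooth_manifold M"
begin

lemmas in_max = smooth_manifold_max_atlas[OF M]

lemma chart_at_max: "p \<in> points M \<Longrightarrow> chart_at M p \<in> max_atlas M"
  by (rule in_max[OF chart_at(1)])

lemma coord_comp_vec:
  assumes C: "C \<in> max_atlas M" "p \<in> cdom C"
  shows "coord_comp M C p (coord_vec M C p v) = v" "coord_vec M C p (coord_comp M C p v) = v"
    "linear (coord_comp M C p)" "linear (coord_vec M C p)"
proof -
  have p: "p \<in> points M" using max_atlasD(1)[OF C(1)] C(2) by auto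
  note D = chart_at_max[OF p] chart_at(2)[OF p]
  note id = C2_map_id[OF M]
  show "coord_comp M C p (coord_vec M C p v) = v"
    unfolding coord_comp_def coord_vec_def o_def
    by (simp only: dir_deriv_chart_compose[OF id id C D C, symmetric] dir_deriv_chart_id[OF C])
  show "coord_vec M C p (coord_comp M C p v) = v"
    unfolding coord_comp_def coord_vec_def o_def
    by (simp only: dir_deriv_chart_compose[OF id id D C D, symmetric] dir_deriv_chart_id[OF D])
  show "linear (coord_comp M C p)" "linear (coord_vec M C p)"
    unfolding coord_comp_def coord_vec_def o_def
    using linear_dir_deriv_chart[OF id D C] linear_dir_deriv_chart[OF id C D] by simp_all
qed

lemma coord_comp_eq_iff:
  assumes C: "C \<in> max_atlas M" "p \<in> cdom C"
  shows "coord_comp M C p v = coord_comp M C p w \<longleftrightarrow> v = w"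
proof
  assume "coord_comp M C p v = coord_comp M C p w"
  then have "coord_vec M C p (coord_comp M C p v) = coord_vec M C p (coord_comp M C p w)" by simp
  then show "v = w" by (simp only: coord_comp_vec(2)[OF C])
qed simp

lemma coord_comp_coord_vec:
  assumes C: "C \<in> max_atlas M" "p \<in> cdom C" and D: "D \<in> max_atlas M" "p \<in> cdom D"
  shows "coord_comp M D p (coord_vec M C p v) = dir_deriv (\<lambda>u. cmap D (cinv C u)) (cmap C p) v"
proof -
  have p: "p \<in> points M" using max_atlasD(1)[OF C(1)] C(2) by auto
  note E = chart_at_max[OF p] chart_at(2)[OF p]
  note id = C2_map_id[OF M]
  show ?thesis
    unfolding coord_comp_def coord_vec_def o_def
    by (simp only: dir_deriv_chart_compose[OF id id C E D, symmetric])
qed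

end

section \<open>Functoriality of tangent maps\<close>

lemma tangent_map_chart:
  fixes M :: "('a, 'e::real_normed_vector) atlas" and N :: "('b, 'f::real_normed_vector) atlas"
  assumes M: "smooth_manifold M" and N: "smooth_manifold N" and f: "C2_map M N f"
    and C: "C \<in> max_atlas M" "p \<in> cdom C" and D: "D \<in> max_atlas N" "f p \<in> cdom D"
  shows "coord_comp N D (f p) (tangent_map M N f p v) =
    dir_deriv (\<lambda>u. cmap D (f (cinv C u))) (cmap C p) (coord_comp M C p v)"
proof -
  have p: "p \<in> points M" using max_atlasD(1)[OF C(1)] C(2) by auto
  have fp: "f p \<in> points N" using max_atlasD(1)[OF D(1)] D(2) by auto
  interpret M: manifold M using M by unfold_locales
  interpret N: manifold N using N by unfold_locales
  note C' = M.chart_at_max[OF p] chart_at(2)[OF p] and D' = N.chart_at_max[OF fp] chart_at(2)[OF fp]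
  show ?thesis
    unfolding coord_comp_def tangent_map_def o_def
    by (simp only: dir_deriv_chart_compose[OF f C2_map_id[OF N] C' D' D, symmetric]
      dir_deriv_chart_compose[OF C2_map_id[OF M] f C' C D, symmetric])
qed

lemma tangent_map_compose:
  fixes M :: "('a, 'e::real_normed_vector) atlas" and N :: "('b, 'f::real_normed_vector) atlas"
    and P :: "('c, 'g::real_normed_vector) atlas"
  assumes M: "smooth_manifold M" and N: "smooth_manifold N" and P: "smooth_manifold P"
    and f: "C2_map M N f" and g: "C2_map N P g" and p: "p \<in> points M"
  shows "tangent_map M P (\<lambda>p. g (f p)) p v = tangent_map N P g (f p) (tangent_map M N f p v)"
proof -
  have fp: "f p \<in> points N" and gfp: "g (f p) \<in> points P"
    using C2_mapD(1)[OF f p] C2_mapD(1)[OF g] by auto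
  interpret M: manifold M using M by unfold_locales
  interpret N: manifold N using N by unfold_locales
  interpret P: manifold P using P by unfold_locales
  note C = M.chart_at_max[OF p] chart_at(2)[OF p] and D = N.chart_at_max[OF fp] chart_at(2)[OF fp]
    and E = P.chart_at_max[OF gfp] chart_at(2)[OF gfp]
  show ?thesis
    unfolding tangent_map_def o_def
    by (simp only: dir_deriv_chart_compose[OF f g C D E, symmetric])
qed

lemma linear_tangent_map:
  fixes M :: "('a, 'e::real_normed_vector) atlas" and N :: "('b, 'f::real_normed_vector) atlas"
  assumes M: "smooth_manifold M" and N: "smooth_manifold N" and f: "C2_map M N f" and p: "p \<in> points M"
  shows "linear (tangent_map M N f p)"
proof -
  have fp: "f p \<in> points N" using C2_mapD(1)[OF f p] .
  interpret M: manifold M using M by unfold_locales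
  interpret N: manifold N using N by unfold_locales
  show ?thesis
    unfolding tangent_map_def o_def
    using linear_dir_deriv_chart[OF f M.chart_at_max[OF p] chart_at(2)[OF p] N.chart_at_max[OF fp] chart_at(2)[OF fp]]
    by simp
qed

text \<open>Meant for inverses: \<open>inv_into\<close> and the flow at the opposite time are known
  to agree on the points of the manifold only.\<close>

lemma tangent_map_cong:
  fixes M :: "('a, 'e::real_normed_vector) atlas"
  assumes M: "smooth_manifold M" and p: "p \<in> points M" and eq: "\<And>q. q \<in> points M \<Longrightarrow> f q = g q"
  shows "tangent_map M N f p = tangent_map M N g p"
proof (rule ext)
  fix v
  interpret M: manifold M using M by unfold_locales
  let ?C = "chart_at M p"
  note C = M.chart_at_max[OF p] chart_at(2)[OF p]
  have "\<forall>\<^sub>F u in nhds (cmap ?C p). f (cinv ?C u) = g (cinv ?C u)"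
    using eventually_nhds_in_open[OF max_atlasD(3)[OF C(1)] imageI[OF C(2)]]
    by eventually_elim (rule eq[OF max_atlasD(1)[OF C(1), THEN subsetD, OF max_atlasD(7)[OF C(1)]]])
  then show "tangent_map M N f p v = tangent_map M N g p v"
    unfolding tangent_map_def o_def eq[OF p]
    by (intro dir_deriv_cong, eventually_elim) simp
qed

lemma tangent_map_id:
  fixes M :: "('a, 'e::real_normed_vector) atlas"
  assumes M: "smooth_manifold M" and p: "p \<in> points M"
  shows "tangent_map M M (\<lambda>p. p) p v = v"
proof -
  interpret M: manifold M using M by unfold_locales
  show ?thesis
    unfolding tangent_map_def o_def
    by (rule dir_deriv_chart_id[OF M.chart_at_max[OF p] chart_at(2)[OF p]])
qed

section \<open>Adapted charts\<close>

lemma smooth_on_cong: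
  fixes f :: "'a::locally_convex_space \<Rightarrow> 'b::locally_convex_space"
  assumes f: "smooth_on U f" and eq: "\<And>x. x \<in> U \<Longrightarrow> g x = f x"
  shows "smooth_on U g"
proof -
  have o: "open U" using f unfolding smooth_on_def by blast
  have it: "iter_deriv g vs x = iter_deriv f vs x" if "x \<in> U" for vs x
    using that
  proof (induction vs arbitrary: x)
    case (Cons v vs)
    have "\<forall>\<^sub>F y in nhds x. iter_deriv g vs y = iter_deriv f vs y"
      using eventually_nhds_in_open[OF o Cons.prems] by eventually_elim (rule Cons.IH)
    then show ?case by (simp add: dir_deriv_cong)
  qed (simp add: eq)
  have "\<exists>l. has_dir_deriv (iter_deriv g vs) l x v" if x: "x \<in> U" for x vs v
  proof -
    have "\<forall>\<^sub>F y in nhds x. iter_deriv g vs y = iter_deriv f vs y"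
      using eventually_nhds_in_open[OF o x] by eventually_elim (rule it)
    from has_dir_deriv_cong[OF this] show ?thesis
      using f x unfolding smooth_on_def has_dir_deriv_def by simp
  qed
  moreover have "continuous_on (U \<times> UNIV) (\<lambda>(x, v :: nat \<Rightarrow> 'a). iter_deriv g (map v [0..<k]) x)" for k
  proof -
    have "continuous_on (U \<times> UNIV) (\<lambda>(x, v :: nat \<Rightarrow> 'a). iter_deriv f (map v [0..<k]) x)"
      using f unfolding smooth_on_def by blast
    then show ?thesis
      by (rule iffD2[OF continuous_on_cong[OF refl], rotated]) (auto simp: it)
  qed
  ultimately show ?thesis using o unfolding smooth_on_def has_dir_deriv_def by blast
qed

lemma points_open_submanifold: "points (open_submanifold S M) = points M \<inter> S"
  unfolding points_def open_submanifold_def by auto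

lemma points_prod_atlas: "points (prod_atlas M N) = points M \<times> points N"
  unfolding points_def prod_atlas_def by force

text \<open>A local trivialisation followed by a product chart of \<open>B\<close> and a fibre chart
  has \<open>B\<close> of the projection as first component. The work lies in its compatibility with
  \<open>Y\<close>, since the trivialisation is smooth in terms of the restricted atlases.\<close>

lemma adapted_exists:
  fixes X :: "('x, 'e::real_normed_vector) atlas" and Y :: "('y, 'e \<times> 'v::real_normed_vector) atlas"
    and F :: "('f, 'v) atlas"
  assumes X: "smooth_manifold X" and Y: "smooth_manifold Y" and F: "smooth_manifold F"
    and fb: "fiber_bundle Y X F \<pi>" and y0: "y0 \<in> points Y" and B: "B \<in> X" "\<pi> y0 \<in> cdom B"
  shows "\<exists>C. adapted X Y \<pi> B C \<and> y0 \<in> cdom C"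
proof -
  have Bm: "B \<in> max_atlas X" by (rule smooth_manifold_max_atlas[OF X B(1)])
  have "\<pi> y0 \<in> points X" using max_atlasD(1)[OF Bm] B(2) by blast
  then obtain U \<psi> where U: "\<pi> y0 \<in> U"
    and diff: "diffeomorphism (open_submanifold (\<pi> -` U) Y) (prod_atlas (open_submanifold U X) F) \<psi>"
    and \<psi>: "\<And>y. y \<in> points Y \<Longrightarrow> \<pi> y \<in> U \<Longrightarrow> fst (\<psi> y) = \<pi> y"
    using fb unfolding fiber_bundle_def by blast
  let ?YU = "points Y \<inter> \<pi> -` U"
  let ?inv = "inv_into ?YU \<psi>"
  have bij: "bij_betw \<psi> ?YU ((points X \<inter> U) \<times> points F)"
    and sm: "smooth_map (open_submanifold (\<pi> -` U) Y) (prod_atlas (open_submanifold U X) F) \<psi>"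
    and smi: "smooth_map (prod_atlas (open_submanifold U X) F) (open_submanifold (\<pi> -` U) Y) ?inv"
    using diff unfolding diffeomorphism_def points_open_submanifold points_prod_atlas by blast+
  have inj: "inj_on \<psi> ?YU" using bij by (rule bij_betw_imp_inj_on)
  have inv: "?inv (\<psi> y) = y" if "y \<in> ?YU" for y
    by (rule inv_into_f_f[OF inj that])
  have inv': "\<psi> (?inv q) = q" "?inv q \<in> ?YU" if "q \<in> (points X \<inter> U) \<times> points F" for q
  proof -
    have "q \<in> \<psi> ` ?YU" using bij that unfolding bij_betw_def by simp
    then show "\<psi> (?inv q) = q" "?inv q \<in> ?YU" by (rule f_inv_into_f, rule inv_into_into)
  qed
  have "\<psi> y0 \<in> (points X \<inter> U) \<times> points F"
    using bij y0 U by (auto dest: bij_betwE)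
  then have "snd (\<psi> y0) \<in> points F" by auto
  then obtain D where D: "D \<in> F" "snd (\<psi> y0) \<in> cdom D" unfolding points_def by blast
  have Dm: "D \<in> max_atlas F" by (rule smooth_manifold_max_atlas[OF F D(1)])
  define P :: "('x \<times> 'f, 'e \<times> 'v) chart" where
    "P = ((cdom B \<inter> U) \<times> cdom D, \<lambda>(a, b). (cmap B a, cmap D b))"
  have P: "P \<in> prod_atlas (open_submanifold U X) F"
    unfolding prod_atlas_def open_submanifold_def P_def
    using B(1) D(1) by (intro image_eqI[where x = "((cdom B \<inter> U, cmap B), D)"]) auto
  have Pdom: "cdom P \<subseteq> (points X \<inter> U) \<times> points F"
    using max_atlasD(1)[OF Bm] max_atlasD(1)[OF Dm] by (auto simp: P_def)
  have Pinj: "inj_on (cmap P) (cdom P)"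
    using max_atlasD(2)[OF Bm] max_atlasD(2)[OF Dm] by (auto simp: P_def inj_on_def)
  define C :: "('y, 'e \<times> 'v) chart" where
    "C = ({y \<in> ?YU. \<psi> y \<in> cdom P}, \<lambda>y. cmap P (\<psi> y))"
  have Cdom: "y \<in> cdom C \<longleftrightarrow> y \<in> ?YU \<and> \<psi> y \<in> cdom P" for y by (simp add: C_def)
  have Cmap: "cmap C y = cmap P (\<psi> y)" for y by (simp add: C_def)
  have Cinj: "inj_on (cmap C) (cdom C)"
  proof (rule inj_onI)
    fix y y' assume "y \<in> cdom C" "y' \<in> cdom C" "cmap C y = cmap C y'"
    then have "\<psi> y = \<psi> y'" "y \<in> ?YU" "y' \<in> ?YU"
      unfolding Cdom Cmap using inj_onD[OF Pinj] by blast+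
    then show "y = y'" using inj_onD[OF inj] by blast
  qed
  have s1: "smooth_change E C" and s2: "smooth_change C E" if E: "E \<in> Y" for E
  proof -
    have Em: "E \<in> max_atlas Y" by (rule smooth_manifold_max_atlas[OF Y E])
    \<comment> \<open>Restricting the domain of a chart changes \<open>cinv\<close> as a function;
      the two inverses agree only on the image of the smaller domain.\<close>
    define E' where "E' = (cdom E \<inter> \<pi> -` U, cmap E)"
    have E': "E' \<in> open_submanifold (\<pi> -` U) Y"
      unfolding open_submanifold_def E'_def using E by (rule imageI)
    have E'inv: "cinv E' (cmap E y) = y" if "y \<in> cdom E \<inter> \<pi> -` U" for y
      using inv_into_f_f[OF inj_on_subset[OF max_atlasD(2)[OF Em]], of "cdom E \<inter> \<pi> -` U" y] that
      by (simp add: E'_def)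
    have set1: "cdom E' \<inter> \<psi> -` cdom P = cdom E \<inter> cdom C"
      using max_atlasD(1)[OF Em] by (auto simp: E'_def Cdom)
    have "smooth_on (cmap E' ` (cdom E' \<inter> \<psi> -` cdom P)) (cmap P \<circ> \<psi> \<circ> cinv E')"
      using sm E' P unfolding smooth_map_def by blast
    then have "smooth_on (cmap E ` (cdom E \<inter> cdom C)) (cmap P \<circ> \<psi> \<circ> cinv E')"
      unfolding set1 by (simp add: E'_def)
    then show "smooth_change E C"
      unfolding smooth_change_def
    proof (rule smooth_on_cong)
      fix u assume "u \<in> cmap E ` (cdom E \<inter> cdom C)"
      then obtain y where y: "y \<in> cdom E" "y \<in> cdom C" "u = cmap E y" by blast
      have "y \<in> cdom E \<inter> \<pi> -` U" using y Cdom by blast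
      then show "(cmap C \<circ> cinv E) u = (cmap P \<circ> \<psi> \<circ> cinv E') u"
        by (simp add: y(3) max_atlasD(6)[OF Em y(1)] E'inv Cmap)
    qed
    have set2: "\<psi> ` (cdom C \<inter> cdom E) = cdom P \<inter> ?inv -` cdom E'"
    proof (intro equalityI subsetI)
      fix q assume "q \<in> \<psi> ` (cdom C \<inter> cdom E)"
      then obtain y where y: "y \<in> cdom C" "y \<in> cdom E" "q = \<psi> y" by blast
      then show "q \<in> cdom P \<inter> ?inv -` cdom E'" using Cdom inv by (auto simp: E'_def)
    next
      fix q assume q: "q \<in> cdom P \<inter> ?inv -` cdom E'"
      then have "q \<in> (points X \<inter> U) \<times> points F" using Pdom by blast
      note i = inv'[OF this]
      have "?inv q \<in> cdom C \<inter> cdom E" using i q Cdom by (auto simp: E'_def)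
      then show "q \<in> \<psi> ` (cdom C \<inter> cdom E)" using i(1) by (metis imageI)
    qed
    have img: "cmap C ` S = cmap P ` (\<psi> ` S)" for S by (auto simp: Cmap)
    have "smooth_on (cmap P ` (cdom P \<inter> ?inv -` cdom E')) (cmap E' \<circ> ?inv \<circ> cinv P)"
      using smi E' P unfolding smooth_map_def by blast
    then have "smooth_on (cmap C ` (cdom C \<inter> cdom E)) (cmap E' \<circ> ?inv \<circ> cinv P)"
      unfolding img set2 .
    then show "smooth_change C E"
      unfolding smooth_change_def
    proof (rule smooth_on_cong)
      fix u assume "u \<in> cmap C ` (cdom C \<inter> cdom E)"
      then obtain y where y: "y \<in> cdom E" "y \<in> cdom C" "u = cmap C y" by blast
      have "cinv P (cmap P (\<psi> y)) = \<psi> y" using y Cdom by (intro inv_into_f_f[OF Pinj]) blast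
      moreover have "cinv C (cmap C y) = y" by (rule inv_into_f_f[OF Cinj y(2)])
      moreover have "?inv (\<psi> y) = y" using y Cdom by (intro inv) blast
      ultimately show "(cmap E \<circ> cinv C) u = (cmap E' \<circ> ?inv \<circ> cinv P) u"
        by (simp add: y(3) Cmap[symmetric]) (simp add: Cmap E'_def)
    qed
  qed
  \<comment> \<open>The image of \<open>C\<close> is the union of its overlaps with charts of
    \<open>Y\<close>, and each overlap image is open because \<open>smooth_on\<close> includes
    openness.\<close>
  have "open (\<Union>E\<in>Y. cmap C ` (cdom C \<inter> cdom E))"
    using s2 unfolding smooth_change_def smooth_on_def by (intro open_UN) blast
  moreover have "(\<Union>E\<in>Y. cmap C ` (cdom C \<inter> cdom E)) = cmap C ` cdom C"
    using Cdom unfolding points_def by blast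
  ultimately have "open (cmap C ` cdom C)" by simp
  then have "chart_of (points Y) C"
    using Cinj Cdom unfolding chart_of_def by blast
  then have "C \<in> max_atlas Y"
    using s1 s2 unfolding max_atlas_def by blast
  moreover have "y0 \<in> cdom C"
    unfolding Cdom using y0 U B(2) D(2) \<psi>[OF y0 U] by (auto simp: P_def mem_Times_iff)
  moreover have "\<pi> ` cdom C \<subseteq> cdom B" "\<forall>y\<in>cdom C. fst (cmap C y) = cmap B (\<pi> y)"
  proof -
    have *: "fst (\<psi> y) = \<pi> y \<and> \<psi> y \<in> cdom P" if "y \<in> cdom C" for y
      using that \<psi> Cdom by blast
    show "\<pi> ` cdom C \<subseteq> cdom B"
      using * by (force simp: P_def mem_Times_iff)
    show "\<forall>y\<in>cdom C. fst (cmap C y) = cmap B (\<pi> y)"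
      using * by (auto simp: Cmap P_def case_prod_beta)
  qed
  ultimately show ?thesis using Bm unfolding adapted_def by blast
qed

lemma alternating_forms_map_linear:
  assumes \<omega>: "\<omega> \<in> alternating_forms k" and L: "linear L"
  shows "(\<lambda>vs. \<omega> (map L vs)) \<in> alternating_forms k"
proof (rule alternating_formsI)
  show "linear (\<lambda>v. \<omega> (map L (vs[i := v])))" if "length vs = k" "i < k" for vs i
    using linear_compose[OF L alternating_formsD(2)[OF \<omega>, of "map L vs" i]] that
    by (simp add: o_def map_update)
  show "\<omega> (map L vs) = 0" if "length vs \<noteq> k" for vs
    using alternating_formsD(1)[OF \<omega>, of "map L vs"] that by simp
  show "\<omega> (map L vs) = 0" if "length vs = k" "i < j" "j < k" "vs ! i = vs ! j" for vs i j
    using alternating_formsD(3)[OF \<omega>, of "map L vs" i j] that by simp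
qed

text \<open>Local triviality is kept in the form \<open>ex_adapted\<close>, where the base chart can
  be prescribed; \<open>fin\<close> is kept for the operator norms in
  \<open>dual_chart\<close>.\<close>

locale bundle_setting =
  fixes X :: "('x, real^'n) atlas" and Y :: "('y, (real^'n) \<times> 'v::real_normed_vector) atlas"
    and \<pi> :: "'y \<Rightarrow> 'x"
  assumes X: "smooth_manifold X" and Y: "smooth_manifold Y" and proj: "C2_map Y X \<pi>"
    and fin: "\<exists>D :: 'v set. finite D \<and> span D = UNIV"
    and ex_adapted: "\<And>y B. y \<in> points Y \<Longrightarrow> B \<in> X \<Longrightarrow> \<pi> y \<in> cdom B \<Longrightarrow> \<exists>C. adapted X Y \<pi> B C \<and> y \<in> cdom C"
begin

sublocale X: manifold X using X by unfold_locales
sublocale Y: manifold Y using Y by unfold_locales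

lemma adaptedD:
  assumes "adapted X Y \<pi> B C"
  shows "B \<in> max_atlas X" "C \<in> max_atlas Y" "y \<in> cdom C \<Longrightarrow> \<pi> y \<in> cdom B"
    "y \<in> cdom C \<Longrightarrow> fst (cmap C y) = cmap B (\<pi> y)"
  using assms unfolding adapted_def by auto

lemma fst_coord_comp:
  assumes a: "adapted X Y \<pi> B C" and y: "y \<in> cdom C"
  shows "fst (coord_comp Y C y v) = coord_comp X B (\<pi> y) (tangent_map Y X \<pi> y v)"
proof -
  note C = adaptedD(2)[OF a]
  have "coord_comp X B (\<pi> y) (tangent_map Y X \<pi> y v) =
      dir_deriv (\<lambda>u. cmap B (\<pi> (cinv C u))) (cmap C y) (coord_comp Y C y v)"
    by (rule tangent_map_chart[OF Y X proj C y adaptedD(1)[OF a] adaptedD(3)[OF a y]])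
  also have "\<dots> = dir_deriv fst (cmap C y) (coord_comp Y C y v)"
  proof (rule dir_deriv_cong)
    show "\<forall>\<^sub>F u in nhds (cmap C y). cmap B (\<pi> (cinv C u)) = fst u"
      using eventually_nhds_in_open[OF max_atlasD(3)[OF C] imageI[OF y]]
    proof eventually_elim
      case (elim u)
      show ?case
        using adaptedD(4)[OF a max_atlasD(7)[OF C elim]] max_atlasD(8)[OF C elim] by simp
    qed
  qed
  also have "\<dots> = fst (coord_comp Y C y v)"
    by (rule dir_deriv_eqI[OF has_dir_deriv_linear[OF linear_fst]])
  finally show ?thesis by simp
qed

lemma jet_fiber_iff:
  assumes a: "adapted X Y \<pi> B C" and y: "y \<in> cdom C"
  shows "\<gamma> \<in> jet_fiber X Y \<pi> y \<longleftrightarrow>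
    linear \<gamma> \<and> (\<forall>u. fst (coord_comp Y C y (\<gamma> u)) = coord_comp X B (\<pi> y) u)"
  unfolding jet_fiber_def mem_Collect_eq fst_coord_comp[OF a y]
    X.coord_comp_eq_iff[OF adaptedD(1)[OF a] adaptedD(3)[OF a y]] ..

section \<open>Coordinates on the jet bundle\<close>

definition jet_of where
  "jet_of B C y v u = coord_vec Y C y (coord_comp X B (\<pi> y) u, \<Sum>\<mu>\<in>UNIV. (coord_comp X B (\<pi> y) u $ \<mu>) *\<^sub>R (v $ \<mu>))"

lemma coord_comp_jet_of:
  assumes a: "adapted X Y \<pi> B C" and y: "y \<in> cdom C"
  shows "coord_comp Y C y (jet_of B C y v u) =
    (coord_comp X B (\<pi> y) u, \<Sum>\<mu>\<in>UNIV. (coord_comp X B (\<pi> y) u $ \<mu>) *\<^sub>R (v $ \<mu>))"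
  unfolding jet_of_def by (rule Y.coord_comp_vec(1)[OF adaptedD(2)[OF a] y])

lemma jet_of_in_fiber:
  assumes a: "adapted X Y \<pi> B C" and y: "y \<in> cdom C"
  shows "jet_of B C y v \<in> jet_fiber X Y \<pi> y"
proof -
  note lX = X.coord_comp_vec(3)[OF adaptedD(1)[OF a] adaptedD(3)[OF a y]]
    and lY = Y.coord_comp_vec(4)[OF adaptedD(2)[OF a] y]
  let ?k = "\<lambda>w::real^'n. (w, \<Sum>\<mu>\<in>UNIV. (w $ \<mu>) *\<^sub>R (v $ \<mu>))"
  have "linear ?k"
    by (intro linearI) (auto simp: scaleR_add_left sum.distrib scaleR_sum_right)
  from linear_compose[OF linear_compose[OF lX this] lY]
  have "linear (jet_of B C y v)"
    by (simp add: jet_of_def[abs_def] o_def)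
  then show ?thesis
    unfolding jet_fiber_iff[OF a y] by (simp add: coord_comp_jet_of[OF a y])
qed

abbreviation jchart where "jchart B C \<equiv> jet_chart X Y \<pi> B C"

lemma cmap_jchart:
  "cmap (jchart B C) (y, \<gamma>) = (cmap C y, \<chi> \<mu>. snd (coord_comp Y C y (\<gamma> (coord_vec X B (\<pi> y) (axis \<mu> 1)))))"
  by (simp add: jet_chart_def)

lemma jet_coords:
  assumes a: "adapted X Y \<pi> B C" and y: "y \<in> cdom C" and \<gamma>: "\<gamma> \<in> jet_fiber X Y \<pi> y"
  shows "\<gamma> = jet_of B C y (snd (cmap (jchart B C) (y, \<gamma>)))"
proof (rule ext)
  fix u
  note BX = adaptedD(1)[OF a] adaptedD(3)[OF a y] and CY = adaptedD(2)[OF a] y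
  let ?w = "coord_comp X B (\<pi> y) u"
  let ?L = "\<lambda>w. snd (coord_comp Y C y (\<gamma> (coord_vec X B (\<pi> y) w)))"
  have "linear \<gamma>" using \<gamma> unfolding jet_fiber_def by blast
  from linear_compose[OF linear_compose[OF linear_compose[OF X.coord_comp_vec(4)[OF BX] this] Y.coord_comp_vec(3)[OF CY]] linear_snd]
  have L: "linear ?L" by (simp add: o_def)
  have "?L ?w = (\<Sum>\<mu>\<in>UNIV. (?w $ \<mu>) *\<^sub>R ?L (axis \<mu> 1))"
  proof -
    have "?w = (\<Sum>\<mu>\<in>UNIV. (?w $ \<mu>) *\<^sub>R axis \<mu> 1)"
      by (simp add: basis_expansion flip: scalar_mult_eq_scaleR)
    then have "?L ?w = ?L (\<Sum>\<mu>\<in>UNIV. (?w $ \<mu>) *\<^sub>R axis \<mu> 1)" by (rule arg_cong)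
    also have "\<dots> = (\<Sum>\<mu>\<in>UNIV. (?w $ \<mu>) *\<^sub>R ?L (axis \<mu> 1))"
      unfolding linear_sum[OF L] linear_scale[OF L] ..
    finally show ?thesis .
  qed
  then have "coord_comp Y C y (\<gamma> u) = coord_comp Y C y (jet_of B C y (snd (cmap (jchart B C) (y, \<gamma>))) u)"
    using \<gamma> unfolding jet_fiber_iff[OF a y]
    by (simp add: coord_comp_jet_of[OF a y] cmap_jchart prod_eq_iff X.coord_comp_vec(2)[OF BX])
  then show "\<gamma> u = jet_of B C y (snd (cmap (jchart B C) (y, \<gamma>))) u"
    by (simp only: Y.coord_comp_eq_iff[OF CY])
qed

lemma cmap_jchart_jet_of:
  assumes a: "adapted X Y \<pi> B C" and y: "y \<in> cdom C"
  shows "cmap (jchart B C) (y, jet_of B C y v) = (cmap C y, v)"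
proof -
  have "(\<Sum>\<kappa>\<in>UNIV. (axis \<mu> 1 $ \<kappa>) *\<^sub>R (v $ \<kappa>)) = v $ \<mu>" for \<mu>
    by (simp add: axis_def if_distrib[of "\<lambda>c. c *\<^sub>R _"] cong: if_cong)
  then show ?thesis
    by (simp add: cmap_jchart coord_comp_jet_of[OF a y] vec_eq_iff
        X.coord_comp_vec(1)[OF adaptedD(1)[OF a] adaptedD(3)[OF a y]])
qed

lemma jchart_dom:
  assumes "adapted X Y \<pi> B C"
  shows "(y, \<gamma>) \<in> cdom (jchart B C) \<longleftrightarrow> y \<in> cdom C \<and> \<gamma> \<in> jet_fiber X Y \<pi> y"
  using max_atlasD(1)[OF adaptedD(2)[OF assms]] by (auto simp: jet_chart_def jet_space_def)

lemma jchart_image: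
  assumes a: "adapted X Y \<pi> B C"
  shows "cmap (jchart B C) ` cdom (jchart B C) = (cmap C ` cdom C) \<times> UNIV"
proof (intro equalityI subsetI)
  fix q assume "q \<in> cmap (jchart B C) ` cdom (jchart B C)"
  then obtain y \<gamma> where "(y, \<gamma>) \<in> cdom (jchart B C)" "q = cmap (jchart B C) (y, \<gamma>)" by force
  then show "q \<in> (cmap C ` cdom C) \<times> UNIV" by (simp add: jchart_dom[OF a] cmap_jchart)
next
  fix q :: "((real^'n) \<times> 'v) \<times> ('v^'n)"
  assume "q \<in> (cmap C ` cdom C) \<times> UNIV"
  then obtain y where y: "y \<in> cdom C" "q = (cmap C y, snd q)" by (auto simp: prod_eq_iff)
  then have "q = cmap (jchart B C) (y, jet_of B C y (snd q))"
    by (simp add: cmap_jchart_jet_of[OF a])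
  moreover have "(y, jet_of B C y (snd q)) \<in> cdom (jchart B C)"
    by (simp add: jchart_dom[OF a] y(1) jet_of_in_fiber[OF a])
  ultimately show "q \<in> cmap (jchart B C) ` cdom (jchart B C)" by (rule image_eqI)
qed

lemma jchart_inj:
  assumes a: "adapted X Y \<pi> B C"
  shows "inj_on (cmap (jchart B C)) (cdom (jchart B C))"
proof (rule inj_onI)
  fix p q assume p: "p \<in> cdom (jchart B C)" and q: "q \<in> cdom (jchart B C)"
    and eq: "cmap (jchart B C) p = cmap (jchart B C) q"
  obtain y \<gamma> where p': "p = (y, \<gamma>)" by (cases p)
  obtain y' \<gamma>' where q': "q = (y', \<gamma>')" by (cases q)
  have d: "y \<in> cdom C" "\<gamma> \<in> jet_fiber X Y \<pi> y" "y' \<in> cdom C" "\<gamma>' \<in> jet_fiber X Y \<pi> y'"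
    using p q unfolding p' q' jchart_dom[OF a] by auto
  have "cmap C y = cmap C y'" using eq unfolding p' q' cmap_jchart by simp
  then have "y = y'" using inj_onD[OF max_atlasD(2)[OF adaptedD(2)[OF a]]] d by blast
  moreover have "\<gamma> = \<gamma>'"
    using jet_coords[OF a d(1,2)] jet_coords[OF a d(3,4)] eq \<open>y = y'\<close> unfolding p' q' by simp
  ultimately show "p = q" unfolding p' q' by simp
qed

lemma cinv_jchart:
  assumes a: "adapted X Y \<pi> B C" and y: "y \<in> cdom C"
  shows "cinv (jchart B C) (cmap C y, v) = (y, jet_of B C y v)"
  unfolding cmap_jchart_jet_of[OF a y, symmetric]
  by (rule inv_into_f_f[OF jchart_inj[OF a]]) (simp add: jchart_dom[OF a] y jet_of_in_fiber[OF a])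

section \<open>Coordinates on the dual jet bundle\<close>

lemma vertical_iff:
  assumes a: "adapted X Y \<pi> B C" and y: "y \<in> cdom C"
  shows "tangent_map Y X \<pi> y v = 0 \<longleftrightarrow> fst (coord_comp Y C y v) = 0"
proof -
  note BX = adaptedD(1)[OF a] adaptedD(3)[OF a y]
  show ?thesis
    unfolding fst_coord_comp[OF a y]
    using X.coord_comp_eq_iff[OF BX, of _ 0] linear_0[OF X.coord_comp_vec(3)[OF BX]] by simp
qed

lemma map_coord:
  assumes "C \<in> max_atlas Y" "y \<in> cdom C"
  shows "map (coord_comp Y C y) (map (coord_vec Y C y) vs) = vs"
    "map (coord_vec Y C y) (map (coord_comp Y C y) vs) = vs"
  by (auto simp: Y.coord_comp_vec[OF assms] intro: map_idI)

lemma dual_fiber_iff: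
  assumes a: "adapted X Y \<pi> B C" and y: "y \<in> cdom C"
  shows "z \<in> dual_fiber X Y \<pi> y \<longleftrightarrow> z \<in> alternating_forms CARD('n) \<and>
    (\<forall>v w us. fst (coord_comp Y C y v) = 0 \<longrightarrow> fst (coord_comp Y C y w) = 0 \<longrightarrow> z (w # v # us) = 0)"
  unfolding dual_fiber_def mem_Collect_eq vertical_iff[OF a y] interior_prod_def fun_eq_iff by blast

lemma vertical_affine_iff:
  fixes z :: "((real^'n) \<times> 'v) form"
  shows "vertical_affine z \<longleftrightarrow> z \<in> alternating_forms CARD('n) \<and>
    (\<forall>v w us. fst v = 0 \<longrightarrow> fst w = 0 \<longrightarrow> z (w # v # us) = 0)"
  unfolding vertical_affine_def interior_prod_def fun_eq_iff by blast

lemma dual_fiberI: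
  assumes a: "adapted X Y \<pi> B C" and y: "y \<in> cdom C" and \<zeta>: "vertical_affine \<zeta>"
  shows "(\<lambda>vs. \<zeta> (map (coord_comp Y C y) vs)) \<in> dual_fiber X Y \<pi> y"
  unfolding dual_fiber_iff[OF a y]
proof (intro conjI allI impI)
  show "(\<lambda>vs. \<zeta> (map (coord_comp Y C y) vs)) \<in> alternating_forms CARD('n)"
    using \<zeta> unfolding vertical_affine_iff
    by (blast intro: alternating_forms_map_linear[OF _ Y.coord_comp_vec(3)[OF adaptedD(2)[OF a] y]])
  show "\<zeta> (map (coord_comp Y C y) (w # v # us)) = 0"
    if "fst (coord_comp Y C y v) = 0" "fst (coord_comp Y C y w) = 0" for v w us
    using \<zeta> that unfolding vertical_affine_iff list.map by blast
qed

lemma dual_fiberD: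
  assumes a: "adapted X Y \<pi> B C" and y: "y \<in> cdom C" and z: "z \<in> dual_fiber X Y \<pi> y"
  shows "vertical_affine (\<lambda>vs. z (map (coord_vec Y C y) vs))"
  unfolding vertical_affine_iff
proof (intro conjI allI impI)
  show "(\<lambda>vs. z (map (coord_vec Y C y) vs)) \<in> alternating_forms CARD('n)"
    using z unfolding dual_fiber_iff[OF a y]
    by (blast intro: alternating_forms_map_linear[OF _ Y.coord_comp_vec(4)[OF adaptedD(2)[OF a] y]])
  fix v w :: "(real^'n) \<times> 'v" and us
  assume "fst v = 0" "fst w = 0"
  then have "fst (coord_comp Y C y (coord_vec Y C y v)) = 0" "fst (coord_comp Y C y (coord_vec Y C y w)) = 0"
    by (simp_all only: Y.coord_comp_vec(1)[OF adaptedD(2)[OF a] y])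
  then show "z (map (coord_vec Y C y) (w # v # us)) = 0"
    using z unfolding dual_fiber_iff[OF a y] list.map by blast
qed

lemma det_list_basis: "det_list (map (\<lambda>\<mu>. axis \<mu> 1) (indices :: 'n list)) = 1"
proof -
  have "(\<chi> \<mu>. axis \<mu> 1) = (mat 1 :: real^'n^'n)"
    by (simp add: vec_eq_iff axis_def mat_def)
  then show ?thesis by (simp add: det_list_map_indices)
qed

lemma affine_form_basis:
  fixes P :: "'n \<Rightarrow> 'v \<Rightarrow> real"
  assumes P: "\<And>\<mu>. linear (P \<mu>)"
  shows "affine_form p P (map (\<lambda>\<nu>. (axis \<nu> 1, 0)) indices) = p"
proof -
  have "P \<mu> 0 = 0" for \<mu> using linear_0[OF P[of \<mu>]] .
  then show ?thesis
    using affine_form_jet[where P = P and h = "\<lambda>_. 0" and p = p and us = "map (\<lambda>\<mu>. axis \<mu> 1) indices"]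
      P linear_zero det_list_basis
    by (simp add: o_def)
qed

text \<open>The coefficients are read off on the axes; the difference to the resulting
  \<open>affine_form\<close> has vanishing coordinates and is 0 by
  \<open>vertical_affine_coords_0\<close>.\<close>

lemma dual_fiber_affine_form:
  assumes a: "adapted X Y \<pi> B C" and y: "y \<in> cdom C" and z: "z \<in> dual_fiber X Y \<pi> y"
  obtains p P where "\<And>\<mu>. linear (P \<mu>)" "z = (\<lambda>vs. affine_form p P (map (coord_comp Y C y) vs))"
proof -
  define \<zeta> where "\<zeta> vs = z (map (coord_vec Y C y) vs)" for vs
  have \<zeta>: "vertical_affine \<zeta>" unfolding \<zeta>_def[abs_def] by (rule dual_fiberD[OF a y z])
  define p where "p = \<zeta> (map (\<lambda>\<nu>. (axis \<nu> 1, 0)) indices)"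
  define P where "P \<mu> w = \<zeta> (map (\<lambda>\<nu>. if \<nu> = \<mu> then (0, w) else (axis \<nu> 1, 0)) indices)" for \<mu> w
  have P: "linear (P \<mu>)" for \<mu>
  proof -
    have alt: "\<zeta> \<in> alternating_forms CARD('n)" using \<zeta> unfolding vertical_affine_def by blast
    have "linear (\<lambda>w::'v. (0::real^'n, w))" by (intro linearI) auto
    from linear_compose[OF this alternating_linear[OF alt, of "\<lambda>\<nu>. (axis \<nu> 1, 0)" \<mu>]]
    show ?thesis unfolding P_def[abs_def] by (simp add: o_def fun_upd_def)
  qed
  have "vertical_affine (\<lambda>vs. \<zeta> vs - affine_form p P vs)"
    by (rule vertical_affine_diff[OF \<zeta> vertical_affine_form[OF P]])
  then have "\<zeta> vs - affine_form p P vs = 0" for vs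
    by (rule vertical_affine_coords_0)
      (simp_all only: affine_form_basis[OF P] affine_form_vertical_basis[OF P] p_def P_def diff_self)
  then have "z = (\<lambda>vs. affine_form p P (map (coord_comp Y C y) vs))"
    unfolding \<zeta>_def fun_eq_iff
    using map_coord(2)[OF adaptedD(2)[OF a] y] by (metis eq_iff_diff_eq_0)
  with P that show ?thesis by blast
qed

abbreviation dchart where "dchart C \<equiv> dual_chart X Y \<pi> C"

text \<open>\<open>cinv\<close> is meaningful only on the chart image, so an element of
  \<open>Z\<close> with coordinates \<open>(c, q)\<close> is constructed first. Every preimage then
  lies over the point of \<open>C\<close> with coordinates \<open>c\<close>.\<close>

lemma fst_cinv_dchart:
  assumes a: "adapted X Y \<pi> B C" and c: "c \<in> cmap C ` cdom C"
  shows "fst (cinv (dchart C) (c, q)) = cinv C c"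
proof -
  obtain p P where q: "q = (p, P)" by (cases q)
  note C = adaptedD(2)[OF a]
  define y where "y = cinv C c"
  have y: "y \<in> cdom C" "cmap C y = c" using max_atlasD(7,8)[OF C c] by (auto simp: y_def)
  let ?P = "\<lambda>\<mu>. blinfun_apply (P $ \<mu>)"
  have P: "linear (?P \<mu>)" for \<mu> by (simp add: bounded_linear.linear blinfun.bounded_linear_right)
  define z where "z vs = affine_form p ?P (map (coord_comp Y C y) vs)" for vs
  have z: "z \<in> dual_fiber X Y \<pi> y"
    unfolding z_def[abs_def] by (rule dual_fiberI[OF a y(1) vertical_affine_form[OF P]])
  have zc: "z (map (\<lambda>\<nu>. coord_vec Y C y (f \<nu>)) indices) = affine_form p ?P (map f indices)" for f :: "'n \<Rightarrow> _"
    by (simp add: z_def o_def Y.coord_comp_vec[OF C y(1)])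
  have dom: "(y, z) \<in> cdom (dchart C)"
    using y(1) z max_atlasD(1)[OF C] by (auto simp: dual_chart_def dual_space_def)
  have "cmap (dchart C) (y, z) = (c, q)"
    by (simp add: dual_chart_def zc y(2) q affine_form_basis[OF P] affine_form_vertical_basis[OF P]
        blinfun_apply_inverse vec_eq_iff)
  then have im: "(c, q) \<in> cmap (dchart C) ` cdom (dchart C)" using dom by (metis imageI)
  let ?d = "cinv (dchart C) (c, q)"
  have d: "?d \<in> cdom (dchart C)" "cmap (dchart C) ?d = (c, q)"
    using inv_into_into[OF im] f_inv_into_f[OF im] by auto
  then have "fst ?d \<in> cdom C" "cmap C (fst ?d) = c"
    by (auto simp: dual_chart_def case_prod_beta)
  then show ?thesis using max_atlasD(6)[OF C] by metis
qed

lemma top_form_coords: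
  assumes B: "B \<in> max_atlas X" "x \<in> cdom B" and \<omega>: "\<omega> \<in> alternating_forms CARD('n)"
  shows "\<omega> us = det_list (map (coord_comp X B x) us) * \<omega> (map (\<lambda>\<mu>. coord_vec X B x (axis \<mu> 1)) indices)"
proof -
  have "map (coord_vec X B x) (map (coord_comp X B x) us) = us"
    by (simp add: X.coord_comp_vec[OF B] o_def)
  then show ?thesis
    using alternating_top_form[OF \<omega> X.coord_comp_vec(4)[OF B], of "map (coord_comp X B x) us"] by simp
qed

end

section \<open>The Legendre transformation in coordinates\<close>

lemma linear_axis: "linear (axis \<mu> :: 'v::real_vector \<Rightarrow> 'v^'n)"
  by (intro linearI) (auto simp: axis_def vec_eq_iff)

lemma sum_axis: "(\<Sum>\<mu>\<in>UNIV. axis \<mu> (v $ \<mu>)) = (v :: 'v::real_vector^'n)"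
  by (simp add: vec_eq_iff axis_def if_distrib cong: if_cong)

definition jet_lin :: "'v::real_vector^'n \<Rightarrow> real^'n \<Rightarrow> 'v" where
  "jet_lin v w = (\<Sum>\<mu>\<in>UNIV. (w $ \<mu>) *\<^sub>R (v $ \<mu>))"

lemma linear_jet_lin: "linear (jet_lin v)"
  unfolding jet_lin_def by (intro linearI) (auto simp: scaleR_add_left sum.distrib scaleR_sum_right)

lemma jet_lin_axis [simp]: "jet_lin v (axis \<mu> 1) = v $ \<mu>"
  by (simp add: jet_lin_def axis_def if_distrib[of "\<lambda>c. c *\<^sub>R _"] cong: if_cong)

lemma jet_lin_linear:
  assumes "linear h"
  shows "jet_lin (\<chi> \<mu>. h (axis \<mu> 1)) w = h w"
proof -
  have "w = (\<Sum>\<mu>\<in>UNIV. (w $ \<mu>) *\<^sub>R axis \<mu> 1)"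
    by (simp add: basis_expansion flip: scalar_mult_eq_scaleR)
  then have "h w = h (\<Sum>\<mu>\<in>UNIV. (w $ \<mu>) *\<^sub>R axis \<mu> 1)" by (rule arg_cong)
  then show ?thesis
    unfolding linear_sum[OF assms] linear_scale[OF assms] by (simp add: jet_lin_def)
qed

locale lagrangian = bundle_setting X Y \<pi>
  for X :: "('x, real^'n) atlas" and Y :: "('y, (real^'n) \<times> 'v::real_normed_vector) atlas"
    and \<pi> :: "'y \<Rightarrow> 'x" +
  fixes \<L> :: "('x, 'y, real^'n, (real^'n) \<times> 'v) density"
  assumes lagr: "lagrangian_density X Y \<pi> \<L>"
begin

abbreviation lcoord where "lcoord B C \<equiv> lagrangian_coord X Y \<pi> \<L> B C"

lemma lagrangian_value:
  assumes "y \<in> points Y" "\<gamma> \<in> jet_fiber X Y \<pi> y"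
  shows "fst (\<L> (y, \<gamma>)) = \<pi> y" "snd (\<L> (y, \<gamma>)) \<in> alternating_forms CARD('n)"
proof -
  have j: "(y, \<gamma>) \<in> jet_space X Y \<pi>" using assms by (simp add: jet_space_def)
  then show "fst (\<L> (y, \<gamma>)) = \<pi> y"
    using lagr unfolding lagrangian_density_def by blast
  have "\<pi> y \<in> points X" using C2_mapD(1)[OF proj assms(1)] .
  then obtain B where B: "B \<in> X" "\<pi> y \<in> cdom B" unfolding points_def by blast
  then obtain C where C: "adapted X Y \<pi> B C" "y \<in> cdom C" using ex_adapted assms(1) by blast
  then have "(y, \<gamma>) \<in> cdom (jchart B C)" using assms(2) by (simp add: jchart_dom)
  moreover have "jchart B C \<in> jet_atlas X Y \<pi>" using C(1) unfolding jet_atlas_def by blast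
  ultimately have "(y, \<gamma>) \<in> points (jet_atlas X Y \<pi>)" unfolding points_def by blast
  then have "\<L> (y, \<gamma>) \<in> points (top_form_atlas X)"
    using lagr unfolding lagrangian_density_def smooth_map_def by blast
  then show "snd (\<L> (y, \<gamma>)) \<in> alternating_forms CARD('n)"
    unfolding points_def top_form_atlas_def by (auto simp: top_form_chart_def)
qed

text \<open>\<open>B\<close> has to belong to the atlas \<open>X\<close> itself, because the charts
  of \<open>top_form_atlas\<close> come from there; \<open>C\<close> may be any chart adapted to
  it.\<close>

lemma lcoord_C2:
  assumes a: "adapted X Y \<pi> B C" and B: "B \<in> X"
  shows "C2_on ((cmap C ` cdom C) \<times> UNIV) (lcoord B C)"
proof -
  let ?J = "jchart B C" and ?T = "top_form_chart X B"
  have "?J \<in> jet_atlas X Y \<pi>" using a unfolding jet_atlas_def by blast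
  moreover have "?T \<in> top_form_atlas X" using B unfolding top_form_atlas_def by blast
  ultimately have "smooth_on (cmap ?J ` (cdom ?J \<inter> \<L> -` cdom ?T)) (cmap ?T \<circ> \<L> \<circ> cinv ?J)"
    using lagr unfolding lagrangian_density_def smooth_map_def by blast
  moreover have "cdom ?J \<inter> \<L> -` cdom ?T = cdom ?J"
  proof -
    have "\<L> (y, \<gamma>) \<in> cdom ?T" if "(y, \<gamma>) \<in> cdom ?J" for y \<gamma>
    proof -
      have y: "y \<in> cdom C" "\<gamma> \<in> jet_fiber X Y \<pi> y" using that by (auto simp: jchart_dom[OF a])
      have "y \<in> points Y" using max_atlasD(1)[OF adaptedD(2)[OF a]] y(1) by blast
      from lagrangian_value[OF this y(2)] adaptedD(3)[OF a y(1)] show ?thesis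
        by (simp add: top_form_chart_def case_prod_beta mem_Times_iff)
    qed
    then show ?thesis by auto
  qed
  ultimately have "smooth_on ((cmap C ` cdom C) \<times> UNIV) (\<lambda>q. cmap ?T (\<L> (cinv ?J q)))"
    by (simp add: jchart_image[OF a] o_def)
  from C2_on_compose[OF smooth_on_C2_on[OF this] C2_on_linear[OF linear_snd _ open_UNIV]]
  have "C2_on ((cmap C ` cdom C) \<times> UNIV) (\<lambda>q. snd (cmap ?T (\<L> (cinv ?J q))))"
    by (simp add: continuous_on_snd continuous_on_id)
  then show ?thesis unfolding lagrangian_coord_def[abs_def] .
qed

lemma lagrangian_coords:
  assumes a: "adapted X Y \<pi> B C" and y: "y \<in> cdom C" and \<gamma>: "\<gamma> \<in> jet_fiber X Y \<pi> y"
  shows "snd (\<L> (y, \<gamma>)) us = det_list (map (coord_comp X B (\<pi> y)) us) * lcoord B C (cmap (jchart B C) (y, \<gamma>))"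
proof -
  have yp: "y \<in> points Y" using max_atlasD(1)[OF adaptedD(2)[OF a]] y by blast
  note L = lagrangian_value[OF yp \<gamma>]
  have "(y, \<gamma>) \<in> cdom (jchart B C)" using y \<gamma> by (simp add: jchart_dom[OF a])
  then have "cinv (jchart B C) (cmap (jchart B C) (y, \<gamma>)) = (y, \<gamma>)"
    by (rule inv_into_f_f[OF jchart_inj[OF a]])
  then have "lcoord B C (cmap (jchart B C) (y, \<gamma>)) =
      snd (\<L> (y, \<gamma>)) (map (\<lambda>\<mu>. coord_vec X B (\<pi> y) (axis \<mu> 1)) indices)"
    by (simp add: lagrangian_coord_def top_form_chart_def case_prod_beta L(1))
  then show ?thesis
    using top_form_coords[OF adaptedD(1)[OF a] adaptedD(3)[OF a y] L(2), of us] by simp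
qed

text \<open>The momenta \<open>p\<^sub>A\<^sup>\<mu> = \<partial>L/\<partial>v\<^sup>A\<^sub>\<mu>\<close> and \<open>p = L - p\<^sub>A\<^sup>\<mu> v\<^sup>A\<^sub>\<mu>\<close> at the jet with coordinates \<open>q\<close>.\<close>

definition momentum where
  "momentum B C q \<mu> w = dir_deriv (lcoord B C) q (0, axis \<mu> w)"

definition energy where
  "energy B C q = lcoord B C q - dir_deriv (lcoord B C) q (0, snd q)"

lemma linear_momentum:
  assumes a: "adapted X Y \<pi> B C" and B: "B \<in> X" and q: "fst q \<in> cmap C ` cdom C"
  shows "linear (dir_deriv (lcoord B C) q)" "linear (momentum B C q \<mu>)"
proof -
  have "q \<in> (cmap C ` cdom C) \<times> UNIV" using q by (simp add: mem_Times_iff)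
  then show 1: "linear (dir_deriv (lcoord B C) q)"
    by (rule linear_dir_deriv[OF C2_onD(1)[OF lcoord_C2[OF a B]]])
  have "linear (\<lambda>w::'v. (0 :: (real^'n) \<times> 'v, axis \<mu> w :: 'v^'n))"
    by (intro linearI) (auto simp: linear_add[OF linear_axis] linear_scale[OF linear_axis])
  from linear_compose[OF this 1] show "linear (momentum B C q \<mu>)"
    unfolding momentum_def[abs_def] by (simp add: o_def)
qed

text \<open>The affine function with these coefficients is the first-order Taylor polynomial of the
  Lagrangian in the velocities at \<open>q\<close>, as the definition of the Legendre transformation
  asks.\<close>

lemma energy_plus_momentum:
  assumes a: "adapted X Y \<pi> B C" and B: "B \<in> X" and q: "fst q \<in> cmap C ` cdom C"
  shows "energy B C q + (\<Sum>\<mu>\<in>UNIV. momentum B C q \<mu> (v $ \<mu>)) =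
    lcoord B C q + dir_deriv (lcoord B C) q (0, v - snd q)"
proof -
  note D = linear_momentum(1)[OF a B q]
  have "(\<Sum>\<mu>\<in>UNIV. momentum B C q \<mu> (v $ \<mu>)) = dir_deriv (lcoord B C) q (\<Sum>\<mu>\<in>UNIV. (0, axis \<mu> (v $ \<mu>)))"
    by (simp add: momentum_def linear_sum[OF D])
  also have "(\<Sum>\<mu>\<in>UNIV. (0 :: (real^'n) \<times> 'v, axis \<mu> (v $ \<mu>))) = (0, v)"
    by (simp add: prod_eq_iff fst_sum snd_sum sum_axis)
  finally have "energy B C q + (\<Sum>\<mu>\<in>UNIV. momentum B C q \<mu> (v $ \<mu>)) =
      lcoord B C q + (dir_deriv (lcoord B C) q (0, v) - dir_deriv (lcoord B C) q (0, snd q))"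
    by (simp add: energy_def)
  also have "dir_deriv (lcoord B C) q (0, v) - dir_deriv (lcoord B C) q (0, snd q) =
      dir_deriv (lcoord B C) q ((0, v) - (0, snd q))"
    by (rule linear_diff[OF D, symmetric])
  finally show ?thesis by simp
qed

lemma coord_jet_of:
  assumes a: "adapted X Y \<pi> B C" and y: "y \<in> cdom C"
  shows "map (coord_comp Y C y) (map (jet_of B C y v) us) =
    map (\<lambda>u. (u, jet_lin v u)) (map (coord_comp X B (\<pi> y)) us)"
  by (simp add: coord_comp_jet_of[OF a y] jet_lin_def)

lemma affine_form_legendre_jet:
  assumes a: "adapted X Y \<pi> B C" and B: "B \<in> X" and q: "fst q \<in> cmap C ` cdom C"
  shows "affine_form (energy B C q) (momentum B C q) (map (\<lambda>u. (u, jet_lin v u)) us) =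
    det_list us * (lcoord B C q + dir_deriv (lcoord B C) q (0, v - snd q))"
  unfolding affine_form_jet[OF linear_momentum(2)[OF a B q] linear_jet_lin] jet_lin_axis
    energy_plus_momentum[OF a B q] ..

lemma jet_segment:
  assumes a: "adapted X Y \<pi> B C" and y: "y \<in> cdom C"
  shows "(\<lambda>u. jet_of B C y v u + \<epsilon> *\<^sub>R (jet_of B C y v' u - jet_of B C y v u)) = jet_of B C y (v + \<epsilon> *\<^sub>R (v' - v))"
proof (rule ext)
  fix u
  note CY = adaptedD(2)[OF a] y
  note l = linear_add[OF Y.coord_comp_vec(3)[OF CY]] linear_scale[OF Y.coord_comp_vec(3)[OF CY]]
    linear_diff[OF Y.coord_comp_vec(3)[OF CY]]
  have "coord_comp Y C y (jet_of B C y v u + \<epsilon> *\<^sub>R (jet_of B C y v' u - jet_of B C y v u)) =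
      coord_comp Y C y (jet_of B C y (v + \<epsilon> *\<^sub>R (v' - v)) u)"
    by (simp add: l coord_comp_jet_of[OF a y] scaleR_add_right scaleR_diff_right sum.distrib sum_subtractf
        scaleR_sum_right mult.commute)
  then show "jet_of B C y v u + \<epsilon> *\<^sub>R (jet_of B C y v' u - jet_of B C y v u) = jet_of B C y (v + \<epsilon> *\<^sub>R (v' - v)) u"
    by (simp only: Y.coord_comp_eq_iff[OF CY])
qed

lemma legendre_defining_rhs:
  assumes a: "adapted X Y \<pi> B C" and B: "B \<in> X" and y: "y \<in> cdom C"
  shows "snd (\<L> (y, jet_of B C y v)) us +
      deriv (\<lambda>\<epsilon>. snd (\<L> (y, \<lambda>u. jet_of B C y v u + \<epsilon> *\<^sub>R (jet_of B C y v' u - jet_of B C y v u))) us) 0 =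
    det_list (map (coord_comp X B (\<pi> y)) us) *
      (lcoord B C (cmap C y, v) + dir_deriv (lcoord B C) (cmap C y, v) (0, v' - v))"
proof -
  let ?d = "det_list (map (coord_comp X B (\<pi> y)) us)"
  have L: "snd (\<L> (y, jet_of B C y v)) us = ?d * lcoord B C (cmap C y, v)" for v
    using lagrangian_coords[OF a y jet_of_in_fiber[OF a y]] by (simp add: cmap_jchart_jet_of[OF a y])
  have "has_dir_deriv (lcoord B C) (dir_deriv (lcoord B C) (cmap C y, v) (0, v' - v)) (cmap C y, v) (0, v' - v)"
    using y by (intro C1_onD(3)[OF C2_onD(1)[OF lcoord_C2[OF a B]]]) auto
  then have "((\<lambda>\<epsilon>. lcoord B C (cmap C y, v + \<epsilon> *\<^sub>R (v' - v))) has_real_derivative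
      dir_deriv (lcoord B C) (cmap C y, v) (0, v' - v)) (at 0)"
    by (simp add: has_dir_deriv_iff_has_vector_derivative has_real_derivative_iff_has_vector_derivative)
  from DERIV_imp_deriv[OF DERIV_cmult[OF this, of ?d]] show ?thesis
    unfolding jet_segment[OF a y] L by (simp add: distrib_left)
qed

text \<open>\<open>legendre\<close> is a definite description, so the coordinate formula must be
  shown to satisfy the condition and to be the only element that does.\<close>

lemma legendre_coords:
  assumes a: "adapted X Y \<pi> B C" and B: "B \<in> X" and y: "y \<in> cdom C" and \<gamma>: "\<gamma> \<in> jet_fiber X Y \<pi> y"
  shows "legendre X Y \<pi> \<L> (y, \<gamma>) = (y, \<lambda>vs. affine_form (energy B C (cmap (jchart B C) (y, \<gamma>)))
    (momentum B C (cmap (jchart B C) (y, \<gamma>))) (map (coord_comp Y C y) vs))"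
proof -
  define v where "v = snd (cmap (jchart B C) (y, \<gamma>))"
  have \<gamma>v: "\<gamma> = jet_of B C y v" unfolding v_def by (rule jet_coords[OF a y \<gamma>])
  define q where "q = (cmap C y, v)"
  have q: "cmap (jchart B C) (y, \<gamma>) = q" unfolding \<gamma>v q_def by (rule cmap_jchart_jet_of[OF a y])
  have q1: "fst q \<in> cmap C ` cdom C" using y by (simp add: q_def)
  note BX = adaptedD(1)[OF a] adaptedD(3)[OF a y] and CY = adaptedD(2)[OF a] y
  define \<zeta> where "\<zeta> = affine_form (energy B C q) (momentum B C q)"
  define z where "z vs = \<zeta> (map (coord_comp Y C y) vs)" for vs
  have \<zeta>: "vertical_affine \<zeta>"
    unfolding \<zeta>_def by (rule vertical_affine_form[OF linear_momentum(2)[OF a B q1]])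
  let ?R = "\<lambda>v' us. det_list (map (coord_comp X B (\<pi> y)) us) * (lcoord B C q + dir_deriv (lcoord B C) q (0, v' - v))"
  let ?cond = "\<lambda>z. z \<in> dual_fiber X Y \<pi> y \<and>
    (\<forall>\<gamma>'\<in>jet_fiber X Y \<pi> y. \<forall>us. z (map \<gamma>' us) =
      snd (\<L> (y, \<gamma>)) us + deriv (\<lambda>\<epsilon>. snd (\<L> (y, \<lambda>u. \<gamma> u + \<epsilon> *\<^sub>R (\<gamma>' u - \<gamma> u))) us) 0)"
  have rhs: "snd (\<L> (y, \<gamma>)) us + deriv (\<lambda>\<epsilon>. snd (\<L> (y, \<lambda>u. \<gamma> u + \<epsilon> *\<^sub>R (jet_of B C y v' u - \<gamma> u))) us) 0 = ?R v' us"
    for v' us unfolding \<gamma>v q_def by (rule legendre_defining_rhs[OF a B y])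
  have zj: "z (map (jet_of B C y v') us) = ?R v' us" for v' us
    unfolding z_def \<zeta>_def coord_jet_of[OF a y] affine_form_legendre_jet[OF a B q1] by (simp add: q_def)
  have cond: "?cond z"
  proof (intro conjI ballI allI)
    show "z \<in> dual_fiber X Y \<pi> y"
      unfolding z_def[abs_def] by (rule dual_fiberI[OF a y \<zeta>])
    fix \<gamma>' us assume "\<gamma>' \<in> jet_fiber X Y \<pi> y"
    from jet_coords[OF a y this] obtain v' where \<gamma>': "\<gamma>' = jet_of B C y v'" by blast
    show "z (map \<gamma>' us) = snd (\<L> (y, \<gamma>)) us + deriv (\<lambda>\<epsilon>. snd (\<L> (y, \<lambda>u. \<gamma> u + \<epsilon> *\<^sub>R (\<gamma>' u - \<gamma> u))) us) 0"
      unfolding \<gamma>' rhs zj ..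
  qed
  \<comment> \<open>Every linear \<open>h\<close> is the coordinate expression of a jet, so the
    condition fixes the form on all graphs, and \<open>vertical_affine_eq_0\<close> applies to the
    difference.\<close>
  have uniq: "z' = z" if c: "?cond z'" for z'
  proof -
    define \<zeta>' where "\<zeta>' vs = z' (map (coord_vec Y C y) vs)" for vs
    have "vertical_affine \<zeta>'"
      unfolding \<zeta>'_def[abs_def] using c by (intro dual_fiberD[OF a y]) blast
    then have "vertical_affine (\<lambda>vs. \<zeta>' vs - \<zeta> vs)" by (rule vertical_affine_diff[OF _ \<zeta>])
    moreover have "\<zeta>' (map (\<lambda>u. (u, h u)) us) - \<zeta> (map (\<lambda>u. (u, h u)) us) = 0" if h: "linear h" for h us
    proof -
      let ?v = "\<chi> \<mu>. h (axis \<mu> 1)" and ?us = "map (coord_vec X B (\<pi> y)) us"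
      have us: "map (coord_comp X B (\<pi> y)) ?us = us"
        by (simp add: X.coord_comp_vec[OF BX] o_def)
      have "map (coord_vec Y C y) (map (\<lambda>u. (u, h u)) us) = map (jet_of B C y ?v) ?us"
        using jet_lin_linear[OF h] by (simp add: jet_of_def X.coord_comp_vec[OF BX] jet_lin_def)
      then have "\<zeta>' (map (\<lambda>u. (u, h u)) us) = z' (map (jet_of B C y ?v) ?us)"
        unfolding \<zeta>'_def by (rule arg_cong)
      also have "\<dots> = ?R ?v ?us"
        by (simp only: bspec[OF conjunct2[OF c] jet_of_in_fiber[OF a y]] rhs)
      also have "\<dots> = \<zeta> (map (\<lambda>u. (u, jet_lin ?v u)) us)"
        unfolding us \<zeta>_def affine_form_legendre_jet[OF a B q1] by (simp add: q_def)
      also have "\<dots> = \<zeta> (map (\<lambda>u. (u, h u)) us)"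
        by (simp only: jet_lin_linear[OF h])
      finally show ?thesis by simp
    qed
    ultimately have *: "\<zeta>' vs - \<zeta> vs = 0" for vs by (rule vertical_affine_eq_0)
    show "z' = z"
    proof (rule ext)
      fix vs
      have "z' vs = \<zeta>' (map (coord_comp Y C y) vs)"
        unfolding \<zeta>'_def map_coord(2)[OF CY] ..
      then show "z' vs = z vs" using *[of "map (coord_comp Y C y) vs"] by (simp add: z_def)
    qed
  qed
  have "legendre X Y \<pi> \<L> (y, \<gamma>) = (y, THE z. ?cond z)"
    by (simp add: legendre_def)
  also have "(THE z. ?cond z) = z"
    by (rule the_equality[where P = ?cond, OF cond uniq])
  finally show ?thesis unfolding z_def[abs_def] \<zeta>_def q .
qed

text \<open>The Noether current: contraction with \<open>V\<close>, of components \<open>(s, b)\<close>, splits into a part tangent to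
  the jet and the vertical part \<open>b - v s\<close>.\<close>

lemma legendre_contract:
  assumes a: "adapted X Y \<pi> B C" and B: "B \<in> X" and y: "y \<in> cdom C" and \<gamma>: "\<gamma> \<in> jet_fiber X Y \<pi> y"
    and q: "q = cmap (jchart B C) (y, \<gamma>)" and V: "coord_comp Y C y V = (s, b)"
  shows "snd (legendre X Y \<pi> \<L> (y, \<gamma>)) (V # map \<gamma> us) =
    det_list ((lcoord B C q *\<^sub>R s + (\<chi> \<mu>. momentum B C q \<mu> (b - jet_lin (snd q) s))) # map (coord_comp X B (\<pi> y)) us)"
proof -
  have q1: "fst q \<in> cmap C ` cdom C" using y by (simp add: q cmap_jchart)
  have \<gamma>q: "\<gamma> = jet_of B C y (snd q)" unfolding q by (rule jet_coords[OF a y \<gamma>])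
  note P = linear_momentum(2)[OF a B q1]
  let ?z = "affine_form (energy B C q) (momentum B C q)"
  let ?us = "map (coord_comp X B (\<pi> y)) us" and ?h = "jet_lin (snd q)"
  let ?Q = "\<chi> \<mu>. momentum B C q \<mu> (b - ?h s)"
  have alt: "?z \<in> alternating_forms CARD('n)" by (rule alternating_affine_form[OF P])
  have "snd (legendre X Y \<pi> \<L> (y, \<gamma>)) (V # map \<gamma> us) = ?z (coord_comp Y C y V # map (coord_comp Y C y) (map \<gamma> us))"
    unfolding legendre_coords[OF a B y \<gamma>] q[symmetric] by simp
  also have "\<dots> = ?z ((s, b) # map (\<lambda>u. (u, ?h u)) ?us)"
  proof -
    have "map \<gamma> us = map (jet_of B C y (snd q)) us" using \<gamma>q by (rule arg_cong)
    then show ?thesis unfolding V by (simp only: coord_jet_of[OF a y])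
  qed
  also have "\<dots> = det_list ((lcoord B C q *\<^sub>R s + ?Q) # ?us)"
  proof (cases "Suc (length us) = CARD('n)")
    case True
    have "?z (((s, ?h s) + (0, b - ?h s)) # map (\<lambda>u. (u, ?h u)) ?us) =
        ?z ((s, ?h s) # map (\<lambda>u. (u, ?h u)) ?us) + ?z ((0, b - ?h s) # map (\<lambda>u. (u, ?h u)) ?us)"
      using linear_add[OF alternating_linear_list[OF alt, of "[]" "map (\<lambda>u. (u, ?h u)) ?us"], of "(s, ?h s)" "(0, b - ?h s)"] True
      by simp
    \<comment> \<open>This is the value on the jet at which the Legendre transformation is taken:
      the linear term of the Taylor polynomial vanishes there and only the Lagrangian is
      left.\<close>
    moreover have "?z ((s, ?h s) # map (\<lambda>u. (u, ?h u)) ?us) = det_list (s # ?us) * lcoord B C q"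
      using affine_form_legendre_jet[OF a B q1, of "snd q" "s # ?us"]
        linear_0[OF linear_momentum(1)[OF a B q1]] by (simp add: zero_prod_def[symmetric])
    moreover have "?z ((0, b - ?h s) # map (\<lambda>u. (u, ?h u)) ?us) = det_list (?Q # ?us)"
      by (rule affine_form_vertical_arg[OF P linear_jet_lin])
    moreover have lin: "linear (\<lambda>v. det_list (v # ?us))"
      using alternating_linear_list[OF alternating_det_list, of "[]" ?us] True by simp
    moreover have "det_list ((lcoord B C q *\<^sub>R s + ?Q) # ?us) = lcoord B C q * det_list (s # ?us) + det_list (?Q # ?us)"
      using linear_add[OF lin, of "lcoord B C q *\<^sub>R s" ?Q] linear_scale[OF lin, of "lcoord B C q" s] by simp
    ultimately show ?thesis by simp
  next
    case False
    then show ?thesis by (simp add: affine_form_def det_list_def)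
  qed
  finally show ?thesis .
qed

end

section \<open>Differentiability of curves\<close>

lemma curve_diff_iff:
  fixes f :: "real \<Rightarrow> 'b::real_normed_vector"
  shows "f differentiable (at 0) \<longleftrightarrow> (\<exists>l. has_dir_deriv f l 0 1)"
  unfolding has_dir_deriv_real using differentiableI_vector vector_derivative_works by blast

text \<open>Turns the bare \<open>Lim\<close> in \<open>dir_deriv\<close> into a genuine derivative
  without computing its value.\<close>

lemma curve_diff_dir:
  fixes f :: "'a::locally_convex_space \<Rightarrow> 'b::real_normed_vector"
  assumes "(\<lambda>t. f (x + t *\<^sub>R v)) differentiable (at 0)"
  shows "has_dir_deriv f (dir_deriv f x v) x v"
  using assms unfolding curve_diff_iff
  by (intro has_dir_deriv_exI) (auto simp: has_dir_deriv_def)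

lemma curve_diff_cong:
  fixes f g :: "real \<Rightarrow> 'b::real_normed_vector"
  assumes "\<forall>\<^sub>F t in nhds 0. f t = g t" and "g differentiable (at 0)"
  shows "f differentiable (at 0)"
  using assms(2) unfolding curve_diff_iff has_dir_deriv_cong[OF assms(1)] .

lemma C1_curve_deriv:
  fixes g :: "'a::real_normed_vector \<Rightarrow> 'b::real_normed_vector"
  assumes "C1_on U g" "(h has_vector_derivative w) (at 0)" "h 0 \<in> U"
  shows "((\<lambda>t. g (h t)) has_vector_derivative dir_deriv g (h 0) w) (at 0)"
  using has_dir_deriv_compose[of h w 0 1 U g] assms unfolding has_dir_deriv_real by blast

lemma C1_curve_diff:
  fixes g :: "'a::real_normed_vector \<Rightarrow> 'b::real_normed_vector" and h :: "real \<Rightarrow> 'a"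
  assumes "C1_on U g" "h differentiable (at 0)" "h 0 \<in> U"
  shows "(\<lambda>t. g (h t)) differentiable (at 0)"
  by (rule differentiableI_vector[OF C1_curve_deriv[OF assms(1) vector_derivative_works[THEN iffD1, OF assms(2)] assms(3)]])

lemma C2_curve_diff:
  fixes g :: "'a::real_normed_vector \<Rightarrow> 'b::real_normed_vector" and h w :: "real \<Rightarrow> 'a"
  assumes "C2_on U g" "h differentiable (at 0)" "w differentiable (at 0)" "h 0 \<in> U"
  shows "(\<lambda>t. dir_deriv g (h t) (w t)) differentiable (at 0)"
proof -
  have "(\<lambda>t. (h t, w t)) differentiable (at 0)"
    using assms(2,3) unfolding curve_diff_iff by (blast intro: has_dir_deriv_Pair)
  from C1_curve_diff[OF C2_onD(2)[OF assms(1)] this] show ?thesis using assms(4) by simp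
qed

lemma curve_diff_Pair:
  assumes "f differentiable (at (0::real))" "g differentiable (at 0)"
  shows "(\<lambda>t. (f t, g t)) differentiable (at 0)"
  using assms unfolding curve_diff_iff by (blast intro: has_dir_deriv_Pair)

lemma has_vector_derivative_vec:
  fixes f :: "real \<Rightarrow> 'b::real_normed_vector^'n"
  assumes "\<And>i. ((\<lambda>t. f t $ i) has_vector_derivative l $ i) (at x)"
  shows "(f has_vector_derivative l) (at x)"
  using assms unfolding has_dir_deriv_real[symmetric] has_dir_deriv_def
  by (intro vec_tendstoI) simp

lemma curve_diff_vec:
  fixes f :: "real \<Rightarrow> 'b::real_normed_vector^'n"
  assumes "\<And>i. (\<lambda>t. f t $ i) differentiable (at 0)"
  shows "f differentiable (at 0)"
proof -
  have "\<forall>i. \<exists>l. ((\<lambda>t. f t $ i) has_vector_derivative l) (at 0)"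
    using assms vector_derivative_works by blast
  then obtain l where "\<And>i. ((\<lambda>t. f t $ i) has_vector_derivative l i) (at 0)" by metis
  then have "(f has_vector_derivative (\<chi> i. l i)) (at 0)"
    by (intro has_vector_derivative_vec) simp
  then show ?thesis by (rule differentiableI_vector)
qed

lemma curve_diff_linear:
  assumes "bounded_linear L" "f differentiable (at (0::real))"
  shows "(\<lambda>t. L (f t)) differentiable (at 0)"
  by (rule differentiableI_vector[OF bounded_linear.has_vector_derivative[OF assms(1)
        vector_derivative_works[THEN iffD1, OF assms(2)]]])

lemma curve_diff_nth:
  fixes f :: "real \<Rightarrow> 'b::real_normed_vector^'n"
  assumes "f differentiable (at 0)"
  shows "(\<lambda>t. f t $ i) differentiable (at 0)"
  by (rule curve_diff_linear[OF bounded_linear_vec_nth assms])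

lemma curve_diff_fst_snd:
  assumes "f differentiable (at (0::real))"
  shows "(\<lambda>t. fst (f t)) differentiable (at 0)" "(\<lambda>t. snd (f t)) differentiable (at 0)"
  by (rule curve_diff_linear[OF bounded_linear_fst assms], rule curve_diff_linear[OF bounded_linear_snd assms])

lemma curve_diff_line: "(\<lambda>t. x + t *\<^sub>R v :: 'a::real_normed_vector) differentiable (at 0)"
  by (rule differentiableI_vector[of _ v]) (auto intro!: derivative_eq_intros)

lemma curve_eventually_in:
  fixes c :: "real \<Rightarrow> 'a::real_normed_vector"
  assumes "c differentiable (at 0)" "open U" "c 0 \<in> U"
  shows "\<forall>\<^sub>F t in nhds 0. c t \<in> U"
proof -
  have "isCont c 0" using assms(1) by (rule differentiable_imp_continuous_within)
  then have "(c \<longlongrightarrow> c 0) (nhds 0)"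
    using tendsto_at_iff_tendsto_nhds[of c 0] by (simp add: isCont_def)
  then show ?thesis using assms(2,3) by (rule topological_tendstoD)
qed

lemma curve_diff_jet_lin:
  fixes v :: "real \<Rightarrow> 'v::real_normed_vector^'n"
  assumes v: "v differentiable (at 0)" and w: "w differentiable (at 0)"
  shows "(\<lambda>t. jet_lin (v t) (w t)) differentiable (at 0)"
  unfolding jet_lin_def
  by (intro differentiable_sum differentiable_scaleR curve_diff_nth v w finite ballI)

lemma curve_diff_det:
  fixes A :: "real \<Rightarrow> real^'n^'n"
  assumes "\<And>i. (\<lambda>t. A t $ i) differentiable (at 0)"
  shows "(\<lambda>t. det (A t)) differentiable (at 0)"
proof -
  have "\<And>i. ((\<lambda>t. A t $ i) has_vector_derivative vector_derivative (\<lambda>t. A t $ i) (at 0)) (at 0)"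
    using assms vector_derivative_works by blast
  from has_real_derivative_det[OF this] show ?thesis
    unfolding has_real_derivative_iff_has_vector_derivative by (rule differentiableI_vector)
qed

lemma curve_diff_affine_form:
  fixes V :: "'n::finite \<Rightarrow> real \<Rightarrow> (real^'n) \<times> 'v::real_normed_vector"
  assumes p: "p differentiable (at 0)" and V: "\<And>i. V i differentiable (at 0)"
    and P: "\<And>\<mu> i. (\<lambda>t. P t \<mu> (snd (V i t))) differentiable (at 0)"
  shows "(\<lambda>t. affine_form (p t) (P t) (map (\<lambda>i. V i t) indices)) differentiable (at 0)"
proof -
  have 1: "(\<lambda>t. det (\<chi> i. fst (V i t))) differentiable (at 0)"
    by (rule curve_diff_det) (simp add: curve_diff_fst_snd V)
  have 2: "(\<lambda>t. det (\<chi> i. \<chi> \<nu>. if \<nu> = \<mu> then P t \<mu> (snd (V i t)) else fst (V i t) $ \<nu>)) differentiable (at 0)" for \<mu>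
  proof (rule curve_diff_det)
    fix i
    have "(\<lambda>t. if \<nu> = \<mu> then P t \<mu> (snd (V i t)) else fst (V i t) $ \<nu>) differentiable (at 0)" for \<nu>
      by (cases "\<nu> = \<mu>") (simp_all add: P curve_diff_nth curve_diff_fst_snd V)
    then show "(\<lambda>t. (\<chi> i. \<chi> \<nu>. if \<nu> = \<mu> then P t \<mu> (snd (V i t)) else fst (V i t) $ \<nu>) $ i) differentiable (at 0)"
      by (intro curve_diff_vec) simp
  qed
  have "(\<lambda>t. p t * det (\<chi> i. fst (V i t)) +
      (\<Sum>\<mu>\<in>UNIV. det (\<chi> i. \<chi> \<nu>. if \<nu> = \<mu> then P t \<mu> (snd (V i t)) else fst (V i t) $ \<nu>))) differentiable (at 0)"
    by (intro differentiable_add differentiable_mult p 1 differentiable_sum finite ballI 2)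
  then show ?thesis
    by (simp add: affine_form_def o_def det_list_map_indices)
qed

section \<open>Differentiability of curves under changes of charts\<close>

context bundle_setting
begin

lemma chart_transition_C2:
  assumes "C \<in> max_atlas Y" "D \<in> max_atlas Y"
  shows "C2_on (cmap C ` (cdom C \<inter> cdom D)) (\<lambda>u. cmap D (cinv C u))"
  using C2_mapD(2)[OF C2_map_id[OF Y] assms] by simp

text \<open>The base change \<open>\<sigma>\<close> runs against \<open>\<tau>\<close>: a basis
  vector of \<open>B\<close> is expressed in \<open>B1\<close>, pushed through the jet, and carried
  to \<open>C\<close> by the derivative of \<open>\<tau>\<close>. The formula contains first
  derivatives of transitions, which is why these must be C^2.\<close>

lemma jet_transition_diff:
  assumes a: "adapted X Y \<pi> B C" and a1: "adapted X Y \<pi> B1 C1"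
    and c: "c differentiable (at 0)" and v: "v differentiable (at (0::real))"
    and c0: "c 0 \<in> cmap C1 ` (cdom C1 \<inter> cdom C)"
  shows "(\<lambda>t. cmap (jchart B C) (cinv C1 (c t), jet_of B1 C1 (cinv C1 (c t)) (v t))) differentiable (at 0)"
proof -
  note C = adaptedD(2)[OF a] and C1 = adaptedD(2)[OF a1] and B = adaptedD(1)[OF a] and B1 = adaptedD(1)[OF a1]
  define \<tau> where "\<tau> u = cmap C (cinv C1 u)" for u
  define \<sigma> where "\<sigma> u = cmap B1 (cinv B u)" for u
  have \<tau>: "C2_on (cmap C1 ` (cdom C1 \<inter> cdom C)) \<tau>"
    using chart_transition_C2[OF C1 C] by (simp add: \<tau>_def[abs_def])
  have \<sigma>: "C2_on (cmap B ` (cdom B \<inter> cdom B1)) \<sigma>"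
    using C2_mapD(2)[OF C2_map_id[OF X] B B1] by (simp add: \<sigma>_def[abs_def])
  have ev: "\<forall>\<^sub>F t in nhds 0. c t \<in> cmap C1 ` (cdom C1 \<inter> cdom C)"
    by (rule curve_eventually_in[OF c C2_onD(3)[OF \<tau>] c0])
  have \<tau>c: "(\<lambda>t. \<tau> (c t)) differentiable (at 0)"
    by (rule C1_curve_diff[OF C2_onD(1)[OF \<tau>] c c0])
  have pt: "cinv C1 u \<in> cdom C1 \<and> cinv C1 u \<in> cdom C \<and> cmap C1 (cinv C1 u) = u"
    if "u \<in> cmap C1 ` (cdom C1 \<inter> cdom C)" for u
  proof -
    from that obtain y where "y \<in> cdom C1" "y \<in> cdom C" "u = cmap C1 y" by blast
    then show ?thesis using max_atlasD(6)[OF C1] by simp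
  qed
  have fst\<tau>: "fst (\<tau> u) = cmap B (\<pi> (cinv C1 u))" if "u \<in> cmap C1 ` (cdom C1 \<inter> cdom C)" for u
    using adaptedD(4)[OF a] pt[OF that] by (simp add: \<tau>_def)
  define A where "A \<mu> t = dir_deriv \<sigma> (fst (\<tau> (c t))) (axis \<mu> 1)" for \<mu> t
  have A: "A \<mu> differentiable (at 0)" for \<mu>
    unfolding A_def[abs_def]
  proof (rule C2_curve_diff[OF \<sigma> curve_diff_fst_snd(1)[OF \<tau>c] differentiable_const])
    have "\<pi> (cinv C1 (c 0)) \<in> cdom B" "\<pi> (cinv C1 (c 0)) \<in> cdom B1"
      using pt[OF c0] adaptedD(3)[OF a] adaptedD(3)[OF a1] by auto
    then show "fst (\<tau> (c 0)) \<in> cmap B ` (cdom B \<inter> cdom B1)"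
      unfolding fst\<tau>[OF c0] by blast
  qed
  have coords: "cmap (jchart B C) (cinv C1 u, jet_of B1 C1 (cinv C1 u) w) =
      (\<tau> u, \<chi> \<mu>. snd (dir_deriv \<tau> u (dir_deriv \<sigma> (fst (\<tau> u)) (axis \<mu> 1), jet_lin w (dir_deriv \<sigma> (fst (\<tau> u)) (axis \<mu> 1)))))"
    if u: "u \<in> cmap C1 ` (cdom C1 \<inter> cdom C)" for u w
  proof -
    let ?y = "cinv C1 u"
    note y = pt[OF u]
    have y1: "?y \<in> cdom C1" and y2: "?y \<in> cdom C" and uy: "cmap C1 ?y = u" using y by blast+
    have b: "\<pi> ?y \<in> cdom B" "\<pi> ?y \<in> cdom B1"
      using adaptedD(3)[OF a y2] adaptedD(3)[OF a1 y1] by auto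
    have 1: "coord_comp X B1 (\<pi> ?y) (coord_vec X B (\<pi> ?y) x) = dir_deriv \<sigma> (fst (\<tau> u)) x" for x
      using X.coord_comp_coord_vec[OF B b(1) B1 b(2)] by (simp add: \<sigma>_def[abs_def] fst\<tau>[OF u])
    have 2: "coord_comp Y C ?y (coord_vec Y C1 ?y x) = dir_deriv \<tau> u x" for x
      using Y.coord_comp_coord_vec[OF C1 y1 C y2] by (simp add: \<tau>_def[abs_def] uy)
    show ?thesis
      unfolding cmap_jchart jet_of_def 1 2 jet_lin_def[symmetric] by (simp add: \<tau>_def)
  qed
  have ev': "\<forall>\<^sub>F t in nhds 0. cmap (jchart B C) (cinv C1 (c t), jet_of B1 C1 (cinv C1 (c t)) (v t)) =
      (\<tau> (c t), \<chi> \<mu>. snd (dir_deriv \<tau> (c t) (A \<mu> t, jet_lin (v t) (A \<mu> t))))"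
    using ev unfolding A_def by eventually_elim (rule coords)
  have "(\<lambda>t. snd (dir_deriv \<tau> (c t) (A \<mu> t, jet_lin (v t) (A \<mu> t)))) differentiable (at 0)" for \<mu>
    by (intro curve_diff_fst_snd(2) C2_curve_diff[OF \<tau> c _ c0] curve_diff_Pair curve_diff_jet_lin A v)
  then have "(\<lambda>t. (\<tau> (c t), \<chi> \<mu>. snd (dir_deriv \<tau> (c t) (A \<mu> t, jet_lin (v t) (A \<mu> t))))) differentiable (at 0)"
    by (intro curve_diff_Pair \<tau>c curve_diff_vec) simp
  then show ?thesis by (rule curve_diff_cong[OF ev'])
qed

text \<open>Common to the Legendre transformation and the lifted flow: \<open>K t\<close> carries
  the arguments from \<open>C2\<close> to coordinates in which the form is an
  \<open>affine_form\<close>. Linearity near 0 makes the \<open>Blinfun\<close> in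
  \<open>dual_chart\<close> genuine.\<close>

lemma dual_curve_diff:
  fixes K :: "real \<Rightarrow> (real^'n) \<times> 'v \<Rightarrow> (real^'n) \<times> 'v" and P :: "real \<Rightarrow> 'n \<Rightarrow> 'v \<Rightarrow> real"
    and y :: "real \<Rightarrow> 'y" and z :: "real \<Rightarrow> ((real^'n) \<times> 'v) form" and C2 :: "('y, (real^'n) \<times> 'v) chart"
  assumes y: "(\<lambda>t. cmap C2 (y t)) differentiable (at 0)"
    and z: "\<forall>\<^sub>F t in nhds 0. \<forall>f :: 'n \<Rightarrow> (real^'n) \<times> 'v. z t (map (\<lambda>\<nu>. coord_vec Y C2 (y t) (f \<nu>)) indices) =
      affine_form (p t) (P t) (map (\<lambda>\<nu>. K t (f \<nu>)) indices)"
    and lin: "\<forall>\<^sub>F t in nhds 0. linear (K t) \<and> (\<forall>\<mu>. linear (P t \<mu>))"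
    and p: "p differentiable (at 0)" and K: "\<And>x. (\<lambda>t. K t x) differentiable (at 0)"
    and P: "\<And>\<mu> x. (\<lambda>t. P t \<mu> (snd (K t x))) differentiable (at 0)"
  shows "(\<lambda>t. cmap (dchart C2) (y t, z t)) differentiable (at (0::real))"
proof -
  define AF where "AF t f = affine_form (p t) (P t) (map (\<lambda>\<nu>. K t (f \<nu>)) indices)" for t and f :: "'n \<Rightarrow> _"
  have AF: "(\<lambda>t. AF t f) differentiable (at 0)" for f
    unfolding AF_def
    by (rule curve_diff_affine_form[where p = p and V = "\<lambda>\<nu> t. K t (f \<nu>)" and P = P]) (rule p K P)+
  define G where "G \<mu> t = Blinfun (\<lambda>w. AF t (\<lambda>\<nu>. if \<nu> = \<mu> then (0, w) else (axis \<nu> 1, 0)))" for \<mu> t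
  have G: "G \<mu> differentiable (at 0)" for \<mu>
  proof -
    have evG: "\<forall>\<^sub>F t in nhds 0. blinfun_apply (G \<mu> t) w = AF t (\<lambda>\<nu>. if \<nu> = \<mu> then (0, w) else (axis \<nu> 1, 0))" for w
      using lin
    proof eventually_elim
      case (elim t)
      then have Kl: "linear (K t)" and Pl: "\<And>\<mu>. linear (P t \<mu>)" by blast+
      note alt = alternating_affine_form[OF Pl, of "p t"]
      have "linear (\<lambda>w::'v. (0::real^'n, w))" by (intro linearI) auto
      from linear_compose[OF linear_compose[OF this Kl] alternating_linear[OF alt, where f = "\<lambda>\<nu>. K t (axis \<nu> 1, 0)" and i = \<mu>]]
      have "linear (\<lambda>w. affine_form (p t) (P t) (map ((\<lambda>\<nu>. K t (axis \<nu> 1, 0))(\<mu> := K t (0, w))) indices))"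
        by (simp add: o_def)
      moreover have "(\<lambda>\<nu>. K t (axis \<nu> 1, 0))(\<mu> := K t (0, w)) = (\<lambda>\<nu>. K t (if \<nu> = \<mu> then (0, w) else (axis \<nu> 1, 0)))" for w
        by auto
      ultimately have "linear (\<lambda>w. AF t (\<lambda>\<nu>. if \<nu> = \<mu> then (0, w) else (axis \<nu> 1, 0)))"
        unfolding AF_def by (simp only:)
      from finite_span_bounded_linear[OF fin this] show ?case
        unfolding G_def by (simp add: bounded_linear_Blinfun_apply)
    qed
    have "(\<lambda>t. blinfun_apply (G \<mu> t) w) differentiable (at 0)" for w
      by (rule curve_diff_cong[OF evG AF])
    then have "\<And>w. ((\<lambda>t. blinfun_apply (G \<mu> t) w) has_vector_derivative vector_derivative (\<lambda>t. blinfun_apply (G \<mu> t) w) (at 0)) (at 0)"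
      using vector_derivative_works by blast
    from blinfun_curve_differentiable[OF fin this] show ?thesis
      using differentiableI_vector by blast
  qed
  have "\<forall>\<^sub>F t in nhds 0. cmap (dchart C2) (y t, z t) =
      (cmap C2 (y t), AF t (\<lambda>\<nu>. (axis \<nu> 1, 0)), \<chi> \<mu>. G \<mu> t)"
    using z
  proof eventually_elim
    case (elim t)
    have e: "z t (map (\<lambda>\<nu>. coord_vec Y C2 (y t) (f \<nu>)) indices) = AF t f" for f
      unfolding AF_def using elim by blast
    show ?case
      by (simp only: dual_chart_def G_def snd_conv case_prod_conv e)
  qed
  moreover have "(\<lambda>t. (cmap C2 (y t), AF t (\<lambda>\<nu>. (axis \<nu> 1, 0)), \<chi> \<mu>. G \<mu> t)) differentiable (at 0)"
    by (intro curve_diff_Pair y AF curve_diff_vec) (simp add: G)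
  ultimately show ?thesis by (rule curve_diff_cong)
qed

text \<open>In a \<open>dual_chart\<close> the base point depends on the first coordinate alone, so
  of a tangent vector to \<open>Z\<close> only \<open>fst w\<close> matters from here on.\<close>

lemma tangent_fst:
  assumes a: "adapted X Y \<pi> B C" and y: "y \<in> cdom C" and ch: "chart_at (dual_atlas X Y \<pi>) (y, z) = dchart C"
  shows "tangent_map (dual_atlas X Y \<pi>) Y fst (y, z) w =
    dir_deriv (\<lambda>u. cmap (chart_at Y y) (cinv C u)) (cmap C y) (fst w)"
proof -
  note C = adaptedD(2)[OF a]
  have yp: "y \<in> points Y" using max_atlasD(1)[OF C] y by blast
  note D = Y.chart_at_max[OF yp] chart_at(2)[OF yp]
  let ?D = "chart_at Y y" and ?g = "\<lambda>u. cmap (chart_at Y y) (cinv C u)"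
  have c: "fst (cmap (dchart C) (y, z)) = cmap C y" by (simp add: dual_chart_def)
  have o: "open (cmap C ` cdom C)" by (rule max_atlasD(3)[OF C])
  have "tangent_map (dual_atlas X Y \<pi>) Y fst (y, z) w =
      dir_deriv (\<lambda>u. cmap ?D (fst (cinv (dchart C) u))) (cmap (dchart C) (y, z)) w"
    by (simp add: tangent_map_def ch o_def)
  also have "\<dots> = dir_deriv (\<lambda>u. ?g (fst u)) (cmap (dchart C) (y, z)) w"
  proof (rule dir_deriv_cong)
    have "\<forall>\<^sub>F u in nhds (cmap (dchart C) (y, z)). u \<in> (cmap C ` cdom C) \<times> UNIV"
      using o y by (intro eventually_nhds_in_open open_Times) (auto simp: mem_Times_iff c)
    then show "\<forall>\<^sub>F u in nhds (cmap (dchart C) (y, z)). cmap ?D (fst (cinv (dchart C) u)) = ?g (fst u)"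
    proof eventually_elim
      case (elim u)
      then have "fst u \<in> cmap C ` cdom C" by (simp add: mem_Times_iff)
      from fst_cinv_dchart[OF a this, of "snd u"] show ?case by simp
    qed
  qed
  also have "\<dots> = dir_deriv ?g (fst (cmap (dchart C) (y, z))) (fst w)"
  proof (rule dir_deriv_eqI, rule has_dir_deriv_compose[OF has_dir_deriv_linear[OF linear_fst]])
    show "C1_on (cmap C ` (cdom C \<inter> cdom ?D)) ?g"
      by (rule C2_onD(1)[OF chart_transition_C2[OF C D(1)]])
    show "fst (cmap (dchart C) (y, z)) \<in> cmap C ` (cdom C \<inter> cdom ?D)"
      unfolding c using y D(2) by blast
  qed
  finally show ?thesis unfolding c .
qed

text \<open>The choice behind \<open>chart_at\<close> guarantees an adapted pair and no more; its
  base chart lies in the maximal atlas, and a second pair over a chart of \<open>X\<close> is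
  brought in where the Lagrangian is differentiated.\<close>

lemma chart_at_jet:
  assumes "y \<in> points Y" "\<gamma> \<in> jet_fiber X Y \<pi> y"
  obtains B C where "adapted X Y \<pi> B C" "y \<in> cdom C" "chart_at (jet_atlas X Y \<pi>) (y, \<gamma>) = jchart B C"
proof -
  have "\<pi> y \<in> points X" using C2_mapD(1)[OF proj assms(1)] .
  then obtain B where B: "B \<in> X" "\<pi> y \<in> cdom B" unfolding points_def by blast
  then obtain C where C: "adapted X Y \<pi> B C" "y \<in> cdom C" using ex_adapted assms(1) by blast
  have "(y, \<gamma>) \<in> cdom (jchart B C)" using C assms(2) by (simp add: jchart_dom)
  moreover have "jchart B C \<in> jet_atlas X Y \<pi>" using C(1) unfolding jet_atlas_def by blast
  ultimately have "(y, \<gamma>) \<in> points (jet_atlas X Y \<pi>)" unfolding points_def by blast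
  note ch = chart_at[OF this]
  from ch(1) obtain B' C' where a: "adapted X Y \<pi> B' C'" "chart_at (jet_atlas X Y \<pi>) (y, \<gamma>) = jchart B' C'"
    unfolding jet_atlas_def by blast
  then have "y \<in> cdom C'" using ch(2) by (simp add: jchart_dom)
  with a that show ?thesis by blast
qed

lemma chart_at_dual:
  assumes "y \<in> points Y" "z \<in> dual_fiber X Y \<pi> y"
  obtains B C where "adapted X Y \<pi> B C" "y \<in> cdom C" "chart_at (dual_atlas X Y \<pi>) (y, z) = dchart C"
proof -
  have "\<pi> y \<in> points X" using C2_mapD(1)[OF proj assms(1)] .
  then obtain B where B: "B \<in> X" "\<pi> y \<in> cdom B" unfolding points_def by blast
  then obtain C where C: "adapted X Y \<pi> B C" "y \<in> cdom C" using ex_adapted assms(1) by blast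
  have "(y, z) \<in> cdom (dchart C)" using C assms by (simp add: dual_chart_def dual_space_def)
  moreover have "dchart C \<in> dual_atlas X Y \<pi>" using C(1) unfolding dual_atlas_def by blast
  ultimately have "(y, z) \<in> points (dual_atlas X Y \<pi>)" unfolding points_def by blast
  note ch = chart_at[OF this]
  from ch(1) obtain B' C' where a: "adapted X Y \<pi> B' C'" "chart_at (dual_atlas X Y \<pi>) (y, z) = dchart C'"
    unfolding dual_atlas_def by blast
  then have "y \<in> cdom C'" using ch(2) by (simp add: dual_chart_def)
  with a that show ?thesis by blast
qed

end

context lagrangian
begin

text \<open>The curve of jets is moved to an auxiliary pair with base chart in \<open>X\<close>,
  where the Legendre transform is an explicit \<open>affine_form\<close> with C^2 data, and is then
  read in the target chart \<open>C2\<close>.\<close>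

lemma legendre_diff:
  assumes a1: "adapted X Y \<pi> B1 C1" and a2: "adapted X Y \<pi> B2 C2"
    and c: "c differentiable (at 0)" and v: "v differentiable (at (0::real))"
    and c0: "c 0 \<in> cmap C1 ` (cdom C1 \<inter> cdom C2)"
  shows "(\<lambda>t. cmap (dchart C2) (legendre X Y \<pi> \<L> (cinv C1 (c t), jet_of B1 C1 (cinv C1 (c t)) (v t)))) differentiable (at 0)"
proof -
  note C1 = adaptedD(2)[OF a1] and C2 = adaptedD(2)[OF a2]
  define y where "y t = cinv C1 (c t)" for t
  have pt: "cinv C1 u \<in> cdom C1 \<and> cinv C1 u \<in> cdom D \<and> cmap C1 (cinv C1 u) = u"
    if "u \<in> cmap C1 ` (cdom C1 \<inter> cdom D)" for u D
  proof -
    from that obtain y where "y \<in> cdom C1" "y \<in> cdom D" "u = cmap C1 y" by blast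
    then show ?thesis using max_atlasD(6)[OF C1] by simp
  qed
  have y0: "y 0 \<in> cdom C1" "y 0 \<in> cdom C2" "cmap C1 (y 0) = c 0" using pt[OF c0] by (auto simp: y_def)
  have yp: "y 0 \<in> points Y" using max_atlasD(1)[OF C1] y0(1) by blast
  have "\<pi> (y 0) \<in> points X" using C2_mapD(1)[OF proj yp] .
  then obtain B where B: "B \<in> X" "\<pi> (y 0) \<in> cdom B" unfolding points_def by blast
  then obtain C where a: "adapted X Y \<pi> B C" "y 0 \<in> cdom C" using ex_adapted yp by blast
  note C = adaptedD(2)[OF a(1)]
  have c0': "c 0 \<in> cmap C1 ` (cdom C1 \<inter> cdom C)" using y0 a(2) by (metis IntI imageI)
  have \<tau>2: "C2_on (cmap C1 ` (cdom C1 \<inter> cdom C2)) (\<lambda>u. cmap C2 (cinv C1 u))"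
    by (rule chart_transition_C2[OF C1 C2])
  have \<tau>: "C2_on (cmap C2 ` (cdom C2 \<inter> cdom C)) (\<lambda>u. cmap C (cinv C2 u))"
    by (rule chart_transition_C2[OF C2 C])
  have ev1: "\<forall>\<^sub>F t in nhds 0. c t \<in> cmap C1 ` (cdom C1 \<inter> cdom C2)"
    by (rule curve_eventually_in[OF c C2_onD(3)[OF \<tau>2] c0])
  have ev2: "\<forall>\<^sub>F t in nhds 0. c t \<in> cmap C1 ` (cdom C1 \<inter> cdom C)"
    by (rule curve_eventually_in[OF c C2_onD(3)[OF chart_transition_C2[OF C1 C]] c0'])
  define q where "q t = cmap (jchart B C) (y t, jet_of B1 C1 (y t) (v t))" for t
  have q: "q differentiable (at 0)"
    unfolding q_def y_def by (rule jet_transition_diff[OF a(1) a1 c v c0'])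
  have fq: "fst (q t) = cmap C (y t)" for t by (simp add: q_def cmap_jchart)
  have q0: "q 0 \<in> (cmap C ` cdom C) \<times> UNIV" using a(2) by (simp add: mem_Times_iff fq)
  define z where "z t vs = affine_form (energy B C (q t)) (momentum B C (q t)) (map (coord_comp Y C (y t)) vs)" for t vs
  define K where "K t = dir_deriv (\<lambda>u. cmap C (cinv C2 u)) (cmap C2 (y t))" for t
  have y2: "(\<lambda>t. cmap C2 (y t)) differentiable (at 0)"
    unfolding y_def by (rule C1_curve_diff[OF C2_onD(1)[OF \<tau>2] c c0])
  have Kd: "(\<lambda>t. K t x) differentiable (at 0)" for x
    unfolding K_def by (rule C2_curve_diff[OF \<tau> y2 differentiable_const]) (use y0 a(2) in blast)
  note ell = lcoord_C2[OF a(1) B(1)]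
  have pd: "(\<lambda>t. energy B C (q t)) differentiable (at 0)"
    unfolding energy_def
    by (intro differentiable_diff C1_curve_diff[OF C2_onD(1)[OF ell] q q0] C2_curve_diff[OF ell q _ q0]
        curve_diff_Pair differentiable_const curve_diff_fst_snd(2)[OF q])
  have Pd: "(\<lambda>t. momentum B C (q t) \<mu> (snd (K t x))) differentiable (at 0)" for \<mu> x
  proof -
    have "(\<lambda>t. axis \<mu> (snd (K t x)) :: 'v^'n) differentiable (at 0)"
    proof (rule curve_diff_vec)
      fix i
      show "(\<lambda>t. (axis \<mu> (snd (K t x)) :: 'v^'n) $ i) differentiable (at 0)"
        by (cases "i = \<mu>") (simp_all add: axis_def curve_diff_fst_snd(2)[OF Kd])
    qed
    then show ?thesis
      unfolding momentum_def
      by (intro C2_curve_diff[OF ell q _ q0] curve_diff_Pair differentiable_const)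
  qed
  have main: "(\<lambda>t. cmap (dchart C2) (y t, z t)) differentiable (at 0)"
  proof (rule dual_curve_diff[where p = "\<lambda>t. energy B C (q t)" and P = "\<lambda>t. momentum B C (q t)" and K = K])
    show "(\<lambda>t. cmap C2 (y t)) differentiable (at 0)" "(\<lambda>t. energy B C (q t)) differentiable (at 0)"
      by (rule y2, rule pd)
    show "(\<lambda>t. K t x) differentiable (at 0)" "(\<lambda>t. momentum B C (q t) \<mu> (snd (K t x))) differentiable (at 0)" for x \<mu>
      by (rule Kd, rule Pd)
    show "\<forall>\<^sub>F t in nhds 0. \<forall>f :: 'n \<Rightarrow> (real^'n) \<times> 'v. z t (map (\<lambda>\<nu>. coord_vec Y C2 (y t) (f \<nu>)) indices) =
        affine_form (energy B C (q t)) (momentum B C (q t)) (map (\<lambda>\<nu>. K t (f \<nu>)) indices)"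
      using ev1 ev2
    proof eventually_elim
      case (elim t)
      have "y t \<in> cdom C2" "y t \<in> cdom C" using pt[OF elim(1)] pt[OF elim(2)] by (auto simp: y_def)
      from Y.coord_comp_coord_vec[OF C2 this(1) C this(2)] show ?case
        by (simp add: z_def K_def o_def)
    qed
    show "\<forall>\<^sub>F t in nhds 0. linear (K t) \<and> (\<forall>\<mu>. linear (momentum B C (q t) \<mu>))"
      using ev1 ev2
    proof eventually_elim
      case (elim t)
      have yt: "y t \<in> cdom C2" "y t \<in> cdom C" using pt[OF elim(1)] pt[OF elim(2)] by (auto simp: y_def)
      have "linear (K t)"
        unfolding K_def using yt by (intro linear_dir_deriv[OF C2_onD(1)[OF \<tau>]]) blast
      moreover have "linear (momentum B C (q t) \<mu>)" for \<mu>
        using yt(2) by (intro linear_momentum(2)[OF a(1) B(1)]) (simp add: fq)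
      ultimately show ?case by blast
    qed
  qed
  have "\<forall>\<^sub>F t in nhds 0. cmap (dchart C2) (legendre X Y \<pi> \<L> (cinv C1 (c t), jet_of B1 C1 (cinv C1 (c t)) (v t))) =
      cmap (dchart C2) (y t, z t)"
    using ev2
  proof eventually_elim
    case (elim t)
    have yt: "y t \<in> cdom C1" "y t \<in> cdom C" using pt[OF elim] by (auto simp: y_def)
    show ?case
      using legendre_coords[OF a(1) B(1) yt(2) jet_of_in_fiber[OF a1 yt(1)]]
      by (simp add: y_def z_def[abs_def] q_def)
  qed
  then show ?thesis using main by (rule curve_diff_cong)
qed

end

section \<open>The divergence of the Noether current\<close>

lemma C1_line_deriv:
  fixes f :: "'a::real_normed_vector \<Rightarrow> 'b::real_normed_vector"
  assumes "C1_on U f" "x \<in> U"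
  shows "((\<lambda>t. f (x + t *\<^sub>R v)) has_vector_derivative dir_deriv f x v) (at 0)"
  using C1_onD(3)[OF assms] unfolding has_dir_deriv_iff_has_vector_derivative .

text \<open>The derivative on pairs of point and direction is split by linearity; in the direction
  slot the map is linear and equals its own derivative.\<close>

lemma C2_curve_deriv:
  fixes g :: "'a::real_normed_vector \<Rightarrow> 'b::real_normed_vector"
  assumes g: "C2_on U g" and h: "(h has_vector_derivative h') (at 0)" and k: "(k has_vector_derivative k') (at 0)"
    and x: "h 0 \<in> U"
  shows "((\<lambda>t. dir_deriv g (h t) (k t)) has_vector_derivative
    (dir_deriv (\<lambda>p. dir_deriv g p (k 0)) (h 0) h' + dir_deriv g (h 0) k')) (at 0)"
proof -
  let ?T = "\<lambda>p. dir_deriv g (fst p) (snd p)"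
  note T = C2_onD(2)[OF g]
  have in_UU: "(h 0, k 0) \<in> U \<times> UNIV" using x by simp
  have "((\<lambda>t. (h t, k t)) has_vector_derivative (h', k')) (at 0)"
    using h k unfolding has_dir_deriv_real[symmetric] by (rule has_dir_deriv_Pair)
  from C1_curve_deriv[OF T this] in_UU
  have "((\<lambda>t. dir_deriv g (h t) (k t)) has_vector_derivative dir_deriv ?T (h 0, k 0) (h', k')) (at 0)"
    by simp
  moreover have "dir_deriv ?T (h 0, k 0) (h', k') = dir_deriv ?T (h 0, k 0) (h', 0) + dir_deriv ?T (h 0, k 0) (0, k')"
    using linear_add[OF linear_dir_deriv[OF T in_UU], of "(h', 0)" "(0, k')"] by simp
  moreover have "dir_deriv ?T (h 0, k 0) (h', 0) = dir_deriv (\<lambda>p. dir_deriv g p (k 0)) (h 0) h'"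
    using C2_on_partial(2)[OF g x] by simp
  moreover have "dir_deriv ?T (h 0, k 0) (0, k') = dir_deriv g (h 0) k'"
  proof (rule dir_deriv_eqI)
    note l = linear_dir_deriv[OF C2_onD(1)[OF g] x]
    have "((\<lambda>t. dir_deriv g (h 0) (k 0) + t *\<^sub>R dir_deriv g (h 0) k') has_vector_derivative dir_deriv g (h 0) k') (at 0)"
      by (auto intro!: derivative_eq_intros)
    then show "has_dir_deriv ?T (dir_deriv g (h 0) k') (h 0, k 0) (0, k')"
      unfolding has_dir_deriv_iff_has_vector_derivative by (simp add: linear_add[OF l] linear_scale[OF l])
  qed
  ultimately show ?thesis by simp
qed

lemma C1_on_vec:
  fixes f :: "'a::real_normed_vector \<Rightarrow> 'b::real_normed_vector^'n"
  assumes "open U" "\<And>i. C1_on U (\<lambda>x. f x $ i)"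
  shows "C1_on U f"
proof (rule C1_onI(1)[where D = "\<lambda>x v. \<chi> i. dir_deriv (\<lambda>x. f x $ i) x v"])
  show "open U" by fact
  have "continuous_on U (\<lambda>x. \<chi> i. f x $ i)"
    by (intro continuous_on_vec_lambda C1_onD(2) assms)
  then show "continuous_on U f" by simp
  show "has_dir_deriv f (\<chi> i. dir_deriv (\<lambda>x. f x $ i) x v) x v" if "x \<in> U" for x v
    using C1_line_deriv[OF assms(2) that] unfolding has_dir_deriv_iff_has_vector_derivative
    by (intro has_vector_derivative_vec) simp
  have "continuous_on (U \<times> UNIV) (\<lambda>z. \<chi> i. (\<lambda>(x, v). dir_deriv (\<lambda>x. f x $ i) x v) z)"
    by (intro continuous_on_vec_lambda C1_onD(4) assms)
  then show "continuous_on (U \<times> UNIV) (\<lambda>(x, v). \<chi> i. dir_deriv (\<lambda>x. f x $ i) x v)"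
    by (simp add: case_prod_beta)
qed

lemma C1_on_bounded_linear:
  fixes f :: "'a::real_normed_vector \<Rightarrow> 'b::real_normed_vector"
  assumes L: "bounded_linear L" and f: "C1_on U f"
  shows "C1_on U (\<lambda>x. L (f x))"
  by (rule C1_on_compose(1)[OF f C1_on_linear(1)[OF bounded_linear.linear[OF L] _ open_UNIV]])
    (auto intro: linear_continuous_on L)

lemma C1_on_bilinear:
  fixes f :: "'a::real_normed_vector \<Rightarrow> 'b::real_normed_vector" and g :: "'a \<Rightarrow> 'c::real_normed_vector"
  assumes m: "bounded_bilinear m" and f: "C1_on U f" and g: "C1_on U g"
  shows "C1_on U (\<lambda>x. m (f x) (g x))"
proof (rule C1_onI(1)[where D = "\<lambda>x v. m (f x) (dir_deriv g x v) + m (dir_deriv f x v) (g x)"])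
  interpret bounded_bilinear m by (rule m)
  show "open U" using C1_onD(1)[OF f] .
  show "continuous_on U (\<lambda>x. m (f x) (g x))"
    by (intro continuous_on C1_onD(2) f g)
  show "has_dir_deriv (\<lambda>x. m (f x) (g x)) (m (f x) (dir_deriv g x v) + m (dir_deriv f x v) (g x)) x v"
    if "x \<in> U" for x v
    using has_vector_derivative[OF C1_line_deriv[OF f that] C1_line_deriv[OF g that], of v v]
    unfolding has_dir_deriv_iff_has_vector_derivative by simp
  have cf: "continuous_on (U \<times> UNIV) (\<lambda>z. f (fst z))" "continuous_on (U \<times> UNIV) (\<lambda>z. g (fst z))"
    by (rule continuous_on_compose2[OF C1_onD(2)[OF f]], auto intro!: continuous_intros,
        rule continuous_on_compose2[OF C1_onD(2)[OF g]], auto intro!: continuous_intros)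
  have "continuous_on (U \<times> UNIV) (\<lambda>z. dir_deriv f (fst z) (snd z))" "continuous_on (U \<times> UNIV) (\<lambda>z. dir_deriv g (fst z) (snd z))"
    using C1_onD(4)[OF f] C1_onD(4)[OF g] by (simp_all add: case_prod_beta)
  then have "continuous_on (U \<times> UNIV)
      (\<lambda>z. m (f (fst z)) (dir_deriv g (fst z) (snd z)) + m (dir_deriv f (fst z) (snd z)) (g (fst z)))"
    by (intro continuous_on_add continuous_on cf)
  then show "continuous_on (U \<times> UNIV) (\<lambda>(x, v). m (f x) (dir_deriv g x v) + m (dir_deriv f x v) (g x))"
    by (simp add: case_prod_beta)
qed

lemma C1_on_diff:
  fixes f g :: "'a::real_normed_vector \<Rightarrow> 'b::real_normed_vector"
  assumes "C1_on U f" "C1_on U g"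
  shows "C1_on U (\<lambda>x. f x - g x)"
proof -
  have "bounded_linear (\<lambda>p::'b \<times> 'b. fst p - snd p)"
    by (intro bounded_linear_sub bounded_linear_fst bounded_linear_snd)
  from C1_on_bounded_linear[OF this C1_on_Pair(1)[OF assms]] show ?thesis by simp
qed

lemma C1_on_add:
  fixes f g :: "'a::real_normed_vector \<Rightarrow> 'b::real_normed_vector"
  assumes "C1_on U f" "C1_on U g"
  shows "C1_on U (\<lambda>x. f x + g x)"
proof -
  have "bounded_linear (\<lambda>p::'b \<times> 'b. fst p + snd p)"
    by (intro bounded_linear_add bounded_linear_fst bounded_linear_snd)
  from C1_on_bounded_linear[OF this C1_on_Pair(1)[OF assms]] show ?thesis by simp
qed

lemma C1_on_dir_deriv:
  fixes g :: "'a::real_normed_vector \<Rightarrow> 'b::real_normed_vector" and h k :: "'c::real_normed_vector \<Rightarrow> 'a"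
  assumes g: "C2_on U g" and h: "C1_on W h" and k: "C1_on W k" and sub: "\<And>x. x \<in> W \<Longrightarrow> h x \<in> U"
  shows "C1_on W (\<lambda>x. dir_deriv g (h x) (k x))"
proof -
  have "C1_on W (\<lambda>x. (\<lambda>p. dir_deriv g (fst p) (snd p)) (h x, k x))"
    by (rule C1_on_compose(1)[OF C1_on_Pair(1)[OF h k] C2_onD(2)[OF g]]) (simp add: sub)
  then show ?thesis by simp
qed

lemma bounded_linear_axis: "bounded_linear (axis \<mu> :: 'v::real_normed_vector \<Rightarrow> 'v^'n)"
proof (rule bounded_linear_intro[of _ 1])
  show "norm (axis \<mu> w) \<le> norm w * 1" for w :: 'v
  proof -
    have "norm (axis \<mu> w :: 'v^'n) \<le> (\<Sum>i\<in>UNIV. norm ((axis \<mu> w :: 'v^'n) $ i))"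
      unfolding norm_vec_def by (rule L2_set_le_sum) simp
    also have "\<dots> = norm w"
      by (simp add: axis_def if_distrib cong: if_cong)
    finally show ?thesis by simp
  qed
qed (simp_all add: linear_add[OF linear_axis] linear_scale[OF linear_axis])

text \<open>The theorem in one adapted chart: \<open>c\<close> is the graph of the section,
  \<open>j\<close> its jet, \<open>H\<close> the flow, \<open>V\<close> the generator along the
  graph, \<open>J\<close> the current and \<open>M t\<close> the derivative of the inverse base
  flow. The Euler-Lagrange equations rewrite the divergence of \<open>J\<close>; equivariance,
  differentiated at 0, shows that the result vanishes.\<close>

lemma noether_divergence:
  fixes \<phi> :: "real^'n \<Rightarrow> 'v::real_normed_vector"
    and H :: "real \<times> ((real^'n) \<times> 'v) \<Rightarrow> (real^'n) \<times> 'v"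
    and L :: "((real^'n) \<times> 'v) \<times> ('v^'n) \<Rightarrow> real" and u0 :: "real^'n"
  defines "c \<equiv> \<lambda>u. (u, \<phi> u)"
  defines "j \<equiv> \<lambda>u. (c u, \<chi> \<mu>. dir_deriv \<phi> u (axis \<mu> 1))"
  defines "V \<equiv> \<lambda>u. dir_deriv H (0, c u) (1, 0)"
  defines "J \<equiv> \<lambda>u. L (j u) *\<^sub>R fst (V u) +
    (\<chi> \<mu>. dir_deriv L (j u) (0, axis \<mu> (snd (V u) - dir_deriv \<phi> u (fst (V u)))))"
  defines "M \<equiv> \<lambda>t w. fst (dir_deriv H (- t, H (t, c u0)) (0, (w, dir_deriv \<phi> u0 w)))"
  assumes \<phi>: "C2_on W \<phi>" and u0: "u0 \<in> W"
    and H: "C2_on \<Theta> H" and \<Theta>: "\<And>u. u \<in> W \<Longrightarrow> (0, c u) \<in> \<Theta>"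
    and H0: "\<And>x. (0, x) \<in> \<Theta> \<Longrightarrow> H (0, x) = x"
    and L: "C2_on \<Omega> L" and \<Omega>: "\<And>u. u \<in> W \<Longrightarrow> j u \<in> \<Omega>"
    and equivariant: "\<forall>\<^sub>F t in nhds 0.
      L (H (t, c u0), \<chi> \<mu>. snd (dir_deriv H (t, c u0) (0, (M t (axis \<mu> 1), dir_deriv \<phi> u0 (M t (axis \<mu> 1)))))) =
      L (j u0) * det (\<chi> \<mu>. M t (axis \<mu> 1))"
    and EL: "\<And>w. dir_deriv L (j u0) ((0, w), 0) =
      (\<Sum>\<mu>\<in>UNIV. dir_deriv (\<lambda>u. dir_deriv L (j u) (0, axis \<mu> w)) u0 (axis \<mu> 1))"
  shows "C1_on W J" and "(\<Sum>\<mu>\<in>UNIV. dir_deriv J u0 (axis \<mu> 1) $ \<mu>) = 0"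
proof -
  note oW = C2_onD(3)[OF \<phi>] and \<phi>1 = C2_onD(1)[OF \<phi>] and L1 = C2_onD(1)[OF L] and H1 = C2_onD(1)[OF H]
  have id: "C1_on W (\<lambda>u. u)"
    by (rule C1_on_linear(1)[OF linear_ident continuous_on_id oW])
  have c1: "C1_on W c" unfolding c_def by (rule C1_on_Pair(1)[OF id \<phi>1])
  have j1: "C1_on W j" unfolding j_def
    by (intro C1_on_Pair(1) c1 C1_on_vec oW) (simp add: C2_on_partial(1)[OF \<phi>])
  have V1: "C1_on W V" unfolding V_def
    by (intro C1_on_dir_deriv[OF H] C1_on_Pair(1) C1_on_const(1) c1 oW \<Theta>)
  have s1: "C1_on W (\<lambda>u. fst (V u))" and b1: "C1_on W (\<lambda>u. snd (V u))"
    by (intro C1_on_bounded_linear[OF bounded_linear_fst V1] C1_on_bounded_linear[OF bounded_linear_snd V1])+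
  define w where "w u = snd (V u) - dir_deriv \<phi> u (fst (V u))" for u
  have w1: "C1_on W w"
    unfolding w_def[abs_def] by (intro C1_on_diff b1 C1_on_dir_deriv[OF \<phi> id s1])
  have Lj1: "C1_on W (\<lambda>u. L (j u))" by (rule C1_on_compose(1)[OF j1 L1 \<Omega>])
  have p1: "C1_on W (\<lambda>u. dir_deriv L (j u) (0, axis \<mu> (w u)))" for \<mu>
    by (intro C1_on_dir_deriv[OF L j1] C1_on_Pair(1) C1_on_const(1) oW C1_on_bounded_linear[OF bounded_linear_axis w1] \<Omega>)
  show J1: "C1_on W J"
    unfolding J_def w_def[symmetric]
    by (intro C1_on_add C1_on_bilinear[OF bounded_bilinear_scaleR Lj1 s1] C1_on_vec oW) (simp add: p1)
  define D where "D = dir_deriv L (j u0)"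
  have D: "linear D" unfolding D_def by (rule linear_dir_deriv[OF L1 \<Omega>[OF u0]])
  define d\<phi> where "d\<phi> = dir_deriv \<phi> u0"
  have d\<phi>: "linear d\<phi>" unfolding d\<phi>_def by (rule linear_dir_deriv[OF \<phi>1 u0])
  define s b where "s = fst (V u0)" and "b = snd (V u0)"
  have V0: "V u0 = (s, b)" by (simp add: s_def b_def)
  define s' b' where "s' \<mu> = fst (dir_deriv V u0 (axis \<mu> 1))" and "b' \<mu> = snd (dir_deriv V u0 (axis \<mu> 1))" for \<mu>
  define \<phi>2 where "\<phi>2 v = (\<chi> \<mu>. dir_deriv (\<lambda>u. dir_deriv \<phi> u (axis \<mu> 1)) u0 v)" for v
  let ?line = "\<lambda>\<mu> t. u0 + t *\<^sub>R axis \<mu> 1"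
  have dj: "dir_deriv j u0 v = ((v, d\<phi> v), \<phi>2 v)" for v
  proof (rule dir_deriv_eqI)
    have "((\<lambda>t. \<chi> \<mu>. dir_deriv \<phi> (u0 + t *\<^sub>R v) (axis \<mu> 1)) has_vector_derivative \<phi>2 v) (at 0)"
      by (rule has_vector_derivative_vec)
        (simp add: \<phi>2_def C1_line_deriv[OF C2_on_partial(1)[OF \<phi>] u0])
    then have "has_dir_deriv (\<lambda>u. \<chi> \<mu>. dir_deriv \<phi> u (axis \<mu> 1)) (\<phi>2 v) u0 v"
      unfolding has_dir_deriv_iff_has_vector_derivative .
    then show "has_dir_deriv j ((v, d\<phi> v), \<phi>2 v) u0 v"
      unfolding j_def c_def d\<phi>_def
      by (intro has_dir_deriv_Pair C1_onD(3)[OF \<phi>1 u0] has_dir_deriv_linear[OF linear_ident])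
  qed
  have dj_lin: "linear (dir_deriv j u0)" by (rule linear_dir_deriv[OF j1 u0])
  \<comment> \<open>Differentiating \<open>\<phi>\<close> along \<open>s\<close> and then along an
    axis is replaced by the opposite order, the one in which the jet itself varies.\<close>
  have \<phi>2_sym: "dir_deriv (\<lambda>u. dir_deriv \<phi> u s) u0 (axis \<mu> 1) = \<phi>2 s $ \<mu>" for \<mu>
    unfolding \<phi>2_def by (simp add: mixed_dir_deriv_commute[OF \<phi> u0, of s])
  have dV: "((\<lambda>t. V (?line \<mu> t)) has_vector_derivative (s' \<mu>, b' \<mu>)) (at 0)" for \<mu>
    using C1_line_deriv[OF V1 u0] by (simp add: s'_def b'_def)
  have ds: "((\<lambda>t. fst (V (?line \<mu> t))) has_vector_derivative s' \<mu>) (at 0)"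
    and db: "((\<lambda>t. snd (V (?line \<mu> t))) has_vector_derivative b' \<mu>) (at 0)" for \<mu>
    using bounded_linear.has_vector_derivative[OF bounded_linear_fst dV[of \<mu>]]
      bounded_linear.has_vector_derivative[OF bounded_linear_snd dV[of \<mu>]] by simp_all
  have line: "(?line \<mu> has_vector_derivative axis \<mu> 1) (at 0)" for \<mu>
    by (auto intro!: derivative_eq_intros)
  have dw: "((\<lambda>t. w (?line \<mu> t)) has_vector_derivative b' \<mu> - (\<phi>2 s $ \<mu> + d\<phi> (s' \<mu>))) (at 0)" for \<mu>
    using has_vector_derivative_diff[OF db[of \<mu>] C2_curve_deriv[OF \<phi> line[of \<mu>] ds[of \<mu>]]] u0
    by (simp add: w_def s_def[symmetric] \<phi>2_sym d\<phi>_def)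
  have djl: "((\<lambda>t. j (?line \<mu> t)) has_vector_derivative dir_deriv j u0 (axis \<mu> 1)) (at 0)" for \<mu>
    by (rule C1_line_deriv[OF j1 u0])
  have dL: "((\<lambda>t. L (j (?line \<mu> t))) has_vector_derivative D (dir_deriv j u0 (axis \<mu> 1))) (at 0)" for \<mu>
    using C1_curve_deriv[OF L1 djl[of \<mu>]] \<Omega>[OF u0] by (simp add: D_def)
  define E where "E \<mu> = dir_deriv (\<lambda>u. dir_deriv L (j u) (0, axis \<mu> (w u0))) u0 (axis \<mu> 1)" for \<mu>
  have dp: "((\<lambda>t. dir_deriv L (j (?line \<mu> t)) (0, axis \<mu> (w (?line \<mu> t)))) has_vector_derivative
      E \<mu> + D (0, axis \<mu> (b' \<mu> - (\<phi>2 s $ \<mu> + d\<phi> (s' \<mu>))))) (at 0)" for \<mu>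
  proof -
    have k: "((\<lambda>t. (0 :: (real^'n) \<times> 'v, axis \<mu> (w (?line \<mu> t)) :: 'v^'n)) has_vector_derivative
        (0, axis \<mu> (b' \<mu> - (\<phi>2 s $ \<mu> + d\<phi> (s' \<mu>))))) (at 0)"
      using bounded_linear.has_vector_derivative[OF bounded_linear_axis dw[of \<mu>]]
      unfolding has_dir_deriv_real[symmetric]
      by (intro has_dir_deriv_Pair) (simp_all add: has_dir_deriv_def)
    have "E \<mu> = dir_deriv (\<lambda>p. dir_deriv L p (0, axis \<mu> (w u0))) (j u0) (dir_deriv j u0 (axis \<mu> 1))"
      unfolding E_def by (rule C1_on_compose(2)[OF j1 C2_on_partial(1)[OF L] \<Omega> u0])
    with C2_curve_deriv[OF L djl[of \<mu>] k] \<Omega>[OF u0] show ?thesis by (simp add: D_def)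
  qed
  have dJ: "dir_deriv J u0 (axis \<mu> 1) $ \<mu> =
      L (j u0) * (s' \<mu> $ \<mu>) + D (dir_deriv j u0 (axis \<mu> 1)) * s $ \<mu> +
      (E \<mu> + D (0, axis \<mu> (b' \<mu> - (\<phi>2 s $ \<mu> + d\<phi> (s' \<mu>)))))" for \<mu>
  proof -
    have "((\<lambda>t. J (?line \<mu> t) $ \<mu>) has_vector_derivative dir_deriv J u0 (axis \<mu> 1) $ \<mu>) (at 0)"
      by (rule bounded_linear.has_vector_derivative[OF bounded_linear_vec_nth C1_line_deriv[OF J1 u0]])
    moreover have "((\<lambda>t. L (j (?line \<mu> t)) * fst (V (?line \<mu> t)) $ \<mu> +
        dir_deriv L (j (?line \<mu> t)) (0, axis \<mu> (w (?line \<mu> t)))) has_vector_derivative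
        (L (j (?line \<mu> 0)) * (s' \<mu> $ \<mu>) + D (dir_deriv j u0 (axis \<mu> 1)) * fst (V (?line \<mu> 0)) $ \<mu>) +
        (E \<mu> + D (0, axis \<mu> (b' \<mu> - (\<phi>2 s $ \<mu> + d\<phi> (s' \<mu>)))))) (at 0)"
      by (intro has_vector_derivative_add has_vector_derivative_mult dL dp
          bounded_linear.has_vector_derivative[OF bounded_linear_vec_nth ds])
    ultimately show ?thesis
      by (simp add: J_def w_def[symmetric] s_def[symmetric]) (rule vector_derivative_unique_at)
  qed
  define dv where "dv = (\<Sum>\<mu>\<in>UNIV. s' \<mu> $ \<mu>)"
  have sum1: "(\<Sum>\<mu>\<in>UNIV. D (dir_deriv j u0 (axis \<mu> 1)) * s $ \<mu>) = D ((s, d\<phi> s), \<phi>2 s)"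
  proof -
    have "s = (\<Sum>\<mu>\<in>UNIV. (s $ \<mu>) *\<^sub>R axis \<mu> 1)"
      by (simp add: basis_expansion flip: scalar_mult_eq_scaleR)
    then have "D (dir_deriv j u0 s) = D (dir_deriv j u0 (\<Sum>\<mu>\<in>UNIV. (s $ \<mu>) *\<^sub>R axis \<mu> 1))" by (rule arg_cong)
    also have "\<dots> = (\<Sum>\<mu>\<in>UNIV. D (dir_deriv j u0 (axis \<mu> 1)) * s $ \<mu>)"
      unfolding linear_sum[OF dj_lin] linear_scale[OF dj_lin] linear_sum[OF D] linear_scale[OF D]
      by (simp add: mult.commute)
    finally show ?thesis by (simp add: dj)
  qed
  have sum2: "(\<Sum>\<mu>\<in>UNIV. E \<mu>) = D ((0, b - d\<phi> s), 0)"
    using EL[of "w u0"] unfolding E_def by (simp add: w_def s_def b_def D_def d\<phi>_def)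
  have sum3: "(\<Sum>\<mu>\<in>UNIV. D (0, axis \<mu> (x \<mu>))) = D (0, \<chi> \<mu>. x \<mu>)" for x :: "'n \<Rightarrow> 'v"
  proof -
    have "(\<Sum>\<mu>\<in>UNIV. D (0, axis \<mu> (x \<mu>))) = D (\<Sum>\<mu>\<in>UNIV. (0, axis \<mu> ((\<chi> \<mu>. x \<mu>) $ \<mu>)))"
      by (simp add: linear_sum[OF D])
    also have "(\<Sum>\<mu>\<in>UNIV. (0 :: (real^'n) \<times> 'v, axis \<mu> ((\<chi> \<mu>. x \<mu>) $ \<mu>))) = (0, \<chi> \<mu>. x \<mu>)"
      by (simp add: prod_eq_iff fst_sum snd_sum sum_axis del: vec_lambda_beta)
    finally show ?thesis .
  qed
  \<comment> \<open>The \<open>\<phi>2 s\<close> from the chain rule along \<open>s\<close> cancels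
    the one in the derivative of \<open>w\<close>. What remains is the prolonged generator at the
    jet.\<close>
  have divJ: "(\<Sum>\<mu>\<in>UNIV. dir_deriv J u0 (axis \<mu> 1) $ \<mu>) =
      L (j u0) * dv + D ((s, b), \<chi> \<mu>. b' \<mu> - d\<phi> (s' \<mu>))"
  proof -
    have "(\<Sum>\<mu>\<in>UNIV. dir_deriv J u0 (axis \<mu> 1) $ \<mu>) = L (j u0) * dv +
        (D ((s, d\<phi> s), \<phi>2 s) + (D ((0, b - d\<phi> s), 0) + D (0, \<chi> \<mu>. b' \<mu> - (\<phi>2 s $ \<mu> + d\<phi> (s' \<mu>)))))"
      by (simp only: dJ sum.distrib sum1 sum2 sum3 dv_def sum_distrib_left add.assoc)
    also have "D ((s, d\<phi> s), \<phi>2 s) + (D ((0, b - d\<phi> s), 0) + D (0, \<chi> \<mu>. b' \<mu> - (\<phi>2 s $ \<mu> + d\<phi> (s' \<mu>)))) =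
        D (((s, d\<phi> s), \<phi>2 s) + (((0, b - d\<phi> s), 0) + (0, \<chi> \<mu>. b' \<mu> - (\<phi>2 s $ \<mu> + d\<phi> (s' \<mu>)))))"
      by (simp only: linear_add[OF D])
    also have "((s, d\<phi> s), \<phi>2 s) + (((0, b - d\<phi> s), 0) + (0, \<chi> \<mu>. b' \<mu> - (\<phi>2 s $ \<mu> + d\<phi> (s' \<mu>)))) =
        ((s, b), \<chi> \<mu>. b' \<mu> - d\<phi> (s' \<mu>))"
      by (simp add: prod_eq_iff vec_eq_iff)
    finally show ?thesis by (simp add: add.assoc)
  qed
  define x0 where "x0 = c u0"
  have \<Theta>0: "(0, x0) \<in> \<Theta>" using \<Theta>[OF u0] by (simp add: x0_def)
  have Hx0: "H (0, x0) = x0" by (rule H0[OF \<Theta>0])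
  \<comment> \<open>At time 0 the flow is the identity on a neighbourhood of \<open>x0\<close>,
    hence so is its derivative at fixed time.\<close>
  have H_fib: "\<forall>\<^sub>F r in nhds 0. dir_deriv H (0, x0 + r *\<^sub>R z) (0, x) = x" for x z
  proof -
    have "\<forall>\<^sub>F r in nhds 0. (0, x0 + r *\<^sub>R z) \<in> \<Theta>"
      using curve_eventually_in[OF curve_diff_line[of "(0, x0)" "(0, z)"] C2_onD(3)[OF H]] \<Theta>0 by simp
    then show ?thesis
    proof eventually_elim
      case (elim r)
      let ?y = "x0 + r *\<^sub>R z"
      have "\<forall>\<^sub>F q in nhds 0. (0, ?y + q *\<^sub>R x) \<in> \<Theta>"
        using curve_eventually_in[OF curve_diff_line[of "(0, ?y)" "(0, x)"] C2_onD(3)[OF H]] elim by simp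
      then have ev: "\<forall>\<^sub>F q in nhds 0. H (0, ?y + q *\<^sub>R x) = ?y + q *\<^sub>R x"
        by eventually_elim (rule H0)
      have "((\<lambda>q. ?y + q *\<^sub>R x) has_vector_derivative x) (at 0)"
        by (auto intro!: derivative_eq_intros)
      then have "has_dir_deriv (\<lambda>q. ?y + q *\<^sub>R x) x 0 1"
        unfolding has_dir_deriv_real .
      from iffD2[OF has_dir_deriv_cong[OF ev] this]
      have "has_dir_deriv H x (0, ?y) (0, x)"
        unfolding has_dir_deriv_real has_dir_deriv_iff_has_vector_derivative by simp
      then show ?case by (rule dir_deriv_eqI)
    qed
  qed
  have H_fib0: "dir_deriv H (0, x0) (0, x) = x" for x
    using eventually_nhds_x_imp_x[OF H_fib[of 0 x]] by simp
  have Vx: "V u0 = dir_deriv H (0, x0) (1, 0)" by (simp add: V_def x0_def)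
  have dHt: "((\<lambda>t. H (t, x0)) has_vector_derivative (s, b)) (at 0)"
    using C1_line_deriv[OF H1 \<Theta>0, of "(1, 0)"] by (simp add: V0[symmetric] Vx)
  define kk where "kk \<mu> = (0 :: real, (axis \<mu> 1 :: real^'n, d\<phi> (axis \<mu> 1)))" for \<mu>
  \<comment> \<open>Time and space derivatives of the flow commute; the result is the derivative
    along the graph of the generator.\<close>
  have mixed: "dir_deriv (\<lambda>p. dir_deriv H p (kk \<mu>)) (0, x0) (1, 0) = (s' \<mu>, b' \<mu>)" for \<mu>
  proof -
    have "dir_deriv (\<lambda>p. dir_deriv H p (kk \<mu>)) (0, x0) (1, 0) = dir_deriv (\<lambda>p. dir_deriv H p (1, 0)) (0, x0) (kk \<mu>)"
      by (rule mixed_dir_deriv_commute[OF H \<Theta>0])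
    also have "\<dots> = dir_deriv V u0 (axis \<mu> 1)"
    proof -
      have 0: "C1_on W (\<lambda>u. (0::real, c u))" by (rule C1_on_Pair(1)[OF C1_on_const(1)[OF oW] c1])
      have "dir_deriv (\<lambda>u. (0::real, c u)) u0 (axis \<mu> 1) = kk \<mu>"
        unfolding c_def kk_def d\<phi>_def
        by (intro dir_deriv_eqI has_dir_deriv_Pair C1_onD(3)[OF \<phi>1 u0] has_dir_deriv_linear[OF linear_ident])
          (simp add: has_dir_deriv_def)
      then show ?thesis
        using C1_on_compose(2)[OF 0 C2_on_partial(1)[OF H, of "(1, 0)"] \<Theta> u0, of "axis \<mu> 1"]
        by (simp add: V_def x0_def)
    qed
    finally show ?thesis by (simp add: s'_def b'_def)
  qed
  \<comment> \<open>The derivative at fixed time 0 is constant near \<open>x0\<close>, so moving the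
    point alone has no first-order effect. In \<open>dM\<close> this removes the contribution of the
    moving point \<open>H (t, x0)\<close>.\<close>
  have flat: "dir_deriv (\<lambda>p. dir_deriv H p (kk \<mu>)) (0, x0) (0, z) = 0" for \<mu> z
  proof (rule dir_deriv_eqI)
    have ev: "\<forall>\<^sub>F r in nhds 0. dir_deriv H (0, x0 + r *\<^sub>R z) (kk \<mu>) = (axis \<mu> 1, d\<phi> (axis \<mu> 1))"
      unfolding kk_def by (rule H_fib)
    have "has_dir_deriv (\<lambda>r::real. (axis \<mu> 1 :: real^'n, d\<phi> (axis \<mu> 1))) 0 0 1"
      by (simp add: has_dir_deriv_def)
    from iffD2[OF has_dir_deriv_cong[OF ev] this] show "has_dir_deriv (\<lambda>p. dir_deriv H p (kk \<mu>)) 0 (0, x0) (0, z)"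
      unfolding has_dir_deriv_real has_dir_deriv_iff_has_vector_derivative by simp
  qed
  \<comment> \<open>The minus sign comes from the time \<open>- t\<close>: \<open>M t\<close>
    belongs to the inverse flow.\<close>
  have dM: "((\<lambda>t. M t (axis \<mu> 1)) has_vector_derivative - s' \<mu>) (at 0)" for \<mu>
  proof -
    have h: "((\<lambda>t. (- t, H (t, x0))) has_vector_derivative (-1, (s, b))) (at 0)"
      unfolding has_dir_deriv_real[symmetric]
      by (intro has_dir_deriv_Pair) (simp_all only: has_dir_deriv_real dHt, auto intro!: derivative_eq_intros)
    have k: "((\<lambda>t. kk \<mu>) has_vector_derivative 0) (at 0)" by simp
    have l: "linear (dir_deriv (\<lambda>p. dir_deriv H p (kk \<mu>)) (0, x0))"
      by (rule linear_dir_deriv[OF C2_on_partial(1)[OF H] \<Theta>0])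
    have "dir_deriv (\<lambda>p. dir_deriv H p (kk \<mu>)) (0, x0) (-1, (s, b)) =
        dir_deriv (\<lambda>p. dir_deriv H p (kk \<mu>)) (0, x0) (- (1, 0) + (0, (s, b)))" by simp
    also have "\<dots> = - (s' \<mu>, b' \<mu>)"
      unfolding linear_add[OF l] linear_neg[OF l] mixed flat by simp
    finally have "((\<lambda>t. dir_deriv H (- t, H (t, x0)) (kk \<mu>)) has_vector_derivative - (s' \<mu>, b' \<mu>)) (at 0)"
      using C2_curve_deriv[OF H h k] \<Theta>0 linear_0[OF linear_dir_deriv[OF H1 \<Theta>0]] by (simp add: Hx0)
    from bounded_linear.has_vector_derivative[OF bounded_linear_fst this] show ?thesis
      by (simp add: M_def kk_def x0_def d\<phi>_def)
  qed
  have M0: "M 0 (axis \<mu> 1) = axis \<mu> 1" for \<mu>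
    using H_fib0 Hx0 by (simp add: M_def x0_def)
  have dM\<phi>: "((\<lambda>t. (0::real, (M t (axis \<mu> 1), d\<phi> (M t (axis \<mu> 1))))) has_vector_derivative (0, (- s' \<mu>, d\<phi> (- s' \<mu>)))) (at 0)" for \<mu>
  proof -
    have bl: "C1_on UNIV d\<phi>"
      unfolding d\<phi>_def
    proof (rule C1_on_linear(1)[OF linear_dir_deriv[OF \<phi>1 u0] _ open_UNIV])
      show "continuous_on UNIV (dir_deriv \<phi> u0)"
        using continuous_on_compose2[OF C1_onD(4)[OF \<phi>1], of UNIV "\<lambda>v. (u0, v)"] u0
        by (simp add: continuous_on_Pair continuous_on_id image_subset_iff)
    qed
    have "dir_deriv d\<phi> x v = d\<phi> v" for x v by (rule dir_deriv_eqI[OF has_dir_deriv_linear[OF d\<phi>]])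
    with C1_curve_deriv[OF bl dM[of \<mu>]] have "((\<lambda>t. d\<phi> (M t (axis \<mu> 1))) has_vector_derivative d\<phi> (- s' \<mu>)) (at 0)"
      by simp
    with dM[of \<mu>] show ?thesis
      unfolding has_dir_deriv_real[symmetric]
      by (intro has_dir_deriv_Pair) (simp_all add: has_dir_deriv_def)
  qed
  have dN: "((\<lambda>t. snd (dir_deriv H (t, x0) (0, (M t (axis \<mu> 1), d\<phi> (M t (axis \<mu> 1)))))) has_vector_derivative
      b' \<mu> - d\<phi> (s' \<mu>)) (at 0)" for \<mu>
  proof -
    have h: "((\<lambda>t. (t, x0)) has_vector_derivative (1, 0)) (at 0)"
      unfolding has_dir_deriv_real[symmetric]
      by (intro has_dir_deriv_Pair) (simp_all only: has_dir_deriv_real, auto intro!: derivative_eq_intros)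
    have "((\<lambda>t. dir_deriv H (t, x0) (0, (M t (axis \<mu> 1), d\<phi> (M t (axis \<mu> 1))))) has_vector_derivative
        (s' \<mu>, b' \<mu>) + (- s' \<mu>, d\<phi> (- s' \<mu>))) (at 0)"
      using C2_curve_deriv[OF H h dM\<phi>[of \<mu>]] \<Theta>0 mixed[of \<mu>] by (simp add: M0 kk_def H_fib0)
    from bounded_linear.has_vector_derivative[OF bounded_linear_snd this] show ?thesis
      by (simp add: linear_neg[OF d\<phi>])
  qed
  define Q where "Q t = (H (t, x0), \<chi> \<mu>. snd (dir_deriv H (t, x0) (0, (M t (axis \<mu> 1), d\<phi> (M t (axis \<mu> 1))))))" for t
  have dQ: "(Q has_vector_derivative ((s, b), \<chi> \<mu>. b' \<mu> - d\<phi> (s' \<mu>))) (at 0)"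
  proof -
    have "((\<lambda>t. \<chi> \<mu>. snd (dir_deriv H (t, x0) (0, (M t (axis \<mu> 1), d\<phi> (M t (axis \<mu> 1)))))) has_vector_derivative
        (\<chi> \<mu>. b' \<mu> - d\<phi> (s' \<mu>))) (at 0)"
      by (rule has_vector_derivative_vec) (simp add: dN)
    with dHt show ?thesis
      unfolding has_dir_deriv_real[symmetric] Q_def[abs_def] by (rule has_dir_deriv_Pair)
  qed
  have Q0: "Q 0 = j u0"
    unfolding Q_def Hx0 M0 H_fib0 by (simp add: j_def x0_def d\<phi>_def)
  \<comment> \<open>The curve \<open>Q\<close> of transformed jets is differentiated once by the
    chain rule and once through the determinant; comparing the two values cancels
    \<open>divJ\<close>.\<close>
  have "((\<lambda>t. L (Q t)) has_vector_derivative D ((s, b), \<chi> \<mu>. b' \<mu> - d\<phi> (s' \<mu>))) (at 0)"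
    using C1_curve_deriv[OF L1 dQ] \<Omega>[OF u0] unfolding Q0 D_def by simp
  moreover have "((\<lambda>t. L (Q t)) has_vector_derivative - (L (j u0) * dv)) (at 0)"
  proof -
    have "((\<lambda>t. det (\<chi> \<mu>. M t (axis \<mu> 1))) has_real_derivative (\<Sum>\<mu>\<in>UNIV. (- s' \<mu>) $ \<mu>)) (at 0)"
      by (rule has_real_derivative_det_identity) (simp_all add: dM M0)
    from DERIV_cmult[OF this, of "L (j u0)"]
    have rhs: "has_dir_deriv (\<lambda>t. L (j u0) * det (\<chi> \<mu>. M t (axis \<mu> 1))) (- (L (j u0) * dv)) 0 1"
      unfolding has_dir_deriv_real by (simp add: dv_def sum_negf has_real_derivative_iff_has_vector_derivative)
    have ev: "\<forall>\<^sub>F t in nhds 0. L (Q t) = L (j u0) * det (\<chi> \<mu>. M t (axis \<mu> 1))"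
      using equivariant by (simp add: Q_def x0_def d\<phi>_def)
    show ?thesis
      using iffD2[OF has_dir_deriv_cong[OF ev] rhs] unfolding has_dir_deriv_real .
  qed
  ultimately have "D ((s, b), \<chi> \<mu>. b' \<mu> - d\<phi> (s' \<mu>)) = - (L (j u0) * dv)"
    by (rule vector_derivative_unique_at)
  then show "(\<Sum>\<mu>\<in>UNIV. dir_deriv J u0 (axis \<mu> 1) $ \<mu>) = 0"
    unfolding divJ by simp
qed

section \<open>Prolongation of a section\<close>

lemma tangent_map_eq:
  "tangent_map M N f p v =
    dir_deriv (\<lambda>u. cmap (chart_at N (f p)) (f (cinv (chart_at M p) u))) (cmap (chart_at M p) p) v"
  by (simp add: tangent_map_def o_def)

locale section_setting = lagrangian X Y \<pi> \<L>
  for X :: "('x, real^'n) atlas" and Y :: "('y, (real^'n) \<times> 'v::real_normed_vector) atlas"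
    and \<pi> :: "'y \<Rightarrow> 'x" and \<L> :: "('x, 'y, real^'n, (real^'n) \<times> 'v) density" +
  fixes \<phi> :: "'x \<Rightarrow> 'y"
  assumes \<phi>: "C2_map X Y \<phi>" and \<pi>\<phi>: "\<And>x. x \<in> points X \<Longrightarrow> \<pi> (\<phi> x) = x"
begin

abbreviation j1 where "j1 x \<equiv> jet_prolongation X Y \<phi> x"

lemma j1_in_fiber:
  assumes p: "p \<in> points X"
  shows "tangent_map X Y \<phi> p \<in> jet_fiber X Y \<pi> (\<phi> p)"
  unfolding jet_fiber_def mem_Collect_eq
proof (intro conjI allI)
  show "linear (tangent_map X Y \<phi> p)" by (rule linear_tangent_map[OF X Y \<phi> p])
  fix u
  have "tangent_map Y X \<pi> (\<phi> p) (tangent_map X Y \<phi> p u) = tangent_map X X (\<lambda>p. \<pi> (\<phi> p)) p u"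
    by (rule tangent_map_compose[OF X Y X \<phi> proj p, symmetric])
  also have "tangent_map X X (\<lambda>p. \<pi> (\<phi> p)) p = tangent_map X X (\<lambda>p. p) p"
    by (rule tangent_map_cong[OF X p \<pi>\<phi>])
  also have "tangent_map X X (\<lambda>p. p) p u = u" by (rule tangent_map_id[OF X p])
  finally show "tangent_map Y X \<pi> (\<phi> p) (tangent_map X Y \<phi> p u) = u" .
qed

lemma section_dom:
  assumes a: "adapted X Y \<pi> B C" and p: "p \<in> points X" "\<phi> p \<in> cdom C"
  shows "p \<in> cdom B"
  using adaptedD(3)[OF a p(2)] \<pi>\<phi>[OF p(1)] by simp

lemma j1_coords:
  assumes a: "adapted X Y \<pi> B C" and p: "p \<in> points X" "\<phi> p \<in> cdom C"
  shows "cmap (jchart B C) (j1 p) =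
    (cmap C (\<phi> p), \<chi> \<mu>. snd (dir_deriv (\<lambda>u. cmap C (\<phi> (cinv B u))) (cmap B p) (axis \<mu> 1)))"
proof -
  note B = adaptedD(1)[OF a] section_dom[OF a p] and C = adaptedD(2)[OF a] p(2)
  have "coord_comp Y C (\<phi> p) (tangent_map X Y \<phi> p (coord_vec X B p w)) =
      dir_deriv (\<lambda>u. cmap C (\<phi> (cinv B u))) (cmap B p) w" for w
    using tangent_map_chart[OF X Y \<phi> B C] by (simp add: X.coord_comp_vec(1)[OF B])
  then show ?thesis
    by (simp add: jet_prolongation_def cmap_jchart \<pi>\<phi>[OF p(1)])
qed

lemma fst_dir_deriv:
  fixes f :: "'e::real_normed_vector \<Rightarrow> 'b::real_normed_vector \<times> 'c::real_normed_vector"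
  assumes "has_dir_deriv f l x v"
  shows "has_dir_deriv (\<lambda>u. fst (f u)) (fst l) x v" "has_dir_deriv (\<lambda>u. snd (f u)) (snd l) x v"
  using assms unfolding has_dir_deriv_iff_has_vector_derivative
  by (rule bounded_linear.has_vector_derivative[OF bounded_linear_fst],
      rule bounded_linear.has_vector_derivative[OF bounded_linear_snd])

text \<open>The prolongation covers \<open>\<phi>\<close> and the Legendre transformation covers the
  identity of \<open>Y\<close>. In the selected charts this is a statement about first components of
  derivatives, each obtained once the full derivative is known to exist.\<close>

lemma tangent_chain:
  assumes p: "p \<in> points X"
  shows "tangent_map (dual_atlas X Y \<pi>) Y fst (legendre X Y \<pi> \<L> (j1 p))
      (tangent_map (jet_atlas X Y \<pi>) (dual_atlas X Y \<pi>) (legendre X Y \<pi> \<L>) (j1 p)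
        (tangent_map X (jet_atlas X Y \<pi>) (jet_prolongation X Y \<phi>) p v)) =
    tangent_map X Y \<phi> p v"
proof -
  let ?y = "\<phi> p" and ?\<gamma> = "tangent_map X Y \<phi> p"
  have yp: "?y \<in> points Y" using C2_mapD(1)[OF \<phi> p] .
  note \<gamma> = j1_in_fiber[OF p]
  have j: "j1 p = (?y, ?\<gamma>)" by (simp add: jet_prolongation_def)
  let ?X = "chart_at X p" and ?Y = "chart_at Y ?y"
  note CX = X.chart_at_max[OF p] chart_at(2)[OF p] and CY = Y.chart_at_max[OF yp] chart_at(2)[OF yp]
  obtain B1 C1 where a1: "adapted X Y \<pi> B1 C1" and y1: "?y \<in> cdom C1"
    and ch1: "chart_at (jet_atlas X Y \<pi>) (?y, ?\<gamma>) = jchart B1 C1"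
    by (rule chart_at_jet[OF yp \<gamma>])
  note C1 = adaptedD(2)[OF a1] and B1 = adaptedD(1)[OF a1] section_dom[OF a1 p y1]
  define w1 where "w1 = tangent_map X (jet_atlas X Y \<pi>) (jet_prolongation X Y \<phi>) p v"
  let ?f1 = "\<lambda>u. cmap (jchart B1 C1) (j1 (cinv ?X u))"
  have w1_def': "w1 = dir_deriv ?f1 (cmap ?X p) v"
    unfolding w1_def tangent_map_eq[where N = "jet_atlas X Y \<pi>"] j ch1 ..
  let ?U1 = "cmap ?X ` (cdom ?X \<inter> \<phi> -` cdom C1)"
  let ?g1 = "\<lambda>u. cmap C1 (\<phi> (cinv ?X u))"
  have g1: "C2_on ?U1 ?g1" by (rule C2_mapD(2)[OF \<phi> CX(1) C1])
  have u1: "cmap ?X p \<in> ?U1" using CX(2) y1 by blast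
  have dom: "cinv ?X u \<in> points X \<and> cinv ?X u \<in> cdom ?X \<and> \<phi> (cinv ?X u) \<in> cdom C1" if "u \<in> ?U1" for u
  proof -
    from that obtain q where q: "q \<in> cdom ?X" "\<phi> q \<in> cdom C1" "u = cmap ?X q" by blast
    then show ?thesis using max_atlasD(1)[OF CX(1)] by (auto simp: max_atlasD(6)[OF CX(1)])
  qed
  have f1: "?f1 u = (?g1 u, \<chi> \<mu>. snd (dir_deriv (\<lambda>u. cmap C1 (\<phi> (cinv B1 u))) (cmap B1 (cinv ?X u)) (axis \<mu> 1)))"
    if "u \<in> ?U1" for u
    using dom[OF that] by (intro j1_coords[OF a1]) blast+
  have line: "\<forall>\<^sub>F t in nhds 0. cmap ?X p + t *\<^sub>R v \<in> ?U1"
    using curve_eventually_in[OF curve_diff_line C2_onD(3)[OF g1]] u1 by simp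
  \<comment> \<open>Existence of the whole derivative comes first: only then is
    \<open>fst w1\<close> the derivative of the first component.\<close>
  have d1: "has_dir_deriv ?f1 w1 (cmap ?X p) v"
    unfolding w1_def'
  proof (rule curve_diff_dir, rule curve_diff_cong)
    show "\<forall>\<^sub>F t in nhds 0. ?f1 (cmap ?X p + t *\<^sub>R v) = (?g1 (cmap ?X p + t *\<^sub>R v),
        \<chi> \<mu>. snd (dir_deriv (\<lambda>u. cmap C1 (\<phi> (cinv B1 u))) (cmap B1 (cinv ?X (cmap ?X p + t *\<^sub>R v))) (axis \<mu> 1)))"
      using line by eventually_elim (rule f1)
    have tr: "C2_on (cmap ?X ` (cdom ?X \<inter> cdom B1)) (\<lambda>u. cmap B1 (cinv ?X u))"
      using C2_mapD(2)[OF C2_map_id[OF X] CX(1) B1(1)] by simp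
    have "(\<lambda>t. cmap B1 (cinv ?X (cmap ?X p + t *\<^sub>R v))) differentiable (at 0)"
      by (rule C1_curve_diff[OF C2_onD(1)[OF tr] curve_diff_line]) (use CX(2) B1(2) in simp)
    from C2_curve_diff[OF C2_mapD(2)[OF \<phi> B1(1) C1] this differentiable_const]
    have "(\<lambda>t. dir_deriv (\<lambda>u. cmap C1 (\<phi> (cinv B1 u))) (cmap B1 (cinv ?X (cmap ?X p + t *\<^sub>R v))) (axis \<mu> 1)) differentiable (at 0)" for \<mu>
      using B1(2) y1 by (simp add: max_atlasD(6)[OF CX])
    then show "(\<lambda>t. (?g1 (cmap ?X p + t *\<^sub>R v),
        \<chi> \<mu>. snd (dir_deriv (\<lambda>u. cmap C1 (\<phi> (cinv B1 u))) (cmap B1 (cinv ?X (cmap ?X p + t *\<^sub>R v))) (axis \<mu> 1)))) differentiable (at 0)"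
      using u1
      by (intro curve_diff_Pair C1_curve_diff[OF C2_onD(1)[OF g1] curve_diff_line] curve_diff_vec)
        (simp_all add: curve_diff_fst_snd(2))
  qed
  have fst_w1: "fst w1 = dir_deriv ?g1 (cmap ?X p) v"
  proof -
    have "has_dir_deriv (\<lambda>u. fst (?f1 u)) (fst w1) (cmap ?X p) v" by (rule fst_dir_deriv(1)[OF d1])
    then have "dir_deriv (\<lambda>u. fst (?f1 u)) (cmap ?X p) v = fst w1" by (rule dir_deriv_eqI)
    moreover have "dir_deriv (\<lambda>u. fst (?f1 u)) (cmap ?X p) v = dir_deriv ?g1 (cmap ?X p) v"
    proof (rule dir_deriv_cong)
      show "\<forall>\<^sub>F u in nhds (cmap ?X p). fst (?f1 u) = ?g1 u"
        using eventually_nhds_in_open[OF C2_onD(3)[OF g1] u1] by eventually_elim (simp add: f1)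
    qed
    ultimately show ?thesis by simp
  qed
  have yl: "fst (legendre X Y \<pi> \<L> q) = fst q" for q
    by (simp add: legendre_def case_prod_beta)
  \<comment> \<open>A third pair, over a chart of \<open>X\<close>, gives access to
    \<open>legendre_coords\<close>, which shows that the image lies in the fibre of
    \<open>Z\<close>.\<close>
  have "\<pi> ?y \<in> points X" using p by (simp add: \<pi>\<phi>)
  then obtain B where B: "B \<in> X" "\<pi> ?y \<in> cdom B" unfolding points_def by blast
  obtain C where a: "adapted X Y \<pi> B C" and yC: "?y \<in> cdom C" using ex_adapted[OF yp B] by blast
  define z where "z = snd (legendre X Y \<pi> \<L> (?y, ?\<gamma>))"
  have leg: "legendre X Y \<pi> \<L> (?y, ?\<gamma>) = (?y, z)"
    unfolding z_def using yl[of "(?y, ?\<gamma>)"] by (simp add: prod_eq_iff)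
  have z: "z \<in> dual_fiber X Y \<pi> ?y"
    unfolding z_def legendre_coords[OF a B(1) yC \<gamma>] snd_conv
    by (rule dual_fiberI[OF a yC vertical_affine_form[OF linear_momentum(2)[OF a B(1)]]])
      (simp add: cmap_jchart yC)
  obtain B2 C2 where a2: "adapted X Y \<pi> B2 C2" and y2: "?y \<in> cdom C2"
    and ch2: "chart_at (dual_atlas X Y \<pi>) (?y, z) = dchart C2"
    by (rule chart_at_dual[OF yp z])
  note C2 = adaptedD(2)[OF a2]
  define w2 where "w2 = tangent_map (jet_atlas X Y \<pi>) (dual_atlas X Y \<pi>) (legendre X Y \<pi> \<L>) (?y, ?\<gamma>) w1"
  let ?q1 = "cmap (jchart B1 C1) (?y, ?\<gamma>)"
  let ?f2 = "\<lambda>q. cmap (dchart C2) (legendre X Y \<pi> \<L> (cinv (jchart B1 C1) q))"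
  let ?g2 = "\<lambda>u. cmap C2 (cinv C1 u)"
  have w2_def': "w2 = dir_deriv ?f2 ?q1 w1"
    unfolding w2_def tangent_map_eq[where M = "jet_atlas X Y \<pi>"] leg ch1 ch2 ..
  have q1: "fst ?q1 = cmap C1 ?y" by (simp add: cmap_jchart)
  have g2: "C2_on (cmap C1 ` (cdom C1 \<inter> cdom C2)) ?g2" by (rule chart_transition_C2[OF C1 C2])
  have cinv1: "cinv (jchart B1 C1) q = (cinv C1 (fst q), jet_of B1 C1 (cinv C1 (fst q)) (snd q))"
    if "fst q \<in> cmap C1 ` cdom C1" for q
    using cinv_jchart[OF a1 max_atlasD(7)[OF C1 that], of "snd q"] max_atlasD(8)[OF C1 that] by simp
  have o1: "open (cmap C1 ` cdom C1)" by (rule max_atlasD(3)[OF C1])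
  have d2: "has_dir_deriv ?f2 w2 ?q1 w1"
    unfolding w2_def'
  proof (rule curve_diff_dir, rule curve_diff_cong)
    have "\<forall>\<^sub>F t in nhds 0. fst ?q1 + t *\<^sub>R fst w1 \<in> cmap C1 ` cdom C1"
      using curve_eventually_in[OF curve_diff_line o1] y1 by (simp add: q1)
    then show "\<forall>\<^sub>F t in nhds 0. ?f2 (?q1 + t *\<^sub>R w1) = cmap (dchart C2) (legendre X Y \<pi> \<L>
        (cinv C1 (fst ?q1 + t *\<^sub>R fst w1), jet_of B1 C1 (cinv C1 (fst ?q1 + t *\<^sub>R fst w1)) (snd ?q1 + t *\<^sub>R snd w1)))"
    proof eventually_elim
      case (elim t)
      show ?case using cinv1[of "?q1 + t *\<^sub>R w1"] elim by simp
    qed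
    show "(\<lambda>t. cmap (dchart C2) (legendre X Y \<pi> \<L> (cinv C1 (fst ?q1 + t *\<^sub>R fst w1),
        jet_of B1 C1 (cinv C1 (fst ?q1 + t *\<^sub>R fst w1)) (snd ?q1 + t *\<^sub>R snd w1)))) differentiable (at 0)"
      by (rule legendre_diff[OF a1 a2 curve_diff_line curve_diff_line]) (use y1 y2 in \<open>simp add: q1\<close>)
  qed
  have fst_w2: "fst w2 = dir_deriv ?g2 (cmap C1 ?y) (fst w1)"
  proof -
    have f2: "has_dir_deriv (\<lambda>q. fst (?f2 q)) (fst w2) ?q1 w1" by (rule fst_dir_deriv(1)[OF d2])
    have ev: "\<forall>\<^sub>F q in nhds ?q1. fst (?f2 q) = ?g2 (fst q)"
    proof -
      have "\<forall>\<^sub>F q in nhds ?q1. q \<in> (cmap C1 ` cdom C1) \<times> UNIV"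
        using o1 y1 by (intro eventually_nhds_in_open open_Times) (auto simp: mem_Times_iff q1)
      then show ?thesis
      proof eventually_elim
        case (elim q)
        then have "fst q \<in> cmap C1 ` cdom C1" by (simp add: mem_Times_iff)
        from cinv1[OF this] show ?case
          by (simp add: dual_chart_def case_prod_beta yl)
      qed
    qed
    have e1: "has_dir_deriv (\<lambda>q. ?g2 (fst q)) (fst w2) ?q1 w1"
      by (rule iffD1[OF has_dir_deriv_cong[OF ev] f2])
    have e2: "has_dir_deriv (\<lambda>q. ?g2 (fst q)) (dir_deriv ?g2 (fst ?q1) (fst w1)) ?q1 w1"
      by (rule has_dir_deriv_compose[OF has_dir_deriv_linear[OF linear_fst] C2_onD(1)[OF g2]])
        (use y1 y2 in \<open>simp add: q1\<close>)
    show ?thesis using dir_deriv_eqI[OF e1] dir_deriv_eqI[OF e2] unfolding q1 by simp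
  qed
  have "tangent_map (dual_atlas X Y \<pi>) Y fst (?y, z) w2 =
      dir_deriv (\<lambda>u. cmap ?Y (cinv C2 u)) (cmap C2 ?y) (dir_deriv ?g2 (cmap C1 ?y) (dir_deriv ?g1 (cmap ?X p) v))"
    unfolding tangent_fst[OF a2 y2 ch2] fst_w2 fst_w1 ..
  also have "\<dots> = dir_deriv (\<lambda>u. cmap ?Y (\<phi> (cinv ?X u))) (cmap ?X p) v"
    by (simp only: dir_deriv_chart_compose[OF \<phi> C2_map_id[OF Y] CX C1 y1 C2 y2, symmetric]
        dir_deriv_chart_compose[OF \<phi> C2_map_id[OF Y] CX C2 y2 CY, symmetric])
  also have "\<dots> = tangent_map X Y \<phi> p v"
    by (simp add: tangent_map_def o_def)
  finally show ?thesis unfolding w2_def w1_def j leg .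
qed

end

section \<open>The flow of an infinitesimal symmetry\<close>

lemma points_vs_atlas: "points vs_atlas = UNIV"
  by (simp add: points_def vs_atlas_def)

lemma chart_at_vs: "chart_at vs_atlas p = (UNIV, \<lambda>v. v)"
  unfolding chart_at_def vs_atlas_def by (rule some_equality) auto

lemma inv_into_ident: "inv_into UNIV (\<lambda>v. v) u = u"
  using inv_into_f_f[of "\<lambda>v. v" UNIV u] by (simp add: inj_on_def)

lemma velocity_eq: "velocity M c = dir_deriv (\<lambda>t. cmap (chart_at M (c 0)) (c t)) 0 1"
  by (simp add: velocity_def tangent_map_def chart_at_vs o_def inv_into_ident)

locale symmetry_setting = section_setting X Y \<pi> \<L> \<phi>
  for X :: "('x, real^'n) atlas" and Y :: "('y, (real^'n) \<times> 'v::real_normed_vector) atlas"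
    and \<pi> :: "'y \<Rightarrow> 'x" and \<L> :: "('x, 'y, real^'n, (real^'n) \<times> 'v) density" and \<phi> :: "'x \<Rightarrow> 'y" +
  fixes G :: "('g, 'm) monoid_scheme" and A :: "('g, 'a::locally_convex_space) atlas"
    and ex :: "'a \<Rightarrow> 'g" and act :: "'g \<Rightarrow> 'y \<Rightarrow> 'y" and actX :: "'g \<Rightarrow> 'x \<Rightarrow> 'x" and \<xi> :: 'a
  assumes lie: "lie_group G A" and expo: "exponential_map G A ex"
    and acts: "acts_by_bundle_automorphisms G A X Y \<pi> act actX"
    and equi: "equivariant G X Y \<pi> act actX \<L>"
begin

section \<open>The one-parameter group of bundle automorphisms\<close>

abbreviation g where "g t \<equiv> ex (t *\<^sub>R \<xi>)"
abbreviation f where "f t \<equiv> act (g t)"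

lemma group: "group G" and A_pts: "points A = carrier G" and A_man: "smooth_manifold A"
  using lie unfolding lie_group_def by auto

lemma g_smooth: "smooth_map vs_atlas A (\<lambda>t::real. g t)" and g_add: "g (s + t) = g s \<otimes>\<^bsub>G\<^esub> g t"
  using expo unfolding exponential_map_def by auto

lemma g_carrier: "g t \<in> carrier G"
proof -
  have "(\<lambda>t::real. g t) ` points vs_atlas \<subseteq> points A" using g_smooth unfolding smooth_map_def by blast
  then show ?thesis unfolding A_pts points_vs_atlas by blast
qed

lemma g_zero: "g 0 = \<one>\<^bsub>G\<^esub>"
proof -
  interpret G: group G by (rule group)
  have "g 0 \<otimes>\<^bsub>G\<^esub> g 0 = g 0" using g_add[of 0 0] by simp
  then show ?thesis using G.l_cancel_one[OF g_carrier g_carrier] by blast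
qed

lemma action: "group_action G (points Y) act"
  and act_smooth: "smooth_map (prod_atlas A Y) Y (\<lambda>(g, y). act g y)"
  and actX_diff: "diffeomorphism X X (actX (g t))"
  and act_cover: "y \<in> points Y \<Longrightarrow> \<pi> (f t y) = actX (g t) (\<pi> y)"
  using acts g_carrier unfolding acts_by_bundle_automorphisms_def by auto

lemma f_points: "y \<in> points Y \<Longrightarrow> f t y \<in> points Y"
  using group_action.element_image[OF action g_carrier] by blast

lemma f_zero: "y \<in> points Y \<Longrightarrow> f 0 y = y"
  using group_action.id_eq_one[OF action] unfolding g_zero by (metis restrict_apply')

lemma f_add: "y \<in> points Y \<Longrightarrow> f (s + t) y = f s (f t y)"
  unfolding g_add by (rule group_action.composition_rule[OF action _ g_carrier g_carrier])

lemma f_neg: "y \<in> points Y \<Longrightarrow> f t (f (- t) y) = y" "y \<in> points Y \<Longrightarrow> f (- t) (f t y) = y"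
  using f_add[of y t "- t"] f_add[of y "- t" t] f_zero[of y] by simp_all

lemma f_inv:
  assumes y: "y \<in> points Y"
  shows "inv_into (points Y) (f t) y = f (- t) y"
proof (rule inv_into_f_eq)
  show "inj_on (f t) (points Y)" by (rule inj_on_inverseI[of _ "f (- t)"]) (rule f_neg(2))
  show "f (- t) y \<in> points Y" using y by (rule f_points)
  show "f t (f (- t) y) = y" using y by (rule f_neg(1))
qed

text \<open>The maps on the base are tied to those on \<open>Y\<close> by the covering relation;
  projecting the flow at the opposite time yields the inverse.\<close>

lemma actX_inv:
  assumes y: "y \<in> points Y"
  shows "inv_into (points X) (actX (g t)) (\<pi> y) = \<pi> (f (- t) y)"
proof (rule inv_into_f_eq)
  show "inj_on (actX (g t)) (points X)"
    using actX_diff unfolding diffeomorphism_def by (blast dest: bij_betw_imp_inj_on)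
  show "\<pi> (f (- t) y) \<in> points X" by (rule C2_mapD(1)[OF proj f_points[OF y]])
  show "actX (g t) (\<pi> (f (- t) y)) = \<pi> y"
    using act_cover[OF f_points[OF y], of t "- t"] f_neg(1)[OF y] by simp
qed

text \<open>The flow is the one-parameter subgroup in a chart of the group followed by the action
  map. The model space of the group is only passed through: \<open>smooth_curve_C2_on\<close> treats
  the map into it, and the map out of it has a normed target.\<close>

lemma flow_C2:
  assumes C: "C \<in> max_atlas Y" and D: "D \<in> max_atlas Y"
  shows "C2_on {p. snd p \<in> cmap C ` cdom C \<and> f (fst p) (cinv C (snd p)) \<in> cdom D}
    (\<lambda>p. cmap D (f (fst p) (cinv C (snd p))))"
proof (rule C2_on_local)
  fix p0 assume "p0 \<in> {p. snd p \<in> cmap C ` cdom C \<and> f (fst p) (cinv C (snd p)) \<in> cdom D}"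
  then obtain t0 y0 where p0: "p0 = (t0, cmap C y0)" "y0 \<in> cdom C" "f t0 y0 \<in> cdom D"
    by (auto simp: prod_eq_iff max_atlasD(6)[OF C])
  have y0: "y0 \<in> points Y" using max_atlasD(1)[OF C] p0(2) by blast
  have fy0: "f t0 y0 \<in> points Y" by (rule f_points[OF y0])
  have "g t0 \<in> points A" unfolding A_pts by (rule g_carrier)
  then have A1: "chart_at A (g t0) \<in> A" "g t0 \<in> cdom (chart_at A (g t0))" by (rule chart_at)+
  let ?A = "chart_at A (g t0)" and ?C = "chart_at Y y0" and ?D = "chart_at Y (f t0 y0)"
  have Am: "?A \<in> max_atlas A" by (rule smooth_manifold_max_atlas[OF A_man A1(1)])
  note C' = Y.chart_at_max[OF y0] chart_at[OF y0] and D' = Y.chart_at_max[OF fy0] chart_at[OF fy0]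
  define P :: "('g \<times> 'y, 'a \<times> ((real^'n) \<times> 'v)) chart" where
    "P = (cdom ?A \<times> cdom ?C, \<lambda>(a, b). (cmap ?A a, cmap ?C b))"
  have P: "P \<in> prod_atlas A Y"
    unfolding prod_atlas_def P_def
    using A1(1) C'(2) by (intro image_eqI[where x = "(?A, ?C)"]) auto
  have Pinj: "inj_on (cmap P) (cdom P)"
    using max_atlasD(2)[OF Am] max_atlasD(2)[OF C'(1)] by (auto simp: P_def inj_on_def)
  let ?act = "\<lambda>(g, y). act g y"
  define I where "I = {t::real. g t \<in> cdom ?A}"
  have "smooth_on (cmap (UNIV, \<lambda>v. v) ` (cdom (UNIV, \<lambda>v. v) \<inter> (\<lambda>t::real. g t) -` cdom ?A))
      (cmap ?A \<circ> (\<lambda>t. g t) \<circ> cinv (UNIV, \<lambda>v. v))"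
    using g_smooth A1(1) unfolding smooth_map_def vs_atlas_def by blast
  then have "smooth_on I (\<lambda>t. cmap ?A (g t))"
    by (simp add: I_def vimage_def o_def inv_into_ident)
  then have s0: "C2_on I (\<lambda>t. cmap ?A (g t))" by (rule smooth_curve_C2_on)
  define U1 where "U1 = I \<times> cmap C ` (cdom C \<inter> cdom ?C)"
  define U2 where "U2 = cmap P ` (cdom P \<inter> ?act -` cdom ?D)"
  define U3 where "U3 = cmap ?D ` (cdom ?D \<inter> cdom D)"
  \<comment> \<open>The summands 0 fit the shape of \<open>C2_on_affine\<close>, which is used with
    the projections because one target is not normed.\<close>
  define h1 where "h1 = (\<lambda>p. (cmap ?A (g (0 + fst p)), cmap ?C (cinv C (0 + snd p))))"
  define h2 where "h2 = (\<lambda>u. cmap ?D (?act (cinv P u)))"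
  define h3 where "h3 = (\<lambda>u. cmap D (cinv ?D u))"
  note t1 = chart_transition_C2[OF C C'(1)]
  have oU1: "open U1" unfolding U1_def by (rule open_Times[OF C2_onD(3)[OF s0] C2_onD(3)[OF t1]])
  have s1: "C2_on U1 h1"
    unfolding h1_def
  proof (rule C2_on_Pair)
    show "C2_on U1 (\<lambda>p. cmap ?A (g (0 + fst p)))"
      by (rule C2_on_affine[OF s0 linear_fst _ oU1]) (auto simp: U1_def intro: continuous_intros)
    show "C2_on U1 (\<lambda>p. cmap ?C (cinv C (0 + snd p)))"
      by (rule C2_on_affine[OF t1 linear_snd _ oU1]) (auto simp: U1_def intro: continuous_intros)
  qed
  have "smooth_on U2 (cmap ?D \<circ> ?act \<circ> cinv P)"
    using act_smooth P D'(2) unfolding smooth_map_def U2_def by blast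
  then have s2: "C2_on U2 h2" unfolding h2_def o_def by (rule smooth_on_C2_on)
  have s3: "C2_on U3 h3" unfolding U3_def h3_def by (rule chart_transition_C2[OF D'(1) D])
  define V1 where "V1 = {u \<in> U1. h1 u \<in> U2}"
  define V where "V = {u \<in> V1. h2 (h1 u) \<in> U3}"
  have oV1: "open V1"
    using continuous_open_preimage[OF C2_onD(4,3)[OF s1] C2_onD(3)[OF s2]]
    by (simp add: V1_def Int_def vimage_def)
  have c1: "C2_on V1 h1" by (rule C2_on_subset[OF s1 oV1]) (auto simp: V1_def)
  have c2: "C2_on V1 (\<lambda>u. h2 (h1 u))" by (rule C2_on_compose[OF c1 s2]) (auto simp: V1_def)
  have oV: "open V"
    using continuous_open_preimage[OF C2_onD(4,3)[OF c2] C2_onD(3)[OF s3]]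
    by (simp add: V_def Int_def vimage_def)
  have c3: "C2_on V (\<lambda>u. h2 (h1 u))" by (rule C2_on_subset[OF c2 oV]) (auto simp: V_def)
  have c4: "C2_on V (\<lambda>u. h3 (h2 (h1 u)))" by (rule C2_on_compose[OF c3 s3]) (auto simp: V_def)
  have calc: "h1 (t, cmap C q) = cmap P (g t, q)"
    if "q \<in> cdom C" for t q
    using that by (simp add: h1_def P_def max_atlasD(6)[OF C])
  have calc2: "h2 (cmap P (g t, q)) = cmap ?D (f t q)" if "(g t, q) \<in> cdom P" for t q
    by (simp add: h2_def inv_into_f_f[OF Pinj that])
  have calc3: "h3 (cmap ?D (f t q)) = cmap D (f t q)" if "f t q \<in> cdom ?D" for t q
    by (simp add: h3_def max_atlasD(6)[OF D'(1) that])
  have pt: "p \<in> {p. snd p \<in> cmap C ` cdom C \<and> f (fst p) (cinv C (snd p)) \<in> cdom D}"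
    "cmap D (f (fst p) (cinv C (snd p))) = h3 (h2 (h1 p))" if "p \<in> V" for p
  proof -
    from that have m: "p \<in> U1" "h1 p \<in> U2" "h2 (h1 p) \<in> U3" by (auto simp: V_def V1_def)
    then obtain t q where q: "q \<in> cdom C" "q \<in> cdom ?C" "g t \<in> cdom ?A" "p = (t, cmap C q)"
      unfolding U1_def I_def by auto
    have dP: "(g t, q) \<in> cdom P" using q by (simp add: P_def)
    have h1p: "h1 p = cmap P (g t, q)" unfolding q(4) by (rule calc[OF q(1)])
    from m(2) obtain r where r: "r \<in> cdom P" "?act r \<in> cdom ?D" "cmap P (g t, q) = cmap P r"
      unfolding U2_def h1p by blast
    have "(g t, q) = r" by (rule inj_onD[OF Pinj r(3) dP r(1)])
    then have fD: "f t q \<in> cdom ?D" using r(2) by auto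
    have h2p: "h2 (h1 p) = cmap ?D (f t q)" unfolding h1p by (rule calc2[OF dP])
    from m(3) obtain r' where r': "r' \<in> cdom ?D" "r' \<in> cdom D" "cmap ?D (f t q) = cmap ?D r'"
      unfolding U3_def h2p by blast
    have "f t q = r'" by (rule inj_onD[OF max_atlasD(2)[OF D'(1)] r'(3) fD r'(1)])
    then have fd: "f t q \<in> cdom D" using r'(2) by simp
    have ci: "cinv C (cmap C q) = q" by (rule max_atlasD(6)[OF C q(1)])
    show "p \<in> {p. snd p \<in> cmap C ` cdom C \<and> f (fst p) (cinv C (snd p)) \<in> cdom D}"
      unfolding q(4) mem_Collect_eq fst_conv snd_conv ci using fd q(1) by blast
    show "cmap D (f (fst p) (cinv C (snd p))) = h3 (h2 (h1 p))"
      unfolding h2p calc3[OF fD] unfolding q(4) fst_conv snd_conv ci ..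
  qed
  show "\<exists>V. p0 \<in> V \<and> V \<subseteq> {p. snd p \<in> cmap C ` cdom C \<and> f (fst p) (cinv C (snd p)) \<in> cdom D} \<and>
      C2_on V (\<lambda>p. cmap D (f (fst p) (cinv C (snd p))))"
  proof (intro exI[of _ V] conjI)
    have dP: "(g t0, y0) \<in> cdom P" using A1(2) C'(3) by (simp add: P_def)
    have "h1 p0 = cmap P (g t0, y0)" unfolding p0(1) by (rule calc[OF p0(2)])
    moreover have "h2 (cmap P (g t0, y0)) = cmap ?D (f t0 y0)" by (rule calc2[OF dP])
    moreover have "p0 \<in> U1" unfolding U1_def I_def p0(1) using p0(2) C'(3) A1(2) by blast
    moreover have "cmap P (g t0, y0) \<in> U2" unfolding U2_def using dP D'(3) by (intro imageI) simp
    moreover have "cmap ?D (f t0 y0) \<in> U3" unfolding U3_def using p0(3) D'(3) by blast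
    ultimately show "p0 \<in> V" unfolding V_def V1_def by simp
    show "V \<subseteq> {p. snd p \<in> cmap C ` cdom C \<and> f (fst p) (cinv C (snd p)) \<in> cdom D}"
      using pt(1) by blast
    show "C2_on V (\<lambda>p. cmap D (f (fst p) (cinv C (snd p))))"
      by (rule C2_on_cong[OF c4]) (rule pt(2))
  qed
qed

text \<open>Restricts the joint regularity in time and point to the slice at time \<open>t\<close>,
  an affine subspace.\<close>

lemma f_C2_map: "C2_map Y Y (f t)"
  unfolding C2_map_def
proof (intro conjI ballI)
  show "f t ` points Y \<subseteq> points Y" using f_points by blast
  fix C D assume C: "C \<in> max_atlas Y" and D: "D \<in> max_atlas Y"
  let ?\<Theta> = "{p. snd p \<in> cmap C ` cdom C \<and> f (fst p) (cinv C (snd p)) \<in> cdom D}"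
  let ?W = "cmap C ` (cdom C \<inter> f t -` cdom D)"
  have L: "linear (\<lambda>c::(real^'n) \<times> 'v. (0::real, c))" by (intro linearI) auto
  have cL: "continuous_on UNIV (\<lambda>c::(real^'n) \<times> 'v. (0::real, c))" by (intro continuous_intros)
  have W: "?W = (\<lambda>c. (t, c)) -` ?\<Theta>"
  proof (intro equalityI subsetI)
    fix c assume "c \<in> ?W"
    then show "c \<in> (\<lambda>c. (t, c)) -` ?\<Theta>" using max_atlasD(6)[OF C] by auto
  next
    fix c assume "c \<in> (\<lambda>c. (t, c)) -` ?\<Theta>"
    then have c: "c \<in> cmap C ` cdom C" "f t (cinv C c) \<in> cdom D" by auto
    have "c = cmap C (cinv C c)" "cinv C c \<in> cdom C"
      using max_atlasD(7,8)[OF C c(1)] by auto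
    then show "c \<in> ?W" using c(2) by blast
  qed
  have "open ?W"
    unfolding W by (rule open_vimage[OF C2_onD(3)[OF flow_C2[OF C D]]]) (intro continuous_intros)
  then have "C2_on ?W (\<lambda>c. (\<lambda>p. cmap D (f (fst p) (cinv C (snd p)))) ((t, 0) + (0, c)))"
    by (rule C2_on_affine[OF flow_C2[OF C D] L cL]) (use W in auto)
  then show "C2_on ?W (\<lambda>u. cmap D (f t (cinv C u)))" by simp
qed

end

context symmetry_setting
begin

section \<open>The flow, its generator and the Noether current in coordinates\<close>

definition flow where "flow C p = cmap C (f (fst p) (cinv C (snd p)))"

abbreviation flow_dom where
  "flow_dom C \<equiv> {p. snd p \<in> cmap C ` cdom C \<and> f (fst p) (cinv C (snd p)) \<in> cdom C}"

lemma flow_C2': "C \<in> max_atlas Y \<Longrightarrow> C2_on (flow_dom C) (flow C)"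
  unfolding flow_def[abs_def] by (rule flow_C2)

lemma flow_at:
  assumes C: "C \<in> max_atlas Y" and y: "y \<in> cdom C"
  shows "flow C (t, cmap C y) = cmap C (f t y)" "(t, cmap C y) \<in> flow_dom C \<longleftrightarrow> f t y \<in> cdom C"
    "f 0 y = y" "(0, cmap C y) \<in> flow_dom C"
proof -
  have y0: "f 0 y = y" using max_atlasD(1)[OF C] y by (intro f_zero) blast
  then show "flow C (t, cmap C y) = cmap C (f t y)" "(t, cmap C y) \<in> flow_dom C \<longleftrightarrow> f t y \<in> cdom C"
    "f 0 y = y" "(0, cmap C y) \<in> flow_dom C"
    using y by (simp_all add: flow_def max_atlasD(6)[OF C y])
qed

lemma flow_partial: "dir_deriv (flow C) (t, c) (0, x) = dir_deriv (\<lambda>u. cmap C (f t (cinv C u))) c x"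
  by (simp add: dir_deriv_def flow_def)

lemma flow_curve:
  assumes C: "C \<in> max_atlas Y" and y: "y \<in> cdom C"
  shows "((\<lambda>t. cmap C (f t y)) has_vector_derivative dir_deriv (flow C) (0, cmap C y) (1, 0)) (at 0)"
  using C1_line_deriv[OF C2_onD(1)[OF flow_C2'[OF C]] flow_at(4)[OF C y], of "(1, 0)"]
  by (simp add: flow_at(1)[OF C y])

lemma flow_eventually:
  assumes C: "C \<in> max_atlas Y" and y: "y \<in> cdom C"
  shows "\<forall>\<^sub>F t in nhds 0. f t y \<in> cdom C"
proof -
  have "\<forall>\<^sub>F t in nhds 0. (0, cmap C y) + t *\<^sub>R (1, 0) \<in> flow_dom C"
  proof (rule curve_eventually_in[OF curve_diff_line C2_onD(3)[OF flow_C2'[OF C]]])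
    show "(0, cmap C y) + 0 *\<^sub>R (1, 0) \<in> flow_dom C"
      using flow_at(4)[OF C y] by (simp only: scaleR_zero_left add_0_right)
  qed
  then show ?thesis
  proof eventually_elim
    case (elim t)
    then show ?case using flow_at(2)[OF C y, of t] by simp
  qed
qed

lemma form_action_eq:
  assumes y: "y \<in> points Y"
  shows "form_action Y (f t) (y, z) = (f t y, \<lambda>vs. z (map (tangent_map Y Y (f (- t)) (f t y)) vs))"
proof -
  have "tangent_map Y Y (inv_into (points Y) (f t)) (f t y) = tangent_map Y Y (f (- t)) (f t y)"
    by (rule tangent_map_cong[OF Y f_points[OF y] f_inv])
  then show ?thesis by (simp add: form_action_def)
qed

text \<open>The lifted flow on \<open>Z\<close> covers the flow on \<open>Y\<close>. The generator
  is a velocity in a selected chart, so the momentum coordinates of the lifted curve are shown to be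
  differentiable before its first component is used.\<close>

lemma generator_projection:
  assumes y: "y \<in> points Y" and z: "z \<in> dual_fiber X Y \<pi> y" and C: "C \<in> max_atlas Y" "y \<in> cdom C"
  shows "coord_comp Y C y (tangent_map (dual_atlas X Y \<pi>) Y fst (y, z)
      (generator (dual_atlas X Y \<pi>) ex (\<lambda>g. form_action Y (act g)) \<xi> (y, z))) =
    dir_deriv (flow C) (0, cmap C y) (1, 0)"
proof -
  obtain B2 C2 where a2: "adapted X Y \<pi> B2 C2" and y2: "y \<in> cdom C2"
    and ch2: "chart_at (dual_atlas X Y \<pi>) (y, z) = dchart C2"
    by (rule chart_at_dual[OF y z])
  note C2 = adaptedD(2)[OF a2]
  define zt where "zt t vs = z (map (tangent_map Y Y (f (- t)) (f t y)) vs)" for t vs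
  have fa: "form_action Y (f t) (y, z) = (f t y, zt t)" for t
    unfolding form_action_eq[OF y] zt_def ..
  have fz: "f 0 y = y" by (rule f_zero[OF y])
  have "tangent_map Y Y (f 0) y = tangent_map Y Y (\<lambda>y. y) y"
    by (rule tangent_map_cong[OF Y y f_zero])
  then have "tangent_map Y Y (f 0) y = (\<lambda>v. v)" using tangent_map_id[OF Y y] by (simp add: fun_eq_iff)
  then have "zt 0 vs = z vs" for vs unfolding zt_def minus_zero fz by simp
  then have fa0: "form_action Y (f 0) (y, z) = (y, z)" unfolding fa fz by (simp add: fun_eq_iff)
  define w where "w = generator (dual_atlas X Y \<pi>) ex (\<lambda>g. form_action Y (act g)) \<xi> (y, z)"
  have w: "w = dir_deriv (\<lambda>t. cmap (dchart C2) (f t y, zt t)) 0 1"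
    unfolding w_def generator_def velocity_eq fa0 ch2 unfolding fa ..
  obtain P p where P: "\<And>\<mu>. linear (P \<mu>)" and zP: "z = (\<lambda>vs. affine_form p P (map (coord_comp Y C2 y) vs))"
    by (rule dual_fiber_affine_form[OF a2 y2 z]) blast
  have Pb: "bounded_linear (P \<mu>)" for \<mu> by (rule finite_span_bounded_linear[OF fin P])
  \<comment> \<open>The action on forms is the pullback by the inverse, so arguments at
    \<open>f t y\<close> are carried back to \<open>y\<close> by the derivative of the flow at
    \<open>- t\<close>.\<close>
  define K where "K t = dir_deriv (\<lambda>u. cmap C2 (f (- t) (cinv C2 u))) (cmap C2 (f t y))" for t
  have yd: "(\<lambda>t. cmap C2 (f t y)) differentiable (at 0)"
    by (rule differentiableI_vector[OF flow_curve[OF C2 y2]])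
  have Kd: "(\<lambda>t. K t x) differentiable (at 0)" for x
  proof -
    have "(\<lambda>t::real. - t) differentiable (at 0)"
      by (rule differentiableI_vector[of _ "-1"]) (auto intro!: derivative_eq_intros)
    then have "(\<lambda>t. dir_deriv (flow C2) (- t, cmap C2 (f t y)) (0, x)) differentiable (at 0)"
      using flow_at(3,4)[OF C2 y2]
      by (intro C2_curve_diff[OF flow_C2'[OF C2] curve_diff_Pair[OF _ yd] differentiable_const]) simp_all
    then show ?thesis unfolding K_def flow_partial .
  qed
  have dz: "(\<lambda>t. cmap (dchart C2) (f t y, zt t)) differentiable (at 0)"
  proof (rule dual_curve_diff[where p = "\<lambda>_. p" and P = "\<lambda>_. P" and K = K])
    show "\<forall>\<^sub>F t in nhds 0. \<forall>F :: 'n \<Rightarrow> (real^'n) \<times> 'v. zt t (map (\<lambda>\<nu>. coord_vec Y C2 (f t y) (F \<nu>)) indices) =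
        affine_form p P (map (\<lambda>\<nu>. K t (F \<nu>)) indices)"
      using flow_eventually[OF C2 y2]
    proof eventually_elim
      case (elim t)
      have "coord_comp Y C2 y (tangent_map Y Y (f (- t)) (f t y) (coord_vec Y C2 (f t y) x)) = K t x" for x
        using tangent_map_chart[OF Y Y f_C2_map C2 elim C2, of "- t" "coord_vec Y C2 (f t y) x"] y2
        by (simp add: f_neg(2)[OF y] Y.coord_comp_vec(1)[OF C2 elim] K_def del: scaleR_minus_left)
      then show ?case by (simp add: zt_def zP o_def del: scaleR_minus_left)
    qed
    show "\<forall>\<^sub>F t in nhds 0. linear (K t) \<and> (\<forall>\<mu>. linear (P \<mu>))"
      using flow_eventually[OF C2 y2]
    proof eventually_elim
      case (elim t)
      show ?case
        using linear_dir_deriv_chart[OF f_C2_map C2 elim C2, of "- t"] y2 P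
        by (simp add: f_neg(2)[OF y] K_def del: scaleR_minus_left)
    qed
    show "(\<lambda>t. P \<mu> (snd (K t x))) differentiable (at 0)" for \<mu> x
      by (rule curve_diff_linear[OF Pb curve_diff_fst_snd(2)[OF Kd]])
  qed (rule yd differentiable_const Kd)+
  have "has_dir_deriv (\<lambda>t. cmap (dchart C2) (f t y, zt t)) w 0 1"
    unfolding w using dz by (intro curve_diff_dir) simp
  from fst_dir_deriv(1)[OF this]
  have dw: "((\<lambda>t. cmap C2 (f t y)) has_vector_derivative fst w) (at 0)"
    unfolding has_dir_deriv_real by (simp add: dual_chart_def)
  note DY = Y.chart_at_max[OF y] chart_at(2)[OF y] and id = C2_map_id[OF Y]
  have "coord_comp Y C y (tangent_map (dual_atlas X Y \<pi>) Y fst (y, z) w) =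
      dir_deriv (\<lambda>u. cmap C (cinv (chart_at Y y) u)) (cmap (chart_at Y y) y)
        (dir_deriv (\<lambda>u. cmap (chart_at Y y) (cinv C2 u)) (cmap C2 y) (fst w))"
    unfolding tangent_fst[OF a2 y2 ch2] coord_comp_def o_def ..
  also have "\<dots> = dir_deriv (\<lambda>u. cmap C (cinv C2 u)) (cmap C2 y) (fst w)"
    by (simp only: dir_deriv_chart_compose[OF id id C2 y2 DY C, symmetric])
  also have "\<dots> = dir_deriv (flow C) (0, cmap C y) (1, 0)"
  proof (rule vector_derivative_unique_at)
    have "((\<lambda>t. cmap C (cinv C2 (cmap C2 (f t y)))) has_vector_derivative
        dir_deriv (\<lambda>u. cmap C (cinv C2 u)) (cmap C2 (f 0 y)) (fst w)) (at 0)"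
      by (rule C1_curve_deriv[OF C2_onD(1)[OF chart_transition_C2[OF C2 C(1)]] dw]) (use y2 C(2) fz in simp)
    then have h: "has_dir_deriv (\<lambda>t. cmap C (cinv C2 (cmap C2 (f t y))))
        (dir_deriv (\<lambda>u. cmap C (cinv C2 u)) (cmap C2 y) (fst w)) 0 1"
      unfolding has_dir_deriv_real fz .
    have ev: "\<forall>\<^sub>F t in nhds 0. cmap C (cinv C2 (cmap C2 (f t y))) = cmap C (f t y)"
      using flow_eventually[OF C2 y2] by eventually_elim (simp add: max_atlasD(6)[OF C2])
    show "((\<lambda>t. cmap C (f t y)) has_vector_derivative dir_deriv (\<lambda>u. cmap C (cinv C2 u)) (cmap C2 y) (fst w)) (at 0)"
      using iffD1[OF has_dir_deriv_cong[OF ev] h] unfolding has_dir_deriv_real .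
    show "((\<lambda>t. cmap C (f t y)) has_vector_derivative dir_deriv (flow C) (0, cmap C y) (1, 0)) (at 0)"
      by (rule flow_curve[OF C])
  qed
  finally show ?thesis unfolding w_def .
qed

abbreviation noether_form where
  "noether_form \<equiv> pullback X (jet_atlas X Y \<pi>) (jet_prolongation X Y \<phi>)
    (lagrangian_momentum_map X Y \<pi> \<L> ex act \<xi>)"

text \<open>All arguments of \<open>canonical_form\<close> are projected to \<open>Y\<close>:
  \<open>generator_projection\<close> settles the first and \<open>tangent_chain\<close> the others,
  after which \<open>legendre_contract\<close> yields the current.\<close>

lemma noether_form_coords:
  assumes a: "adapted X Y \<pi> B C" and B: "B \<in> X" and p: "p \<in> points X" "\<phi> p \<in> cdom C"
    and q: "q = cmap (jchart B C) (j1 p)" and V: "dir_deriv (flow C) (0, cmap C (\<phi> p)) (1, 0) = (s, b)"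
  shows "noether_form p ws =
    det_list ((lcoord B C q *\<^sub>R s + (\<chi> \<mu>. momentum B C q \<mu> (b - jet_lin (snd q) s))) # map (coord_comp X B p) ws)"
proof -
  let ?y = "\<phi> p" and ?\<gamma> = "tangent_map X Y \<phi> p"
  have yp: "?y \<in> points Y" using C2_mapD(1)[OF \<phi> p(1)] .
  note \<gamma> = j1_in_fiber[OF p(1)] and C = adaptedD(2)[OF a] p(2)
  have j: "j1 p = (?y, ?\<gamma>)" by (simp add: jet_prolongation_def)
  let ?z = "legendre X Y \<pi> \<L> (j1 p)"
  let ?gen = "generator (dual_atlas X Y \<pi>) ex (\<lambda>g. form_action Y (act g)) \<xi> ?z"
  define U where "U = tangent_map (dual_atlas X Y \<pi>) Y fst ?z ?gen"
  have leg: "?z = (?y, snd ?z)" unfolding j by (simp add: legendre_def)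
  have z: "snd ?z \<in> dual_fiber X Y \<pi> ?y"
    unfolding j legendre_coords[OF a B p(2) \<gamma>] snd_conv
    by (rule dual_fiberI[OF a p(2) vertical_affine_form[OF linear_momentum(2)[OF a B]]])
      (simp add: cmap_jchart p(2))
  have U: "coord_comp Y C ?y U = (s, b)"
    unfolding U_def using generator_projection[OF yp z C] unfolding leg[symmetric] V .
  have "noether_form p ws = snd ?z (U # map ?\<gamma> ws)"
    unfolding pullback_def lagrangian_momentum_map_def momentum_map_def interior_prod_def canonical_form_def
    by (simp add: U_def tangent_chain[OF p(1)] o_def)
  also have "\<dots> = det_list ((lcoord B C q *\<^sub>R s + (\<chi> \<mu>. momentum B C q \<mu> (b - jet_lin (snd q) s))) #
      map (coord_comp X B (\<pi> ?y)) ws)"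
    unfolding j by (rule legendre_contract[OF a B p(2) \<gamma> q[unfolded j] U])
  finally show ?thesis by (simp add: \<pi>\<phi>[OF p(1)])
qed

text \<open>The flow at \<open>- t\<close> covers the inverse base map, so any lift \<open>k\<close>
  of a base vector computes its derivative.\<close>

lemma flow_base:
  assumes a: "adapted X Y \<pi> B C" and y: "y \<in> cdom C" and fy: "f t y \<in> cdom C"
  shows "dir_deriv (\<lambda>u. cmap B (inv_into (points X) (actX (g t)) (cinv B u))) (cmap B (\<pi> (f t y))) (fst k) =
    fst (dir_deriv (flow C) (- t, cmap C (f t y)) (0, k))"
proof -
  note C = adaptedD(2)[OF a] and B = adaptedD(1)[OF a]
  let ?inv = "inv_into (points X) (actX (g t))" and ?y' = "f t y"
  have yp: "y \<in> points Y" using max_atlasD(1)[OF C] y by blast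
  have yp': "?y' \<in> points Y" by (rule f_points[OF yp])
  have "smooth_map X X ?inv" using actX_diff unfolding diffeomorphism_def by blast
  then have inv: "C2_map X X ?inv" by (rule smooth_map_imp_C2_map[OF X X])
  have piy: "?inv (\<pi> ?y') = \<pi> y" unfolding actX_inv[OF yp'] f_neg(2)[OF yp] ..
  note Bf = adaptedD(3)[OF a fy] and By = adaptedD(3)[OF a y]
  have oC: "open (cmap C ` cdom C)" by (rule max_atlasD(3)[OF C])
  have fstC: "dir_deriv (\<lambda>u. cmap B (\<pi> (cinv C u))) (cmap C ?y') k = fst k"
  proof -
    have "dir_deriv (\<lambda>u. cmap B (\<pi> (cinv C u))) (cmap C ?y') k = dir_deriv fst (cmap C ?y') k"
    proof (rule dir_deriv_cong)
      show "\<forall>\<^sub>F u in nhds (cmap C ?y'). cmap B (\<pi> (cinv C u)) = fst u"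
        using eventually_nhds_in_open[OF oC imageI[OF fy]]
      proof eventually_elim
        case (elim u)
        show ?case using adaptedD(4)[OF a max_atlasD(7)[OF C elim]] max_atlasD(8)[OF C elim] by simp
      qed
    qed
    then show ?thesis by (simp add: dir_deriv_eqI[OF has_dir_deriv_linear[OF linear_fst]])
  qed
  have "dir_deriv (\<lambda>u. cmap B (?inv (cinv B u))) (cmap B (\<pi> ?y')) (fst k) =
      dir_deriv (\<lambda>u. cmap B (?inv (\<pi> (cinv C u)))) (cmap C ?y') k"
    using dir_deriv_chart_compose[OF proj inv C fy B Bf B, of k] By unfolding fstC piy by simp
  also have "\<dots> = fst (dir_deriv (\<lambda>u. cmap C (f (- t) (cinv C u))) (cmap C ?y') k)"
  proof (rule dir_deriv_eqI)
    let ?S = "cmap C ` (cdom C \<inter> f (- t) -` cdom C)"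
    note S = C2_mapD(2)[OF f_C2_map C C, of "- t"]
    have inS: "cmap C ?y' \<in> ?S" using fy y by (intro imageI) (simp add: f_neg(2)[OF yp] del: scaleR_minus_left)
    have h: "has_dir_deriv (\<lambda>u. fst (cmap C (f (- t) (cinv C u))))
        (fst (dir_deriv (\<lambda>u. cmap C (f (- t) (cinv C u))) (cmap C ?y') k)) (cmap C ?y') k"
      by (rule fst_dir_deriv(1)[OF C1_onD(3)[OF C2_onD(1)[OF S] inS]])
    have ev: "\<forall>\<^sub>F u in nhds (cmap C ?y'). fst (cmap C (f (- t) (cinv C u))) = cmap B (?inv (\<pi> (cinv C u)))"
      using eventually_nhds_in_open[OF C2_onD(3)[OF S] inS]
    proof eventually_elim
      case (elim u)
      then obtain r where r: "r \<in> cdom C" "f (- t) r \<in> cdom C" "u = cmap C r" by blast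
      have rp: "r \<in> points Y" using max_atlasD(1)[OF C] r(1) by blast
      show ?case
        unfolding r(3) max_atlasD(6)[OF C r(1)] actX_inv[OF rp] by (rule adaptedD(4)[OF a r(2)])
    qed
    show "has_dir_deriv (\<lambda>u. cmap B (?inv (\<pi> (cinv C u))))
        (fst (dir_deriv (\<lambda>u. cmap C (f (- t) (cinv C u))) (cmap C ?y') k)) (cmap C ?y') k"
      by (rule iffD1[OF has_dir_deriv_cong[OF ev] h])
  qed
  finally show ?thesis unfolding flow_partial .
qed

lemma jet_action_in_fiber:
  assumes y: "y \<in> points Y" and \<gamma>: "\<gamma> \<in> jet_fiber X Y \<pi> y"
  shows "tangent_map Y Y (f t) y \<circ> \<gamma> \<circ> tangent_map X X (inv_into (points X) (actX (g t))) (actX (g t) (\<pi> y))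
    \<in> jet_fiber X Y \<pi> (f t y)"
proof -
  let ?a = "actX (g t)" and ?inv = "inv_into (points X) (actX (g t))"
  have x: "\<pi> y \<in> points X" by (rule C2_mapD(1)[OF proj y])
  have "smooth_map X X ?inv" "smooth_map X X ?a" and bij: "bij_betw ?a (points X) (points X)"
    using actX_diff unfolding diffeomorphism_def by blast+
  then have inv: "C2_map X X ?inv" and act: "C2_map X X ?a"
    by (blast intro: smooth_map_imp_C2_map[OF X X])+
  have ax: "?a (\<pi> y) \<in> points X" by (rule C2_mapD(1)[OF act x])
  have ia: "?inv (?a (\<pi> y)) = \<pi> y"
    by (rule inv_into_f_f[OF bij_betw_imp_inj_on[OF bij] x])
  have ai: "?a (?inv x') = x'" if "x' \<in> points X" for x'
    using bij that unfolding bij_betw_def by (metis f_inv_into_f)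
  have l\<gamma>: "linear \<gamma>" and T\<gamma>: "\<And>u. tangent_map Y X \<pi> y (\<gamma> u) = u" using \<gamma> unfolding jet_fiber_def by blast+
  show ?thesis
    unfolding jet_fiber_def mem_Collect_eq o_def
  proof (intro conjI allI)
    have "linear (tangent_map X X ?inv (?a (\<pi> y)))" by (rule linear_tangent_map[OF X X inv ax])
    from linear_compose[OF linear_compose[OF this l\<gamma>] linear_tangent_map[OF Y Y f_C2_map y]]
    show "linear (\<lambda>u. tangent_map Y Y (f t) y (\<gamma> (tangent_map X X ?inv (?a (\<pi> y)) u)))"
      by (simp add: o_def)
    fix u
    let ?u = "tangent_map X X ?inv (?a (\<pi> y)) u"
    have "tangent_map Y X \<pi> (f t y) (tangent_map Y Y (f t) y (\<gamma> ?u)) = tangent_map Y X (\<lambda>y. \<pi> (f t y)) y (\<gamma> ?u)"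
      by (rule tangent_map_compose[OF Y Y X f_C2_map proj y, symmetric])
    also have "tangent_map Y X (\<lambda>y. \<pi> (f t y)) y = tangent_map Y X (\<lambda>y. ?a (\<pi> y)) y"
      by (rule tangent_map_cong[OF Y y act_cover])
    also have "tangent_map Y X (\<lambda>y. ?a (\<pi> y)) y (\<gamma> ?u) = tangent_map X X ?a (\<pi> y) (tangent_map Y X \<pi> y (\<gamma> ?u))"
      by (rule tangent_map_compose[OF Y X X proj act y])
    also have "\<dots> = tangent_map X X ?a (?inv (?a (\<pi> y))) ?u" unfolding T\<gamma> ia ..
    also have "\<dots> = tangent_map X X (\<lambda>x. ?a (?inv x)) (?a (\<pi> y)) u"
      by (rule tangent_map_compose[OF X X X inv act ax, symmetric])
    also have "tangent_map X X (\<lambda>x. ?a (?inv x)) (?a (\<pi> y)) = tangent_map X X (\<lambda>x. x) (?a (\<pi> y))"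
      by (rule tangent_map_cong[OF X ax ai])
    also have "tangent_map X X (\<lambda>x. x) (?a (\<pi> y)) u = u" by (rule tangent_map_id[OF X ax])
    finally show "tangent_map Y X \<pi> (f t y) (tangent_map Y Y (f t) y (\<gamma> ?u)) = u" .
  qed
qed

text \<open>Both sides of the equivariance are top forms at the transformed base point, evaluated on
  the coordinate basis \<open>e\<close>. The left side gives the Lagrangian at the transformed jet;
  on the right the basis is pulled back by the inverse base map, and its components form the matrix
  of \<open>M\<close>.\<close>

lemma equivariance_coords:
  fixes M
  assumes a: "adapted X Y \<pi> B C" and B: "B \<in> X" and p: "p \<in> points X" and y: "\<phi> p \<in> cdom C" and fy: "f t (\<phi> p) \<in> cdom C"
    and d\<phi>: "\<And>w. dir_deriv (\<lambda>u. cmap C (\<phi> (cinv B u))) (cmap B p) w = (w, h w)"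
  defines "M \<equiv> \<lambda>w. fst (dir_deriv (flow C) (- t, flow C (t, cmap C (\<phi> p))) (0, (w, h w)))"
  shows "lcoord B C (flow C (t, cmap C (\<phi> p)),
      \<chi> \<mu>. snd (dir_deriv (flow C) (t, cmap C (\<phi> p)) (0, (M (axis \<mu> 1), h (M (axis \<mu> 1)))))) =
    lcoord B C (cmap (jchart B C) (j1 p)) * det (\<chi> \<mu>. M (axis \<mu> 1))"
proof -
  let ?y = "\<phi> p" and ?\<gamma> = "tangent_map X Y \<phi> p" and ?a = "actX (g t)" and ?inv = "inv_into (points X) (actX (g t))"
  have yp: "?y \<in> points Y" using C2_mapD(1)[OF \<phi> p] .
  have x: "\<pi> ?y = p" by (rule \<pi>\<phi>[OF p])
  note \<gamma> = j1_in_fiber[OF p] and Cm = adaptedD(2)[OF a] and Bm = adaptedD(1)[OF a]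
  note pB = section_dom[OF a p y]
  have cover: "\<pi> (f t ?y) = ?a p" using act_cover[OF yp] by (simp add: x)
  have apB: "?a p \<in> cdom B" using adaptedD(3)[OF a fy] by (simp add: cover)
  have ip: "?inv (?a p) = p" using actX_inv[OF f_points[OF yp], of t t] unfolding cover f_neg(2)[OF yp] x .
  have "smooth_map X X ?inv" using actX_diff unfolding diffeomorphism_def by blast
  then have inv: "C2_map X X ?inv" by (rule smooth_map_imp_C2_map[OF X X])
  define e where "e \<mu> = coord_vec X B (?a p) (axis \<mu> 1)" for \<mu>
  define m where "m \<mu> = tangent_map X X ?inv (?a p) (e \<mu>)" for \<mu>
  define \<gamma>t where "\<gamma>t = tangent_map Y Y (f t) ?y \<circ> ?\<gamma> \<circ> tangent_map X X ?inv (?a p)"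
  have fl: "flow C (t, cmap C ?y) = cmap C (f t ?y)" by (rule flow_at(1)[OF Cm y])
  have m: "coord_comp X B p (m \<mu>) = M (axis \<mu> 1)" for \<mu>
  proof -
    have "coord_comp X B (?inv (?a p)) (m \<mu>) = dir_deriv (\<lambda>u. cmap B (?inv (cinv B u))) (cmap B (?a p)) (axis \<mu> 1)"
      unfolding m_def using tangent_map_chart[OF X X inv Bm apB Bm, of "e \<mu>"] pB
      by (simp add: ip e_def X.coord_comp_vec(1)[OF Bm apB])
    also have "\<dots> = M (axis \<mu> 1)"
      using flow_base[OF a y fy, of "(axis \<mu> 1, h (axis \<mu> 1))"] by (simp add: M_def fl cover)
    finally show ?thesis by (simp add: ip)
  qed
  have \<gamma>tf: "\<gamma>t \<in> jet_fiber X Y \<pi> (f t ?y)"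
    using jet_action_in_fiber[OF yp \<gamma>, of t] by (simp add: \<gamma>t_def x)
  have jact: "jet_action X Y \<pi> (f t) ?a (?y, ?\<gamma>) = (f t ?y, \<gamma>t)"
    by (simp add: jet_action_def \<gamma>t_def x)
  have "(?y, ?\<gamma>) \<in> jet_space X Y \<pi>" using yp \<gamma> by (simp add: jet_space_def)
  then have "\<L> (jet_action X Y \<pi> (f t) ?a (?y, ?\<gamma>)) = form_action X ?a (\<L> (?y, ?\<gamma>))"
    using equi g_carrier unfolding equivariant_def by blast
  moreover have "fst (\<L> (?y, ?\<gamma>)) = p"
    using lagrangian_value(1)[OF yp \<gamma>] by (simp add: x)
  ultimately have "snd (\<L> (f t ?y, \<gamma>t)) = (\<lambda>vs. snd (\<L> (?y, ?\<gamma>)) (map (tangent_map X X ?inv (?a p)) vs))"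
    unfolding jact by (simp add: form_action_def case_prod_beta)
  then have eq: "snd (\<L> (f t ?y, \<gamma>t)) (map e indices) = snd (\<L> (?y, ?\<gamma>)) (map m indices)"
    by (simp add: m_def[abs_def] o_def)
  have "snd (\<L> (?y, ?\<gamma>)) (map m indices) = lcoord B C (cmap (jchart B C) (j1 p)) * det (\<chi> \<mu>. M (axis \<mu> 1))"
    unfolding lagrangian_coords[OF a y \<gamma>] x map_map o_def m det_list_map_indices
    by (simp add: jet_prolongation_def)
  moreover have "snd (\<L> (f t ?y, \<gamma>t)) (map e indices) = lcoord B C (cmap (jchart B C) (f t ?y, \<gamma>t))"
    unfolding lagrangian_coords[OF a fy \<gamma>tf] cover map_map o_def e_def X.coord_comp_vec(1)[OF Bm apB] det_list_basis
    by simp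
  moreover have "cmap (jchart B C) (f t ?y, \<gamma>t) = (flow C (t, cmap C ?y),
      \<chi> \<mu>. snd (dir_deriv (flow C) (t, cmap C ?y) (0, (M (axis \<mu> 1), h (M (axis \<mu> 1))))))"
  proof -
    have "coord_comp Y C (f t ?y) (\<gamma>t (e \<mu>)) = dir_deriv (flow C) (t, cmap C ?y) (0, (M (axis \<mu> 1), h (M (axis \<mu> 1))))" for \<mu>
    proof -
      have "coord_comp Y C (f t ?y) (\<gamma>t (e \<mu>)) =
          dir_deriv (\<lambda>u. cmap C (f t (cinv C u))) (cmap C ?y) (coord_comp Y C ?y (?\<gamma> (m \<mu>)))"
        unfolding \<gamma>t_def o_def m_def[symmetric] by (rule tangent_map_chart[OF Y Y f_C2_map Cm y Cm fy])
      also have "coord_comp Y C ?y (?\<gamma> (m \<mu>)) = (M (axis \<mu> 1), h (M (axis \<mu> 1)))"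
        unfolding tangent_map_chart[OF X Y \<phi> Bm pB Cm y] m d\<phi> ..
      finally show ?thesis unfolding flow_partial .
    qed
    then show ?thesis unfolding cmap_jchart cover fl e_def by simp
  qed
  ultimately show ?thesis using eq by simp
qed

end

section \<open>Closedness of the pulled-back momentum form\<close>

context symmetry_setting
begin

lemma noether_form_closed:
  assumes x0: "x0 \<in> points X" and el: "euler_lagrange X Y \<pi> \<L> \<phi>"
  shows "ext_deriv X (CARD('n) - 1) noether_form x0 vs = 0"
proof -
  \<comment> \<open>The chart in which \<open>ext_deriv\<close> differentiates; it belongs to
    \<open>X\<close>, as the Lagrangian coordinate requires.\<close>
  define B where "B = chart_at X x0"
  have B: "B \<in> X" "x0 \<in> cdom B" unfolding B_def by (rule chart_at[OF x0])+
  have Bm: "B \<in> max_atlas X" by (rule X.in_max[OF B(1)])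
  have yp: "\<phi> x0 \<in> points Y" using C2_mapD(1)[OF \<phi> x0] .
  have "\<pi> (\<phi> x0) \<in> cdom B" using B(2) \<pi>\<phi>[OF x0] by simp
  then obtain C where a: "adapted X Y \<pi> B C" and y0: "\<phi> x0 \<in> cdom C"
    using ex_adapted[OF yp B(1)] by blast
  note C = adaptedD(2)[OF a]
  define W where "W = cmap B ` (cdom B \<inter> \<phi> -` cdom C)"
  define u0 where "u0 = cmap B x0"
  define \<Phi> where "\<Phi> u = snd (cmap C (\<phi> (cinv B u)))" for u
  have u0: "u0 \<in> W" unfolding W_def u0_def using B(2) y0 by blast
  have W: "cinv B u \<in> points X" "\<phi> (cinv B u) \<in> cdom C" "cmap B (cinv B u) = u"
    "cinv B u \<in> cdom B" if "u \<in> W" for u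
  proof -
    from that obtain q where q: "q \<in> cdom B" "\<phi> q \<in> cdom C" "u = cmap B q" unfolding W_def by blast
    then show "cinv B u \<in> points X" "\<phi> (cinv B u) \<in> cdom C" "cmap B (cinv B u) = u" "cinv B u \<in> cdom B"
      using max_atlasD(1)[OF Bm] max_atlasD(6)[OF Bm q(1)] by auto
  qed
  have cC2: "C2_on W (\<lambda>u. cmap C (\<phi> (cinv B u)))" unfolding W_def by (rule C2_mapD(2)[OF \<phi> Bm C])
  note oW = C2_onD(3)[OF cC2]
  have \<Phi>2: "C2_on W \<Phi>"
    unfolding \<Phi>_def[abs_def]
    by (rule C2_on_compose[OF cC2 C2_on_linear[OF linear_snd _ open_UNIV]]) (auto intro: continuous_intros)
  have cC: "cmap C (\<phi> (cinv B u)) = (u, \<Phi> u)" if "u \<in> W" for u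
    using adaptedD(4)[OF a W(2)[OF that]] W(3)[OF that] \<pi>\<phi>[OF W(1)[OF that]]
    by (simp add: prod_eq_iff \<Phi>_def)
  have dcC: "dir_deriv (\<lambda>u. cmap C (\<phi> (cinv B u))) u w = (w, dir_deriv \<Phi> u w)" if u: "u \<in> W" for u w
  proof -
    have "\<forall>\<^sub>F u in nhds u. cmap C (\<phi> (cinv B u)) = (u, \<Phi> u)"
      using eventually_nhds_in_open[OF oW u] by eventually_elim (rule cC)
    then have "dir_deriv (\<lambda>u. cmap C (\<phi> (cinv B u))) u w = dir_deriv (\<lambda>u. (u, \<Phi> u)) u w"
      by (rule dir_deriv_cong)
    also have "\<dots> = (w, dir_deriv \<Phi> u w)"
      by (intro dir_deriv_eqI has_dir_deriv_Pair has_dir_deriv_linear[OF linear_ident] C1_onD(3)[OF C2_onD(1)[OF \<Phi>2] u])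
    finally show ?thesis .
  qed
  define jj where "jj u = ((u, \<Phi> u), \<chi> \<mu>. dir_deriv \<Phi> u (axis \<mu> 1))" for u
  have jj: "cmap (jchart B C) (j1 (cinv B u)) = jj u" if u: "u \<in> W" for u
    unfolding j1_coords[OF a W(1,2)[OF u]] W(3)[OF u] dcC[OF u] cC[OF u] jj_def by simp
  define V where "V u = dir_deriv (flow C) (0, (u, \<Phi> u)) (1, 0)" for u
  define J where "J u = lcoord B C (jj u) *\<^sub>R fst (V u) +
    (\<chi> \<mu>. dir_deriv (lcoord B C) (jj u) (0, axis \<mu> (snd (V u) - dir_deriv \<Phi> u (fst (V u)))))" for u
  have cu0: "cinv B u0 = x0" unfolding u0_def by (rule max_atlasD(6)[OF Bm B(2)])
  have cx0: "cmap C (\<phi> x0) = (u0, \<Phi> u0)" using cC[OF u0] unfolding cu0 .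
  have inC: "(u, \<Phi> u) \<in> cmap C ` cdom C" if "u \<in> W" for u
    unfolding cC[OF that, symmetric] using W(2)[OF that] by (rule imageI)
  have n1: "(0, u, \<Phi> u) \<in> flow_dom C" if "u \<in> W" for u
    using flow_at(4)[OF C W(2)[OF that]] unfolding cC[OF that] .
  have n2: "flow C (0, x) = x" if "(0, x) \<in> flow_dom C" for x
  proof -
    from that obtain y where y: "y \<in> cdom C" "x = cmap C y" by auto
    show ?thesis unfolding y(2) using flow_at(1,3)[OF C y(1)] by simp
  qed
  have n3: "jj u \<in> (cmap C ` cdom C) \<times> UNIV" if "u \<in> W" for u
    using inC[OF that] by (simp add: jj_def)
  have n4: "\<forall>\<^sub>F t in nhds 0. lcoord B C (flow C (t, u0, \<Phi> u0),
        \<chi> \<mu>. snd (dir_deriv (flow C) (t, u0, \<Phi> u0)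
          (0, fst (dir_deriv (flow C) (- t, flow C (t, u0, \<Phi> u0)) (0, axis \<mu> 1, dir_deriv \<Phi> u0 (axis \<mu> 1))),
            dir_deriv \<Phi> u0 (fst (dir_deriv (flow C) (- t, flow C (t, u0, \<Phi> u0)) (0, axis \<mu> 1, dir_deriv \<Phi> u0 (axis \<mu> 1))))))) =
      lcoord B C (jj u0) *
        det (\<chi> \<mu>. fst (dir_deriv (flow C) (- t, flow C (t, u0, \<Phi> u0)) (0, axis \<mu> 1, dir_deriv \<Phi> u0 (axis \<mu> 1))))"
    using flow_eventually[OF C y0]
  proof eventually_elim
    case (elim t)
    have d: "dir_deriv (\<lambda>u. cmap C (\<phi> (cinv B u))) (cmap B x0) w = (w, dir_deriv \<Phi> u0 w)" for w
      using dcC[OF u0] unfolding u0_def .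
    show ?case
      using equivariance_coords[OF a B(1) x0 y0 elim d] jj[OF u0] unfolding cx0 cu0 by simp
  qed
  have n5: "dir_deriv (lcoord B C) (jj u0) ((0, w), 0) =
      (\<Sum>\<mu>\<in>UNIV. dir_deriv (\<lambda>u. dir_deriv (lcoord B C) (jj u) (0, axis \<mu> w)) u0 (axis \<mu> 1))" for w
  proof -
    let ?j = "\<lambda>u. cmap (jchart B C) (j1 (cinv B u))"
    have "dir_deriv (lcoord B C) (?j (cmap B x0)) ((0, w), 0) -
        (\<Sum>\<mu>\<in>UNIV. dir_deriv (\<lambda>u. dir_deriv (lcoord B C) (?j u) ((0, 0), axis \<mu> w)) (cmap B x0) (axis \<mu> 1)) = 0"
      using el a x0 y0 unfolding euler_lagrange_def Let_def by blast
    moreover have "dir_deriv (\<lambda>u. dir_deriv (lcoord B C) (?j u) ((0, 0), axis \<mu> w)) u0 (axis \<mu> 1) =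
        dir_deriv (\<lambda>u. dir_deriv (lcoord B C) (jj u) (0, axis \<mu> w)) u0 (axis \<mu> 1)" for \<mu>
    proof (rule dir_deriv_cong)
      show "\<forall>\<^sub>F u in nhds u0. dir_deriv (lcoord B C) (?j u) ((0, 0), axis \<mu> w) =
          dir_deriv (lcoord B C) (jj u) (0, axis \<mu> w)"
        using eventually_nhds_in_open[OF oW u0] by eventually_elim (simp add: jj zero_prod_def)
    qed
    ultimately show ?thesis
      unfolding u0_def[symmetric] jj[OF u0] by simp
  qed
  note nd = noether_divergence[OF \<Phi>2 u0 flow_C2'[OF C] n1 n2 lcoord_C2[OF a B(1)] n3[unfolded jj_def]
      n4[unfolded jj_def] n5[unfolded jj_def]]
  have noether1: "C1_on W J" unfolding J_def[abs_def] V_def jj_def by (rule nd(1))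
  have noether2: "(\<Sum>\<mu>\<in>UNIV. dir_deriv J u0 (axis \<mu> 1) $ \<mu>) = 0"
    using nd(2) unfolding J_def[abs_def] V_def jj_def .
  \<comment> \<open>For arguments with constant components the form is the volume form contracted
    with the current, so \<open>ext_deriv\<close> only differentiates \<open>J\<close>.\<close>
  have form: "noether_form (cinv B u) (map (coord_vec X B (cinv B u)) ws) = det_list (J u # ws)"
    if u: "u \<in> W" for u ws
  proof -
    have "map (coord_comp X B (cinv B u)) (map (coord_vec X B (cinv B u)) ws) = ws"
      using X.coord_comp_vec(1)[OF Bm W(4)[OF u]] by (simp add: o_def)
    moreover have "dir_deriv (flow C) (0, cmap C (\<phi> (cinv B u))) (1, 0) = (fst (V u), snd (V u))"
      unfolding cC[OF u] V_def by simp
    note noether_form_coords[OF a B(1) W(1,2)[OF u] jj[OF u, symmetric] this]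
    moreover have "jet_lin (snd (jj u)) w = dir_deriv \<Phi> u w" for w
      unfolding jj_def snd_conv by (rule jet_lin_linear[OF linear_dir_deriv[OF C2_onD(1)[OF \<Phi>2] u]])
    ultimately show ?thesis by (simp add: J_def momentum_def)
  qed
  have J': "linear (dir_deriv J u0)" by (rule linear_dir_deriv[OF noether1 u0])
  show ?thesis
  proof (cases "length vs = CARD('n)")
    case True
    have "dir_deriv (\<lambda>u. noether_form (cinv B u) (map (coord_vec X B (cinv B u)) (take i vs @ drop (Suc i) vs)))
        u0 (vs ! i) = det_list (dir_deriv J u0 (vs ! i) # take i vs @ drop (Suc i) vs)"
      if i: "i < CARD('n)" for i
    proof -
      let ?ws = "take i vs @ drop (Suc i) vs"
      have "dir_deriv (\<lambda>u. noether_form (cinv B u) (map (coord_vec X B (cinv B u)) ?ws)) u0 (vs ! i) =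
          dir_deriv (\<lambda>u. det_list (J u # ?ws)) u0 (vs ! i)"
      proof (rule dir_deriv_cong)
        show "\<forall>\<^sub>F u in nhds u0. noether_form (cinv B u) (map (coord_vec X B (cinv B u)) ?ws) = det_list (J u # ?ws)"
          using eventually_nhds_in_open[OF oW u0] by eventually_elim (rule form)
      qed
      also have "\<dots> = det_list (dir_deriv J u0 (vs ! i) # ?ws)"
      proof (rule dir_deriv_eqI)
        have "linear (\<lambda>r. det_list ([] @ r # ?ws))"
          using True i by (intro alternating_linear_list[OF alternating_det_list]) simp
        then have "bounded_linear (\<lambda>r. det_list (r # ?ws))"
          by (simp add: linear_conv_bounded_linear)
        from bounded_linear.has_vector_derivative[OF this C1_line_deriv[OF noether1 u0]]
        show "has_dir_deriv (\<lambda>u. det_list (J u # ?ws)) (det_list (dir_deriv J u0 (vs ! i) # ?ws)) u0 (vs ! i)"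
          unfolding has_dir_deriv_iff_has_vector_derivative .
      qed
      finally show ?thesis .
    qed
    \<comment> \<open>The natural subtraction in the degree is exact because \<open>'n\<close> is
      inhabited.\<close>
    moreover have S: "Suc (CARD('n) - 1) = CARD('n)"
      using zero_less_card_finite[where 'a = 'n] by (rule Suc_diff_1)
    moreover have "{..CARD('n) - 1} = {..<CARD('n)}"
      by (simp only: lessThan_Suc_atMost[symmetric] S)
    ultimately have "ext_deriv X (CARD('n) - 1) noether_form x0 vs =
        (\<Sum>i<CARD('n). (-1) ^ i * det_list (dir_deriv J u0 (vs ! i) # take i vs @ drop (Suc i) vs))"
      using True by (simp add: ext_deriv_def Let_def B_def[symmetric] u0_def[symmetric])
    \<comment> \<open>The alternating sum is the trace of the derivative of \<open>J\<close> times a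
      determinant, and that trace is the divergence.\<close>
    also have "\<dots> = 0"
      unfolding sum_det_list_replace[OF J' True] noether2 by simp
    finally show ?thesis .
  next
    case False
    moreover have "Suc (CARD('n) - 1) = CARD('n)"
      using zero_less_card_finite[where 'a = 'n] by (rule Suc_diff_1)
    ultimately show ?thesis by (simp add: ext_deriv_def Let_def)
  qed
qed

end

theorem theorem4p7:
  fixes X :: "('x, real^'n) atlas"
    and F :: "('f, 'v::real_normed_vector) atlas"
    and Y :: "('y, (real^'n) \<times> 'v) atlas"
    and \<pi> :: "'y \<Rightarrow> 'x"
    and \<L> :: "('x, 'y, real^'n, (real^'n) \<times> 'v) density"
    and G :: "('g, 'm) monoid_scheme"
    and A :: "('g, 'a::locally_convex_space) atlas"
    and ex :: "'a \<Rightarrow> 'g"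
    and act :: "'g \<Rightarrow> 'y \<Rightarrow> 'y"
    and actX :: "'g \<Rightarrow> 'x \<Rightarrow> 'x"
    and \<xi> :: 'a
    and \<phi> :: "'x \<Rightarrow> 'y"
  assumes "smooth_manifold X" and "second_countable (atlas_topology X)" and "oriented_atlas X"
    and "\<exists>D :: 'v set. finite D \<and> span D = UNIV"
    and "smooth_manifold F" and "second_countable (atlas_topology F)"
    and "smooth_manifold Y" and "second_countable (atlas_topology Y)"
    and "fiber_bundle Y X F \<pi>"
    and "lagrangian_density X Y \<pi> \<L>"
    and "lie_group G A" and "exponential_map G A ex"
    and "acts_by_bundle_automorphisms G A X Y \<pi> act actX"
    and "equivariant G X Y \<pi> act actX \<L>"
    and "smooth_section X Y \<pi> \<phi>" and "euler_lagrange X Y \<pi> \<L> \<phi>"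
  shows "\<forall>x\<in>points X.
    ext_deriv X (CARD('n) - 1)
      (pullback X (jet_atlas X Y \<pi>) (jet_prolongation X Y \<phi>)
        (lagrangian_momentum_map X Y \<pi> \<L> ex act \<xi>)) x = (\<lambda>_. 0)"
proof -
  interpret symmetry_setting X Y \<pi> \<L> \<phi> G A ex act actX \<xi>
  proof unfold_locales
    show "C2_map Y X \<pi>"
      using assms(9) unfolding fiber_bundle_def by (intro smooth_map_imp_C2_map assms(1,7)) blast
    show "C2_map X Y \<phi>" "\<And>x. x \<in> points X \<Longrightarrow> \<pi> (\<phi> x) = x"
      using assms(15) unfolding smooth_section_def by (blast intro: smooth_map_imp_C2_map assms(1,7))+
    show "\<exists>C. adapted X Y \<pi> B C \<and> y \<in> cdom C" if "y \<in> points Y" "B \<in> X" "\<pi> y \<in> cdom B" for y B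
      by (rule adapted_exists[OF assms(1,7,5,9) that])
  qed (rule assms)+
  show ?thesis
    using noether_form_closed[OF _ assms(16)] by (intro ballI ext) blast
qed

end
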